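(* Let $n\ge 3$, let $\Sigma'$ be an oriented sphere with $n$ punctures, and let $\rho\colon\pi_1\Sigma'\to\operatorname{PSL}_2\mathbb R$ be a Deroin–Tholozan representation. Then there exist a geometric presentation of $\pi_1\Sigma'$ and a pants decomposition of $\Sigma'$ compatible with it such that, in the triangle chain associated with $\rho$, no triangle is degenerate and no two consecutive triangles overlap.
   Context: **Deroin–Tholozan (DT) representations.** Let $\mathcal P$ be the set of punctures and $\mathbb H$ the oriented hyperbolic plane. An elliptic element of $\operatorname{PSL}_2\mathbb R$ has rotation angle $\vartheta\in(0,2\pi)$ if it rotates $\mathbb H$ counterclockwise by $\vartheta$ around its fixed point. For $\alpha\in(0,2\pi)^{\mathcal P}$, $\operatorname{Rep}_\alpha(\Sigma',\operatorname{PSL}_2\mathbb R)$ is the space of conjugacy classes of homomorphisms $\pi_1\Sigma'\to\operatorname{PSL}_2\mathbb R$ sending every counterclockwise loop around the puncture $p$ to an elliptic element of rotation angle $\alpha_p$, for all $p$. If $\sum_p\alpha_p\in(0,2\pi)$ or $\sum_p\alpha_p\in(2\pi(n-1),2\pi n)$, this space has a unique compact connected component; homomorphisms whose classes lie in it are called DT representations. A DT representation sends every (non-trivial) simple closed curve to an elliptic element. **Geometric presentations and compatible pants decompositions.** A geometric presentation of $\pi_1\Sigma'$ is a presentation with generators $c_1,\dots,c_n$ and relation $c_1c_2\cdots c_n=1$, where each $c_i$ is the homotopy class of a counterclockwise loop around a different puncture. Indices are cyclically ordered modulo $n$. For a set $I=\{i,i+1,\dots,i+k\}$ of cyclically consecutive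 indices put $c_I=c_ic_{i+1}\cdots c_{i+k}$; it is represented by a simple loop around the punctures in $I$. A pants decomposition compatible with the presentation is given by a chain $I_1\subset I_2\subset\dots\subset I_{n-3}$ of sets of cyclically consecutive indices with $|I_k|=k+1$; its pants curves are represented by $c_{I_1},\dots,c_{I_{n-3}}$. **Triangle chain.** Given $\rho$, such a presentation and such a decomposition, let $F(c)\in\mathbb H$ denote the fixed point of the elliptic element $\rho(c)$. For $n\ge4$ the triangle chain consists of $n-2$ (possibly degenerate) geodesic triangles in $\mathbb H$, one for each pair of pants: the first has vertices $F(c_i),F(c_{i+1}),F(c_{I_1})$ where $I_1=\{i,i+1\}$; for $2\le k\le n-3$ the $k$-th has vertices $F(c_{I_{k-1}}),F(c_z),F(c_{I_k})$ where $I_k=I_{k-1}\cup\{z\}$; the last has vertices $F(c_{I_{n-3}}),F(c_x),F(c_y)$ where $x,y$ are the two indices not in $I_{n-3}$. For $n=3$ the chain is the single triangle $F(c_1),F(c_2),F(c_3)$. Consecutive triangles share the vertex $F(c_{I_k})$ of the common pants curve. A triangle is degenerate if it has zero area. Two triangles overlap if their interiors are not disjoint. *)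

theory Defs
  imports "HOL-Analysis.Analysis" "HOL-Algebra.Generated_Groups"
begin

section \<open>Quotient topologies\<close>

definition quotient_topology :: "'a topology \<Rightarrow> ('a \<Rightarrow> 'b) \<Rightarrow> 'b topology" where
  "quotient_topology X q =
     topology (\<lambda>U. U \<subseteq> q ` topspace X \<and> openin X {x \<in> topspace X. q x \<in> U})"

lemma openin_quotient_topology:
  "openin (quotient_topology X q) U \<longleftrightarrow>
     U \<subseteq> q ` topspace X \<and> openin X {x \<in> topspace X. q x \<in> U}"
proof -
  let ?L = "\<lambda>U. U \<subseteq> q ` topspace X \<and> openin X {x \<in> topspace X. q x \<in> U}"
  have "?L (S \<inter> T)" if "?L S" "?L T" for S T
  proof -
    have "{x \<in> topspace X. q x \<in> S \<inter> T} = {x \<in> topspace X. q x \<in> S} \<inter> {x \<in> topspace X. q x \<in> T}"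
      by auto
    with that show ?thesis by auto
  qed
  moreover have "?L (\<Union>\<K>)" if "\<forall>K\<in>\<K>. ?L K" for \<K>
  proof -
    have "{x \<in> topspace X. q x \<in> \<Union>\<K>} = (\<Union>K\<in>\<K>. {x \<in> topspace X. q x \<in> K})"
      by auto
    moreover have "openin X (\<Union>K\<in>\<K>. {x \<in> topspace X. q x \<in> K})"
      using that by auto
    ultimately show ?thesis using that by auto
  qed
  ultimately have "istopology ?L"
    unfolding istopology_def by blast
  then show ?thesis
    by (simp add: quotient_topology_def)
qed

lemma topspace_quotient_topology [simp]: "topspace (quotient_topology X q) = q ` topspace X"
proof
  show "topspace (quotient_topology X q) \<subseteq> q ` topspace X"
    using openin_quotient_topology[of X q "topspace (quotient_topology X q)"] by simp
  have "{x \<in> topspace X. q x \<in> q ` topspace X} = topspace X" by auto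
  then have "openin (quotient_topology X q) (q ` topspace X)"
    by (simp add: openin_quotient_topology)
  then show "q ` topspace X \<subseteq> topspace (quotient_topology X q)"
    by (rule openin_subset)
qed

lemma quotient_map_quotient_topology: "quotient_map X (quotient_topology X q) q"
  by (auto simp: quotient_map_def openin_quotient_topology)


section \<open>The hyperbolic plane\<close>

text \<open>The upper half-plane model, oriented as an open subset of the complex plane.\<close>

definition hyp_plane :: "complex set" where
  "hyp_plane = {z. Im z > 0}"

definition hyp_dist :: "complex \<Rightarrow> complex \<Rightarrow> real" where
  "hyp_dist z w = arcosh (1 + (cmod (z - w))\<^sup>2 / (2 * Im z * Im w))"

definition hyp_segment :: "complex \<Rightarrow> complex \<Rightarrow> complex set" where
  "hyp_segment z w = {x \<in> hyp_plane. hyp_dist z x + hyp_dist x w = hyp_dist z w}"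

definition hyp_convex :: "complex set \<Rightarrow> bool" where
  "hyp_convex S \<longleftrightarrow> S \<subseteq> hyp_plane \<and> (\<forall>z\<in>S. \<forall>w\<in>S. hyp_segment z w \<subseteq> S)"

text \<open>The filled-in geodesic triangle with vertex set \<open>V\<close> (at most three points of the
  hyperbolic plane, possibly coinciding) is the hyperbolic convex hull of \<open>V\<close>.\<close>

definition geodesic_triangle :: "complex set \<Rightarrow> complex set" where
  "geodesic_triangle V = hyp_convex hull V"

lemma hyp_convex_hyp_plane: "hyp_convex hyp_plane"
  by (auto simp: hyp_convex_def hyp_segment_def)

lemma hyp_convex_geodesic_triangle:
  assumes "V \<subseteq> hyp_plane"
  shows "hyp_convex (geodesic_triangle V)"
  using assms hyp_convex_hyp_plane
  unfolding geodesic_triangle_def hull_def hyp_convex_def by blast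

definition hyp_area :: "complex set \<Rightarrow> ennreal" where
  "hyp_area T = (\<integral>\<^sup>+z\<in>T. ennreal (1 / (Im z)\<^sup>2) \<partial>lborel)"

definition degenerate :: "complex set \<Rightarrow> bool" where
  "degenerate T \<longleftrightarrow> hyp_area T = 0"

definition overlap :: "complex set \<Rightarrow> complex set \<Rightarrow> bool" where
  "overlap T T' \<longleftrightarrow> interior T \<inter> interior T' \<noteq> {}"


section \<open>The group PSL(2,R) and its action on the hyperbolic plane\<close>

definition SL2R :: "(real^2^2) monoid" where
  "SL2R = \<lparr>carrier = {A. det A = 1}, mult = (**), one = mat 1\<rparr>"

definition PSL2R :: "(real^2^2) set monoid" where
  "PSL2R = SL2R Mod {mat 1, - mat 1}"

definition PSL2R_topology :: "(real^2^2) set topology" where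
  "PSL2R_topology =
     quotient_topology (top_of_set (carrier SL2R)) (\<lambda>A. {mat 1, - mat 1} #>\<^bsub>SL2R\<^esub> A)"

definition moebius :: "real^2^2 \<Rightarrow> complex \<Rightarrow> complex" where
  "moebius A z = (of_real (A$1$1) * z + of_real (A$1$2)) / (of_real (A$2$1) * z + of_real (A$2$2))"

text \<open>An element of \<^const>\<open>PSL2R\<close> is a coset \<open>{A, - A}\<close>; both matrices induce the same map.\<close>

definition PSL2R_act :: "(real^2^2) set \<Rightarrow> complex \<Rightarrow> complex" where
  "PSL2R_act g = moebius (SOME A. A \<in> g)"

text \<open>The isometry \<open>g\<close> is conformal and orientation preserving, so it rotates
  counterclockwise by \<open>\<theta>\<close> about a fixed point iff its complex derivative there
  is \<open>cis \<theta>\<close>.\<close>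

definition elliptic_with_angle :: "(real^2^2) set \<Rightarrow> real \<Rightarrow> bool" where
  "elliptic_with_angle g \<theta> \<longleftrightarrow> g \<in> carrier PSL2R \<and> 0 < \<theta> \<and> \<theta> < 2 * pi \<and>
     (\<exists>z\<in>hyp_plane. PSL2R_act g z = z \<and> (PSL2R_act g has_field_derivative cis \<theta>) (at z))"

definition fixed_point :: "(real^2^2) set \<Rightarrow> complex" where
  "fixed_point g = (THE z. z \<in> hyp_plane \<and> PSL2R_act g z = z)"

lemma group_SL2R: "group SL2R"
proof (rule groupI)
  fix A assume "A \<in> carrier SL2R"
  then have d: "det A = 1" by (simp add: SL2R_def)
  then obtain B where B: "A ** B = mat 1" "B ** A = mat 1"
    using invertible_det_nz[of A] unfolding invertible_def by auto
  have "det B = 1" using arg_cong[OF B(2), of det] d by (simp add: det_mul)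
  with B show "\<exists>B\<in>carrier SL2R. B \<otimes>\<^bsub>SL2R\<^esub> A = \<one>\<^bsub>SL2R\<^esub>"
    by (auto simp: SL2R_def)
qed (auto simp: SL2R_def det_mul matrix_mul_assoc)

lemma matrix_minus_mult:
  fixes A B :: "real^2^2"
  shows "(- A) ** B = - (A ** B)" "A ** (- B) = - (A ** B)"
  by (simp_all add: matrix_matrix_mult_def vec_eq_iff sum_negf)

lemma minus_mat_1_in_SL2R: "- mat 1 \<in> carrier SL2R"
  by (simp add: SL2R_def det_2 mat_def)

lemma normal_SL2R: "{mat 1, - mat 1} \<lhd> SL2R"
proof -
  interpret group SL2R by (rule group_SL2R)
  have m: "(- mat 1) \<otimes>\<^bsub>SL2R\<^esub> (- mat 1) = \<one>\<^bsub>SL2R\<^esub>"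
    by (simp add: SL2R_def matrix_minus_mult)
  have i: "inv\<^bsub>SL2R\<^esub> (- mat 1) = - mat 1"
    using inv_equality[OF m minus_mat_1_in_SL2R minus_mat_1_in_SL2R] .
  have o: "\<one>\<^bsub>SL2R\<^esub> = mat 1" by (simp add: SL2R_def)
  have "subgroup {mat 1, - mat 1} SL2R"
  proof (rule subgroupI)
    show "{mat 1, - mat 1} \<subseteq> carrier SL2R"
      using minus_mat_1_in_SL2R one_closed o by auto
    show "inv\<^bsub>SL2R\<^esub> a \<in> {mat 1, - mat 1}" if "a \<in> {mat 1, - mat 1}" for a
      using that i inv_one o by auto
    show "a \<otimes>\<^bsub>SL2R\<^esub> b \<in> {mat 1, - mat 1}"
      if "a \<in> {mat 1, - mat 1}" "b \<in> {mat 1, - mat 1}" for a b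
      using that by (auto simp: SL2R_def matrix_minus_mult)
  qed simp
  moreover have "\<forall>x\<in>carrier SL2R. {mat 1, - mat 1} #>\<^bsub>SL2R\<^esub> x = x <#\<^bsub>SL2R\<^esub> {mat 1, - mat 1}"
    by (auto simp: r_coset_def l_coset_def SL2R_def matrix_minus_mult)
  ultimately show ?thesis
    by (simp add: normal_def normal_axioms_def is_group)
qed

lemma group_PSL2R: "group PSL2R"
  unfolding PSL2R_def by (rule normal.factorgroup_is_group[OF normal_SL2R])

lemma carrier_PSL2R: "carrier PSL2R = (\<lambda>A. {A, - A}) ` {A. det A = 1}"
  by (auto simp: PSL2R_def carrier_FactGroup r_coset_def SL2R_def matrix_minus_mult image_iff)

lemma topspace_PSL2R_topology: "topspace PSL2R_topology = carrier PSL2R"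
  by (simp add: PSL2R_topology_def PSL2R_def carrier_FactGroup)

lemma PSL2R_act_eq_moebius:
  assumes "g \<in> carrier PSL2R" "A \<in> g"
  shows "PSL2R_act g = moebius A"
proof -
  have neg: "moebius (- B) = moebius B" for B
  proof
    fix z
    have "moebius (- B) z = (- (of_real (B$1$1) * z + of_real (B$1$2))) /
                            (- (of_real (B$2$1) * z + of_real (B$2$2)))"
      by (simp add: moebius_def)
    also have "\<dots> = moebius B z"
      unfolding moebius_def by (rule minus_divide_divide)
    finally show "moebius (- B) z = moebius B z" .
  qed
  have "(SOME B. B \<in> g) \<in> g" using assms(2) by (rule someI)
  with assms have "(SOME B. B \<in> g) = A \<or> (SOME B. B \<in> g) = - A"
    by (auto simp: carrier_PSL2R)
  then show ?thesis using neg by (auto simp: PSL2R_act_def)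
qed


section \<open>Fundamental groups\<close>

definition path_class :: "'a::real_normed_vector set \<Rightarrow> (real \<Rightarrow> 'a) \<Rightarrow> (real \<Rightarrow> 'a) set" where
  "path_class S \<gamma> = {\<delta>. homotopic_paths S \<gamma> \<delta>}"

definition based_loops :: "'a::real_normed_vector set \<Rightarrow> 'a \<Rightarrow> (real \<Rightarrow> 'a) set" where
  "based_loops S x = {\<gamma>. path \<gamma> \<and> path_image \<gamma> \<subseteq> S \<and> pathstart \<gamma> = x \<and> pathfinish \<gamma> = x}"

text \<open>In a product the left factor is traversed first.\<close>

definition fundamental_group :: "'a::real_normed_vector set \<Rightarrow> 'a \<Rightarrow> (real \<Rightarrow> 'a) set monoid" where
  "fundamental_group S x =
     \<lparr>carrier = path_class S ` based_loops S x,
      mult = (\<lambda>X Y. {\<delta>. \<exists>\<gamma>\<^sub>1\<in>X. \<exists>\<gamma>\<^sub>2\<in>Y. homotopic_paths S (\<gamma>\<^sub>1 +++ \<gamma>\<^sub>2) \<delta>}),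
      one = path_class S (linepath x x)\<rparr>"

lemma path_class_eq_iff:
  assumes "\<gamma> \<in> based_loops S x"
  shows "path_class S \<gamma> = path_class S \<delta> \<longleftrightarrow> homotopic_paths S \<gamma> \<delta>"
proof
  assume eq: "path_class S \<gamma> = path_class S \<delta>"
  have "\<gamma> \<in> path_class S \<gamma>" using assms by (simp add: path_class_def based_loops_def)
  then have "\<gamma> \<in> path_class S \<delta>" using eq by simp
  then show "homotopic_paths S \<gamma> \<delta>"
    by (simp add: path_class_def homotopic_paths_sym)
next
  assume "homotopic_paths S \<gamma> \<delta>"
  then show "path_class S \<gamma> = path_class S \<delta>"
    unfolding path_class_def by (blast intro: homotopic_paths_trans homotopic_paths_sym)
qed

lemma based_loops_join:
  "\<gamma> \<in> based_loops S x \<Longrightarrow> \<delta> \<in> based_loops S x \<Longrightarrow> \<gamma> +++ \<delta> \<in> based_loops S x"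
  by (simp add: based_loops_def path_image_join)

lemma fundamental_group_mult:
  assumes "\<gamma> \<in> based_loops S x" "\<delta> \<in> based_loops S x"
  shows "path_class S \<gamma> \<otimes>\<^bsub>fundamental_group S x\<^esub> path_class S \<delta> = path_class S (\<gamma> +++ \<delta>)"
proof -
  have refl: "homotopic_paths S \<gamma> \<gamma>" "homotopic_paths S \<delta> \<delta>"
    using assms by (simp_all add: based_loops_def)
  have ends: "pathfinish \<gamma> = pathstart \<delta>"
    using assms by (simp add: based_loops_def)
  show ?thesis
  proof (intro Set.set_eqI iffI)
    fix r assume "r \<in> path_class S \<gamma> \<otimes>\<^bsub>fundamental_group S x\<^esub> path_class S \<delta>"
    then obtain a b where "homotopic_paths S \<gamma> a" "homotopic_paths S \<delta> b"
        and r: "homotopic_paths S (a +++ b) r"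
      by (auto simp: fundamental_group_def path_class_def)
    then have "homotopic_paths S (\<gamma> +++ \<delta>) (a +++ b)"
      using ends homotopic_paths_join by blast
    with r show "r \<in> path_class S (\<gamma> +++ \<delta>)"
      unfolding path_class_def by (blast intro: homotopic_paths_trans)
  next
    fix r assume "r \<in> path_class S (\<gamma> +++ \<delta>)"
    then have "homotopic_paths S (\<gamma> +++ \<delta>) r" by (simp add: path_class_def)
    moreover have "\<gamma> \<in> path_class S \<gamma>" "\<delta> \<in> path_class S \<delta>"
      using refl by (simp_all only: path_class_def mem_Collect_eq)
    ultimately show "r \<in> path_class S \<gamma> \<otimes>\<^bsub>fundamental_group S x\<^esub> path_class S \<delta>"
      unfolding fundamental_group_def by auto
  qed
qed

lemma group_fundamental_group:
  assumes "x \<in> S"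
  shows "group (fundamental_group S x)"
proof -
  have c: "carrier (fundamental_group S x) = path_class S ` based_loops S x"
    and o: "\<one>\<^bsub>fundamental_group S x\<^esub> = path_class S (linepath x x)"
    by (simp_all add: fundamental_group_def)
  have const: "linepath x x \<in> based_loops S x"
    using assms by (simp add: based_loops_def)
  have rev: "reversepath \<gamma> \<in> based_loops S x" if "\<gamma> \<in> based_loops S x" for \<gamma>
    using that by (simp add: based_loops_def)
  show ?thesis
  proof (rule groupI)
    show "\<one>\<^bsub>fundamental_group S x\<^esub> \<in> carrier (fundamental_group S x)"
      using const by (simp add: c o)
  next
    fix X Y assume "X \<in> carrier (fundamental_group S x)" "Y \<in> carrier (fundamental_group S x)"
    then show "X \<otimes>\<^bsub>fundamental_group S x\<^esub> Y \<in> carrier (fundamental_group S x)"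
      by (auto simp: c fundamental_group_mult based_loops_join)
  next
    fix X Y Z
    assume "X \<in> carrier (fundamental_group S x)" "Y \<in> carrier (fundamental_group S x)"
           "Z \<in> carrier (fundamental_group S x)"
    then obtain p q r where pqr: "p \<in> based_loops S x" "q \<in> based_loops S x" "r \<in> based_loops S x"
      and XYZ: "X = path_class S p" "Y = path_class S q" "Z = path_class S r"
      by (auto simp: c)
    have "homotopic_paths S (p +++ (q +++ r)) ((p +++ q) +++ r)"
      using pqr by (intro homotopic_paths_assoc) (auto simp: based_loops_def)
    then have "path_class S ((p +++ q) +++ r) = path_class S (p +++ (q +++ r))"
      using pqr by (metis path_class_eq_iff based_loops_join)
    then show "X \<otimes>\<^bsub>fundamental_group S x\<^esub> Y \<otimes>\<^bsub>fundamental_group S x\<^esub> Z =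
               X \<otimes>\<^bsub>fundamental_group S x\<^esub> (Y \<otimes>\<^bsub>fundamental_group S x\<^esub> Z)"
      using pqr by (simp add: XYZ fundamental_group_mult based_loops_join)
  next
    fix X assume "X \<in> carrier (fundamental_group S x)"
    then obtain p where p: "p \<in> based_loops S x" and X: "X = path_class S p" by (auto simp: c)
    have "homotopic_paths S (linepath x x +++ p) p"
      using p homotopic_paths_lid[of p S] by (simp add: based_loops_def)
    then show "\<one>\<^bsub>fundamental_group S x\<^esub> \<otimes>\<^bsub>fundamental_group S x\<^esub> X = X"
      using p const by (simp add: X o fundamental_group_mult path_class_eq_iff[OF based_loops_join])
    have "homotopic_paths S (reversepath p +++ p) (linepath x x)"
      using p homotopic_paths_linv[of p S] by (simp add: based_loops_def)
    then have "path_class S (reversepath p) \<otimes>\<^bsub>fundamental_group S x\<^esub> X = \<one>\<^bsub>fundamental_group S x\<^esub>"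
      using p rev by (simp add: X o fundamental_group_mult path_class_eq_iff[OF based_loops_join[OF rev[OF p] p]])
    then show "\<exists>Y\<in>carrier (fundamental_group S x).
                 Y \<otimes>\<^bsub>fundamental_group S x\<^esub> X = \<one>\<^bsub>fundamental_group S x\<^esub>"
      using rev p by (auto simp: c)
  qed
qed


section \<open>Group presentations\<close>

text \<open>A letter \<open>(i, True)\<close> stands for the \<open>i\<close>-th generator and \<open>(i, False)\<close> for its inverse.
  Two words over \<open>I\<close> are related by \<open>presented_eq I R\<close> iff they represent the same element of
  the abstract group generated by \<open>I\<close> subject to the relators in \<open>R\<close>.\<close>

inductive presented_eq ::
  "'i set \<Rightarrow> ('i \<times> bool) list set \<Rightarrow> ('i \<times> bool) list \<Rightarrow> ('i \<times> bool) list \<Rightarrow> bool"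
  for I R where
  refl: "presented_eq I R u u"
| sym: "presented_eq I R u v \<Longrightarrow> presented_eq I R v u"
| trans: "presented_eq I R u v \<Longrightarrow> presented_eq I R v w \<Longrightarrow> presented_eq I R u w"
| cancel: "i \<in> I \<Longrightarrow> presented_eq I R (u @ [(i, b), (i, \<not> b)] @ v) (u @ v)"
| relator: "r \<in> R \<Longrightarrow> presented_eq I R (u @ r @ v) (u @ v)"

definition eval_letter :: "('a, 'm) monoid_scheme \<Rightarrow> ('i \<Rightarrow> 'a) \<Rightarrow> 'i \<times> bool \<Rightarrow> 'a" where
  "eval_letter G c x = (if snd x then c (fst x) else inv\<^bsub>G\<^esub> c (fst x))"

definition eval_word :: "('a, 'm) monoid_scheme \<Rightarrow> ('i \<Rightarrow> 'a) \<Rightarrow> ('i \<times> bool) list \<Rightarrow> 'a" where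
  "eval_word G c w = foldr (\<lambda>x g. eval_letter G c x \<otimes>\<^bsub>G\<^esub> g) w \<one>\<^bsub>G\<^esub>"

definition is_presentation ::
  "('a, 'm) monoid_scheme \<Rightarrow> 'i set \<Rightarrow> ('i \<Rightarrow> 'a) \<Rightarrow> ('i \<times> bool) list set \<Rightarrow> bool" where
  "is_presentation G I c R \<longleftrightarrow>
     c ` I \<subseteq> carrier G \<and> generate G (c ` I) = carrier G \<and>
     (\<forall>w \<in> lists (I \<times> UNIV). eval_word G c w = \<one>\<^bsub>G\<^esub> \<longleftrightarrow> presented_eq I R w [])"


section \<open>Punctured spheres\<close>

text \<open>The unit sphere of \<open>\<real>\<^sup>3\<close> is oriented by its outward normal; \<open>P\<close> is the set of punctures.\<close>

definition punctured_sphere :: "(real^3) set \<Rightarrow> (real^3) set" where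
  "punctured_sphere P = sphere 0 1 - P"

abbreviation sphere_group :: "(real^3) set \<Rightarrow> real^3 \<Rightarrow> (real \<Rightarrow> real^3) set monoid" where
  "sphere_group P x \<equiv> fundamental_group (punctured_sphere P) x"

text \<open>The boundary of the spherical cap with centre \<open>p\<close> and angular radius \<open>r\<close>. If \<open>u\<close> and \<open>v\<close> are
  orthonormal with cross product \<open>p\<close>, it runs counterclockwise around \<open>p\<close> as seen from outside.\<close>

definition cap_boundary :: "real^3 \<Rightarrow> real \<Rightarrow> real^3 \<Rightarrow> real^3 \<Rightarrow> real \<Rightarrow> real^3" where
  "cap_boundary p r u v =
     (\<lambda>t. cos r *\<^sub>R p + sin r *\<^sub>R (cos (2 * pi * t) *\<^sub>R u + sin (2 * pi * t) *\<^sub>R v))"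

text \<open>A counterclockwise loop around \<open>p\<close> is a loop freely homotopic in the punctured sphere to the
  boundary of a closed cap that contains no puncture other than \<open>p\<close>.\<close>

definition ccw_loop_around :: "(real^3) set \<Rightarrow> real^3 \<Rightarrow> (real \<Rightarrow> real^3) \<Rightarrow> bool" where
  "ccw_loop_around P p \<gamma> \<longleftrightarrow>
     (\<exists>r u v. 0 < r \<and> r < pi \<and> (\<forall>q\<in>P - {p}. p \<bullet> q < cos r) \<and>
        norm u = 1 \<and> norm v = 1 \<and> u \<bullet> v = 0 \<and> cross3 u v = p \<and>
        homotopic_loops (punctured_sphere P) \<gamma> (cap_boundary p r u v))"

definition peripheral_classes :: "(real^3) set \<Rightarrow> real^3 \<Rightarrow> real^3 \<Rightarrow> (real \<Rightarrow> real^3) set set" where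
  "peripheral_classes P x p = {c \<in> carrier (sphere_group P x). \<exists>\<gamma>\<in>c. ccw_loop_around P p \<gamma>}"


section \<open>Deroin--Tholozan representations\<close>

type_synonym sphere_rep = "(real \<Rightarrow> real^3) set \<Rightarrow> (real^2^2) set"

definition Hom_angles :: "(real^3) set \<Rightarrow> real^3 \<Rightarrow> (real^3 \<Rightarrow> real) \<Rightarrow> sphere_rep set" where
  "Hom_angles P x \<alpha> =
     {\<rho> \<in> hom (sphere_group P x) PSL2R \<inter> extensional (carrier (sphere_group P x)).
        \<forall>p\<in>P. \<forall>c\<in>peripheral_classes P x p. elliptic_with_angle (\<rho> c) (\<alpha> p)}"

definition Hom_angles_topology ::
  "(real^3) set \<Rightarrow> real^3 \<Rightarrow> (real^3 \<Rightarrow> real) \<Rightarrow> sphere_rep topology" where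
  "Hom_angles_topology P x \<alpha> =
     subtopology (product_topology (\<lambda>_. PSL2R_topology) (carrier (sphere_group P x)))
       (Hom_angles P x \<alpha>)"

definition conjugacy_class :: "(real^3) set \<Rightarrow> real^3 \<Rightarrow> sphere_rep \<Rightarrow> sphere_rep set" where
  "conjugacy_class P x \<rho> =
     (\<lambda>g. \<lambda>c\<in>carrier (sphere_group P x). g \<otimes>\<^bsub>PSL2R\<^esub> \<rho> c \<otimes>\<^bsub>PSL2R\<^esub> inv\<^bsub>PSL2R\<^esub> g) ` carrier PSL2R"

definition Rep_angles :: "(real^3) set \<Rightarrow> real^3 \<Rightarrow> (real^3 \<Rightarrow> real) \<Rightarrow> sphere_rep set topology" where
  "Rep_angles P x \<alpha> = quotient_topology (Hom_angles_topology P x \<alpha>) (conjugacy_class P x)"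

lemma topspace_Rep_angles:
  "topspace (Rep_angles P x \<alpha>) = conjugacy_class P x ` Hom_angles P x \<alpha>"
proof -
  have "Hom_angles P x \<alpha> \<subseteq> topspace (product_topology (\<lambda>_. PSL2R_topology) (carrier (sphere_group P x)))"
    by (auto simp: Hom_angles_def topspace_PSL2R_topology hom_def PiE_def)
  then have "topspace (Hom_angles_topology P x \<alpha>) = Hom_angles P x \<alpha>"
    by (metis Hom_angles_topology_def topspace_subtopology_subset)
  then show ?thesis by (simp add: Rep_angles_def)
qed

definition DT_representation :: "(real^3) set \<Rightarrow> real^3 \<Rightarrow> sphere_rep \<Rightarrow> bool" where
  "DT_representation P x \<rho> \<longleftrightarrow>
     (\<exists>\<alpha>. (\<forall>p\<in>P. 0 < \<alpha> p \<and> \<alpha> p < 2 * pi) \<and>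
        (sum \<alpha> P \<in> {0<..<2 * pi} \<or>
         sum \<alpha> P \<in> {2 * pi * (real (card P) - 1)<..<2 * pi * real (card P)}) \<and>
        \<rho> \<in> Hom_angles P x \<alpha> \<and>
        (\<exists>C \<in> connected_components_of (Rep_angles P x \<alpha>).
           compactin (Rep_angles P x \<alpha>) C \<and> conjugacy_class P x \<rho> \<in> C))"


section \<open>Geometric presentations, pants decompositions and triangle chains\<close>

text \<open>Generators are indexed by \<open>0, \<dots>, n - 1\<close>, read cyclically modulo \<open>n\<close>.\<close>

definition geometric_presentation ::
  "(real^3) set \<Rightarrow> real^3 \<Rightarrow> nat \<Rightarrow> (nat \<Rightarrow> (real \<Rightarrow> real^3) set) \<Rightarrow> bool" where
  "geometric_presentation P x n c \<longleftrightarrow>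
     is_presentation (sphere_group P x) {..<n} c {map (\<lambda>i. (i, True)) [0..<n]} \<and>
     (\<exists>p. bij_betw p {..<n} P \<and> (\<forall>i<n. c i \<in> peripheral_classes P x (p i)))"

text \<open>The \<open>m\<close> cyclically consecutive indices starting with \<open>i\<close>, and the product of the
  corresponding generators.\<close>

definition cyclic_interval :: "nat \<Rightarrow> nat \<Rightarrow> nat \<Rightarrow> nat set" where
  "cyclic_interval n i m = (\<lambda>j. (i + j) mod n) ` {..<m}"

definition cyclic_product ::
  "('a, 'm) monoid_scheme \<Rightarrow> nat \<Rightarrow> (nat \<Rightarrow> 'a) \<Rightarrow> nat \<Rightarrow> nat \<Rightarrow> 'a" where
  "cyclic_product G n c i m = foldr (\<lambda>j g. c ((i + j) mod n) \<otimes>\<^bsub>G\<^esub> g) [0..<m] \<one>\<^bsub>G\<^esub>"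

text \<open>A compatible pants decomposition \<open>I\<^sub>1 \<subset> \<dots> \<subset> I\<^sub>n\<^sub>-\<^sub>3\<close> is encoded by the first
  indices \<open>s 1, \<dots>, s (n - 3)\<close> of its members; the set \<open>I\<^sub>k\<close> has \<open>k + 1\<close> elements.\<close>

definition chain_set :: "nat \<Rightarrow> (nat \<Rightarrow> nat) \<Rightarrow> nat \<Rightarrow> nat set" where
  "chain_set n s k = cyclic_interval n (s k) (k + 1)"

definition pants_curve ::
  "('a, 'm) monoid_scheme \<Rightarrow> nat \<Rightarrow> (nat \<Rightarrow> 'a) \<Rightarrow> (nat \<Rightarrow> nat) \<Rightarrow> nat \<Rightarrow> 'a" where
  "pants_curve G n c s k = cyclic_product G n c (s k) (k + 1)"

definition compatible_pants_decomposition :: "nat \<Rightarrow> (nat \<Rightarrow> nat) \<Rightarrow> bool" where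
  "compatible_pants_decomposition n s \<longleftrightarrow>
     (\<forall>k\<in>{1..n - 3}. s k < n) \<and>
     (\<forall>k\<in>{1..<n - 3}. chain_set n s k \<subset> chain_set n s (k + 1))"

text \<open>The vertex set of the \<open>k\<close>-th triangle, for \<open>1 \<le> k \<le> n - 2\<close>, where \<open>F\<close> assigns to a
  group element the fixed point of its image. In the third case \<open>I\<^sub>k - I\<^sub>k\<^sub>-\<^sub>1\<close> is a
  singleton, in the last case \<open>{..<n} - I\<^sub>n\<^sub>-\<^sub>3\<close> consists of two indices.\<close>

definition triangle_vertices ::
  "('a, 'm) monoid_scheme \<Rightarrow> nat \<Rightarrow> (nat \<Rightarrow> 'a) \<Rightarrow> (nat \<Rightarrow> nat) \<Rightarrow> ('a \<Rightarrow> complex) \<Rightarrow> nat \<Rightarrow> complex set"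
  where
  "triangle_vertices G n c s F k =
     (if n = 3 then {F (c 0), F (c 1), F (c 2)}
      else if k = 1 then
        {F (c (s 1)), F (c ((s 1 + 1) mod n)), F (pants_curve G n c s 1)}
      else if k \<le> n - 3 then
        {F (pants_curve G n c s (k - 1)), F (pants_curve G n c s k)} \<union>
        (\<lambda>z. F (c z)) ` (chain_set n s k - chain_set n s (k - 1))
      else
        insert (F (pants_curve G n c s (n - 3)))
          ((\<lambda>z. F (c z)) ` ({..<n} - chain_set n s (n - 3))))"

definition triangle_chain ::
  "(real^3) set \<Rightarrow> real^3 \<Rightarrow> sphere_rep \<Rightarrow> nat \<Rightarrow> (nat \<Rightarrow> (real \<Rightarrow> real^3) set) \<Rightarrow> (nat \<Rightarrow> nat)
     \<Rightarrow> nat \<Rightarrow> complex set" where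
  "triangle_chain P x \<rho> n c s k =
     geodesic_triangle (triangle_vertices (sphere_group P x) n c s (\<lambda>a. fixed_point (\<rho> a)) k)"

end

theory Submission
  imports Defs "HOL-Complex_Analysis.Riemann_Mapping"
begin

text \<open>The chain used is the linear one. For a geometric presentation \<open>c\<^sub>0, \<dots>, c\<^sub>n\<^sub>-\<^sub>1\<close> put
  \<open>P\<^sub>k = c\<^sub>0 \<cdots> c\<^sub>k\<^sub>-\<^sub>1\<close>; then the \<open>k\<close>-th triangle has the vertices \<open>F(P\<^sub>k)\<close>, \<open>F(c\<^sub>k)\<close> and \<open>F(P\<^sub>k\<^sub>+\<^sub>1)\<close>,
  also for \<open>k = n - 2\<close>, because \<open>P\<^sub>n\<^sub>-\<^sub>1\<close> is the inverse of \<open>c\<^sub>n\<^sub>-\<^sub>1\<close>. The task is to choose the \<open>c\<^sub>k\<close>.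

  For \<open>0 < k < n\<close> and every geometric presentation \<open>\<rho>(P\<^sub>k)\<close> is elliptic (\<open>DT_prefix_product_elliptic\<close>).
  Otherwise \<open>\<rho>(P\<^sub>k)\<close> commutes with a noncompact one-parameter group; conjugating the images of
  \<open>c\<^sub>k, \<dots>, c\<^sub>n\<^sub>-\<^sub>1\<close> by it deforms \<open>\<rho>\<close> with fixed peripheral angles, hence inside the compact component,
  but the trace of \<open>c\<^sub>0 c\<^sub>k\<close> is unbounded along the deformation.

  At \<open>F(P\<^sub>k\<^sub>+\<^sub>1)\<close> the lines to \<open>F(P\<^sub>k)\<close> and \<open>F(c\<^sub>k)\<close> enclose half the rotation angle of \<open>\<rho>(P\<^sub>k\<^sub>+\<^sub>1)\<close>
  (\<open>direction_factors\<close>), which is not a multiple of \<open>\<pi>\<close>. So a triangle is degenerate only if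
  \<open>F(P\<^sub>k) = F(c\<^sub>k)\<close>. Hurwitz moves exchange neighbouring generators up to conjugation and change only
  one prefix product, so a generator with another fixed point can be moved into place
  (\<open>extend_nondegenerate\<close>, \<open>move_to_end\<close>). Such generators exist because the angles do not add up to a multiple
  of \<open>2 \<pi>\<close>, which excludes that all generators fix one point.

  The triangles before the pants curve \<open>P\<^sub>k\<^sub>+\<^sub>1\<close> can be rotated about the common vertex \<open>F(P\<^sub>k\<^sub>+\<^sub>1)\<close> by
  any multiple of the rotation angle of \<open>\<rho>(P\<^sub>k\<^sub>+\<^sub>1)\<close>, by Dehn twists. Both triangles at this vertex lie
  in sectors whose width is tied to half that angle, which leaves a closed arc of positions without
  overlap that is long enough not to be jumped over (\<open>separate_sectors_by_rotation\<close>). Treating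
  the vertices from the last to the first removes all overlaps (\<open>twist_separates\<close>).

  It remains to produce one geometric presentation (\<open>geometric_presentation_exists\<close>). The punctured
  sphere is the union of two geodesically star-shaped open sets, whose centres are antipodal points
  in general position and whose intersection consists of \<open>n\<close> lunes between the longitudes of the
  punctures. The van Kampen theorem in this situation (\<open>two_chart_union.presentation\<close>) says that loops
  running along one meridian and back along the next generate with their product as only
  relator; such a loop surrounds one puncture, since it bounds a lune that contains just this one.\<close>

section \<open>Presentations and their universal property\<close>

context group
begin

lemma eval_word_Nil [simp]: "eval_word G c [] = \<one>"
  by (simp add: eval_word_def)

lemma eval_word_Cons [simp]: "eval_word G c (x # w) = eval_letter G c x \<otimes> eval_word G c w"
  by (simp add: eval_word_def)

lemma eval_letter_closed: "(\<And>i. c i \<in> carrier G) \<Longrightarrow> eval_letter G c x \<in> carrier G"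
  by (simp add: eval_letter_def)

lemma eval_word_closed: "(\<And>i. c i \<in> carrier G) \<Longrightarrow> eval_word G c w \<in> carrier G"
  by (induction w) (auto simp: eval_letter_closed)

lemma eval_word_append:
  "(\<And>i. c i \<in> carrier G) \<Longrightarrow> eval_word G c (u @ v) = eval_word G c u \<otimes> eval_word G c v"
  by (induction u) (auto simp: eval_letter_closed eval_word_closed m_assoc)

lemma eval_word_cong:
  "w \<in> lists (I \<times> UNIV) \<Longrightarrow> (\<And>i. i \<in> I \<Longrightarrow> c i = d i) \<Longrightarrow> eval_word G c w = eval_word G d w"
  by (induction w) (auto simp: eval_letter_def)

lemma eval_letter_cancel:
  assumes "\<And>i. c i \<in> carrier G" "g \<in> carrier G"
  shows "eval_letter G c (i, b) \<otimes> (eval_letter G c (i, \<not> b) \<otimes> g) = g"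
  using assms by (cases b) (simp_all add: eval_letter_def flip: m_assoc)

lemma eval_word_presented_eq:
  assumes "presented_eq I R u v" "\<And>i. c i \<in> carrier G" "\<And>r. r \<in> R \<Longrightarrow> eval_word G c r = \<one>"
  shows "eval_word G c u = eval_word G c v"
  using assms
  by (induction rule: presented_eq.induct)
     (simp_all add: eval_word_append eval_word_closed eval_letter_cancel)

end

definition inverse_word :: "('i \<times> bool) list \<Rightarrow> ('i \<times> bool) list" where
  "inverse_word w = rev (map (\<lambda>x. (fst x, \<not> snd x)) w)"

lemma inverse_word_Nil [simp]: "inverse_word [] = []"
  by (simp add: inverse_word_def)

lemma inverse_word_Cons: "inverse_word (x # w) = inverse_word w @ [(fst x, \<not> snd x)]"
  by (simp add: inverse_word_def)

lemma inverse_word_in_lists: "w \<in> lists (I \<times> UNIV) \<Longrightarrow> inverse_word w \<in> lists (I \<times> UNIV)"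
  by (induction w) (auto simp: inverse_word_Cons)

lemma (in group) eval_inverse_word:
  assumes "\<And>i. c i \<in> carrier G"
  shows "eval_word G c (inverse_word w) = inv (eval_word G c w)"
  using assms
  by (induction w)
     (auto simp: inverse_word_Cons eval_word_append eval_word_closed eval_letter_closed
       inv_mult_group eval_letter_def)

lemma (in group) generate_eval_word:
  assumes "x \<in> generate G (c ` I)" "\<And>i. c i \<in> carrier G"
  shows "\<exists>w \<in> lists (I \<times> UNIV). eval_word G c w = x"
  using assms(1)
proof (induction rule: generate.induct)
  case one
  show ?case by (rule bexI[of _ "[]"]) auto
next
  case (incl h)
  then obtain i where "i \<in> I" "h = c i" by auto
  then show ?case using assms(2)
    by (intro bexI[of _ "[(i, True)]"]) (auto simp: eval_letter_def)
next
  case (inv h)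
  then obtain i where "i \<in> I" "h = c i" by auto
  then show ?case using assms(2)
    by (intro bexI[of _ "[(i, False)]"]) (auto simp: eval_letter_def)
next
  case (eng h1 h2)
  then obtain u v where "u \<in> lists (I \<times> UNIV)" "v \<in> lists (I \<times> UNIV)"
     "eval_word G c u = h1" "eval_word G c v = h2" by blast
  then show ?case using assms(2)
    by (intro bexI[of _ "u @ v"]) (auto simp: eval_word_append)
qed

text \<open>A group with a given presentation maps to every group in which the relators hold. The image
  of an element is read off any word that represents it; two such words are related by
  \<^const>\<open>presented_eq\<close>, hence have the same value in the target.\<close>

lemma presentation_universal:
  assumes "group G" "is_presentation G I c R" "R \<subseteq> lists (I \<times> UNIV)" "group K"
    and k: "\<And>i. i \<in> I \<Longrightarrow> k i \<in> carrier K" and R: "\<And>r. r \<in> R \<Longrightarrow> eval_word K k r = \<one>\<^bsub>K\<^esub>"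
  obtains \<phi> where "\<phi> \<in> hom G K" "\<And>i. i \<in> I \<Longrightarrow> \<phi> (c i) = k i"
proof -
  interpret G: group G by fact
  interpret K: group K by fact
  define c' where "c' = (\<lambda>i. if i \<in> I then c i else \<one>\<^bsub>G\<^esub>)"
  define k' where "k' = (\<lambda>i. if i \<in> I then k i else \<one>\<^bsub>K\<^esub>)"
  have c'[simp]: "c' i \<in> carrier G" for i
    using assms(2) by (auto simp: c'_def is_presentation_def)
  have k'[simp]: "k' i \<in> carrier K" for i using k by (auto simp: k'_def)
  have k'R: "eval_word K k' r = \<one>\<^bsub>K\<^esub>" if "r \<in> R" for r
    using R[OF that] K.eval_word_cong[of r I k' k] assms(3) that by (auto simp: k'_def)
  have ec: "eval_word G c w = eval_word G c' w" if "w \<in> lists (I \<times> UNIV)" for w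
    using G.eval_word_cong[OF that, of c c'] by (auto simp: c'_def)
  have wd: "eval_word K k' u = eval_word K k' v"
    if "u \<in> lists (I \<times> UNIV)" "v \<in> lists (I \<times> UNIV)" "eval_word G c' u = eval_word G c' v" for u v
  proof -
    have "eval_word G c' (inverse_word u @ v) = \<one>\<^bsub>G\<^esub>"
      using that by (simp add: G.eval_word_append G.eval_inverse_word G.eval_word_closed)
    then have "presented_eq I R (inverse_word u @ v) []"
      using assms(2) that ec[of "inverse_word u @ v"] inverse_word_in_lists[OF that(1)]
      by (auto simp: is_presentation_def)
    then have "eval_word K k' (inverse_word u @ v) = \<one>\<^bsub>K\<^esub>"
      using K.eval_word_presented_eq[of I R _ _ k'] k'R by fastforce
    then have "inv\<^bsub>K\<^esub> (eval_word K k' u) \<otimes>\<^bsub>K\<^esub> eval_word K k' v = \<one>\<^bsub>K\<^esub>"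
      by (simp add: K.eval_word_append K.eval_inverse_word)
    then show ?thesis
      by (metis K.eval_word_closed K.inv_closed K.inv_equality K.inv_inv k')
  qed
  have img: "c' ` I = c ` I" by (auto simp: c'_def)
  define W where "W = (\<lambda>x. SOME w. w \<in> lists (I \<times> UNIV) \<and> eval_word G c' w = x)"
  have W: "W x \<in> lists (I \<times> UNIV) \<and> eval_word G c' (W x) = x" if "x \<in> carrier G" for x
  proof -
    have "x \<in> generate G (c' ` I)" using that assms(2) img by (simp add: is_presentation_def)
    from G.generate_eval_word[OF this c'] show ?thesis
      unfolding W_def by (intro someI_ex[where P="\<lambda>w. w \<in> lists (I \<times> UNIV) \<and> eval_word G c' w = x"]) blast
  qed
  define \<phi> where "\<phi> = (\<lambda>x. eval_word K k' (W x))"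
  have "\<phi> \<in> hom G K"
  proof (rule homI)
    fix x y assume xy: "x \<in> carrier G" "y \<in> carrier G"
    have "\<phi> (x \<otimes>\<^bsub>G\<^esub> y) = eval_word K k' (W x @ W y)"
      unfolding \<phi>_def using xy W[of x] W[of y] W[of "x \<otimes>\<^bsub>G\<^esub> y"]
      by (intro wd) (auto simp: G.eval_word_append)
    then show "\<phi> (x \<otimes>\<^bsub>G\<^esub> y) = \<phi> x \<otimes>\<^bsub>K\<^esub> \<phi> y"
      by (simp add: \<phi>_def K.eval_word_append)
  qed (simp add: \<phi>_def K.eval_word_closed)
  moreover have "\<phi> (c i) = k i" if i: "i \<in> I" for i
  proof -
    have "c i \<in> carrier G" using c'[of i] i by (simp add: c'_def)
    then have "eval_word K k' (W (c i)) = eval_word K k' [(i, True)]"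
      using W[of "c i"] i c'[of i] by (intro wd) (auto simp: eval_letter_def c'_def)
    then show ?thesis using i k by (simp add: \<phi>_def eval_letter_def k'_def)
  qed
  ultimately show ?thesis using that by blast
qed

text \<open>The abstract group of a presentation. It serves as the universal target: a group generated by
  elements that satisfy the relators is presented by them as soon as it maps to this group,
  generators to generators.\<close>

definition presented_class ::
  "'i set \<Rightarrow> ('i \<times> bool) list set \<Rightarrow> ('i \<times> bool) list \<Rightarrow> ('i \<times> bool) list set" where
  "presented_class I R u = {v. presented_eq I R u v}"

definition presented_group ::
  "'i set \<Rightarrow> ('i \<times> bool) list set \<Rightarrow> ('i \<times> bool) list set monoid" where
  "presented_group I R =
     \<lparr>carrier = presented_class I R ` lists (I \<times> UNIV),
      mult = (\<lambda>X Y. {w. \<exists>u\<in>X. \<exists>v\<in>Y. presented_eq I R (u @ v) w}),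
      one = presented_class I R []\<rparr>"

lemma presented_eq_context: "presented_eq I R u v \<Longrightarrow> presented_eq I R (a @ u @ b) (a @ v @ b)"
proof (induction rule: presented_eq.induct)
  case (cancel i u c v)
  show ?case using presented_eq.cancel[OF cancel, of R "a @ u" c "v @ b"] by simp
next
  case (relator r u v)
  show ?case using presented_eq.relator[OF relator, of I "a @ u" "v @ b"] by simp
qed (blast intro: presented_eq.intros)+

lemma presented_eq_append:
  assumes "presented_eq I R u u'" "presented_eq I R v v'"
  shows "presented_eq I R (u @ v) (u' @ v')"
  using presented_eq_context[OF assms(1), of "[]" v] presented_eq_context[OF assms(2), of u' "[]"]
  by (auto intro: presented_eq.trans)

lemma presented_class_eq_iff: "presented_class I R u = presented_class I R v \<longleftrightarrow> presented_eq I R u v"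
  by (auto simp: presented_class_def intro: presented_eq.intros)

lemma presented_group_mult:
  "presented_class I R u \<otimes>\<^bsub>presented_group I R\<^esub> presented_class I R v = presented_class I R (u @ v)"
  by (auto simp: presented_class_def presented_group_def intro: presented_eq.intros presented_eq_append)

lemma presented_eq_inverse_word:
  "u \<in> lists (I \<times> UNIV) \<Longrightarrow> presented_eq I R (inverse_word u @ u) []"
proof (induction u)
  case (Cons x u)
  then have "presented_eq I R (inverse_word u @ [(fst x, \<not> snd x), (fst x, \<not> (\<not> snd x))] @ u) (inverse_word u @ u)"
    by (intro presented_eq.cancel) auto
  then show ?case using Cons by (auto simp: inverse_word_Cons intro: presented_eq.trans)
qed (simp add: presented_eq.refl)

lemma group_presented_group: "group (presented_group I R)"
proof (rule groupI)
  have c: "carrier (presented_group I R) = presented_class I R ` lists (I \<times> UNIV)"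
    and o: "\<one>\<^bsub>presented_group I R\<^esub> = presented_class I R []"
    by (simp_all add: presented_group_def)
  show "\<one>\<^bsub>presented_group I R\<^esub> \<in> carrier (presented_group I R)"
    by (simp add: c o)
  fix X assume "X \<in> carrier (presented_group I R)"
  then obtain u where u: "u \<in> lists (I \<times> UNIV)" "X = presented_class I R u" by (auto simp: c)
  show "\<one>\<^bsub>presented_group I R\<^esub> \<otimes>\<^bsub>presented_group I R\<^esub> X = X"
    by (simp add: o u presented_group_mult)
  show "\<exists>Y\<in>carrier (presented_group I R). Y \<otimes>\<^bsub>presented_group I R\<^esub> X = \<one>\<^bsub>presented_group I R\<^esub>"
    using u inverse_word_in_lists[OF u(1)] presented_eq_inverse_word[OF u(1), of R]
    by (intro bexI[of _ "presented_class I R (inverse_word u)"])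
       (auto simp: c o presented_group_mult presented_class_eq_iff)
  fix Y assume "Y \<in> carrier (presented_group I R)"
  then obtain v where v: "v \<in> lists (I \<times> UNIV)" "Y = presented_class I R v" by (auto simp: c)
  show "X \<otimes>\<^bsub>presented_group I R\<^esub> Y \<in> carrier (presented_group I R)"
    using u v by (auto simp: presented_group_mult c)
  fix Z assume "Z \<in> carrier (presented_group I R)"
  then obtain w where w: "w \<in> lists (I \<times> UNIV)" "Z = presented_class I R w" by (auto simp: c)
  show "X \<otimes>\<^bsub>presented_group I R\<^esub> Y \<otimes>\<^bsub>presented_group I R\<^esub> Z =
        X \<otimes>\<^bsub>presented_group I R\<^esub> (Y \<otimes>\<^bsub>presented_group I R\<^esub> Z)"
    by (simp add: u v w presented_group_mult)
qed

definition presented_gen :: "'i set \<Rightarrow> ('i \<times> bool) list set \<Rightarrow> 'i \<Rightarrow> ('i \<times> bool) list set" where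
  "presented_gen I R i = presented_class I R [(i, True)]"

lemma presented_gen_closed: "i \<in> I \<Longrightarrow> presented_gen I R i \<in> carrier (presented_group I R)"
  by (auto simp: presented_gen_def presented_group_def)

lemma eval_word_presented_gen:
  assumes "w \<in> lists (I \<times> UNIV)"
  shows "eval_word (presented_group I R) (presented_gen I R) w = presented_class I R w"
  using assms
proof (induction w)
  case Nil
  show ?case by (simp add: eval_word_def presented_group_def)
next
  case (Cons x w)
  interpret group "presented_group I R" by (rule group_presented_group)
  have x: "fst x \<in> I" using Cons by auto
  have "presented_class I R [(fst x, False)] \<otimes>\<^bsub>presented_group I R\<^esub> presented_gen I R (fst x)
     = \<one>\<^bsub>presented_group I R\<^esub>"
    using presented_eq.cancel[OF x, of R "[]" False "[]"]
    by (simp add: presented_gen_def presented_group_mult) (simp add: presented_group_def presented_class_eq_iff)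
  then have "inv\<^bsub>presented_group I R\<^esub> presented_gen I R (fst x) = presented_class I R [(fst x, False)]"
    using x by (intro inv_equality presented_gen_closed) (auto simp: presented_group_def)
  then have "eval_letter (presented_group I R) (presented_gen I R) x = presented_class I R [x]"
    by (cases x) (auto simp: eval_letter_def presented_gen_def)
  then show ?case using Cons by (simp add: presented_group_mult)
qed

lemma hom_eval_word:
  assumes "group G" "group K" "\<phi> \<in> hom G K" "\<And>i. i \<in> I \<Longrightarrow> c i \<in> carrier G" "w \<in> lists (I \<times> UNIV)"
  shows "eval_word G c w \<in> carrier G \<and> \<phi> (eval_word G c w) = eval_word K (\<lambda>i. \<phi> (c i)) w"
proof -
  interpret G: group G by fact
  interpret K: group K by fact
  interpret group_hom G K \<phi> by unfold_locales fact
  show ?thesis using assms(5)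
    by (induction w) (auto simp: eval_letter_def assms(4))
qed

lemma is_presentationI:
  fixes c :: "'i \<Rightarrow> 'a"
  assumes "group G" "R \<subseteq> lists (I \<times> UNIV)" "\<And>i. i \<in> I \<Longrightarrow> c i \<in> carrier G"
    and "generate G (c ` I) = carrier G" "\<And>r. r \<in> R \<Longrightarrow> eval_word G c r = \<one>\<^bsub>G\<^esub>"
    and "\<psi> \<in> hom G (presented_group I R)" "\<And>i. i \<in> I \<Longrightarrow> \<psi> (c i) = presented_gen I R i"
  shows "is_presentation G I c R"
  unfolding is_presentation_def
proof (intro conjI ballI iffI)
  interpret G: group G by fact
  interpret K: group "presented_group I R" by (rule group_presented_group)
  show "c ` I \<subseteq> carrier G" using assms by auto
  show "generate G (c ` I) = carrier G" by fact
  fix w :: "('i \<times> bool) list" assume w: "w \<in> lists (I \<times> UNIV)"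
  {
    assume "eval_word G c w = \<one>\<^bsub>G\<^esub>"
    then have "eval_word (presented_group I R) (\<lambda>i. \<psi> (c i)) w = \<one>\<^bsub>presented_group I R\<^esub>"
      using hom_eval_word[where c=c, OF assms(1) K.is_group assms(6) _ w] assms(3) hom_one[OF assms(6,1) K.is_group] by simp
    moreover have "eval_word (presented_group I R) (\<lambda>i. \<psi> (c i)) w = presented_class I R w"
      using K.eval_word_cong[OF w, of "\<lambda>i. \<psi> (c i)" "presented_gen I R"] assms(7)
        eval_word_presented_gen[OF w] by auto
    ultimately have "presented_class I R w = presented_class I R []"
      by (simp add: presented_group_def)
    then show "presented_eq I R w []" by (simp add: presented_class_eq_iff)
  next
    assume p: "presented_eq I R w []"
    define c' where "c' = (\<lambda>i. if i \<in> I then c i else \<one>\<^bsub>G\<^esub>)"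
    have c': "eval_word G c u = eval_word G c' u" if "u \<in> lists (I \<times> UNIV)" for u
      using that by (rule G.eval_word_cong) (simp add: c'_def)
    have "eval_word G c' w = eval_word G c' []"
      using p
    proof (rule G.eval_word_presented_eq)
      show "eval_word G c' r = \<one>\<^bsub>G\<^esub>" if "r \<in> R" for r
        using c'[OF subsetD[OF assms(2) that]] assms(5)[OF that] by simp
    qed (use assms in \<open>auto simp: c'_def\<close>)
    then show "eval_word G c w = \<one>\<^bsub>G\<^esub>" using c'[OF w] by simp
  }
qed

section \<open>Hurwitz moves and twists of a presentation\<close>

definition prefix_product :: "('a, 'm) monoid_scheme \<Rightarrow> (nat \<Rightarrow> 'a) \<Rightarrow> nat \<Rightarrow> 'a" where
  "prefix_product G c k = foldr (\<lambda>j g. c j \<otimes>\<^bsub>G\<^esub> g) [0..<k] \<one>\<^bsub>G\<^esub>"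

abbreviation product_relator :: "nat \<Rightarrow> (nat \<times> bool) list set" where
  "product_relator n \<equiv> {map (\<lambda>i. (i, True)) [0..<n]}"

lemma product_relator_subset: "product_relator n \<subseteq> lists ({..<n} \<times> UNIV)"
  by auto

lemma eval_word_product_relator:
  "eval_word G c (map (\<lambda>i. (i, True)) [0..<n]) = prefix_product G c n"
  by (simp add: eval_word_def prefix_product_def foldr_map eval_letter_def comp_def)

lemma prefix_product_0 [simp]: "prefix_product G c 0 = \<one>\<^bsub>G\<^esub>"
  by (simp add: prefix_product_def)

lemma (in monoid) foldr_mult_closed:
  "(\<And>j. j \<in> set xs \<Longrightarrow> c j \<in> carrier G) \<Longrightarrow> g \<in> carrier G \<Longrightarrow>
     foldr (\<lambda>j g. c j \<otimes> g) xs \<one> \<in> carrier G \<and>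
     foldr (\<lambda>j g. c j \<otimes> g) xs g = foldr (\<lambda>j g. c j \<otimes> g) xs \<one> \<otimes> g"
  by (induction xs) (auto simp: m_assoc)

lemma (in monoid) prefix_product_closed:
  "(\<And>j. j < k \<Longrightarrow> c j \<in> carrier G) \<Longrightarrow> prefix_product G c k \<in> carrier G"
  unfolding prefix_product_def using foldr_mult_closed[of "[0..<k]" c \<one>] by auto

lemma (in monoid) prefix_product_Suc:
  "(\<And>j. j \<le> k \<Longrightarrow> c j \<in> carrier G) \<Longrightarrow> prefix_product G c (Suc k) = prefix_product G c k \<otimes> c k"
  unfolding prefix_product_def using foldr_mult_closed[of "[0..<k]" c "c k"] by auto

lemma prefix_product_cong:
  "(\<And>j. j < k \<Longrightarrow> c j = d j) \<Longrightarrow> prefix_product G c k = prefix_product G d k"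
  unfolding prefix_product_def by (rule foldr_cong) auto

lemma hom_prefix_product:
  assumes "group G" "group K" "\<phi> \<in> hom G K" "\<And>j. j < k \<Longrightarrow> c j \<in> carrier G"
  shows "\<phi> (prefix_product G c k) = prefix_product K (\<lambda>j. \<phi> (c j)) k"
  using assms(4)
proof (induction k)
  case 0
  then show ?case using hom_one[OF assms(3,1,2)] by simp
next
  case (Suc k)
  interpret G: group G by fact
  interpret K: group K by fact
  have "\<phi> (c j) \<in> carrier K" if "j \<le> k" for j using Suc(2)[of j] that assms(3) by (auto simp: hom_def)
  then show ?case
    using Suc hom_mult[OF assms(3)] by (simp add: G.prefix_product_Suc K.prefix_product_Suc G.prefix_product_closed)
qed

text \<open>A change of generators that makes sense in every group, and can be undone in every group,
  turns presentations into presentations: the homomorphism required by the universal property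
  comes from the undone generators \<open>k\<close> of the abstract group.\<close>

lemma presentation_change_generators:
  fixes n :: nat
  defines "K \<equiv> presented_group {..<n} (product_relator n)"
  assumes "group G" "is_presentation G {..<n} c (product_relator n)"
    and d: "\<And>i. i < n \<Longrightarrow> d i \<in> carrier G" "prefix_product G d n = \<one>\<^bsub>G\<^esub>"
    and gen: "\<And>i. i < n \<Longrightarrow> c i \<in> generate G (d ` {..<n})"
    and k: "\<And>i. i < n \<Longrightarrow> k i \<in> carrier K" "prefix_product K k n = \<one>\<^bsub>K\<^esub>"
    and *: "\<And>\<phi> i. \<phi> \<in> hom G K \<Longrightarrow> (\<And>j. j < n \<Longrightarrow> \<phi> (c j) = k j) \<Longrightarrow> i < n \<Longrightarrow>
               \<phi> (d i) = presented_gen {..<n} (product_relator n) i"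
  shows "is_presentation G {..<n} d (product_relator n)"
proof -
  interpret G: group G by fact
  have K: "group K" unfolding K_def by (rule group_presented_group)
  obtain \<phi> where \<phi>: "\<phi> \<in> hom G K" "\<And>i. i < n \<Longrightarrow> \<phi> (c i) = k i"
    using presentation_universal[OF assms(2,3) product_relator_subset K, of k] k
    by (auto simp: eval_word_product_relator)
  have "carrier G = generate G (c ` {..<n})" using assms(3) by (simp add: is_presentation_def)
  also have "\<dots> \<subseteq> generate G (d ` {..<n})"
    using G.generate_subgroup_incl[OF _ G.generate_is_subgroup] gen d(1) by (metis image_subsetI lessThan_iff)
  finally have "generate G (d ` {..<n}) = carrier G"
    using G.generate_incl d(1) by (metis image_subsetI lessThan_iff subset_antisym)
  then show ?thesis
    using \<phi> d by (intro is_presentationI[where \<psi>=\<phi>] product_relator_subset *[folded K_def, unfolded K_def])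
      (auto simp: eval_word_product_relator G.is_group K_def)
qed

lemma presented_gen_product:
  "prefix_product (presented_group {..<n} (product_relator n)) (presented_gen {..<n} (product_relator n)) n
     = \<one>\<^bsub>presented_group {..<n} (product_relator n)\<^esub>"
proof -
  have "prefix_product (presented_group {..<n} (product_relator n)) (presented_gen {..<n} (product_relator n)) n
      = presented_class {..<n} (product_relator n) (map (\<lambda>i. (i, True)) [0..<n])"
    using eval_word_presented_gen[of "map (\<lambda>i. (i, True)) [0..<n]" "{..<n}" "product_relator n"] product_relator_subset
    by (simp add: eval_word_product_relator)
  then show ?thesis
    using presented_eq.relator[of "map (\<lambda>i. (i, True)) [0..<n]" "product_relator n" "{..<n}" "[]" "[]"]
    by (simp add: presented_group_def presented_class_eq_iff)
qed

lemma presentation_product: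
  assumes "group G" "is_presentation G {..<n} c (product_relator n)"
  shows "prefix_product G c n = \<one>\<^bsub>G\<^esub>"
proof -
  have "presented_eq {..<n} (product_relator n) (map (\<lambda>i. (i, True)) [0..<n]) []"
    using presented_eq.relator[of "map (\<lambda>i. (i, True)) [0..<n]" "product_relator n" "{..<n}" "[]" "[]"] by simp
  then show ?thesis using assms(2) product_relator_subset[of n]
    by (auto simp: is_presentation_def simp flip: eval_word_product_relator)
qed

text \<open>The effect on a geometric presentation of a half twist that exchanges two neighbouring punctures:
  the product of the two generators stays the same.\<close>

definition hurwitz_move :: "('a, 'm) monoid_scheme \<Rightarrow> nat \<Rightarrow> (nat \<Rightarrow> 'a) \<Rightarrow> nat \<Rightarrow> 'a" where
  "hurwitz_move G i c =
     c(i := c (Suc i), Suc i := inv\<^bsub>G\<^esub> c (Suc i) \<otimes>\<^bsub>G\<^esub> c i \<otimes>\<^bsub>G\<^esub> c (Suc i))"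

lemma (in group) hurwitz_move_closed:
  "(\<And>j. j < n \<Longrightarrow> c j \<in> carrier G) \<Longrightarrow> Suc i < n \<Longrightarrow> j < n \<Longrightarrow> hurwitz_move G i c j \<in> carrier G"
  by (auto simp: hurwitz_move_def)

lemma (in group) prefix_product_hurwitz_move:
  assumes "\<And>j. j < n \<Longrightarrow> c j \<in> carrier G" "Suc i < n" "k \<le> n" "k \<noteq> Suc i"
  shows "prefix_product G (hurwitz_move G i c) k = prefix_product G c k"
  using assms(3,4)
proof (induction k)
  case (Suc k)
  show ?case
  proof (cases "k = Suc i")
    case True
    have "prefix_product G (hurwitz_move G i c) i = prefix_product G c i"
      by (rule prefix_product_cong) (auto simp: hurwitz_move_def)
    moreover have "a \<otimes> b \<otimes> (inv b \<otimes> x \<otimes> b) = a \<otimes> x \<otimes> b"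
      if "a \<in> carrier G" "b \<in> carrier G" "x \<in> carrier G" for a b x
      using that by (simp add: m_assoc[symmetric]) (simp add: m_assoc)
    ultimately show ?thesis
      using True assms(1,2) hurwitz_move_closed[OF assms(1,2)] prefix_product_closed[of i c]
      by (simp add: prefix_product_Suc) (simp add: hurwitz_move_def)
  next
    case False
    then show ?thesis using Suc assms hurwitz_move_closed[OF assms(1,2)]
      by (cases "k = Suc i") (auto simp: prefix_product_Suc hurwitz_move_def)
  qed
qed simp

text \<open>The move is undone in the abstract group by the inverse half twist.\<close>

lemma presentation_hurwitz_move:
  assumes "group G" "is_presentation G {..<n} c (product_relator n)" "Suc i < n"
  shows "is_presentation G {..<n} (hurwitz_move G i c) (product_relator n)"
proof -
  interpret G: group G by fact
  let ?K = "presented_group {..<n} (product_relator n)"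
  let ?g = "presented_gen {..<n} (product_relator n)"
  interpret K: group ?K by (rule group_presented_group)
  have c: "c j \<in> carrier G" if "j < n" for j using assms(2) that by (auto simp: is_presentation_def)
  have g: "?g j \<in> carrier ?K" if "j < n" for j using that by (simp add: presented_gen_closed)
  define k where "k = ?g(i := ?g i \<otimes>\<^bsub>?K\<^esub> ?g (Suc i) \<otimes>\<^bsub>?K\<^esub> inv\<^bsub>?K\<^esub> ?g i, Suc i := ?g i)"
  have k: "k j \<in> carrier ?K" if "j < n" for j using that g assms(3) by (auto simp: k_def)
  have mk: "hurwitz_move ?K i k j = ?g j" if "j < n" for j
  proof -
    have "inv\<^bsub>?K\<^esub> a \<otimes>\<^bsub>?K\<^esub> (a \<otimes>\<^bsub>?K\<^esub> b \<otimes>\<^bsub>?K\<^esub> inv\<^bsub>?K\<^esub> a) \<otimes>\<^bsub>?K\<^esub> a = b"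
      if "a \<in> carrier ?K" "b \<in> carrier ?K" for a b
      using that by (simp add: K.m_assoc[symmetric]) (simp add: K.m_assoc)
    then show ?thesis using g assms(3) by (auto simp: hurwitz_move_def k_def)
  qed
  note one = presented_gen_product[of n] and cn = presentation_product[OF assms(1,2)]
  let ?d = "hurwitz_move G i c"
  show ?thesis
  proof (rule presentation_change_generators[OF assms(1,2), where k=k])
    show "?d j \<in> carrier G" if "j < n" for j
      using G.hurwitz_move_closed[of n c] c assms(3) that by blast
    show "prefix_product G ?d n = \<one>\<^bsub>G\<^esub>"
      using G.prefix_product_hurwitz_move[of n c i n] c assms(3) cn by simp
    show "prefix_product ?K k n = \<one>\<^bsub>?K\<^esub>"
      using K.prefix_product_hurwitz_move[of n k i n] k assms(3) prefix_product_cong[of n _ ?g ?K] mk one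
      by simp
    show "\<phi> (?d j) = ?g j" if "\<phi> \<in> hom G ?K" "\<And>j. j < n \<Longrightarrow> \<phi> (c j) = k j" "j < n" for \<phi> j
    proof -
      interpret group_hom G ?K \<phi> by unfold_locales fact
      have "\<phi> (?d j) = hurwitz_move ?K i k j"
        using that c assms(3) by (auto simp: hurwitz_move_def)
      then show ?thesis using mk that by simp
    qed
    show "c j \<in> generate G (?d ` {..<n})" if "j < n" for j
    proof -
      let ?H = "generate G (?d ` {..<n})"
      have sub: "subgroup ?H G"
        by (rule G.generate_is_subgroup) (use G.hurwitz_move_closed[of n c] c assms(3) in auto)
      have inc: "?d j \<in> ?H" if "j < n" for j using that by (intro generate.incl) auto
      have "c i = ?d i \<otimes>\<^bsub>G\<^esub> ?d (Suc i) \<otimes>\<^bsub>G\<^esub> inv\<^bsub>G\<^esub> ?d i"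
        using c assms(3) by (simp add: hurwitz_move_def G.m_assoc[symmetric]) (simp add: G.m_assoc)
      then have ci: "c i \<in> ?H"
        using inc[of i] inc[of "Suc i"] assms(3) sub by (simp add: subgroup.m_closed subgroup.m_inv_closed)
      have csi: "c (Suc i) \<in> ?H" using inc[of i] assms(3) by (simp add: hurwitz_move_def)
      show ?thesis using ci csi inc[OF that] by (cases "j = i"; cases "j = Suc i") (auto simp: hurwitz_move_def)
    qed
  qed (use k in auto)
qed

text \<open>Conjugating the first \<open>m\<close> generators by a power of their product is the effect of a power of
  the Dehn twist along the curve represented by that product.\<close>

definition twist :: "('a, 'm) monoid_scheme \<Rightarrow> nat \<Rightarrow> 'a \<Rightarrow> (nat \<Rightarrow> 'a) \<Rightarrow> nat \<Rightarrow> 'a" where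
  "twist G m g c = (\<lambda>i. if i < m then g \<otimes>\<^bsub>G\<^esub> c i \<otimes>\<^bsub>G\<^esub> inv\<^bsub>G\<^esub> g else c i)"

lemma (in group) twist_closed:
  "(\<And>j. j < n \<Longrightarrow> c j \<in> carrier G) \<Longrightarrow> g \<in> carrier G \<Longrightarrow> j < n \<Longrightarrow> twist G m g c j \<in> carrier G"
  by (auto simp: twist_def)

lemma (in group) conj_mult:
  "g \<in> carrier G \<Longrightarrow> a \<in> carrier G \<Longrightarrow> b \<in> carrier G \<Longrightarrow>
     (g \<otimes> a \<otimes> inv g) \<otimes> (g \<otimes> b \<otimes> inv g) = g \<otimes> (a \<otimes> b) \<otimes> inv g"
  by (metis inv_closed inv_solve_right m_assoc m_closed)

lemma (in group) prefix_product_twist_le: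
  assumes "\<And>j. j < n \<Longrightarrow> c j \<in> carrier G" "g \<in> carrier G" "m \<le> n" "k \<le> m"
  shows "prefix_product G (twist G m g c) k = g \<otimes> prefix_product G c k \<otimes> inv g"
  using assms(4)
proof (induction k)
  case (Suc k)
  then have "prefix_product G (twist G m g c) (Suc k) =
      (g \<otimes> prefix_product G c k \<otimes> inv g) \<otimes> (g \<otimes> c k \<otimes> inv g)"
    using assms by (simp add: prefix_product_Suc twist_closed[OF assms(1,2)]) (simp add: twist_def)
  also have "\<dots> = g \<otimes> (prefix_product G c k \<otimes> c k) \<otimes> inv g"
    using Suc.prems assms by (intro conj_mult prefix_product_closed) auto
  finally show ?case using Suc.prems assms by (simp add: prefix_product_Suc)
qed (use assms in simp)

lemma (in group) prefix_product_twist_ge: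
  assumes "\<And>j. j < n \<Longrightarrow> c j \<in> carrier G" "g \<in> carrier G" "m \<le> k" "k \<le> n"
    and comm: "g \<otimes> prefix_product G c m = prefix_product G c m \<otimes> g"
  shows "prefix_product G (twist G m g c) k = prefix_product G c k"
  using assms(3,4)
proof (induction k rule: dec_induct)
  case base
  have p: "prefix_product G c m \<in> carrier G" using assms base by (intro prefix_product_closed) auto
  have "prefix_product G (twist G m g c) m = g \<otimes> prefix_product G c m \<otimes> inv g"
    using base by (intro prefix_product_twist_le[OF assms(1,2)]) auto
  also have "\<dots> = prefix_product G c m"
    using comm p assms(2) by (simp add: m_assoc)
  finally show ?case .
next
  case (step k)
  then show ?case using assms
    by (simp add: prefix_product_Suc twist_closed[OF assms(1,2)]) (simp add: twist_def)
qed

lemma (in group) power_commutes: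
  fixes j :: int
  assumes "a \<in> carrier G"
  shows "a [^] j \<otimes> a = a \<otimes> a [^] j"
  using int_pow_mult[of a j 1] int_pow_mult[of a 1 j] assms by (simp add: add.commute)

text \<open>The twist is undone in the abstract group by the inverse power, since the product of the first
  \<open>m\<close> generators is not changed by conjugation with itself.\<close>

lemma presentation_twist:
  fixes j :: int
  assumes "group G" "is_presentation G {..<n} c (product_relator n)" "m \<le> n"
  shows "is_presentation G {..<n} (twist G m (prefix_product G c m [^]\<^bsub>G\<^esub> j) c) (product_relator n)"
proof -
  interpret G: group G by fact
  let ?K = "presented_group {..<n} (product_relator n)"
  let ?g = "presented_gen {..<n} (product_relator n)"
  interpret K: group ?K by (rule group_presented_group)
  have c: "c i \<in> carrier G" if "i < n" for i using assms(2) that by (auto simp: is_presentation_def)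
  have g: "?g i \<in> carrier ?K" if "i < n" for i using that by (simp add: presented_gen_closed)
  define p where "p = prefix_product G c m"
  define q where "q = prefix_product ?K ?g m"
  define h where "h = p [^]\<^bsub>G\<^esub> j"
  have p: "p \<in> carrier G" and q: "q \<in> carrier ?K"
    using c g assms(3) by (auto simp: p_def q_def intro!: G.prefix_product_closed K.prefix_product_closed)
  then have h: "h \<in> carrier G" by (simp add: h_def)
  let ?d = "twist G m h c"
  define k where "k = twist ?K m (inv\<^bsub>?K\<^esub> (q [^]\<^bsub>?K\<^esub> j)) ?g"
  have q': "inv\<^bsub>?K\<^esub> (q [^]\<^bsub>?K\<^esub> j) = q [^]\<^bsub>?K\<^esub> (-j)" using q by (simp add: K.int_pow_neg)
  have commk: "inv\<^bsub>?K\<^esub> (q [^]\<^bsub>?K\<^esub> j) \<otimes>\<^bsub>?K\<^esub> q = q \<otimes>\<^bsub>?K\<^esub> inv\<^bsub>?K\<^esub> (q [^]\<^bsub>?K\<^esub> j)"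
    unfolding q' by (rule K.power_commutes[OF q])
  have commc: "h \<otimes>\<^bsub>G\<^esub> p = p \<otimes>\<^bsub>G\<^esub> h" unfolding h_def by (rule G.power_commutes[OF p])
  have km: "prefix_product ?K k i = prefix_product ?K ?g i" if "m \<le> i" "i \<le> n" for i
    unfolding k_def by (rule K.prefix_product_twist_ge[where n=n]) (use g q commk that in \<open>auto simp: q_def\<close>)
  have dm: "prefix_product G ?d i = prefix_product G c i" if "m \<le> i" "i \<le> n" for i
    by (rule G.prefix_product_twist_ge[where n=n]) (use c h commc that in \<open>auto simp: p_def\<close>)
  show "is_presentation G {..<n} (twist G m (prefix_product G c m [^]\<^bsub>G\<^esub> j) c) (product_relator n)"
    unfolding p_def[symmetric] h_def[symmetric]
  proof (rule presentation_change_generators[OF assms(1,2), where k=k])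
    show dc: "?d i \<in> carrier G" if "i < n" for i using G.twist_closed[of n c] c h that by blast
    show "prefix_product G ?d n = \<one>\<^bsub>G\<^esub>" using dm[of n] assms(3) presentation_product[OF assms(1,2)] by simp
    show kc: "k i \<in> carrier ?K" if "i < n" for i
      unfolding k_def using K.twist_closed[of n ?g] g q that by blast
    show "prefix_product ?K k n = \<one>\<^bsub>?K\<^esub>" using km[of n] assms(3) presented_gen_product by simp
    show "\<phi> (?d i) = ?g i" if \<phi>: "\<phi> \<in> hom G ?K" "\<And>j. j < n \<Longrightarrow> \<phi> (c j) = k j" and i: "i < n" for \<phi> i
    proof -
      interpret group_hom G ?K \<phi> by unfold_locales fact
      have "\<phi> p = prefix_product ?K (\<lambda>i. \<phi> (c i)) m"
        unfolding p_def using c assms(3) by (intro hom_prefix_product G.is_group K.is_group \<phi>(1)) auto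
      also have "\<dots> = q"
        using prefix_product_cong[of m "\<lambda>i. \<phi> (c i)" k ?K] \<phi>(2) assms(3) km[of m] by (simp add: q_def)
      finally have ph: "\<phi> h = q [^]\<^bsub>?K\<^esub> j" using p by (simp add: h_def hom_int_pow)
      have "a \<otimes>\<^bsub>?K\<^esub> (inv\<^bsub>?K\<^esub> a \<otimes>\<^bsub>?K\<^esub> b \<otimes>\<^bsub>?K\<^esub> a) \<otimes>\<^bsub>?K\<^esub> inv\<^bsub>?K\<^esub> a = b"
        if "a \<in> carrier ?K" "b \<in> carrier ?K" for a b
        using that by (simp add: K.m_assoc[symmetric]) (simp add: K.m_assoc)
      then show ?thesis
        using c h i ph \<phi>(2) g q by (auto simp: twist_def k_def)
    qed
    show "c i \<in> generate G (?d ` {..<n})" if i: "i < n" for i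
    proof -
      let ?H = "generate G (?d ` {..<n})"
      have sub: "subgroup ?H G" by (rule G.generate_is_subgroup) (use dc in auto)
      have inc: "?d i \<in> ?H" if "i < n" for i using that by (intro generate.incl) auto
      have "prefix_product G ?d i \<in> ?H" if "i \<le> n" for i
        using that
      proof (induction i)
        case (Suc i)
        then show ?case using inc[of i] dc sub by (simp add: G.prefix_product_Suc subgroup.m_closed)
      qed (use sub in \<open>simp add: subgroup.one_closed\<close>)
      from this[of m] have "p \<in> ?H" using dm[of m] assms(3) by (simp add: p_def)
      then have hH: "h \<in> ?H" using G.subgroup_int_pow_closed[OF sub \<open>p \<in> ?H\<close>, of j] by (simp add: h_def)
      have "a = inv\<^bsub>G\<^esub> h \<otimes>\<^bsub>G\<^esub> (h \<otimes>\<^bsub>G\<^esub> a \<otimes>\<^bsub>G\<^esub> inv\<^bsub>G\<^esub> h) \<otimes>\<^bsub>G\<^esub> h" if "a \<in> carrier G" for a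
        using that h by (simp add: G.m_assoc[symmetric]) (simp add: G.m_assoc)
      then have "c i = inv\<^bsub>G\<^esub> h \<otimes>\<^bsub>G\<^esub> ?d i \<otimes>\<^bsub>G\<^esub> h" if "i < m" using c[OF i] that by (simp add: twist_def)
      then show ?thesis using inc[OF i] hH sub
        by (cases "i < m") (auto simp: subgroup.m_closed subgroup.m_inv_closed, simp add: twist_def)
    qed
  qed
qed

section \<open>The hyperboloid model and geodesic triangles\<close>

text \<open>The coordinates \<open>(a, b, c)\<close> stand for the quadratic form \<open>c X\<^sup>2 - 2 b X Y + a Y\<^sup>2\<close>. The form of \<open>z\<close> has the
  root \<open>z\<close> and determinant \<open>1\<close>; \<open>lorentz\<close> is the polarisation of the determinant and computes the
  hyperbolic cosine of the distance.\<close>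

definition hyperboloid_point :: "complex \<Rightarrow> real \<times> real \<times> real" where
  "hyperboloid_point z = ((cmod z)\<^sup>2 / Im z, Re z / Im z, 1 / Im z)"

definition lorentz :: "real \<times> real \<times> real \<Rightarrow> real \<times> real \<times> real \<Rightarrow> real" where
  "lorentz u v = (fst u * snd (snd v) + snd (snd u) * fst v) / 2 - fst (snd u) * fst (snd v)"

lemma lorentz_simps:
  "lorentz (u + v) w = lorentz u w + lorentz v w" "lorentz w (u + v) = lorentz w u + lorentz w v"
  "lorentz (u - v) w = lorentz u w - lorentz v w" "lorentz w (u - v) = lorentz w u - lorentz w v"
  "lorentz (a *\<^sub>R u) w = a * lorentz u w" "lorentz w (a *\<^sub>R u) = a * lorentz w u"
  by (simp_all add: lorentz_def field_simps)

lemma lorentz_commute: "lorentz u v = lorentz v u"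
  by (simp add: lorentz_def field_simps)

lemma lorentz_hyperboloid_point:
  assumes "z \<in> hyp_plane" "w \<in> hyp_plane"
  shows "lorentz (hyperboloid_point z) (hyperboloid_point w) = 1 + (cmod (z - w))\<^sup>2 / (2 * Im z * Im w)"
  using assms unfolding lorentz_def hyperboloid_point_def hyp_plane_def cmod_power2
  by (simp add: field_simps) (simp add: power2_eq_square algebra_simps)

lemma hyp_dist_eq:
  "z \<in> hyp_plane \<Longrightarrow> w \<in> hyp_plane \<Longrightarrow>
     hyp_dist z w = arcosh (lorentz (hyperboloid_point z) (hyperboloid_point w))"
  by (simp add: hyp_dist_def lorentz_hyperboloid_point)

lemma lorentz_ge_1:
  "z \<in> hyp_plane \<Longrightarrow> w \<in> hyp_plane \<Longrightarrow> lorentz (hyperboloid_point z) (hyperboloid_point w) \<ge> 1"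
  by (simp add: lorentz_hyperboloid_point) (simp add: hyp_plane_def)

lemma lorentz_self: "z \<in> hyp_plane \<Longrightarrow> lorentz (hyperboloid_point z) (hyperboloid_point z) = 1"
  by (simp add: lorentz_hyperboloid_point)

lemma lorentz_eq_1_iff:
  "z \<in> hyp_plane \<Longrightarrow> w \<in> hyp_plane \<Longrightarrow>
     lorentz (hyperboloid_point z) (hyperboloid_point w) = 1 \<longleftrightarrow> z = w"
  by (simp add: lorentz_hyperboloid_point) (auto simp: hyp_plane_def)

lemma hyperboloid_point_surj:
  assumes "lorentz v v = 1" "snd (snd v) > 0"
  shows "\<exists>z\<in>hyp_plane. hyperboloid_point z = v"
proof -
  obtain a b c where v: "v = (a, b, c)" by (cases v)
  have c: "c > 0" "a * c = 1 + b\<^sup>2" using assms by (auto simp: v lorentz_def power2_eq_square)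
  then have a: "a = (1 + b\<^sup>2) / c" by (simp add: field_simps)
  have "hyperboloid_point (Complex (b / c) (1 / c)) = v"
    using c unfolding v a hyperboloid_point_def cmod_power2
    by (simp add: field_simps power2_eq_square)
  moreover have "Complex (b / c) (1 / c) \<in> hyp_plane" using c by (simp add: hyp_plane_def)
  ultimately show ?thesis by blast
qed

text \<open>A null vector orthogonal to a point of the hyperboloid vanishes, because the form is definite
  on the tangent plane.\<close>

lemma lorentz_null_orthogonal:
  assumes "z \<in> hyp_plane" "lorentz v (hyperboloid_point z) = 0" "lorentz v v = 0"
  shows "v = 0"
proof -
  obtain a b c where v: "v = (a, b, c)" by (cases v)
  have y: "Im z > 0" using assms(1) by (simp add: hyp_plane_def)
  have "a * c = b\<^sup>2" using assms(3) by (simp add: v lorentz_def power2_eq_square)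
  moreover have "2 * Im z * lorentz v (hyperboloid_point z) = a - (2 * b * Re z - c * (cmod z)\<^sup>2)"
    using y by (simp add: v lorentz_def hyperboloid_point_def field_simps)
  then have a: "a = 2 * b * Re z - c * (cmod z)\<^sup>2" using assms(2) by simp
  ultimately have "(2 * b * Re z - c * (cmod z)\<^sup>2) * c = b\<^sup>2" by (simp only:)
  then have "(b - c * Re z)\<^sup>2 + (c * Im z)\<^sup>2 = 0"
    unfolding cmod_power2 by (simp add: power2_eq_square algebra_simps)
  then have "b - c * Re z = 0" "c * Im z = 0" by (simp_all add: sum_power2_eq_zero_iff)
  then show ?thesis using y a by (simp add: v zero_prod_def)
qed

lemma cosh_add_arcosh:
  fixes a b :: real
  assumes "a \<ge> 1" "b \<ge> 1"
  shows "cosh (arcosh a + arcosh b) = a * b + sqrt ((a\<^sup>2 - 1) * (b\<^sup>2 - 1))"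
  using assms by (simp add: cosh_add cosh_arcosh_real sinh_arcosh_real real_sqrt_mult)

text \<open>Geodesic segments are the nonnegative linear combinations in the hyperboloid model. For a point
  \<open>x\<close> of the segment, equality in the triangle inequality says that the Gram determinant of the three
  vectors vanishes, so the part of \<open>x\<close> orthogonal to the end points is a null vector.\<close>

lemma hyp_segment_hyperboloid:
  assumes z: "z \<in> hyp_plane" and w: "w \<in> hyp_plane" and x: "x \<in> hyp_segment z w"
  obtains l m where "l \<ge> 0" "m \<ge> 0"
    "hyperboloid_point x = l *\<^sub>R hyperboloid_point z + m *\<^sub>R hyperboloid_point w"
proof -
  let ?h = hyperboloid_point
  define A where "A = lorentz (?h z) (?h x)"
  define B where "B = lorentz (?h x) (?h w)"
  define C where "C = lorentz (?h z) (?h w)"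
  have xH: "x \<in> hyp_plane" using x by (simp add: hyp_segment_def)
  have ge: "A \<ge> 1" "B \<ge> 1" "C \<ge> 1" using z w xH by (auto simp: A_def B_def C_def lorentz_ge_1)
  have "arcosh A + arcosh B = arcosh C"
    using x z w xH by (simp add: hyp_segment_def hyp_dist_eq A_def B_def C_def)
  then have CC: "C = A * B + sqrt ((A\<^sup>2 - 1) * (B\<^sup>2 - 1))"
    using cosh_add_arcosh[of A B] ge by (simp add: cosh_arcosh_real)
  have pos: "(A\<^sup>2 - 1) * (B\<^sup>2 - 1) \<ge> 0" using ge by (intro mult_nonneg_nonneg) simp_all
  have Cge: "C \<ge> A * B" using CC pos by simp
  have "(C - A * B)\<^sup>2 = (A\<^sup>2 - 1) * (B\<^sup>2 - 1)" using CC pos by simp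
  then have gram: "C\<^sup>2 - 1 = 2 * A * B * C - A\<^sup>2 - B\<^sup>2" by (simp add: power2_eq_square algebra_simps)
  show ?thesis
  proof (cases "C = 1")
    case True
    then have "A * B \<le> 1" using Cge by simp
    then have "A = 1" using ge by (smt (verit) mult_less_cancel_left2 mult_left_le)
    then have "x = z" using z xH by (simp add: A_def lorentz_eq_1_iff)
    then show ?thesis by (intro that[of 1 0]) auto
  next
    case False
    then have C1: "C\<^sup>2 - 1 > 0" using ge by (simp add: power2_eq_square less_1_mult)
    define l where "l = (B * C - A) / (C\<^sup>2 - 1)"
    define m where "m = (A * C - B) / (C\<^sup>2 - 1)"
    have "B * C \<ge> A" 
    proof -
      have "B * C \<ge> B * (A * B)" using Cge ge by (intro mult_left_mono) auto
      moreover have "A * (B * B) \<ge> A * 1" using ge by (intro mult_left_mono) (auto simp: mult_ge1_I)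
      ultimately show ?thesis by (simp add: mult_ac)
    qed
    then have l0: "l \<ge> 0" using C1 by (simp add: l_def)
    have "A * C \<ge> B"
    proof -
      have "A * C \<ge> A * (A * B)" using Cge ge by (intro mult_left_mono) auto
      moreover have "B * (A * A) \<ge> B * 1" using ge by (intro mult_left_mono) (auto simp: mult_ge1_I)
      ultimately show ?thesis by (simp add: mult_ac)
    qed
    then have m0: "m \<ge> 0" using C1 by (simp add: m_def)
    have lmD: "l * (C\<^sup>2 - 1) = B * C - A" "m * (C\<^sup>2 - 1) = A * C - B"
      using C1 by (simp_all add: l_def m_def)
    have "(l + m * C) * (C\<^sup>2 - 1) = l * (C\<^sup>2 - 1) + m * (C\<^sup>2 - 1) * C"
      "(l * C + m) * (C\<^sup>2 - 1) = l * (C\<^sup>2 - 1) * C + m * (C\<^sup>2 - 1)" by (simp_all add: algebra_simps)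
    then have "(l + m * C) * (C\<^sup>2 - 1) = A * (C\<^sup>2 - 1)" "(l * C + m) * (C\<^sup>2 - 1) = B * (C\<^sup>2 - 1)"
      unfolding lmD by (simp_all add: power2_eq_square algebra_simps)
    then have lm: "l + m * C = A" "l * C + m = B" using C1 by simp_all
    have l3: "l * A + m * B = 1"
    proof -
      have "l * A + m * B = (2 * A * B * C - A\<^sup>2 - B\<^sup>2) / (C\<^sup>2 - 1)"
        by (simp add: l_def m_def power2_eq_square algebra_simps flip: add_divide_distrib)
      then show ?thesis using gram C1 by simp
    qed
    define v where "v = ?h x - (l *\<^sub>R ?h z + m *\<^sub>R ?h w)"
    have vz: "lorentz v (?h z) = 0"
      using lm(1) z by (simp add: v_def lorentz_simps lorentz_self lorentz_commute[of "?h x" "?h z"] lorentz_commute[of "?h w" "?h z"] A_def C_def)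
    have vw: "lorentz v (?h w) = 0"
      using lm(2) w by (simp add: v_def lorentz_simps lorentz_self B_def C_def)
    have "lorentz v v = lorentz v (?h x)"
      using vz vw by (subst (2) v_def) (simp add: lorentz_simps)
    also have "\<dots> = 1 - (l * A + m * B)"
      using xH by (simp add: v_def lorentz_simps lorentz_self A_def B_def lorentz_commute[of "?h w" "?h x"])
    also have "\<dots> = 0" using l3 by simp
    finally have "v = 0" using lorentz_null_orthogonal[OF z vz] by simp
    then show ?thesis using that[of l m] l0 m0 by (simp add: v_def)
  qed
qed

lemma hyperboloid_hyp_segment:
  assumes z: "z \<in> hyp_plane" and w: "w \<in> hyp_plane" and xH: "x \<in> hyp_plane" and "l \<ge> 0" "m \<ge> 0"
    and x: "hyperboloid_point x = l *\<^sub>R hyperboloid_point z + m *\<^sub>R hyperboloid_point w"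
  shows "x \<in> hyp_segment z w"
proof -
  let ?h = hyperboloid_point
  define A where "A = lorentz (?h z) (?h x)"
  define B where "B = lorentz (?h x) (?h w)"
  define C where "C = lorentz (?h z) (?h w)"
  have ge: "A \<ge> 1" "B \<ge> 1" "C \<ge> 1" using z w xH by (auto simp: A_def B_def C_def lorentz_ge_1)
  have A: "A = l + m * C" and B: "B = l * C + m"
    using z w by (simp_all add: A_def B_def C_def x lorentz_simps lorentz_self)
  have "1 = l * A + m * B"
    using lorentz_self[OF xH] unfolding A_def B_def by (subst (asm) x) (simp add: lorentz_simps lorentz_commute)
  then have one: "1 = l\<^sup>2 + m\<^sup>2 + 2 * l * m * C" by (simp add: A B power2_eq_square algebra_simps)
  have "A\<^sup>2 - (l\<^sup>2 + m\<^sup>2 + 2 * l * m * C) = m\<^sup>2 * (C\<^sup>2 - 1)"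
    "B\<^sup>2 - (l\<^sup>2 + m\<^sup>2 + 2 * l * m * C) = l\<^sup>2 * (C\<^sup>2 - 1)"
    unfolding A B by (simp_all add: power2_eq_square algebra_simps)
  then have "A\<^sup>2 - 1 = m\<^sup>2 * (C\<^sup>2 - 1)" and "B\<^sup>2 - 1 = l\<^sup>2 * (C\<^sup>2 - 1)" unfolding one[symmetric] .
  then have "(A\<^sup>2 - 1) * (B\<^sup>2 - 1) = (l * m * (C\<^sup>2 - 1))\<^sup>2" by (simp add: power2_eq_square)
  moreover have "l * m * (C\<^sup>2 - 1) \<ge> 0" using assms ge by (intro mult_nonneg_nonneg) auto
  ultimately have "cosh (arcosh A + arcosh B) = A * B + l * m * (C\<^sup>2 - 1)"
    using cosh_add_arcosh[of A B] ge by simp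
  also have "\<dots> = (l\<^sup>2 + m\<^sup>2 + 2 * l * m * C) * C" by (simp add: A B power2_eq_square algebra_simps)
  finally have "cosh (arcosh A + arcosh B) = C" using one by simp
  moreover have "arcosh A + arcosh B \<ge> 0" using ge by (simp add: arcosh_nonneg_real)
  ultimately have "arcosh A + arcosh B = arcosh C" using arcosh_cosh_real by metis
  then show ?thesis using z w xH by (simp add: hyp_segment_def hyp_dist_eq A_def B_def C_def)
qed

text \<open>A linear inequality in the hyperboloid model cuts out a half-plane bounded by a geodesic.\<close>

lemma hyp_convex_half_plane:
  fixes f :: "real \<times> real \<times> real \<Rightarrow> real"
  assumes "linear f"
  shows "hyp_convex {z \<in> hyp_plane. f (hyperboloid_point z) \<ge> 0}"
  unfolding hyp_convex_def
proof (intro conjI ballI subsetI)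
  fix z w x assume zw: "z \<in> {z \<in> hyp_plane. f (hyperboloid_point z) \<ge> 0}"
     "w \<in> {z \<in> hyp_plane. f (hyperboloid_point z) \<ge> 0}" and x: "x \<in> hyp_segment z w"
  obtain l m where "l \<ge> 0" "m \<ge> 0"
    "hyperboloid_point x = l *\<^sub>R hyperboloid_point z + m *\<^sub>R hyperboloid_point w"
    using hyp_segment_hyperboloid[OF _ _ x] zw by auto
  then show "x \<in> {z \<in> hyp_plane. f (hyperboloid_point z) \<ge> 0}"
    using x zw assms by (auto simp: hyp_segment_def linear_add linear_scale)
qed auto

lemma geodesic_triangle_subset_half_plane:
  fixes f :: "real \<times> real \<times> real \<Rightarrow> real"
  assumes "linear f" "V \<subseteq> hyp_plane" "\<And>z. z \<in> V \<Longrightarrow> f (hyperboloid_point z) \<ge> 0"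
  shows "geodesic_triangle V \<subseteq> {z \<in> hyp_plane. f (hyperboloid_point z) \<ge> 0}"
  unfolding geodesic_triangle_def
  by (rule hull_minimal) (use assms hyp_convex_half_plane in auto)

text \<open>A ray from a vertex through an interior point leaves through the opposite side, so such a point is
  reached by taking geodesic segments twice.\<close>

lemma geodesic_triangle_cone:
  assumes V: "V \<subseteq> hyp_plane" "z1 \<in> V" "z2 \<in> V" "z3 \<in> V" and x: "x \<in> hyp_plane"
    and pos: "a > 0" "b > 0" "c > 0"
    and eq: "hyperboloid_point x = a *\<^sub>R hyperboloid_point z1 + b *\<^sub>R hyperboloid_point z2 + c *\<^sub>R hyperboloid_point z3"
  shows "x \<in> geodesic_triangle V"
proof -
  let ?h = hyperboloid_point
  have H: "z1 \<in> hyp_plane" "z2 \<in> hyp_plane" "z3 \<in> hyp_plane" using V by auto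
  define v where "v = a *\<^sub>R ?h z1 + b *\<^sub>R ?h z2"
  have "lorentz v v = a\<^sup>2 + b\<^sup>2 + 2 * a * b * lorentz (?h z1) (?h z2)"
    using H by (simp add: v_def lorentz_simps lorentz_self lorentz_commute[of "?h z2" "?h z1"] power2_eq_square algebra_simps)
  then have N: "lorentz v v > 0"
    using pos lorentz_ge_1[OF H(1,2)] by (simp add: add_pos_nonneg)
  define s where "s = sqrt (lorentz v v)"
  have s: "s > 0" "lorentz v v = s * s" using N by (auto simp: s_def)
  have "snd (snd v) > 0" using pos H by (simp add: v_def hyperboloid_point_def hyp_plane_def add_pos_pos)
  then obtain p where p: "p \<in> hyp_plane" "?h p = (1 / s) *\<^sub>R v"
    using hyperboloid_point_surj[of "(1 / s) *\<^sub>R v"] s by (auto simp: lorentz_simps)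
  have conv: "hyp_convex (geodesic_triangle V)" by (rule hyp_convex_geodesic_triangle[OF V(1)])
  have sub: "V \<subseteq> geodesic_triangle V" unfolding geodesic_triangle_def by (rule hull_subset)
  have "p \<in> hyp_segment z1 z2"
    by (rule hyperboloid_hyp_segment[where l="a / s" and m="b / s"])
       (use p s pos H in \<open>auto simp: v_def scaleR_add_right\<close>)
  then have pT: "p \<in> geodesic_triangle V" using conv sub V unfolding hyp_convex_def by blast
  have "x \<in> hyp_segment p z3"
    by (rule hyperboloid_hyp_segment[where l="s" and m=c]) (use p s pos H x eq in \<open>auto simp: v_def\<close>)
  then show ?thesis using conv sub V pT unfolding hyp_convex_def by blast
qed

text \<open>Up to the positive factor \<open>1 / (cmod (z - cnj C))\<^sup>2\<close>, the number \<open>direction C z\<close> is the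
  image of \<open>z\<close> under the Cayley map that sends \<open>C\<close> to the centre of the unit disc. Its argument is
  the direction of the geodesic ray from \<open>C\<close> to \<open>z\<close>, and it is real-linear in the hyperboloid model.\<close>

definition direction :: "complex \<Rightarrow> complex \<Rightarrow> complex" where
  "direction C z = (z - C) * (cnj z - C)"

definition direction_lin :: "complex \<Rightarrow> real \<times> real \<times> real \<Rightarrow> complex" where
  "direction_lin C v = of_real (fst v) - 2 * C * of_real (fst (snd v)) + C\<^sup>2 * of_real (snd (snd v))"

lemma linear_direction_lin: "linear (direction_lin C)"
  by (rule linearI) (simp_all add: direction_lin_def scaleR_conv_of_real algebra_simps)

lemma direction_lin:
  assumes "z \<in> hyp_plane"
  shows "direction_lin C (hyperboloid_point z) = direction C z / of_real (Im z)"
proof -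
  have "direction C z = of_real ((cmod z)\<^sup>2) - 2 * C * of_real (Re z) + C\<^sup>2"
    unfolding direction_def complex_norm_square
    by (simp add: complex_eq_iff power2_eq_square algebra_simps)
  then show ?thesis using assms
    by (simp add: direction_lin_def hyperboloid_point_def hyp_plane_def field_simps)
qed

lemma direction_self [simp]: "direction C C = 0"
  by (simp add: direction_def)

text \<open>The equation is quadratic in the coordinates; its first and second differences in the horizontal
  direction determine \<open>n\<close>.\<close>

lemma interior_geodesic_empty:
  assumes n: "n \<noteq> 0" and C: "C \<in> hyp_plane"
  shows "interior {z. Re (cnj n * direction C z) = 0} = {}"
proof (rule ccontr)
  let ?L = "\<lambda>z. Re (cnj n * direction C z)"
  assume "interior {z. ?L z = 0} \<noteq> {}"
  then obtain z e where e: "e > 0" "ball z e \<subseteq> {z. ?L z = 0}" by (auto simp: mem_interior)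
  define d where "d = e / 2"
  have d: "d > 0" "d < e" using e by (auto simp: d_def)
  have 0: "?L z = 0" "?L (z + of_real d) = 0" "?L (z - of_real d) = 0" "?L (z + \<i> * of_real d) = 0"
    using e d by (auto simp: subset_eq dist_norm norm_mult)
  have "?L (z + of_real d) + ?L (z - of_real d) - 2 * ?L z = 2 * Re n * d\<^sup>2"
    by (simp add: direction_def power2_eq_square algebra_simps)
  with 0 d have p: "Re n = 0" by simp
  have "?L (z + of_real d) - ?L z = - 2 * d * Im n * Im C"
    using p by (simp add: direction_def algebra_simps)
  with 0 d C have "Im n = 0" by (simp add: hyp_plane_def)
  with p n show False by (simp add: complex_eq_iff)
qed

text \<open>Two triangles on different sides of a geodesic through \<open>C\<close> do not overlap.\<close>

lemma not_overlap_if_separated: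
  assumes C: "C \<in> hyp_plane" and n: "n \<noteq> 0" and V: "V \<subseteq> hyp_plane" "V' \<subseteq> hyp_plane"
    and 1: "\<And>z. z \<in> V \<Longrightarrow> Re (cnj n * direction C z) \<ge> 0"
    and 2: "\<And>z. z \<in> V' \<Longrightarrow> Re (cnj n * direction C z) \<le> 0"
  shows "\<not> overlap (geodesic_triangle V) (geodesic_triangle V')"
proof -
  define f where "f = (\<lambda>v. Re (cnj n * direction_lin C v))"
  have lin: "linear f" "linear (\<lambda>v. - f v)"
    unfolding f_def
    by (rule linearI, simp_all add: linear_add[OF linear_direction_lin] linear_scale[OF linear_direction_lin] algebra_simps)+
  have f: "f (hyperboloid_point z) = Re (cnj n * direction C z) / Im z" if "z \<in> hyp_plane" for z
    using that by (simp add: f_def direction_lin add_divide_distrib)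
  have "geodesic_triangle V \<subseteq> {z \<in> hyp_plane. f (hyperboloid_point z) \<ge> 0}"
    by (rule geodesic_triangle_subset_half_plane[OF lin(1) V(1)])
       (use V 1 f in \<open>auto simp: hyp_plane_def subset_eq divide_nonneg_pos\<close>)
  moreover have "geodesic_triangle V' \<subseteq> {z \<in> hyp_plane. - f (hyperboloid_point z) \<ge> 0}"
    by (rule geodesic_triangle_subset_half_plane[OF lin(2) V(2)])
       (use V 2 f in \<open>auto simp: hyp_plane_def subset_eq divide_nonpos_pos\<close>)
  ultimately have "geodesic_triangle V \<inter> geodesic_triangle V' \<subseteq> {z. Re (cnj n * direction C z) = 0}"
    using f by (fastforce simp: hyp_plane_def)
  then have "interior (geodesic_triangle V) \<inter> interior (geodesic_triangle V') \<subseteq> {}"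
    using interior_geodesic_empty[OF n C] interior_mono by (metis interior_Int)
  then show ?thesis by (simp add: overlap_def)
qed

definition det3 :: "real \<times> real \<times> real \<Rightarrow> real \<times> real \<times> real \<Rightarrow> real \<times> real \<times> real \<Rightarrow> real" where
  "det3 u v w = fst u * (fst (snd v) * snd (snd w) - snd (snd v) * fst (snd w))
     - fst (snd u) * (fst v * snd (snd w) - snd (snd v) * fst w)
     + snd (snd u) * (fst v * fst (snd w) - fst (snd v) * fst w)"

lemma cramer3:
  assumes "det3 u v w \<noteq> 0"
  shows "x = (det3 x v w / det3 u v w) *\<^sub>R u + (det3 u x w / det3 u v w) *\<^sub>R v + (det3 u v x / det3 u v w) *\<^sub>R w"
proof -
  have "det3 u v w *\<^sub>R x = det3 x v w *\<^sub>R u + det3 u x w *\<^sub>R v + det3 u v x *\<^sub>R w"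
    by (simp add: det3_def prod_eq_iff algebra_simps)
  then have "x = (1 / det3 u v w) *\<^sub>R (det3 x v w *\<^sub>R u + det3 u x w *\<^sub>R v + det3 u v x *\<^sub>R w)"
    using assms by (metis divide_self_if scaleR_one scaleR_scaleR times_divide_eq_left mult_1)
  then show ?thesis by (simp add: scaleR_add_right)
qed

text \<open>Three points lie on a geodesic iff their directions from one of them are linearly dependent.\<close>

lemma det3_direction:
  assumes "z \<in> hyp_plane" "w \<in> hyp_plane" "C \<in> hyp_plane"
  shows "2 * Im z * Im w * (Im C)\<^sup>2 * det3 (hyperboloid_point z) (hyperboloid_point w) (hyperboloid_point C)
      = - Im (cnj (direction C z) * direction C w)"
proof -
  have "det3 u v ((cmod C)\<^sup>2, Re C, 1) * (2 * Im C) = - Im (cnj (direction_lin C u) * direction_lin C v)" for u v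
    unfolding cmod_power2 det3_def direction_lin_def by (simp add: power2_eq_square) algebra
  moreover have "det3 u v ((cmod C)\<^sup>2, Re C, 1) = det3 u v (hyperboloid_point C) * Im C" for u v
    using assms(3) by (simp add: det3_def hyperboloid_point_def hyp_plane_def field_simps)
  ultimately have "det3 u v (hyperboloid_point C) * (2 * (Im C)\<^sup>2) = - Im (cnj (direction_lin C u) * direction_lin C v)" for u v
    by (metis (no_types) mult.assoc mult.commute power2_eq_square)
  from this[of "hyperboloid_point z" "hyperboloid_point w"] show ?thesis
    using assms by (simp add: direction_lin hyp_plane_def field_simps)
qed

text \<open>A triangle whose sides at the vertex \<open>C\<close> point in independent directions has an interior
  point, around which the barycentric coordinates stay positive.\<close>

lemma not_degenerate_if_independent:
  assumes V: "V \<subseteq> hyp_plane" "X \<in> V" "Y \<in> V" "C \<in> V"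
    and ind: "Im (cnj (direction C X) * direction C Y) \<noteq> 0"
  shows "\<not> degenerate (geodesic_triangle V)"
proof -
  let ?h = hyperboloid_point
  have H: "X \<in> hyp_plane" "Y \<in> hyp_plane" "C \<in> hyp_plane" using V by auto
  define D where "D = det3 (?h X) (?h Y) (?h C)"
  have D: "D \<noteq> 0" using det3_direction[OF H] ind by (auto simp: D_def)
  define \<alpha> where "\<alpha> = (\<lambda>x. det3 (?h x) (?h Y) (?h C) / D)"
  define \<beta> where "\<beta> = (\<lambda>x. det3 (?h X) (?h x) (?h C) / D)"
  define \<gamma> where "\<gamma> = (\<lambda>x. det3 (?h X) (?h Y) (?h x) / D)"
  define U where "U = (hyp_plane \<inter> \<alpha> -` {0<..}) \<inter> (hyp_plane \<inter> \<beta> -` {0<..}) \<inter> (hyp_plane \<inter> \<gamma> -` {0<..})"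
  have oH: "open hyp_plane" by (simp add: hyp_plane_def open_halfspace_Im_gt)
  have cont: "continuous_on hyp_plane \<alpha>" "continuous_on hyp_plane \<beta>" "continuous_on hyp_plane \<gamma>"
    unfolding \<alpha>_def \<beta>_def \<gamma>_def det3_def hyperboloid_point_def
    using H by (auto intro!: continuous_intros simp: D hyp_plane_def)
  have oU: "open U" unfolding U_def
    by (intro open_Int continuous_open_preimage oH cont open_greaterThan)
  define v where "v = ?h X + ?h Y + ?h C"
  have N: "lorentz v v > 0"
    using lorentz_ge_1[OF H(1,2)] lorentz_ge_1[OF H(1,3)] lorentz_ge_1[OF H(2,3)] H
    by (simp add: v_def lorentz_simps lorentz_self lorentz_commute)
  define s where "s = sqrt (lorentz v v)"
  have s: "s > 0" "lorentz v v = s * s" using N by (auto simp: s_def)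
  have "snd (snd v) > 0" using H by (simp add: v_def hyperboloid_point_def hyp_plane_def add_pos_pos)
  then obtain p where p: "p \<in> hyp_plane" "?h p = (1 / s) *\<^sub>R v"
    using hyperboloid_point_surj[of "(1 / s) *\<^sub>R v"] s by (auto simp: lorentz_simps)
  have "\<alpha> p = 1 / s" "\<beta> p = 1 / s" "\<gamma> p = 1 / s"
  proof -
    have "det3 (r *\<^sub>R (u + v + w)) v w = r * det3 u v w" "det3 u (r *\<^sub>R (u + v + w)) w = r * det3 u v w"
      "det3 u v (r *\<^sub>R (u + v + w)) = r * det3 u v w" for u v w :: "real \<times> real \<times> real" and r
      by (simp_all add: det3_def algebra_simps)
    then show "\<alpha> p = 1 / s" "\<beta> p = 1 / s" "\<gamma> p = 1 / s"
      unfolding \<alpha>_def \<beta>_def \<gamma>_def p(2) v_def using D by (simp_all add: D_def)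
  qed
  then have pU: "p \<in> U" using p s by (simp add: U_def)
  have sub: "U \<subseteq> geodesic_triangle V"
  proof
    fix x assume x: "x \<in> U"
    show "x \<in> geodesic_triangle V"
      by (rule geodesic_triangle_cone[OF V, where a="\<alpha> x" and b="\<beta> x" and c="\<gamma> x"])
        (use x cramer3[of "?h X" "?h Y" "?h C" "?h x"] D in \<open>auto simp: U_def \<alpha>_def \<beta>_def \<gamma>_def D_def\<close>)
  qed
  show ?thesis
  proof
    assume "degenerate (geodesic_triangle V)"
    then have "(\<integral>\<^sup>+z\<in>geodesic_triangle V. ennreal (1 / (Im z)\<^sup>2) \<partial>lborel) = 0"
      by (simp add: degenerate_def hyp_area_def)
    moreover have "(\<integral>\<^sup>+z\<in>U. ennreal (1 / (Im z)\<^sup>2) \<partial>lborel)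
        \<le> (\<integral>\<^sup>+z\<in>geodesic_triangle V. ennreal (1 / (Im z)\<^sup>2) \<partial>lborel)"
      using sub by (intro nn_integral_mono) (auto simp: indicator_def)
    ultimately have "(\<integral>\<^sup>+z. ennreal (1 / (Im z)\<^sup>2) * indicator U z \<partial>lborel) = 0" by simp
    then have "AE z in lborel. ennreal (1 / (Im z)\<^sup>2) * indicator U z = 0"
      using oU by (subst (asm) nn_integral_0_iff_AE) (auto intro!: borel_measurable_times_ennreal)
    then have "AE z in lborel. z \<notin> U"
      by eventually_elim (auto simp: U_def hyp_plane_def indicator_def split: if_splits)
    then have "emeasure lborel U = 0"
      using oU by (subst (asm) AE_iff_measurable[of U]) auto
    then have "negligible U"
      using oU by (simp add: negligible_iff_emeasure0 emeasure_completion)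
    then show False using open_not_negligible[OF oU] pU by auto
  qed
qed

section \<open>Elliptic elements of PSL(2,R)\<close>

definition denom :: "real^2^2 \<Rightarrow> complex \<Rightarrow> complex" where
  "denom A z = of_real (A$2$1) * z + of_real (A$2$2)"

definition numer :: "real^2^2 \<Rightarrow> complex \<Rightarrow> complex" where
  "numer A z = of_real (A$1$1) * z + of_real (A$1$2)"

lemma moebius_eq: "moebius A z = numer A z / denom A z"
  by (simp add: moebius_def numer_def denom_def)

lemma matrix_mult_2:
  fixes A B :: "real^2^2"
  shows "(A ** B)$i$k = A$i$1 * B$1$k + A$i$2 * B$2$k"
  by (simp add: matrix_matrix_mult_def sum_2)

lemma denom_nonzero:
  assumes "det A = 1" "z \<in> hyp_plane"
  shows "denom A z \<noteq> 0"
proof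
  assume "denom A z = 0"
  then have "A$2$1 * Im z = 0" "A$2$1 * Re z + A$2$2 = 0"
    by (simp_all add: denom_def complex_eq_iff)
  then have "A$2$1 = 0" "A$2$2 = 0" using assms(2) by (auto simp: hyp_plane_def)
  then show False using assms(1) by (simp add: det_2)
qed

lemma Im_moebius:
  assumes "det A = 1"
  shows "Im (moebius A z) = Im z / (cmod (denom A z))\<^sup>2"
proof -
  have "Im (numer A z * cnj (denom A z)) = (A$1$1 * A$2$2 - A$1$2 * A$2$1) * Im z"
    by (simp add: numer_def denom_def algebra_simps)
  then have "Im (numer A z * cnj (denom A z)) = Im z" using assms by (simp add: det_2)
  then show ?thesis
    by (subst moebius_eq, subst complex_div_cnj) (simp flip: of_real_power)
qed

lemma moebius_in_hyp_plane: "det A = 1 \<Longrightarrow> z \<in> hyp_plane \<Longrightarrow> moebius A z \<in> hyp_plane"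
  using denom_nonzero[of A z] by (simp add: hyp_plane_def Im_moebius)

lemma numer_denom_mult:
  assumes "det B = 1" "z \<in> hyp_plane"
  shows "denom (A ** B) z = denom A (moebius B z) * denom B z"
    "numer (A ** B) z = numer A (moebius B z) * denom B z"
  using denom_nonzero[OF assms]
  by (simp_all add: denom_def numer_def moebius_def matrix_mult_2 field_simps)

lemma moebius_mult:
  assumes "det A = 1" "det B = 1" "z \<in> hyp_plane"
  shows "moebius (A ** B) z = moebius A (moebius B z)"
  using denom_nonzero[OF assms(2,3)] numer_denom_mult[OF assms(2,3), of A]
  by (simp add: moebius_eq[of "A ** B"] moebius_eq[of A])

lemma has_field_derivative_moebius:
  assumes "det A = 1" "z \<in> hyp_plane"
  shows "(moebius A has_field_derivative 1 / (denom A z)\<^sup>2) (at z)"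
proof -
  have nz: "of_real (A$2$1) * z + of_real (A$2$2) \<noteq> (0::complex)"
    using denom_nonzero[OF assms] by (simp add: denom_def)
  have d: "of_real (A$1$1) * of_real (A$2$2) - of_real (A$1$2) * of_real (A$2$1) = (1::complex)"
    using assms(1) by (simp add: det_2 flip: of_real_mult of_real_diff)
  have "(moebius A has_field_derivative
     (of_real (A$1$1) * (of_real (A$2$1) * z + of_real (A$2$2)) - (of_real (A$1$1) * z + of_real (A$1$2)) * of_real (A$2$1))
        / ((of_real (A$2$1) * z + of_real (A$2$2)) * (of_real (A$2$1) * z + of_real (A$2$2)))) (at z)"
    unfolding moebius_def[abs_def] using nz by (auto intro!: derivative_eq_intros)
  moreover have "of_real (A$1$1) * (of_real (A$2$1) * z + of_real (A$2$2)) - (of_real (A$1$1) * z + of_real (A$1$2)) * of_real (A$2$1) = 1"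
    using d by (simp add: algebra_simps)
  ultimately show ?thesis by (simp add: denom_def power2_eq_square)
qed

text \<open>The determinant of the vectors \<open>(z, 1)\<close> and \<open>A (z, 1)\<close>; it vanishes iff \<open>A\<close> fixes \<open>z\<close>.\<close>

definition chord :: "real^2^2 \<Rightarrow> complex \<Rightarrow> complex" where
  "chord A z = z * denom A z - numer A z"

lemma moebius_fixed_iff:
  "det A = 1 \<Longrightarrow> z \<in> hyp_plane \<Longrightarrow> moebius A z = z \<longleftrightarrow> chord A z = 0"
  using denom_nonzero[of A z] by (auto simp: moebius_eq chord_def field_simps)

lemma chord_eq: "chord A z = of_real (A$2$1) * z\<^sup>2 - of_real (A$1$1 - A$2$2) * z - of_real (A$1$2)"
  by (simp add: chord_def denom_def numer_def power2_eq_square algebra_simps)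

lemma fixed_coeffs:
  assumes "chord A X = 0" "X \<in> hyp_plane"
  shows "A$1$1 - A$2$2 = 2 * Re X * A$2$1" "A$1$2 = - (cmod X)\<^sup>2 * A$2$1"
proof -
  have y: "Im X \<noteq> 0" using assms(2) by (simp add: hyp_plane_def)
  have "Im (chord A X) = (A$2$1 * (2 * Re X) - (A$1$1 - A$2$2)) * Im X"
    unfolding chord_eq by (simp add: power2_eq_square algebra_simps)
  with assms(1) y show 1: "A$1$1 - A$2$2 = 2 * Re X * A$2$1" by (simp add: mult_ac)
  have "Re (chord A X) = A$2$1 * ((Re X)\<^sup>2 - (Im X)\<^sup>2) - (A$1$1 - A$2$2) * Re X - A$1$2"
    unfolding chord_eq by (simp add: power2_eq_square algebra_simps)
  with assms(1) have "A$1$2 = A$2$1 * ((Re X)\<^sup>2 - (Im X)\<^sup>2) - (A$1$1 - A$2$2) * Re X" by simp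
  then show "A$1$2 = - (cmod X)\<^sup>2 * A$2$1"
    unfolding 1 cmod_power2 by (simp add: power2_eq_square algebra_simps)
qed

lemma fixed_trivial:
  assumes "det A = 1" "chord A X = 0" "X \<in> hyp_plane" "A$2$1 = 0"
  shows "A = mat 1 \<or> A = - mat 1"
proof -
  have e: "A$1$2 = 0" "A$1$1 = A$2$2" using fixed_coeffs[OF assms(2,3)] assms(4) by simp_all
  then have "(A$1$1)\<^sup>2 = 1" using assms(1) by (simp add: det_2 power2_eq_square)
  then have "A$1$1 = 1 \<or> A$1$1 = -1" by (simp add: power2_eq_1_iff)
  then show ?thesis using e assms(4) by (auto simp: vec_eq_iff forall_2 mat_def)
qed

subsection \<open>The action of PSL(2,R)\<close>

definition proj :: "real^2^2 \<Rightarrow> (real^2^2) set" where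
  "proj A = {A, - A}"

lemma det_minus_2: "det (- A :: real^2^2) = det A"
  by (simp add: det_2)

lemma proj_closed: "det A = 1 \<Longrightarrow> proj A \<in> carrier PSL2R"
  by (auto simp: proj_def carrier_PSL2R)

lemma PSL2R_cases:
  assumes "g \<in> carrier PSL2R"
  obtains A where "det A = 1" "g = proj A"
  using assms by (auto simp: proj_def carrier_PSL2R)

lemma mem_proj: "A \<in> proj A"
  by (simp add: proj_def)

lemma proj_mult: "proj A \<otimes>\<^bsub>PSL2R\<^esub> proj B = proj (A ** B)"
  by (auto simp: PSL2R_def FactGroup_def set_mult_def proj_def SL2R_def matrix_minus_mult)

lemma proj_one: "\<one>\<^bsub>PSL2R\<^esub> = proj (mat 1)"
  by (simp add: PSL2R_def FactGroup_def proj_def)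

lemma proj_eq_iff: "proj A = proj B \<longleftrightarrow> A = B \<or> A = - B"
  by (auto simp: proj_def doubleton_eq_iff)

lemma act_proj: "det A = 1 \<Longrightarrow> PSL2R_act (proj A) = moebius A"
  by (rule PSL2R_act_eq_moebius) (simp_all add: proj_closed mem_proj)

interpretation PSL: group PSL2R by (rule group_PSL2R)

lemma act_closed: "g \<in> carrier PSL2R \<Longrightarrow> z \<in> hyp_plane \<Longrightarrow> PSL2R_act g z \<in> hyp_plane"
  by (metis PSL2R_cases act_proj moebius_in_hyp_plane)

lemma act_mult:
  assumes "g \<in> carrier PSL2R" "h \<in> carrier PSL2R" "z \<in> hyp_plane"
  shows "PSL2R_act (g \<otimes>\<^bsub>PSL2R\<^esub> h) z = PSL2R_act g (PSL2R_act h z)"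
proof -
  obtain A B where "det A = 1" "g = proj A" "det B = 1" "h = proj B"
    using PSL2R_cases assms by metis
  then show ?thesis using assms(3) by (simp add: proj_mult act_proj det_mul moebius_mult)
qed

lemma act_one: "PSL2R_act \<one>\<^bsub>PSL2R\<^esub> z = z"
  by (simp add: proj_one act_proj moebius_def) (simp add: mat_def)

lemma act_inv:
  assumes "g \<in> carrier PSL2R" "z \<in> hyp_plane"
  shows "PSL2R_act (inv\<^bsub>PSL2R\<^esub> g) (PSL2R_act g z) = z" "PSL2R_act g (PSL2R_act (inv\<^bsub>PSL2R\<^esub> g) z) = z"
  using assms act_mult[of "inv\<^bsub>PSL2R\<^esub> g" g z] act_mult[of g "inv\<^bsub>PSL2R\<^esub> g" z] by (simp_all add: act_one)

lemma fixed_inv: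
  "g \<in> carrier PSL2R \<Longrightarrow> z \<in> hyp_plane \<Longrightarrow> PSL2R_act g z = z \<Longrightarrow> PSL2R_act (inv\<^bsub>PSL2R\<^esub> g) z = z"
  using act_inv(1)[of g z] by simp

definition elliptic :: "(real^2^2) set \<Rightarrow> bool" where
  "elliptic g \<longleftrightarrow> g \<in> carrier PSL2R \<and> g \<noteq> \<one>\<^bsub>PSL2R\<^esub> \<and> (\<exists>z\<in>hyp_plane. PSL2R_act g z = z)"

lemma elliptic_closed: "elliptic g \<Longrightarrow> g \<in> carrier PSL2R"
  by (simp add: elliptic_def)

lemma elliptic_lift:
  assumes "elliptic g" "det A = 1" "g = proj A"
  shows "A$2$1 \<noteq> 0"
proof
  assume 0: "A$2$1 = 0"
  obtain z where z: "z \<in> hyp_plane" "PSL2R_act g z = z" using assms(1) by (auto simp: elliptic_def)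
  then have "chord A z = 0" using assms(2,3) by (simp add: act_proj moebius_fixed_iff)
  then have "A = mat 1 \<or> A = - mat 1" using fixed_trivial assms(2) z 0 by blast
  then have "g = \<one>\<^bsub>PSL2R\<^esub>" using assms(3) by (auto simp: proj_one proj_eq_iff)
  then show False using assms(1) by (simp add: elliptic_def)
qed

lemma elliptic_fixed_unique:
  assumes "elliptic g" "z \<in> hyp_plane" "w \<in> hyp_plane" "PSL2R_act g z = z" "PSL2R_act g w = w"
  shows "z = w"
proof -
  obtain A where A: "det A = 1" "g = proj A" using PSL2R_cases elliptic_closed[OF assms(1)] by metis
  have c: "A$2$1 \<noteq> 0" by (rule elliptic_lift[OF assms(1) A])
  have "chord A z = 0" "chord A w = 0" using assms A by (simp_all add: act_proj moebius_fixed_iff)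
  then have "2 * Re z * A$2$1 = 2 * Re w * A$2$1" "(cmod z)\<^sup>2 * A$2$1 = (cmod w)\<^sup>2 * A$2$1"
    using fixed_coeffs[of A z] fixed_coeffs[of A w] assms(2,3) by linarith+
  then have re: "Re z = Re w" and "(cmod z)\<^sup>2 = (cmod w)\<^sup>2" using c by simp_all
  then have "(Im z)\<^sup>2 = (Im w)\<^sup>2" by (simp add: cmod_power2)
  then have "Im z = Im w" using assms(2,3) by (simp add: hyp_plane_def power2_eq_iff_nonneg)
  with re show ?thesis by (simp add: complex_eq_iff)
qed

lemma fixed_point_eq:
  assumes "elliptic g" "z \<in> hyp_plane" "PSL2R_act g z = z"
  shows "fixed_point g = z"
  unfolding fixed_point_def using elliptic_fixed_unique[OF assms(1)] assms(2,3) by blast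

lemma fixed_point:
  assumes "elliptic g"
  shows "fixed_point g \<in> hyp_plane" "PSL2R_act g (fixed_point g) = fixed_point g"
  using assms fixed_point_eq[OF assms] by (auto simp: elliptic_def)

lemma elliptic_conj:
  assumes "elliptic g" "h \<in> carrier PSL2R"
  shows "elliptic (h \<otimes>\<^bsub>PSL2R\<^esub> g \<otimes>\<^bsub>PSL2R\<^esub> inv\<^bsub>PSL2R\<^esub> h)"
    "fixed_point (h \<otimes>\<^bsub>PSL2R\<^esub> g \<otimes>\<^bsub>PSL2R\<^esub> inv\<^bsub>PSL2R\<^esub> h) = PSL2R_act h (fixed_point g)"
proof -
  have g: "g \<in> carrier PSL2R" using assms elliptic_closed by simp
  let ?z = "PSL2R_act h (fixed_point g)"
  have "PSL2R_act (h \<otimes>\<^bsub>PSL2R\<^esub> g \<otimes>\<^bsub>PSL2R\<^esub> inv\<^bsub>PSL2R\<^esub> h) ?z = ?z"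
    using g assms fixed_point[OF assms(1)] by (simp add: act_mult act_closed act_inv)
  moreover have z: "?z \<in> hyp_plane" using assms fixed_point[OF assms(1)] by (simp add: act_closed)
  moreover have "h \<otimes>\<^bsub>PSL2R\<^esub> g \<otimes>\<^bsub>PSL2R\<^esub> inv\<^bsub>PSL2R\<^esub> h \<noteq> \<one>\<^bsub>PSL2R\<^esub>"
  proof
    assume "h \<otimes>\<^bsub>PSL2R\<^esub> g \<otimes>\<^bsub>PSL2R\<^esub> inv\<^bsub>PSL2R\<^esub> h = \<one>\<^bsub>PSL2R\<^esub>"
    then have "h \<otimes>\<^bsub>PSL2R\<^esub> g \<otimes>\<^bsub>PSL2R\<^esub> inv\<^bsub>PSL2R\<^esub> h \<otimes>\<^bsub>PSL2R\<^esub> h = \<one>\<^bsub>PSL2R\<^esub> \<otimes>\<^bsub>PSL2R\<^esub> h"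
      by simp
    then have "h \<otimes>\<^bsub>PSL2R\<^esub> g = h" using g assms(2) by (simp add: PSL.m_assoc)
    then have "g = \<one>\<^bsub>PSL2R\<^esub>" using PSL.l_cancel_one[OF assms(2) g] by simp
    then show False using assms(1) by (simp add: elliptic_def)
  qed
  ultimately show 1: "elliptic (h \<otimes>\<^bsub>PSL2R\<^esub> g \<otimes>\<^bsub>PSL2R\<^esub> inv\<^bsub>PSL2R\<^esub> h)"
    using g assms(2) by (auto simp: elliptic_def)
  show "fixed_point (h \<otimes>\<^bsub>PSL2R\<^esub> g \<otimes>\<^bsub>PSL2R\<^esub> inv\<^bsub>PSL2R\<^esub> h) = ?z"
    by (rule fixed_point_eq[OF 1 z]) fact
qed

lemma elliptic_inv:
  assumes "elliptic g"
  shows "elliptic (inv\<^bsub>PSL2R\<^esub> g)" "fixed_point (inv\<^bsub>PSL2R\<^esub> g) = fixed_point g"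
proof -
  have g: "g \<in> carrier PSL2R" using assms elliptic_closed by simp
  show 1: "elliptic (inv\<^bsub>PSL2R\<^esub> g)"
    using assms g fixed_inv[OF g] PSL.inv_eq_1_iff[OF g] by (auto simp: elliptic_def)
  show "fixed_point (inv\<^bsub>PSL2R\<^esub> g) = fixed_point g"
    by (rule fixed_point_eq[OF 1]) (use fixed_point[OF assms] fixed_inv[OF g] in auto)
qed

subsection \<open>Rotation angles\<close>

text \<open>The complex derivative of \<open>g\<close> at \<open>z\<close>.\<close>

definition multiplier :: "(real^2^2) set \<Rightarrow> complex \<Rightarrow> complex" where
  "multiplier g z = 1 / (denom (SOME A. A \<in> g) z)\<^sup>2"

lemma multiplier_proj: "multiplier (proj A) z = 1 / (denom A z)\<^sup>2"
proof -
  have "(SOME B. B \<in> proj A) \<in> proj A" by (rule someI) (rule mem_proj)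
  then have "(SOME B. B \<in> proj A) = A \<or> (SOME B. B \<in> proj A) = - A" by (auto simp: proj_def)
  moreover have "(denom (- A) z)\<^sup>2 = (denom A z)\<^sup>2"
    by (simp add: denom_def power2_eq_square algebra_simps)
  ultimately show ?thesis by (auto simp: multiplier_def)
qed

lemma multiplier_mult:
  assumes "g \<in> carrier PSL2R" "h \<in> carrier PSL2R" "z \<in> hyp_plane"
  shows "multiplier (g \<otimes>\<^bsub>PSL2R\<^esub> h) z = multiplier g (PSL2R_act h z) * multiplier h z"
proof -
  obtain A B where "det A = 1" "g = proj A" "det B = 1" "h = proj B"
    using PSL2R_cases assms by metis
  then show ?thesis using assms(3)
    by (simp add: proj_mult multiplier_proj act_proj numer_denom_mult power_mult_distrib)
qed

lemma multiplier_one: "multiplier \<one>\<^bsub>PSL2R\<^esub> z = 1"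
  by (simp add: proj_one multiplier_proj denom_def mat_def)

lemma multiplier_int_pow:
  fixes m :: int
  assumes "g \<in> carrier PSL2R" "z \<in> hyp_plane" "PSL2R_act g z = z"
  shows "PSL2R_act (g [^]\<^bsub>PSL2R\<^esub> m) z = z \<and> multiplier (g [^]\<^bsub>PSL2R\<^esub> m) z = multiplier g z powi m"
proof -
  have nat: "PSL2R_act (h [^]\<^bsub>PSL2R\<^esub> (k::nat)) z = z \<and> multiplier (h [^]\<^bsub>PSL2R\<^esub> k) z = multiplier h z ^ k"
    if "h \<in> carrier PSL2R" "PSL2R_act h z = z" for h k
    using that assms(2) by (induction k) (simp_all add: act_one multiplier_one act_mult multiplier_mult)
  have inv: "PSL2R_act (inv\<^bsub>PSL2R\<^esub> g) z = z" using fixed_inv assms by simp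
  have "multiplier (inv\<^bsub>PSL2R\<^esub> g) z * multiplier g z = 1"
    using multiplier_mult[of "inv\<^bsub>PSL2R\<^esub> g" g z] assms by (simp add: multiplier_one)
  then have mi: "multiplier (inv\<^bsub>PSL2R\<^esub> g) z = inverse (multiplier g z)"
    by (metis inverse_unique inverse_inverse_eq)
  show ?thesis
  proof (cases m rule: int_cases2)
    case (nonneg k)
    then show ?thesis using nat[OF assms(1,3), of k] by (simp add: int_pow_int)
  next
    case (nonpos k)
    then have "g [^]\<^bsub>PSL2R\<^esub> m = (inv\<^bsub>PSL2R\<^esub> g) [^]\<^bsub>PSL2R\<^esub> k"
      using assms(1) by (simp add: PSL.int_pow_neg_int PSL.nat_pow_inv)
    then show ?thesis using nat[of "inv\<^bsub>PSL2R\<^esub> g" k] inv mi assms(1) nonpos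
      by (simp add: power_int_minus power_inverse)
  qed
qed

lemma cmod_multiplier_fixed:
  assumes "g \<in> carrier PSL2R" "z \<in> hyp_plane" "PSL2R_act g z = z"
  shows "cmod (multiplier g z) = 1"
proof -
  obtain A where A: "det A = 1" "g = proj A" using PSL2R_cases assms(1) by metis
  then have "Im z = Im z / (cmod (denom A z))\<^sup>2" using assms Im_moebius[of A z] by (simp add: act_proj)
  then have "Im z * (cmod (denom A z))\<^sup>2 = Im z * 1"
    using denom_nonzero[OF A(1) assms(2)] by (simp add: field_simps)
  then have "(cmod (denom A z))\<^sup>2 = 1" using assms(2) by (simp add: hyp_plane_def)
  then show ?thesis by (simp add: A multiplier_proj norm_divide norm_power)
qed

text \<open>The derivative of a Moebius map is \<open>1 / (denom A z)\<^sup>2\<close>, for both lifts.\<close>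

lemma elliptic_with_angle_iff:
  "elliptic_with_angle g \<theta> \<longleftrightarrow> g \<in> carrier PSL2R \<and> 0 < \<theta> \<and> \<theta> < 2 * pi \<and>
     (\<exists>z\<in>hyp_plane. PSL2R_act g z = z \<and> multiplier g z = cis \<theta>)"
proof -
  have "(PSL2R_act g has_field_derivative cis \<theta>) (at z) \<longleftrightarrow> multiplier g z = cis \<theta>"
    if g: "g \<in> carrier PSL2R" "z \<in> hyp_plane" for z
  proof -
    obtain A where A: "det A = 1" "g = proj A" using PSL2R_cases g(1) by metis
    have "(PSL2R_act g has_field_derivative multiplier g z) (at z)"
      using has_field_derivative_moebius[of A z] A g(2) by (simp add: act_proj multiplier_proj)
    then show ?thesis by (metis DERIV_unique)
  qed
  then show ?thesis unfolding elliptic_with_angle_def by blast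
qed

lemma elliptic_with_angle_elliptic:
  assumes "elliptic_with_angle g \<theta>"
  shows "elliptic g" "multiplier g (fixed_point g) = cis \<theta>"
proof -
  obtain z where z: "z \<in> hyp_plane" "PSL2R_act g z = z" "multiplier g z = cis \<theta>"
    and g: "g \<in> carrier PSL2R" and \<theta>: "0 < \<theta>" "\<theta> < 2 * pi"
    using assms by (auto simp: elliptic_with_angle_iff)
  have "cis \<theta> \<noteq> 1"
  proof
    assume "cis \<theta> = 1"
    then have "cos \<theta> = 1" by (metis cis.sel(1) one_complex.sel(1))
    then obtain k :: int where "\<theta> = of_int k * (2 * pi)" by (auto simp: cos_one_2pi_int)
    then show False using \<theta> by (auto simp: mult_less_cancel_right1 zero_less_mult_iff)
  qed
  then have "g \<noteq> \<one>\<^bsub>PSL2R\<^esub>" using z(3) by (auto simp: multiplier_one)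
  then show e: "elliptic g" using z g by (auto simp: elliptic_def)
  show "multiplier g (fixed_point g) = cis \<theta>" using fixed_point_eq[OF e z(1,2)] z(3) by simp
qed

lemma elliptic_with_angle_conj:
  assumes "elliptic_with_angle g \<theta>" "h \<in> carrier PSL2R"
  shows "elliptic_with_angle (h \<otimes>\<^bsub>PSL2R\<^esub> g \<otimes>\<^bsub>PSL2R\<^esub> inv\<^bsub>PSL2R\<^esub> h) \<theta>"
proof -
  obtain z where z: "z \<in> hyp_plane" "PSL2R_act g z = z" "multiplier g z = cis \<theta>"
    and g: "g \<in> carrier PSL2R" and \<theta>: "0 < \<theta>" "\<theta> < 2 * pi"
    using assms by (auto simp: elliptic_with_angle_iff)
  let ?w = "PSL2R_act h z"
  have w: "?w \<in> hyp_plane" using z assms act_closed by simp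
  have "multiplier h z * multiplier (inv\<^bsub>PSL2R\<^esub> h) ?w = 1"
    using multiplier_mult[of h "inv\<^bsub>PSL2R\<^esub> h" ?w] assms(2) w z by (simp add: act_inv multiplier_one)
  then have "multiplier (h \<otimes>\<^bsub>PSL2R\<^esub> g \<otimes>\<^bsub>PSL2R\<^esub> inv\<^bsub>PSL2R\<^esub> h) ?w = cis \<theta>"
    using g assms(2) w z by (simp add: multiplier_mult act_inv act_mult)
  moreover have "PSL2R_act (h \<otimes>\<^bsub>PSL2R\<^esub> g \<otimes>\<^bsub>PSL2R\<^esub> inv\<^bsub>PSL2R\<^esub> h) ?w = ?w"
    using g assms z w by (simp add: act_mult act_closed act_inv)
  ultimately show ?thesis using g assms(2) w \<theta> by (auto simp: elliptic_with_angle_iff)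
qed

section \<open>Directions at the fixed point of a product\<close>

lemma direction_eq: "direction C z = of_real ((cmod z)\<^sup>2) - 2 * C * of_real (Re z) + C\<^sup>2"
  unfolding direction_def complex_norm_square
  by (simp add: complex_eq_iff power2_eq_square algebra_simps)

text \<open>The quadratic form of \<open>A\<close> is proportional to the one with root \<open>X\<close>.\<close>

lemma direction_fixed:
  assumes "chord A X = 0" "X \<in> hyp_plane"
  shows "of_real (A$2$1) * direction C X = chord A C"
proof -
  have "of_real (A$1$1 - A$2$2) = (of_real (2 * Re X * A$2$1) :: complex)"
    "of_real (A$1$2) = (of_real (- (cmod X)\<^sup>2 * A$2$1) :: complex)"
    using fixed_coeffs[OF assms] by simp_all
  then show ?thesis unfolding chord_eq direction_eq by (simp add: algebra_simps)
qed

lemma direction_eq_0_iff: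
  assumes "X \<in> hyp_plane" "C \<in> hyp_plane"
  shows "direction C X = 0 \<longleftrightarrow> X = C"
proof -
  have "Im (cnj X - C) < 0" using assms by (simp add: hyp_plane_def)
  then have "cnj X - C \<noteq> 0" by (metis less_irrefl zero_complex.sel(2))
  then show ?thesis by (simp add: direction_def)
qed

text \<open>An elliptic \<open>g\<close> rotates by \<open>\<theta>\<close> about its fixed point iff its lifts to \<open>SL(2,R)\<close>
  have the eigenvalue \<open>\<plusminus> cis (- \<theta> / 2)\<close> on the line spanned by the fixed point; the sign
  depends on the lift.\<close>

definition half_turn :: "(real^2^2) set \<Rightarrow> complex" where
  "half_turn g = denom (SOME A. A \<in> g) (fixed_point g)"

lemma half_turn_lift:
  assumes "elliptic g"
  obtains A where "det A = 1" "g = proj A" "A$2$1 \<noteq> 0" "half_turn g = denom A (fixed_point g)"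
    "chord A (fixed_point g) = 0"
proof -
  obtain B where B: "det B = 1" "g = proj B" using PSL2R_cases elliptic_closed[OF assms] by metis
  define A where "A = (SOME A. A \<in> g)"
  have "A \<in> g" unfolding A_def by (rule someI[of _ B]) (simp add: B mem_proj)
  then have A: "A = B \<or> A = - B" using B by (simp add: proj_def)
  then have A': "det A = 1" "g = proj A" using B by (auto simp: det_minus_2 proj_eq_iff)
  have "chord A (fixed_point g) = 0"
    using fixed_point[OF assms] A' by (simp add: act_proj moebius_fixed_iff)
  then show ?thesis
    using that[OF A' elliptic_lift[OF assms A']] by (simp add: half_turn_def A_def)
qed

lemma half_turn:
  assumes "elliptic g"
  shows "cmod (half_turn g) = 1" "Im (half_turn g) \<noteq> 0" "multiplier g (fixed_point g) = (cnj (half_turn g))\<^sup>2"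
proof -
  obtain A where A: "det A = 1" "g = proj A" "A$2$1 \<noteq> 0" "half_turn g = denom A (fixed_point g)"
    using half_turn_lift[OF assms] by metis
  note F = fixed_point[OF assms]
  have m: "multiplier g (fixed_point g) = 1 / (half_turn g)\<^sup>2"
    by (simp add: A(2) multiplier_proj) (simp add: A(4) flip: A(2))
  then have "cmod (1 / (half_turn g)\<^sup>2) = 1"
    using cmod_multiplier_fixed[OF elliptic_closed[OF assms] F] by simp
  then have "(cmod (half_turn g))\<^sup>2 = 1" by (simp add: norm_divide norm_power divide_eq_1_iff)
  then show 1: "cmod (half_turn g) = 1" by (simp add: power2_eq_1_iff) (smt (verit) norm_ge_zero)
  have "Im (half_turn g) = A$2$1 * Im (fixed_point g)" unfolding A(4) denom_def by simp
  then show "Im (half_turn g) \<noteq> 0" using A(3) F(1) by (simp add: hyp_plane_def)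
  have "half_turn g * cnj (half_turn g) = 1" using 1 by (simp add: complex_norm_square[symmetric])
  then have "(half_turn g)\<^sup>2 * (cnj (half_turn g))\<^sup>2 = 1" by (simp flip: power_mult_distrib)
  then show "multiplier g (fixed_point g) = (cnj (half_turn g))\<^sup>2"
    unfolding m by (metis divide_eq_eq mult.commute mult_zero_left zero_neq_one)
qed

lemma chord_mult:
  assumes "det A = 1" "det B = 1" "chord (A ** B) C = 0" "C \<in> hyp_plane"
  shows "chord B C = - denom (A ** B) C * chord A C"
proof -
  let ?S = "A ** B"
  have "numer ?S C = C * denom ?S C" using assms(3) by (simp add: chord_def)
  moreover have "denom ?S C = of_real (A$2$1) * numer B C + of_real (A$2$2) * denom B C"
    "numer ?S C = of_real (A$1$1) * numer B C + of_real (A$1$2) * denom B C"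
    by (simp_all add: denom_def numer_def matrix_mult_2 algebra_simps)
  moreover have "of_real (A$1$1) * of_real (A$2$2) - of_real (A$1$2) * of_real (A$2$1) = (1::complex)"
    using assms(1) by (simp add: det_2 flip: of_real_mult of_real_diff)
  ultimately show ?thesis unfolding chord_def denom_def[of A] numer_def[of A] by algebra
qed

text \<open>If \<open>s = a b\<close> then, up to sign, the directions from the fixed point of \<open>s\<close> to those of \<open>a\<close>
  and \<open>b\<close> differ by half the rotation angle of \<open>s\<close>: the rotation \<open>s\<close> is the product of the
  reflections in the two lines.\<close>

lemma direction_factors:
  assumes e: "elliptic a" "elliptic b" "elliptic s" and s: "s = a \<otimes>\<^bsub>PSL2R\<^esub> b"
  obtains r :: real where "r \<noteq> 0"
    "direction (fixed_point s) (fixed_point b) = of_real r * half_turn s * direction (fixed_point s) (fixed_point a)"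
proof -
  let ?C = "fixed_point s"
  obtain A where A: "det A = 1" "a = proj A" "A$2$1 \<noteq> 0" "chord A (fixed_point a) = 0"
    using half_turn_lift[OF e(1)] by metis
  obtain B where B: "det B = 1" "b = proj B" "B$2$1 \<noteq> 0" "chord B (fixed_point b) = 0"
    using half_turn_lift[OF e(2)] by metis
  obtain S where S: "det S = 1" "s = proj S" "half_turn s = denom S ?C" "chord S ?C = 0"
    using half_turn_lift[OF e(3)] by metis
  note C = fixed_point(1)[OF e(3)]
  have "proj S = proj (A ** B)" using s S A B by (simp add: proj_mult)
  then have "A ** B = S \<or> A ** B = - S" by (auto simp: proj_eq_iff)
  then obtain \<epsilon> :: real where \<epsilon>: "\<epsilon> \<noteq> 0" "denom (A ** B) ?C = of_real \<epsilon> * denom S ?C" "chord (A ** B) ?C = 0"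
  proof
    assume "A ** B = S"
    then show ?thesis using that[of 1] S by simp
  next
    assume "A ** B = - S"
    then show ?thesis using that[of "-1"] S by (simp add: denom_def chord_def numer_def algebra_simps)
  qed
  have "of_real (B$2$1) * direction ?C (fixed_point b) = - (of_real \<epsilon> * denom S ?C) * (of_real (A$2$1) * direction ?C (fixed_point a))"
    using chord_mult[OF A(1) B(1) \<epsilon>(3) C] direction_fixed[OF A(4) fixed_point(1)[OF e(1)]]
      direction_fixed[OF B(4) fixed_point(1)[OF e(2)]] \<epsilon>(2) by simp
  then have "direction ?C (fixed_point b) = of_real (- \<epsilon> * A$2$1 / B$2$1) * half_turn s * direction ?C (fixed_point a)"
    using B(3) S(3) by (simp add: field_simps)
  then show ?thesis using that[of "- \<epsilon> * A$2$1 / B$2$1"] \<epsilon>(1) A(3) B(3) by simp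
qed

text \<open>The same relation for the factorisation \<open>s = w e\<^sup>-\<^sup>1\<close>.\<close>

lemma direction_multiple:
  assumes e: "elliptic s" "elliptic e" "elliptic w" and w: "w = s \<otimes>\<^bsub>PSL2R\<^esub> e"
  obtains r :: real where "r \<noteq> 0"
    "direction (fixed_point s) (fixed_point w) = of_real r * cnj (half_turn s) * direction (fixed_point s) (fixed_point e)"
proof -
  have s: "s = w \<otimes>\<^bsub>PSL2R\<^esub> inv\<^bsub>PSL2R\<^esub> e"
    using w elliptic_closed[OF e(1)] elliptic_closed[OF e(2)] by (simp add: PSL.m_assoc)
  obtain r :: real where r: "r \<noteq> 0"
    "direction (fixed_point s) (fixed_point e) = of_real r * half_turn s * direction (fixed_point s) (fixed_point w)"
    by (rule direction_factors[OF e(3) elliptic_inv(1)[OF e(2)] e(1) s]) (use elliptic_inv(2)[OF e(2)] in auto)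
  have "half_turn s * cnj (half_turn s) = 1"
    using half_turn(1)[OF e(1)] by (simp flip: complex_norm_square)
  moreover have "of_real (1 / r) * cnj (half_turn s) * direction (fixed_point s) (fixed_point e)
      = of_real (1 / r) * of_real r * (half_turn s * cnj (half_turn s)) * direction (fixed_point s) (fixed_point w)"
    unfolding r(2) by (simp only: mult_ac)
  ultimately have "direction (fixed_point s) (fixed_point w)
      = of_real (1 / r) * cnj (half_turn s) * direction (fixed_point s) (fixed_point e)"
    using r(1) by simp
  then show ?thesis using that[of "1 / r"] r(1) by simp
qed

text \<open>The derivative of \<open>g\<close> at a fixed point acts on the directions there.\<close>

lemma direction_act:
  assumes g: "g \<in> carrier PSL2R" "PSL2R_act g C = C" and C: "C \<in> hyp_plane" and z: "z \<in> hyp_plane"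
  obtains k :: real where "k > 0" "direction C (PSL2R_act g z) = of_real k * multiplier g C * direction C z"
proof -
  obtain A where A: "det A = 1" "g = proj A" using PSL2R_cases g(1) by metis
  have d: "of_real (A$1$1) * of_real (A$2$2) - of_real (A$1$2) * of_real (A$2$1) = (1::complex)"
    using A(1) by (simp add: det_2 flip: of_real_mult of_real_diff)
  have nz: "denom A z \<noteq> 0" "denom A C \<noteq> 0" using denom_nonzero A z C by auto
  have num: "numer A C = C * denom A C"
    using g(2) A nz by (simp add: act_proj moebius_eq field_simps)
  have diff: "(w' - C * v') * denom A C = w - C * v"
    if "w' = of_real (A$1$1) * w + of_real (A$1$2) * v" "v' = of_real (A$2$1) * w + of_real (A$2$2) * v" for w v w' v'
    using that num d unfolding numer_def denom_def by algebra
  have 1: "(numer A z - C * denom A z) * denom A C = z - C"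
    using diff[of "numer A z" z 1 "denom A z"] by (simp add: numer_def denom_def)
  have 2: "(cnj (numer A z) - C * cnj (denom A z)) * denom A C = cnj z - C"
    using diff[of "cnj (numer A z)" "cnj z" 1 "cnj (denom A z)"] by (simp add: numer_def denom_def)
  have "direction C (PSL2R_act g z) * (denom A z * cnj (denom A z)) =
      (numer A z - C * denom A z) * (cnj (numer A z) - C * cnj (denom A z))"
    using nz by (simp add: A act_proj moebius_eq direction_def field_simps)
  then have "direction C (PSL2R_act g z) * (denom A z * cnj (denom A z)) * (denom A C)\<^sup>2 = direction C z"
    unfolding direction_def[of C z] 1[symmetric] 2[symmetric] by (simp add: power2_eq_square)
  then have "direction C (PSL2R_act g z) = of_real (1 / (cmod (denom A z))\<^sup>2) * multiplier g C * direction C z"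
    using nz by (simp add: A(2) multiplier_proj complex_norm_square[symmetric] field_simps)
  then show ?thesis using that[of "1 / (cmod (denom A z))\<^sup>2"] nz by simp
qed

section \<open>Separating two cones by a rotation\<close>

lemma unit_complex_acute:
  assumes "cmod j = 1" "Im j \<noteq> 0"
  obtains \<psi> \<epsilon> :: real and r :: real where "0 < \<psi>" "\<psi> \<le> pi / 2" "\<epsilon> = 1 \<or> \<epsilon> = -1" "r = 1 \<or> r = -1"
    "j = of_real r * cis (\<epsilon> * \<psi>)"
proof -
  have j: "j = cis (Arg j)" using assms(1) by (metis cis_Arg norm_eq_zero sgn_eq zero_neq_one div_by_1 of_real_1)
  have "sin (Arg j) \<noteq> 0" using assms(2) j by (metis cis.sel(2))
  then have nz: "Arg j \<noteq> 0" "Arg j \<noteq> pi" by auto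
  have bd: "- pi < Arg j" "Arg j \<le> pi" using Arg_bounded by auto
  consider "0 < Arg j" "Arg j \<le> pi / 2" | "Arg j > pi / 2" | "Arg j < 0" "Arg j \<ge> - pi / 2" | "Arg j < - pi / 2"
    using nz by linarith
  then show ?thesis
  proof cases
    case 1
    then show ?thesis using that[of "Arg j" 1 1] j by simp
  next
    case 2
    have "j = of_real (-1) * cis (-1 * (pi - Arg j))" by (subst j) (simp add: complex_eq_iff cos_diff sin_diff)
    then show ?thesis using that[of "pi - Arg j" "-1" "-1"] 2 bd nz by simp
  next
    case 3
    have "j = of_real 1 * cis (-1 * (- Arg j))" using j by simp
    then show ?thesis using that[of "- Arg j" "-1" 1] 3 by simp
  next
    case 4
    have "j = of_real (-1) * cis (1 * (pi + Arg j))" by (subst j) (simp add: complex_eq_iff cos_add sin_add)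
    then show ?thesis using that[of "pi + Arg j" "1" "-1"] 4 bd by simp
  qed
qed

text \<open>Two rays whose lines meet at an angle \<open>\<psi> \<le> \<pi>/2\<close> bound a sector of width \<open>\<psi>\<close> or
  \<open>\<pi> - \<psi>\<close>.\<close>

lemma sector_arc:
  fixes r \<psi> \<epsilon> :: real
  assumes "0 < \<psi>" "\<psi> \<le> pi / 2" "\<epsilon> = 1 \<or> \<epsilon> = -1" "r \<noteq> 0" "u \<noteq> 0"
    and v: "v = of_real r * cis (\<epsilon> * \<psi>) * u"
  obtains p where "\<And>w. w = u \<or> w = v \<Longrightarrow> \<exists>k t. k > 0 \<and> p \<le> t \<and> t \<le> p + pi - \<psi> \<and> w = of_real k * cis t"
proof -
  let ?s = "Arg u"
  have u: "u = of_real (cmod u) * cis ?s" using rcis_cmod_Arg[of u] by (simp add: rcis_def)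
  have v': "v = of_real (r * cmod u) * cis (?s + \<epsilon> * \<psi>)"
    unfolding v by (subst u) (simp add: cis_mult add.commute)
  have neg: "of_real (r * cmod u) * cis t = of_real (- r * cmod u) * cis (t + pi)"
    "of_real (r * cmod u) * cis t = of_real (- r * cmod u) * cis (t - pi)" for t
    by (simp_all add: complex_eq_iff cos_diff sin_diff)
  have pos: "cmod u > 0" using assms(5) by simp
  have uk: "\<exists>k t. k > 0 \<and> p \<le> t \<and> t \<le> p + pi - \<psi> \<and> u = of_real k * cis t"
    if "p \<le> ?s" "?s \<le> p + pi - \<psi>" for p
    using that u pos by blast
  have vk: "\<exists>k t. k > 0 \<and> p \<le> t \<and> t \<le> p + pi - \<psi> \<and> v = of_real k * cis t"
    if "p \<le> t" "t \<le> p + pi - \<psi>" "k > 0" "v = of_real k * cis t" for p t k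
    using that by blast
  consider "r > 0" "\<epsilon> = 1" | "r > 0" "\<epsilon> = -1" | "r < 0" "\<epsilon> = 1" | "r < 0" "\<epsilon> = -1"
    using assms(3,4) by linarith
  then show thesis
  proof cases
    case 1
    then show ?thesis
      using uk[of ?s] vk[of ?s "?s + \<psi>" "r * cmod u"] assms(1,2) v' pos by (intro that[of ?s]) auto
  next
    case 2
    then show ?thesis
      using uk[of "?s - \<psi>"] vk[of "?s - \<psi>" "?s - \<psi>" "r * cmod u"] assms(1,2) v' pos
      by (intro that[of "?s - \<psi>"]) auto
  next
    case 3
    then show ?thesis
      using uk[of "?s + \<psi> - pi"] vk[of "?s + \<psi> - pi" "?s + \<psi> - pi" "- r * cmod u"] assms(1,2) v' pos neg(2)[of "?s + \<psi>"]
      by (intro that[of "?s + \<psi> - pi"]) (auto simp: mult_neg_pos)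
  next
    case 4
    then show ?thesis
      using uk[of ?s] vk[of ?s "?s - \<psi> + pi" "- r * cmod u"] assms(1,2) v' pos neg(1)[of "?s - \<psi>"]
      by (intro that[of ?s]) (auto simp: mult_neg_pos)
  qed
qed

text \<open>Each of the two sectors has width at most \<open>\<pi> - \<psi>\<close>, so the sector spanned by \<open>z\<close> and
  \<open>w\<close> leaves an arc of length \<open>2 \<psi>\<close> for the starting ray of a disjoint sector of this width.
  Rotations by \<open>2 \<psi>\<close> cannot jump over it. Convex sectors with a common apex that do not overlap
  are separated by a line.\<close>

lemma separate_sectors_by_rotation:
  fixes r r' :: real
  assumes j: "cmod j = 1" "Im j \<noteq> 0" and nz: "u \<noteq> 0" "z \<noteq> 0" "r \<noteq> 0" "r' \<noteq> 0"
    and v: "v = of_real r * j * u" and w: "w = of_real r' * cnj j * z"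
  obtains m :: int and n :: complex where "n \<noteq> 0"
    "\<And>x. x = u \<or> x = v \<Longrightarrow> Re (cnj n * (((cnj j)\<^sup>2) powi m * x)) \<ge> 0"
    "\<And>x. x = z \<or> x = w \<Longrightarrow> Re (cnj n * x) \<le> 0"
proof -
  obtain \<psi> \<epsilon> \<sigma> :: real where \<psi>: "0 < \<psi>" "\<psi> \<le> pi / 2" and \<epsilon>: "\<epsilon> = 1 \<or> \<epsilon> = -1" and \<sigma>: "\<sigma> = 1 \<or> \<sigma> = -1"
    and jj: "j = of_real \<sigma> * cis (\<epsilon> * \<psi>)"
    using unit_complex_acute[OF j] by metis
  have cj: "cnj j = of_real \<sigma> * cis (- \<epsilon> * \<psi>)" by (simp add: jj cis_cnj)
  have v': "v = of_real (r * \<sigma>) * cis (\<epsilon> * \<psi>) * u" and w': "w = of_real (r' * \<sigma>) * cis (- \<epsilon> * \<psi>) * z"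
    unfolding v w cj by (simp_all add: jj)
  have nz': "r * \<sigma> \<noteq> 0" "r' * \<sigma> \<noteq> 0" and \<epsilon>': "- \<epsilon> = 1 \<or> - \<epsilon> = -1" using nz \<sigma> \<epsilon> by auto
  obtain p where p: "\<And>x. x = u \<or> x = v \<Longrightarrow> \<exists>k t. k > 0 \<and> p \<le> t \<and> t \<le> p + pi - \<psi> \<and> x = of_real k * cis t"
    using sector_arc[OF \<psi> \<epsilon> nz'(1) nz(1) v'] by blast
  obtain q where q: "\<And>x. x = z \<or> x = w \<Longrightarrow> \<exists>k t. k > 0 \<and> q \<le> t \<and> t \<le> q + pi - \<psi> \<and> x = of_real k * cis t"
    using sector_arc[OF \<psi> \<epsilon>' nz'(2) nz(2) w'] by blast
  define l where "l = \<lceil>(q + pi - \<psi> - p) / (2 * \<psi>)\<rceil>"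
  define p' where "p' = p + of_int l * (2 * \<psi>)"
  have "(q + pi - \<psi> - p) / (2 * \<psi>) \<le> of_int l" "of_int l < (q + pi - \<psi> - p) / (2 * \<psi>) + 1"
    unfolding l_def by linarith+
  then have p': "q + pi - \<psi> \<le> p'" "p' < q + pi + \<psi>"
    using \<psi>(1) by (simp_all add: p'_def field_simps)
  define m where "m = (if \<epsilon> = 1 then - l else l)"
  have "((cnj j)\<^sup>2) powi m = cis (of_int l * (2 * \<psi>))"
  proof -
    have "(cnj j)\<^sup>2 = cis (- \<epsilon> * (2 * \<psi>))"
      using \<sigma> unfolding cj power_mult_distrib
      by (auto simp: power2_eq_square cis_mult intro!: arg_cong[of _ _ cis])
    then show ?thesis using \<epsilon> by (auto simp: m_def cis_power_int)
  qed
  then have rot: "((cnj j)\<^sup>2) powi m * (of_real k * cis t) = of_real k * cis (t + of_int l * (2 * \<psi>))" for k t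
    by (simp add: cis_mult add.commute)
  define h where "h = min p' (q + pi)"
  have h: "q + pi - \<psi> \<le> h" "h \<le> q + pi" "h \<le> p'" "p' \<le> h + \<psi>"
    using p' \<psi> by (auto simp: h_def)
  define n where "n = cis (h + pi / 2)"
  have Ren: "Re (cnj n * (of_real k * cis t)) = k * sin (t - h)" for k t
    by (simp add: n_def cis_cnj cis_mult algebra_simps cos_diff sin_diff cos_add sin_add)
  show thesis
  proof (rule that[of n m])
    show "n \<noteq> 0" by (simp add: n_def)
    fix x assume "x = u \<or> x = v"
    then obtain k t where t: "k > 0" "p \<le> t" "t \<le> p + pi - \<psi>" "x = of_real k * cis t" using p by blast
    have "sin (t + of_int l * (2 * \<psi>) - h) \<ge> 0"
      using t h by (intro sin_ge_zero) (auto simp: p'_def)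
    then show "Re (cnj n * (((cnj j)\<^sup>2) powi m * x)) \<ge> 0"
      unfolding t(4) rot Ren using t(1) by simp
  next
    fix x assume "x = z \<or> x = w"
    then obtain k t where t: "k > 0" "q \<le> t" "t \<le> q + pi - \<psi>" "x = of_real k * cis t" using q by blast
    have "sin (h - t) \<ge> 0" using t h by (intro sin_ge_zero) auto
    then have "sin (t - h) \<le> 0" using sin_minus[of "h - t"] by simp
    then show "Re (cnj n * x) \<le> 0"
      unfolding t(4) Ren using t(1) by (simp add: mult_nonneg_nonpos)
  qed
qed

section \<open>Peripheral classes are conjugacy classes\<close>

lemma homotopic_loopsI:
  fixes H :: "real \<Rightarrow> real \<Rightarrow> 'a::topological_space"
  assumes "continuous_on ({0..1} \<times> {0..1}) (\<lambda>z. H (fst z) (snd z))"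
    "\<And>s t. s \<in> {0..1} \<Longrightarrow> t \<in> {0..1} \<Longrightarrow> H s t \<in> S"
    "\<And>s. s \<in> {0..1} \<Longrightarrow> H s 0 = H s 1"
    "\<And>t. t \<in> {0..1} \<Longrightarrow> H 0 t = f t" "\<And>t. t \<in> {0..1} \<Longrightarrow> H 1 t = g t"
  shows "homotopic_loops S f g"
  unfolding homotopic_loops
  by (rule exI[of _ "\<lambda>z. H (fst z) (snd z)"])
     (use assms in \<open>auto simp: pathfinish_def pathstart_def\<close>)

text \<open>The homotopy maps the unit square to \<open>S\<close>; one side of the square is homotopic to the path
  along the other three, and the two sides traced by the base point cancel up to conjugation.\<close>

lemma homotopic_loops_imp_conjugate:
  fixes p q :: "real \<Rightarrow> 'a::real_normed_vector"
  assumes "homotopic_loops S p q"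
  obtains u where "path u" "path_image u \<subseteq> S" "pathstart u = pathstart p" "pathfinish u = pathstart q"
    "homotopic_paths S p (u +++ q +++ reversepath u)"
proof -
  let ?Q = "{0..1} \<times> {0..1} :: (real \<times> real) set"
  obtain h where h: "continuous_on ?Q h" "h ` ?Q \<subseteq> S"
    "\<And>t. t \<in> {0..1} \<Longrightarrow> h (0, t) = p t" "\<And>t. t \<in> {0..1} \<Longrightarrow> h (1, t) = q t"
    "\<And>s. s \<in> {0..1} \<Longrightarrow> h (s, 1) = h (s, 0)"
    using assms unfolding homotopic_loops pathfinish_def pathstart_def image_subset_iff_funcset comp_def
    by blast
  have conv: "convex ?Q" by (intro convex_Times) auto
  let ?l0 = "linepath (0, 0) (0, 1) :: real \<Rightarrow> real \<times> real"
  let ?l1 = "linepath (0, 0) (1, 0) :: real \<Rightarrow> real \<times> real"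
  let ?l2 = "linepath (1, 0) (1, 1) :: real \<Rightarrow> real \<times> real"
  let ?l3 = "linepath (1, 1) (0, 1) :: real \<Rightarrow> real \<times> real"
  have seg: "path_image (linepath a b) \<subseteq> ?Q" if "a \<in> ?Q" "b \<in> ?Q" for a b :: "real \<times> real"
    using that conv by (simp add: closed_segment_subset)
  have "homotopic_paths ?Q ?l0 (?l1 +++ ?l2 +++ ?l3)"
    using conv convex_imp_simply_connected[of ?Q] seg
    unfolding simply_connected_eq_homotopic_paths by (fastforce simp: path_image_join)
  then have "homotopic_paths S (h \<circ> ?l0) (h \<circ> (?l1 +++ ?l2 +++ ?l3))"
    by (rule homotopic_paths_continuous_image) (use h in auto)
  then have *: "homotopic_paths S (h \<circ> ?l0) ((h \<circ> ?l1) +++ (h \<circ> ?l2) +++ (h \<circ> ?l3))"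
    by (simp add: path_compose_join)
  have lin: "?l0 t = (0, t)" "?l1 t = (t, 0)" "?l2 t = (1, t)" "?l3 t = (1 - t, 1)" for t
    by (simp_all add: linepath_def)
  define u where "u = h \<circ> ?l1"
  have pu: "path u" unfolding u_def
    by (intro path_continuous_image continuous_on_subset[OF h(1)] seg) auto
  have ui: "path_image u \<subseteq> S" unfolding u_def path_image_compose
    using h(2) seg[of "(0,0)" "(1,0)"] by (auto simp: image_subset_iff)
  have pq: "path p" "path q" "path_image p \<subseteq> S" "path_image q \<subseteq> S"
    using assms homotopic_loops_imp_path homotopic_loops_imp_subset by blast+
  have "homotopic_paths S p (h \<circ> ?l0)"
    by (rule homotopic_paths_eq) (use pq h(3) in \<open>auto simp: lin\<close>)
  moreover have "(h \<circ> ?l1) +++ (h \<circ> ?l2) +++ (h \<circ> ?l3) = (h \<circ> ?l1) +++ (h \<circ> ?l2) +++ (h \<circ> ?l3)" ..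
  moreover have "homotopic_paths S ((h \<circ> ?l1) +++ (h \<circ> ?l2) +++ (h \<circ> ?l3)) (u +++ q +++ reversepath u)"
  proof (rule homotopic_paths_eq)
    show "path ((h \<circ> ?l1) +++ (h \<circ> ?l2) +++ (h \<circ> ?l3))"
      using homotopic_paths_imp_path[OF *] by simp
    show "path_image ((h \<circ> ?l1) +++ (h \<circ> ?l2) +++ (h \<circ> ?l3)) \<subseteq> S"
      using homotopic_paths_imp_subset[OF *] by simp
    show "((h \<circ> ?l1) +++ (h \<circ> ?l2) +++ (h \<circ> ?l3)) t = (u +++ q +++ reversepath u) t" if "t \<in> {0..1}" for t
      using that h(4,5) by (auto simp: joinpaths_def u_def lin reversepath_def)
  qed
  ultimately have "homotopic_paths S p (u +++ q +++ reversepath u)"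
    using * by (meson homotopic_paths_trans)
  moreover have "pathstart u = pathstart p" "pathfinish u = pathstart q"
    using h(3)[of 0] h(4)[of 0] by (simp_all add: u_def lin pathstart_def pathfinish_def)
  ultimately show ?thesis using that pu ui by blast
qed

lemma cross3_frame:
  fixes p u v :: "real^3"
  assumes "norm u = 1" "norm v = 1" "u \<bullet> v = 0" "cross3 u v = p"
  shows "p \<bullet> u = 0" "p \<bullet> v = 0" "norm p = 1" "cross3 p u = v" "cross3 p v = - u"
proof -
  show "p \<bullet> u = 0" "p \<bullet> v = 0" using assms(4) by (auto simp: dot_cross_self inner_commute)
  have "(norm p)\<^sup>2 + (u \<bullet> v)\<^sup>2 = (norm u * norm v)\<^sup>2" using norm_cross_dot[of u v] assms(4) by simp
  then show "norm p = 1" using assms by (simp add: power2_eq_1_iff) (smt (verit) norm_ge_zero)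
  have L: "cross3 (cross3 a b) c = (a \<bullet> c) *\<^sub>R b - (b \<bullet> c) *\<^sub>R a" for a b c :: "real^3"
    using Lagrange[of c a b] cross_skew[of "cross3 a b" c] by (simp add: inner_commute)
  have uu: "u \<bullet> u = 1" "v \<bullet> v = 1" using assms by (simp_all add: norm_eq_1)
  show "cross3 p u = v" "cross3 p v = - u"
    using L[of u v u] L[of u v v] uu assms(3,4) by (simp_all add: inner_commute)
qed


lemma orthonormal_frame_expand:
  fixes p u v w :: "real^3"
  assumes "norm u = 1" "norm v = 1" "u \<bullet> v = 0" "cross3 u v = p" "p \<bullet> w = 0"
  shows "w = (u \<bullet> w) *\<^sub>R u + (v \<bullet> w) *\<^sub>R v" "cross3 p w = (u \<bullet> w) *\<^sub>R v - (v \<bullet> w) *\<^sub>R u"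
proof -
  note fr = cross3_frame[OF assms(1-4)]
  have "p \<bullet> p = 1" using fr(3) by (simp add: norm_eq_1)
  then have w: "w = - cross3 p (cross3 p w)" using assms(5) by (simp add: Lagrange)
  show pw: "cross3 p w = (u \<bullet> w) *\<^sub>R v - (v \<bullet> w) *\<^sub>R u"
    using Lagrange[of w u v] cross_skew[of p w] assms(4) by (simp add: inner_commute)
  show "w = (u \<bullet> w) *\<^sub>R u + (v \<bullet> w) *\<^sub>R v"
    using w unfolding pw by (simp add: Cross3.right_diff_distrib cross_mult_right fr(4,5) add.commute)
qed

lemma cap_boundary_on_sphere:
  assumes "norm u = 1" "norm v = 1" "u \<bullet> v = 0" "cross3 u v = p"
  shows "norm (cos r *\<^sub>R p + sin r *\<^sub>R (cos a *\<^sub>R u + sin a *\<^sub>R v)) = 1"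
    "p \<bullet> (cos r *\<^sub>R p + sin r *\<^sub>R (cos a *\<^sub>R u + sin a *\<^sub>R v)) = cos r"
proof -
  note fr = cross3_frame[OF assms]
  have d: "p \<bullet> p = 1" "u \<bullet> u = 1" "v \<bullet> v = 1" using fr(3) assms by (simp_all add: norm_eq_1)
  let ?y = "cos r *\<^sub>R p + sin r *\<^sub>R (cos a *\<^sub>R u + sin a *\<^sub>R v)"
  show "p \<bullet> ?y = cos r" using d fr by (simp add: inner_add_right)
  have "?y \<bullet> ?y = cos r * cos r + sin r * sin r * (cos a * cos a + sin a * sin a)"
    using d fr assms(3)
    by (simp add: inner_add_right inner_add_left inner_commute distrib_left mult_ac del: sin_cos_squared_add3)
  then show "norm ?y = 1" by (simp add: norm_eq_1)
qed

lemma in_punctured_sphere_cap: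
  assumes "\<forall>q\<in>P - {p}. p \<bullet> q < cos r" "norm y = 1" "p \<bullet> y \<ge> cos r" "y \<noteq> p"
  shows "y \<in> punctured_sphere P"
proof -
  have "y \<notin> P" using assms(1,3,4) by (metis Diff_iff not_le singletonD)
  then show ?thesis using assms(2) by (simp add: punctured_sphere_def)
qed

text \<open>Shrink or enlarge one cap to the radius of the other and turn its frame.\<close>

lemma homotopic_cap_boundaries:
  assumes r: "0 < r" "r < pi" "\<forall>q\<in>P - {p}. p \<bullet> q < cos r"
    and r': "0 < r'" "r' < pi" "\<forall>q\<in>P - {p}. p \<bullet> q < cos r'"
    and f: "norm u = 1" "norm v = 1" "u \<bullet> v = 0" "cross3 u v = p"
    and f': "norm u' = 1" "norm v' = 1" "u' \<bullet> v' = 0" "cross3 u' v' = p"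
  shows "homotopic_loops (punctured_sphere P) (cap_boundary p r u v) (cap_boundary p r' u' v')"
proof -
  note fr = cross3_frame[OF f] and fr' = cross3_frame[OF f']
  have pp: "p \<bullet> p = 1" using fr(3) by (simp add: norm_eq_1)
  have u': "u' = (u \<bullet> u') *\<^sub>R u + (v \<bullet> u') *\<^sub>R v" "v' = (u \<bullet> u') *\<^sub>R v - (v \<bullet> u') *\<^sub>R u"
    using orthonormal_frame_expand[OF f fr'(1)] fr'(4) by simp_all
  have "(u \<bullet> u')\<^sup>2 + (v \<bullet> u')\<^sup>2 = u' \<bullet> u'"
    by (subst (3) u'(1)) (simp add: inner_add_left power2_eq_square)
  then have "(u \<bullet> u')\<^sup>2 + (v \<bullet> u')\<^sup>2 = 1" using f'(1) by (simp add: norm_eq_1)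
  then obtain b where b: "u \<bullet> u' = cos b" "v \<bullet> u' = sin b" using sincos_total_2pi by metis
  define R where "R = (\<lambda>s. (1 - s) * r + s * r')"
  define H where "H = (\<lambda>s t. cos (R s) *\<^sub>R p + sin (R s) *\<^sub>R (cos (2 * pi * t + s * b) *\<^sub>R u + sin (2 * pi * t + s * b) *\<^sub>R v))"
  show ?thesis
  proof (rule homotopic_loopsI[where H=H])
    show "continuous_on ({0..1} \<times> {0..1}) (\<lambda>z. H (fst z) (snd z))"
      unfolding H_def R_def by (intro continuous_intros)
    show "H 0 t = cap_boundary p r u v t" for t by (simp add: H_def R_def cap_boundary_def)
    show "H 1 t = cap_boundary p r' u' v' t" for t
      unfolding cap_boundary_def by (subst u'(1), subst u'(2))
        (simp add: H_def R_def b cos_add sin_add scaleR_add_right scaleR_diff_right algebra_simps)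
    show "H s 0 = H s 1" for s
      by (simp add: H_def add.commute[of "2 * pi"])
    fix s t :: real assume s: "s \<in> {0..1}"
    define m where "m = max r r'"
    have m: "0 < m" "m < pi" "\<forall>q\<in>P - {p}. p \<bullet> q < cos m" using r r' by (auto simp: m_def max_def)
    have R: "0 < R s" "R s \<le> m"
    proof -
      have "(1 - s) * min r r' + s * min r r' \<le> R s" unfolding R_def
        using s by (intro add_mono mult_left_mono) auto
      moreover have "(1 - s) * min r r' + s * min r r' = min r r'" by (simp add: algebra_simps)
      ultimately show "0 < R s" using r(1) r'(1) by linarith
      have "R s \<le> (1 - s) * m + s * m" unfolding R_def m_def
        using s by (intro add_mono mult_left_mono) auto
      then show "R s \<le> m" by (simp add: algebra_simps)
    qed
    note y = cap_boundary_on_sphere[OF f, of "R s" "2 * pi * t + s * b"]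
    show "H s t \<in> punctured_sphere P"
    proof (rule in_punctured_sphere_cap[OF m(3)])
      show "norm (H s t) = 1" using y by (simp add: H_def)
      show "cos m \<le> p \<bullet> H s t" using y(2) R m cos_mono_le_eq[of m "R s"] by (simp add: H_def)
      have "cos (R s) < cos 0" using R m by (intro cos_monotone_0_pi) auto
      then show "H s t \<noteq> p" using y(2) pp by (auto simp: H_def)
    qed
  qed
qed

lemma ccw_loops_homotopic:
  assumes "ccw_loop_around P p \<gamma>" "ccw_loop_around P p \<delta>"
  shows "homotopic_loops (punctured_sphere P) \<gamma> \<delta>"
proof -
  obtain r u v where 1: "0 < r" "r < pi" "\<forall>q\<in>P - {p}. p \<bullet> q < cos r"
      "norm u = 1" "norm v = 1" "u \<bullet> v = 0" "cross3 u v = p"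
      "homotopic_loops (punctured_sphere P) \<gamma> (cap_boundary p r u v)"
    using assms(1) unfolding ccw_loop_around_def by blast
  obtain r' u' v' where 2: "0 < r'" "r' < pi" "\<forall>q\<in>P - {p}. p \<bullet> q < cos r'"
      "norm u' = 1" "norm v' = 1" "u' \<bullet> v' = 0" "cross3 u' v' = p"
      "homotopic_loops (punctured_sphere P) \<delta> (cap_boundary p r' u' v')"
    using assms(2) unfolding ccw_loop_around_def by blast
  from homotopic_loops_trans[OF homotopic_loops_trans[OF 1(8)
      homotopic_cap_boundaries[OF 1(1-3) 2(1-3) 1(4-7) 2(4-7)]] homotopic_loops_sym[OF 2(8)]]
  show ?thesis .
qed

lemma carrier_fundamental_group: "carrier (fundamental_group S x) = path_class S ` based_loops S x"
  by (simp add: fundamental_group_def)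

lemma one_fundamental_group: "\<one>\<^bsub>fundamental_group S x\<^esub> = path_class S (linepath x x)"
  by (simp add: fundamental_group_def)

lemma reversepath_based_loop: "\<gamma> \<in> based_loops S x \<Longrightarrow> reversepath \<gamma> \<in> based_loops S x"
  by (simp add: based_loops_def)

lemma mem_path_class: "\<gamma> \<in> based_loops S x \<Longrightarrow> \<gamma> \<in> path_class S \<gamma>"
  by (simp add: path_class_def based_loops_def)

lemma path_class_eqI: "homotopic_paths S \<gamma> \<delta> \<Longrightarrow> path_class S \<gamma> = path_class S \<delta>"
  unfolding path_class_def by (blast intro: homotopic_paths_trans homotopic_paths_sym)

lemma inv_path_class:
  assumes "\<gamma> \<in> based_loops S x"
  shows "inv\<^bsub>fundamental_group S x\<^esub> path_class S \<gamma> = path_class S (reversepath \<gamma>)"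
proof -
  have x: "x \<in> S" using assms by (auto simp: based_loops_def path_image_def pathstart_def)
  interpret group "fundamental_group S x" by (rule group_fundamental_group[OF x])
  note r = reversepath_based_loop[OF assms]
  have "homotopic_paths S (reversepath \<gamma> +++ \<gamma>) (linepath x x)"
    using assms homotopic_paths_linv[of \<gamma> S] by (simp add: based_loops_def)
  then have "path_class S (reversepath \<gamma>) \<otimes>\<^bsub>fundamental_group S x\<^esub> path_class S \<gamma> = \<one>\<^bsub>fundamental_group S x\<^esub>"
    by (simp add: fundamental_group_mult[OF r assms] one_fundamental_group path_class_eqI)
  then show ?thesis
    using assms r by (intro inv_equality) (auto simp: carrier_fundamental_group)
qed

lemma conj_path_class:
  assumes "\<gamma> \<in> based_loops S x" "\<delta> \<in> based_loops S x"
  shows "path_class S \<delta> \<otimes>\<^bsub>fundamental_group S x\<^esub> path_class S \<gamma> \<otimes>\<^bsub>fundamental_group S x\<^esub>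
     inv\<^bsub>fundamental_group S x\<^esub> path_class S \<delta> = path_class S (\<delta> +++ \<gamma> +++ reversepath \<delta>)"
proof -
  have x: "x \<in> S" using assms by (auto simp: based_loops_def path_image_def pathstart_def)
  interpret group "fundamental_group S x" by (rule group_fundamental_group[OF x])
  have c: "path_class S \<gamma> \<in> carrier (fundamental_group S x)" "path_class S \<delta> \<in> carrier (fundamental_group S x)"
    using assms by (auto simp: carrier_fundamental_group)
  show ?thesis
    using m_assoc[OF c(2,1) inv_closed[OF c(2)]] assms reversepath_based_loop[OF assms(2)]
    by (simp add: inv_path_class fundamental_group_mult based_loops_join)
qed

text \<open>Loops around the same puncture are freely homotopic, and freely homotopic based loops are
  conjugate. So the peripheral angles of a representation are determined by its values on the
  generators of one geometric presentation.\<close>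

lemma peripheral_classes_conjugate:
  assumes "c \<in> peripheral_classes P x p" "c' \<in> peripheral_classes P x p"
  obtains g where "g \<in> carrier (sphere_group P x)"
    "c' = g \<otimes>\<^bsub>sphere_group P x\<^esub> c \<otimes>\<^bsub>sphere_group P x\<^esub> inv\<^bsub>sphere_group P x\<^esub> g"
proof -
  let ?S = "punctured_sphere P"
  obtain a \<gamma> where a: "a \<in> based_loops ?S x" "c = path_class ?S a" "\<gamma> \<in> c" "ccw_loop_around P p \<gamma>"
    using assms(1) by (auto simp: peripheral_classes_def carrier_fundamental_group)
  obtain a' \<gamma>' where a': "a' \<in> based_loops ?S x" "c' = path_class ?S a'" "\<gamma>' \<in> c'" "ccw_loop_around P p \<gamma>'"
    using assms(2) by (auto simp: peripheral_classes_def carrier_fundamental_group)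
  have h: "homotopic_paths ?S a \<gamma>" "homotopic_paths ?S a' \<gamma>'"
    using a(2,3) a'(2,3) by (simp_all add: path_class_def)
  have loops: "\<gamma> \<in> based_loops ?S x" "\<gamma>' \<in> based_loops ?S x"
    using h a(1) a'(1) homotopic_paths_imp_path homotopic_paths_imp_subset
      homotopic_paths_imp_pathstart homotopic_paths_imp_pathfinish
    unfolding based_loops_def by (metis (no_types, lifting) mem_Collect_eq)+
  have "homotopic_loops ?S \<gamma>' \<gamma>" by (rule ccw_loops_homotopic[OF a'(4) a(4)])
  then obtain u where u: "path u" "path_image u \<subseteq> ?S" "pathstart u = pathstart \<gamma>'" "pathfinish u = pathstart \<gamma>"
    "homotopic_paths ?S \<gamma>' (u +++ \<gamma> +++ reversepath u)" by (rule homotopic_loops_imp_conjugate)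
  then have ul: "u \<in> based_loops ?S x" using loops by (simp add: based_loops_def)
  have "c' = path_class ?S (u +++ \<gamma> +++ reversepath u)"
    using a'(2) h(2) u(5) path_class_eqI by metis
  also have "\<dots> = path_class ?S u \<otimes>\<^bsub>sphere_group P x\<^esub> path_class ?S \<gamma> \<otimes>\<^bsub>sphere_group P x\<^esub> inv\<^bsub>sphere_group P x\<^esub> path_class ?S u"
    using conj_path_class[OF loops(1) ul] by simp
  also have "path_class ?S \<gamma> = c" using a(2) h(1) path_class_eqI by metis
  finally show ?thesis using that[of "path_class ?S u"] ul by (simp add: carrier_fundamental_group)
qed

lemma peripheral_classes_conj_closed:
  assumes "c \<in> peripheral_classes P x p" "g \<in> carrier (sphere_group P x)"
  shows "g \<otimes>\<^bsub>sphere_group P x\<^esub> c \<otimes>\<^bsub>sphere_group P x\<^esub> inv\<^bsub>sphere_group P x\<^esub> g \<in> peripheral_classes P x p"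
proof -
  let ?S = "punctured_sphere P"
  obtain a \<gamma> where a: "a \<in> based_loops ?S x" "c = path_class ?S a" "\<gamma> \<in> c" "ccw_loop_around P p \<gamma>"
    using assms(1) by (auto simp: peripheral_classes_def carrier_fundamental_group)
  obtain d where d: "d \<in> based_loops ?S x" "g = path_class ?S d"
    using assms(2) by (auto simp: carrier_fundamental_group)
  have h: "homotopic_paths ?S a \<gamma>" using a by (simp add: path_class_def)
  have "homotopic_loops ?S (d +++ a +++ reversepath d) a"
    by (rule homotopic_loops_conjugate) (use a(1) d(1) in \<open>auto simp: based_loops_def\<close>)
  moreover have "homotopic_loops ?S a \<gamma>"
    using h a(1) homotopic_paths_imp_homotopic_loops[OF h] homotopic_paths_imp_pathfinish[OF h] by (simp add: based_loops_def)
  ultimately have "ccw_loop_around P p (d +++ a +++ reversepath d)"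
    using a(4) unfolding ccw_loop_around_def by (blast intro: homotopic_loops_trans)
  moreover have "d +++ a +++ reversepath d \<in> based_loops ?S x"
    using a(1) d(1) by (simp add: based_loops_join reversepath_based_loop)
  ultimately show ?thesis
    using conj_path_class[OF a(1) d(1)] a(2) d(2) mem_path_class
    unfolding peripheral_classes_def carrier_fundamental_group by blast
qed

section \<open>Compactness forces elliptic prefix products\<close>

subsection \<open>The squared trace on PSL(2,R)\<close>

definition trace_sq :: "(real^2^2) set \<Rightarrow> real" where
  "trace_sq g = (trace (SOME A. A \<in> g))\<^sup>2"

lemma trace_2: "trace (A :: real^2^2) = A$1$1 + A$2$2"
  by (simp add: trace_def sum_2)

lemma trace_sq_proj: "trace_sq (proj A) = (trace A)\<^sup>2"
proof -
  have "(SOME B. B \<in> proj A) \<in> proj A" by (rule someI) (rule mem_proj)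
  then have "(SOME B. B \<in> proj A) = A \<or> (SOME B. B \<in> proj A) = - A" by (auto simp: proj_def)
  moreover have "(trace (- A))\<^sup>2 = (trace A)\<^sup>2" by (simp add: trace_2 power2_eq_square algebra_simps)
  ultimately show ?thesis by (auto simp: trace_sq_def)
qed

lemma trace_mult_commute: "trace ((A :: real^2^2) ** B) = trace (B ** A)"
  by (simp add: trace_2 matrix_mult_2)

lemma inverse_SL2:
  assumes "det (A :: real^2^2) = 1"
  shows "A ** (trace A *\<^sub>R mat 1 - A) = mat 1" "(trace A *\<^sub>R mat 1 - A) ** A = mat 1"
    "det (trace A *\<^sub>R mat 1 - A) = 1"
  using assms
  by (simp_all add: vec_eq_iff forall_2 matrix_mult_2 trace_2 mat_def det_2 algebra_simps)

lemma inv_proj: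
  assumes "det A = 1"
  shows "inv\<^bsub>PSL2R\<^esub> proj A = proj (trace A *\<^sub>R mat 1 - A)"
  by (rule PSL.inv_equality)
     (use inverse_SL2[OF assms] assms in \<open>simp_all add: proj_mult proj_one proj_closed\<close>)

lemma trace_sq_conj:
  assumes "g \<in> carrier PSL2R" "h \<in> carrier PSL2R"
  shows "trace_sq (h \<otimes>\<^bsub>PSL2R\<^esub> g \<otimes>\<^bsub>PSL2R\<^esub> inv\<^bsub>PSL2R\<^esub> h) = trace_sq g"
proof -
  obtain A where A: "det A = 1" "g = proj A" using PSL2R_cases assms by metis
  obtain B where B: "det B = 1" "h = proj B" using PSL2R_cases assms by metis
  let ?B = "trace B *\<^sub>R mat 1 - B"
  have "trace (B ** A ** ?B) = trace (?B ** (B ** A))" by (rule trace_mult_commute)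
  also have "\<dots> = trace A" using inverse_SL2[OF B(1)] by (simp add: matrix_mul_assoc)
  finally show ?thesis using A B by (simp add: inv_proj proj_mult trace_sq_proj)
qed

lemma coset_proj: "{mat 1, - mat 1} #>\<^bsub>SL2R\<^esub> A = proj A"
  by (auto simp: r_coset_def SL2R_def proj_def matrix_minus_mult)

lemma quotient_map_proj: "quotient_map (top_of_set {A. det A = 1}) PSL2R_topology proj"
  using quotient_map_quotient_topology[of "top_of_set (carrier SL2R)" "\<lambda>A. {mat 1, - mat 1} #>\<^bsub>SL2R\<^esub> A"]
  unfolding PSL2R_topology_def coset_proj by (simp add: SL2R_def)

lemma continuous_map_trace_sq: "continuous_map PSL2R_topology euclideanreal trace_sq"
proof -
  have "continuous_map (top_of_set {A :: real^2^2. det A = 1}) euclideanreal (trace_sq \<circ> proj)"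
    by (auto simp: comp_def trace_sq_proj trace_2 intro!: continuous_intros)
  then show ?thesis using continuous_compose_quotient_map quotient_map_proj by blast
qed

lemma continuous_map_proj:
  assumes "continuous_on UNIV A" "\<And>t. det (A t) = 1"
  shows "continuous_map euclideanreal PSL2R_topology (\<lambda>t. proj (A t))"
proof -
  have "continuous_map euclideanreal (top_of_set {A :: real^2^2. det A = 1}) A"
    using assms by (simp add: continuous_map_in_subtopology image_subset_iff)
  then show ?thesis
    using continuous_map_compose[OF _ quotient_imp_continuous_map[OF quotient_map_proj]] by (auto simp: comp_def)
qed

lemma continuous_on_matrix_mult:
  fixes A B :: "real \<Rightarrow> real^2^2"
  assumes "continuous_on UNIV A" "continuous_on UNIV B"
  shows "continuous_on UNIV (\<lambda>t. A t ** B t)"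
  unfolding matrix_matrix_mult_def
  by (intro continuous_on_vec_lambda continuous_intros assms)

lemma continuous_on_inverse_SL2:
  fixes A :: "real \<Rightarrow> real^2^2"
  assumes "continuous_on UNIV A"
  shows "continuous_on UNIV (\<lambda>t. trace (A t) *\<^sub>R mat 1 - A t)"
  unfolding trace_2 by (intro continuous_intros assms)

subsection \<open>Conjugation invariants on a compact component\<close>

lemma mem_conjugacy_class_self:
  assumes "\<rho> \<in> Hom_angles P x \<alpha>"
  shows "\<rho> \<in> conjugacy_class P x \<rho>"
proof -
  have \<rho>: "\<rho> \<in> hom (sphere_group P x) PSL2R" "\<rho> \<in> extensional (carrier (sphere_group P x))"
    using assms by (auto simp: Hom_angles_def)
  have "\<rho> = (\<lambda>c\<in>carrier (sphere_group P x). \<one>\<^bsub>PSL2R\<^esub> \<otimes>\<^bsub>PSL2R\<^esub> \<rho> c \<otimes>\<^bsub>PSL2R\<^esub> inv\<^bsub>PSL2R\<^esub> \<one>\<^bsub>PSL2R\<^esub>)"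
    using \<rho> by (intro extensionalityI[OF \<rho>(2)]) (auto simp: hom_def Pi_iff)
  then show ?thesis unfolding conjugacy_class_def by blast
qed

lemma topspace_Hom_angles_topology: "topspace (Hom_angles_topology P x \<alpha>) = Hom_angles P x \<alpha>"
proof -
  have "Hom_angles P x \<alpha> \<subseteq> topspace (product_topology (\<lambda>_. PSL2R_topology) (carrier (sphere_group P x)))"
    by (auto simp: Hom_angles_def topspace_PSL2R_topology hom_def PiE_def)
  then show ?thesis by (metis Hom_angles_topology_def topspace_subtopology_subset)
qed

text \<open>The squared trace descends to conjugacy classes of representations; the choice of a
  representative is immaterial.\<close>

definition class_trace_sq :: "(real \<Rightarrow> real^3) set \<Rightarrow> sphere_rep set \<Rightarrow> real" where
  "class_trace_sq c K = trace_sq ((SOME \<rho>. \<rho> \<in> K) c)"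

lemma class_trace_sq:
  assumes "\<rho> \<in> Hom_angles P x \<alpha>" "c \<in> carrier (sphere_group P x)"
  shows "class_trace_sq c (conjugacy_class P x \<rho>) = trace_sq (\<rho> c)"
proof -
  have "(SOME \<sigma>. \<sigma> \<in> conjugacy_class P x \<rho>) \<in> conjugacy_class P x \<rho>"
    using mem_conjugacy_class_self[OF assms(1)] some_in_eq by (metis empty_iff)
  then obtain g where "g \<in> carrier PSL2R"
    "(SOME \<sigma>. \<sigma> \<in> conjugacy_class P x \<rho>) c = g \<otimes>\<^bsub>PSL2R\<^esub> \<rho> c \<otimes>\<^bsub>PSL2R\<^esub> inv\<^bsub>PSL2R\<^esub> g"
    using assms(2) unfolding conjugacy_class_def by auto
  moreover have "\<rho> c \<in> carrier PSL2R" using assms by (auto simp: Hom_angles_def hom_def)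
  ultimately show ?thesis by (simp add: class_trace_sq_def trace_sq_conj)
qed

lemma continuous_map_class_trace_sq:
  assumes "c \<in> carrier (sphere_group P x)"
  shows "continuous_map (Rep_angles P x \<alpha>) euclideanreal (class_trace_sq c)"
proof -
  let ?H = "Hom_angles_topology P x \<alpha>"
  have "continuous_map ?H PSL2R_topology (\<lambda>\<rho>. \<rho> c)"
    unfolding Hom_angles_topology_def
    by (intro continuous_map_from_subtopology continuous_map_product_projection assms)
  then have "continuous_map ?H euclideanreal (trace_sq \<circ> (\<lambda>\<rho>. \<rho> c))"
    using continuous_map_compose continuous_map_trace_sq by blast
  then have "continuous_map ?H euclideanreal (class_trace_sq c \<circ> conjugacy_class P x)"
    by (rule continuous_map_eq) (simp add: topspace_Hom_angles_topology class_trace_sq assms)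
  then show ?thesis
    unfolding Rep_angles_def
    using continuous_compose_quotient_map quotient_map_quotient_topology by blast
qed

text \<open>A continuous family of representations through a point of a compact component stays in
  that component, so squared traces are bounded along the family.\<close>

lemma trace_sq_bounded:
  fixes \<Phi> :: "real \<Rightarrow> sphere_rep"
  assumes C: "C \<in> connected_components_of (Rep_angles P x \<alpha>)" "compactin (Rep_angles P x \<alpha>) C"
    and \<Phi>: "continuous_map euclideanreal (Hom_angles_topology P x \<alpha>) \<Phi>" "conjugacy_class P x (\<Phi> 0) \<in> C"
    and c: "c \<in> carrier (sphere_group P x)"
  obtains B where "\<And>t. trace_sq (\<Phi> t c) \<le> B"
proof -
  have H: "\<Phi> t \<in> Hom_angles P x \<alpha>" for t
    using continuous_map_funspace[OF \<Phi>(1)] by (auto simp: topspace_Hom_angles_topology)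
  have "continuous_map euclideanreal (Rep_angles P x \<alpha>) (conjugacy_class P x \<circ> \<Phi>)"
    using continuous_map_compose[OF \<Phi>(1)] quotient_imp_continuous_map[OF quotient_map_quotient_topology]
    unfolding Rep_angles_def by blast
  then have "connectedin (Rep_angles P x \<alpha>) ((conjugacy_class P x \<circ> \<Phi>) ` UNIV)"
    using connectedin_continuous_map_image[of euclideanreal] by (metis connectedin_iff_connected connected_UNIV)
  moreover have "\<not> disjnt C ((conjugacy_class P x \<circ> \<Phi>) ` UNIV)"
    using \<Phi>(2) by (auto simp: disjnt_def)
  ultimately have sub: "(conjugacy_class P x \<circ> \<Phi>) ` UNIV \<subseteq> C"
    using connected_components_of_maximal[OF C(1)] by (metis disjnt_sym)
  have "compactin euclideanreal (class_trace_sq c ` C)"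
    using image_compactin[OF C(2) continuous_map_class_trace_sq[OF c]] .
  then have "bounded (class_trace_sq c ` C)" by (simp add: compact_imp_bounded)
  then obtain B where B: "\<And>y. y \<in> class_trace_sq c ` C \<Longrightarrow> norm y \<le> B"
    unfolding bounded_iff by blast
  have "trace_sq (\<Phi> t c) \<le> B" for t
  proof -
    have "conjugacy_class P x (\<Phi> t) \<in> C" using sub by auto
    then have "norm (class_trace_sq c (conjugacy_class P x (\<Phi> t))) \<le> B" by (intro B imageI)
    then show ?thesis by (simp add: class_trace_sq[OF H c])
  qed
  then show ?thesis using that by blast
qed

subsection \<open>Unbounded conjugation\<close>

definition mat2 :: "real \<Rightarrow> real \<Rightarrow> real \<Rightarrow> real \<Rightarrow> real^2^2" where
  "mat2 a b c d = vector [vector [a, b], vector [c, d]]"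

lemma mat2_nth [simp]: "mat2 a b c d $ 1 $ 1 = a" "mat2 a b c d $ 1 $ 2 = b"
  "mat2 a b c d $ 2 $ 1 = c" "mat2 a b c d $ 2 $ 2 = d"
  by (simp_all add: mat2_def)

text \<open>If \<open>N\<^sup>2 = \<delta>\<close> and \<open>N\<close> is traceless, these matrices have determinant \<open>1\<close>, commute with \<open>N\<close> and form, up to
  the choice of the parameter, a one-parameter group.\<close>

definition flow :: "real \<Rightarrow> real^2^2 \<Rightarrow> real \<Rightarrow> real^2^2" where
  "flow \<delta> N t = sqrt (1 + \<delta> * t\<^sup>2) *\<^sub>R mat 1 + t *\<^sub>R N"

lemma flow_nth:
  "flow \<delta> (mat2 p q r (- p)) t $ 1 $ 1 = sqrt (1 + \<delta> * t\<^sup>2) + t * p"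
  "flow \<delta> (mat2 p q r (- p)) t $ 1 $ 2 = t * q"
  "flow \<delta> (mat2 p q r (- p)) t $ 2 $ 1 = t * r"
  "flow \<delta> (mat2 p q r (- p)) t $ 2 $ 2 = sqrt (1 + \<delta> * t\<^sup>2) - t * p"
  by (simp_all add: flow_def mat_def)

lemma det_flow:
  assumes "\<delta> = p\<^sup>2 + q * r" "\<delta> \<ge> 0"
  shows "det (flow \<delta> (mat2 p q r (- p)) t) = 1"
proof -
  have "sqrt (1 + \<delta> * t\<^sup>2) * sqrt (1 + \<delta> * t\<^sup>2) = 1 + \<delta> * t\<^sup>2" using assms(2) by simp
  then show ?thesis unfolding assms(1) by (simp add: det_2 flow_nth power2_eq_square algebra_simps)
qed

text \<open>An element of \<open>PSL(2,R)\<close> that is not elliptic is centralised by a noncompact one-parameter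
  group: its lift differs by a scalar from a matrix \<open>N\<close> with trace \<open>0\<close> and \<open>N\<^sup>2 = \<delta>\<close>
  nonnegative, or is itself scalar.\<close>

lemma not_elliptic_flow:
  assumes A: "det A = 1" "\<not> elliptic (proj A)"
  obtains p q r \<delta> where "p \<noteq> 0 \<or> q \<noteq> 0 \<or> r \<noteq> 0" "\<delta> = p\<^sup>2 + q * r" "\<delta> \<ge> 0"
    "\<And>t. flow \<delta> (mat2 p q r (- p)) t ** A = A ** flow \<delta> (mat2 p q r (- p)) t"
proof -
  define p where "p = (A$1$1 - A$2$2) / 2"
  define q where "q = A$1$2"
  define r where "r = A$2$1"
  define \<delta> where "\<delta> = p\<^sup>2 + q * r"
  have "\<delta> \<ge> 0"
  proof (rule ccontr)
    assume "\<not> \<delta> \<ge> 0"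
    then have d: "\<delta> < 0" by simp
    then have r: "r \<noteq> 0" by (auto simp: \<delta>_def) 
    define s where "s = sqrt (- \<delta>)"
    have s: "s > 0" "s\<^sup>2 = - \<delta>" using d by (auto simp: s_def)
    define z where "z = Complex (p / r) (s / \<bar>r\<bar>)"
    have z: "z \<in> hyp_plane" using s r by (simp add: z_def hyp_plane_def)
    have a: "A$1$1 - A$2$2 = 2 * p" by (simp add: p_def)
    define w where "w = of_real r * z"
    have w: "w = Complex p (sgn r * s)"
      using r by (simp add: w_def complex_eq_iff z_def sgn_if)
    have "of_real r * chord A z = w\<^sup>2 - of_real (2 * p) * w - of_real (q * r)"
      unfolding chord_eq a q_def[symmetric] r_def[symmetric] w_def by (simp add: power2_eq_square algebra_simps)
    also have "\<dots> = 0"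
      unfolding w using r s(2) by (simp add: complex_eq_iff power2_eq_square \<delta>_def sgn_if)
    finally have "chord A z = 0" using r by simp
    then have "PSL2R_act (proj A) z = z" using A z by (simp add: act_proj moebius_fixed_iff)
    moreover have "proj A \<noteq> \<one>\<^bsub>PSL2R\<^esub>"
    proof
      assume "proj A = \<one>\<^bsub>PSL2R\<^esub>"
      then have "A = mat 1 \<or> A = - mat 1" by (simp add: proj_one proj_eq_iff)
      then show False using r by (auto simp: r_def mat_def)
    qed
    ultimately show False using A z by (auto simp: elliptic_def proj_closed)
  qed
  show ?thesis
  proof (cases "p = 0 \<and> q = 0 \<and> r = 0")
    case False
    have "flow \<delta> (mat2 p q r (- p)) t ** A = A ** flow \<delta> (mat2 p q r (- p)) t" for t
      by (simp add: vec_eq_iff forall_2 matrix_mult_2 flow_nth p_def q_def r_def algebra_simps)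
    then show ?thesis using that[of p q r \<delta>] False \<open>\<delta> \<ge> 0\<close> \<delta>_def by blast
  next
    case True
    then have "A$1$1 = A$2$2" "A$1$2 = 0" "A$2$1 = 0" by (auto simp: p_def q_def r_def)
    then have "flow 0 (mat2 0 1 0 (- 0)) t ** A = A ** flow 0 (mat2 0 1 0 (- 0)) t" for t
      by (simp add: vec_eq_iff forall_2 matrix_mult_2 flow_nth[of 0 0, simplified] algebra_simps)
    then show ?thesis using that[of 0 1 0 0] by auto
  qed
qed

text \<open>An elliptic matrix has no real eigenvector.\<close>

lemma elliptic_no_eigenvector:
  assumes "elliptic (proj A)" "det A = 1" "x \<noteq> 0 \<or> y \<noteq> 0"
  shows "x * (A$2$1 * x + A$2$2 * y) - y * (A$1$1 * x + A$1$2 * y) \<noteq> 0"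
proof -
  obtain X where X: "X \<in> hyp_plane" "PSL2R_act (proj A) X = X" using assms(1) by (auto simp: elliptic_def)
  then have c: "chord A X = 0" using assms(2) by (simp add: act_proj moebius_fixed_iff)
  have nz: "A$2$1 \<noteq> 0" by (rule elliptic_lift[OF assms(1,2)]) simp
  have "x * (A$2$1 * x + A$2$2 * y) - y * (A$1$1 * x + A$1$2 * y)
      = A$2$1 * x\<^sup>2 - (A$1$1 - A$2$2) * x * y - A$1$2 * y\<^sup>2" by (simp add: power2_eq_square algebra_simps)
  also have "\<dots> = A$2$1 * ((x - Re X * y)\<^sup>2 + (Im X * y)\<^sup>2)"
    unfolding fixed_coeffs[OF c X(1)] cmod_power2 by (simp add: power2_eq_square algebra_simps)
  finally show ?thesis using nz assms(3) X(1) by (auto simp: sum_power2_eq_zero_iff hyp_plane_def)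
qed

text \<open>The matrix \<open>M = (s + p, q; r, s - p)\<close> has rank one, so the trace of \<open>A M B adj(M)\<close> splits into
  two factors that vanish only if \<open>A\<close> or \<open>B\<close> has a real eigenvector.\<close>

lemma trace_rank_one:
  assumes A: "elliptic (proj A)" "det A = 1" and B: "elliptic (proj B)" "det B = 1"
    and M: "s\<^sup>2 = p\<^sup>2 + q * r" "p \<noteq> 0 \<or> q \<noteq> 0 \<or> r \<noteq> 0"
  shows "trace (A ** mat2 (s + p) q r (s - p) ** B ** mat2 (s - p) (- q) (- r) (s + p)) \<noteq> 0"
proof -
  have det: "(s + p) * (s - p) = q * r" using M(1) by (simp add: power2_eq_square algebra_simps)
  obtain u1 u2 v1 v2 where uv: "s + p = u1 * v1" "q = u1 * v2" "r = u2 * v1" "s - p = u2 * v2"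
    and nz: "u1 \<noteq> 0 \<or> u2 \<noteq> 0" "v1 \<noteq> 0 \<or> v2 \<noteq> 0"
  proof (cases "s + p = 0 \<and> q = 0")
    case True
    then have "r \<noteq> 0 \<or> s - p \<noteq> 0" using M(2) by auto
    then show ?thesis using that[of 0 r "s - p" 1] True by auto
  next
    case False
    show ?thesis
    proof (cases "s + p = 0")
      case True
      then have "r = 0" "q \<noteq> 0" using det False by auto
      then show ?thesis using that[of 1 0 q "(s - p) / q"] True by simp
    next
      case F: False
      have "r / (s + p) * q = s - p" using det F by (simp add: field_simps)
      then show ?thesis using that[of 1 "s + p" q "r / (s + p)"] F by simp
    qed
  qed
  have "trace (A ** mat2 (s + p) q r (s - p) ** B ** mat2 (s - p) (- q) (- r) (s + p)) =
     - (u1 * (A$2$1 * u1 + A$2$2 * u2) - u2 * (A$1$1 * u1 + A$1$2 * u2)) *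
     ((- v2) * (B$2$1 * (- v2) + B$2$2 * v1) - v1 * (B$1$1 * (- v2) + B$1$2 * v1))"
    unfolding uv by (simp add: trace_2 matrix_mult_2 algebra_simps)
  moreover have "- v2 \<noteq> 0 \<or> v1 \<noteq> 0" using nz by auto
  ultimately show ?thesis
    using elliptic_no_eigenvector[OF A nz(1)] elliptic_no_eigenvector[OF B, of "- v2" v1] by simp
qed

text \<open>Divided by \<open>t\<close>, the flow tends to the matrix of rank one of the previous lemma, so the trace grows
  like \<open>t\<^sup>2\<close>.\<close>

lemma trace_flow_unbounded:
  assumes A: "elliptic (proj A)" "det A = 1" and B: "elliptic (proj B)" "det B = 1"
    and N: "\<delta> = p\<^sup>2 + q * r" "\<delta> \<ge> 0" "p \<noteq> 0 \<or> q \<noteq> 0 \<or> r \<noteq> 0"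
    and bd: "\<And>t. (trace (A ** flow \<delta> (mat2 p q r (- p)) t ** B **
      (trace (flow \<delta> (mat2 p q r (- p)) t) *\<^sub>R mat 1 - flow \<delta> (mat2 p q r (- p)) t)))\<^sup>2 \<le> K"
  shows False
proof -
  define T where "T = (\<lambda>y. trace (A ** mat2 (y + p) q r (y - p) ** B ** mat2 (y - p) (- q) (- r) (y + p)))"
  define y where "y = (\<lambda>t::real. sqrt (1 / t\<^sup>2 + \<delta>))"
  have sc: "trace (A ** flow \<delta> (mat2 p q r (- p)) t ** B **
      (trace (flow \<delta> (mat2 p q r (- p)) t) *\<^sub>R mat 1 - flow \<delta> (mat2 p q r (- p)) t)) = t\<^sup>2 * T (y t)"
    if "t > 0" for t
  proof -
    have "1 + \<delta> * t\<^sup>2 = t\<^sup>2 * (1 / t\<^sup>2 + \<delta>)" using that by (simp add: field_simps)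
    then have "sqrt (1 + \<delta> * t\<^sup>2) = t * y t" using that by (simp add: y_def real_sqrt_mult)
    then have f: "flow \<delta> (mat2 p q r (- p)) t = t *\<^sub>R mat2 (y t + p) q r (y t - p)"
      by (simp add: vec_eq_iff forall_2 flow_nth algebra_simps)
    then have g: "trace (flow \<delta> (mat2 p q r (- p)) t) *\<^sub>R mat 1 - flow \<delta> (mat2 p q r (- p)) t
        = t *\<^sub>R mat2 (y t - p) (- q) (- r) (y t + p)"
      by (simp add: vec_eq_iff forall_2 trace_2 mat_def algebra_simps)
    show ?thesis unfolding g unfolding f T_def
      by (simp add: trace_2 matrix_mult_2 power2_eq_square algebra_simps)
  qed
  have inv: "((\<lambda>t::real. 1 / t\<^sup>2) \<longlongrightarrow> 0) at_top"
    by (intro tendsto_divide_0[OF tendsto_const] filterlim_at_top_imp_at_infinity filterlim_pow_at_top filterlim_ident) simp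
  then have "(y \<longlongrightarrow> sqrt (0 + \<delta>)) at_top" unfolding y_def by (intro tendsto_intros)
  then have lim: "((\<lambda>t. T (y t)) \<longlongrightarrow> T (sqrt \<delta>)) at_top"
    unfolding T_def trace_2 matrix_mult_2 mat2_nth by (intro tendsto_intros) simp_all
  have "T (sqrt \<delta>) \<noteq> 0" unfolding T_def by (rule trace_rank_one[OF A B]) (use N in auto)
  have "K \<ge> 0" using bd[of 0] by (meson order_trans zero_le_power2)
  have le: "norm (T (y t)) \<le> sqrt K * (1 / t\<^sup>2)" if "t > 0" for t
  proof -
    have "(t\<^sup>2 * T (y t))\<^sup>2 \<le> K" using bd[of t] sc[OF that] by simp
    then have "\<bar>t\<^sup>2 * T (y t)\<bar> \<le> sqrt K" using real_le_rsqrt by (metis power2_abs)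
    then show ?thesis using that by (simp add: abs_mult field_simps)
  qed
  have "((\<lambda>t::real. sqrt K * (1 / t\<^sup>2)) \<longlongrightarrow> 0) at_top" by (intro tendsto_mult_right_zero inv)
  then have "((\<lambda>t. T (y t)) \<longlongrightarrow> 0) at_top"
    by (rule Lim_null_comparison[OF eventually_mono[OF eventually_gt_at_top[of 0]], rotated]) (rule le)
  then have "T (sqrt \<delta>) = 0" using lim tendsto_unique trivial_limit_at_top_linorder by blast
  then show False using \<open>T (sqrt \<delta>) \<noteq> 0\<close> by simp
qed

subsection \<open>Twisting a representation\<close>

lemma geometric_presentation_presentation:
  "geometric_presentation P x n c \<Longrightarrow> is_presentation (sphere_group P x) {..<n} c (product_relator n)"
  by (simp add: geometric_presentation_def)

text \<open>Suppose \<open>\<rho>\<close> maps a prefix product \<open>c\<^sub>0 \<cdots> c\<^sub>k\<^sub>-\<^sub>1\<close> to an element that is not elliptic. Conjugating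
  the images of \<open>c\<^sub>k, \<dots>, c\<^sub>n\<^sub>-\<^sub>1\<close> by a noncompact one-parameter group centralising it gives a
  family of representations with the same peripheral angles along which the trace of
  \<open>c\<^sub>0 c\<^sub>k\<close> is unbounded.\<close>

lemma DT_prefix_product_elliptic:
  assumes x: "x \<in> punctured_sphere P"
    and \<rho>: "\<rho> \<in> Hom_angles P x \<alpha>"
    and C: "C \<in> connected_components_of (Rep_angles P x \<alpha>)" "compactin (Rep_angles P x \<alpha>) C"
      "conjugacy_class P x \<rho> \<in> C"
    and c: "geometric_presentation P x n c" and k: "0 < k" "k < n"
  shows "elliptic (\<rho> (prefix_product (sphere_group P x) c k))"
proof (rule ccontr)
  let ?G = "sphere_group P x"
  interpret G: group ?G by (rule group_fundamental_group[OF x])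
  note pres = geometric_presentation_presentation[OF c]
  have cc: "c i \<in> carrier ?G" if "i < n" for i using pres that by (auto simp: is_presentation_def)
  obtain pt where pt: "bij_betw pt {..<n} P" "\<And>i. i < n \<Longrightarrow> c i \<in> peripheral_classes P x (pt i)"
    using c by (auto simp: geometric_presentation_def)
  have hom: "\<rho> \<in> hom ?G PSL2R" and ext: "\<rho> \<in> extensional (carrier ?G)"
    and ang: "\<And>p c. p \<in> P \<Longrightarrow> c \<in> peripheral_classes P x p \<Longrightarrow> elliptic_with_angle (\<rho> c) (\<alpha> p)"
    using \<rho> by (auto simp: Hom_angles_def)
  have ptP: "pt i \<in> P" if "i < n" for i using pt(1) that by (auto simp: bij_betw_def)
  interpret R: group_hom ?G PSL2R \<rho> by unfold_locales fact
  define pk where "pk = prefix_product ?G c k"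
  have pk: "pk \<in> carrier ?G" unfolding pk_def using cc k by (intro G.prefix_product_closed) auto
  assume ne: "\<not> elliptic (\<rho> (prefix_product ?G c k))"
  obtain S where S: "det S = 1" "\<rho> pk = proj S" using PSL2R_cases R.hom_closed[OF pk] by metis
  obtain p q r \<delta> where N: "p \<noteq> 0 \<or> q \<noteq> 0 \<or> r \<noteq> 0" "\<delta> = p\<^sup>2 + q * r" "\<delta> \<ge> 0"
    and comm: "\<And>t. flow \<delta> (mat2 p q r (- p)) t ** S = S ** flow \<delta> (mat2 p q r (- p)) t"
    using not_elliptic_flow[OF S(1)] ne S(2) unfolding pk_def by metis
  define h where "h = flow \<delta> (mat2 p q r (- p))"
  define h' where "h' = (\<lambda>t. trace (h t) *\<^sub>R mat 1 - h t)"
  have h: "det (h t) = 1" for t unfolding h_def by (rule det_flow[OF N(2,3)])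
  have h': "det (h' t) = 1" for t unfolding h'_def by (rule inverse_SL2(3)[OF h])
  have hinv: "inv\<^bsub>PSL2R\<^esub> proj (h t) = proj (h' t)" for t unfolding h'_def by (rule inv_proj[OF h])
  have hc: "continuous_on UNIV h" unfolding h_def flow_def using N(3) by (intro continuous_intros)
  have h'c: "continuous_on UNIV h'" unfolding h'_def by (rule continuous_on_inverse_SL2[OF hc])
  define L where "L = (\<lambda>i. SOME A. det A = 1 \<and> \<rho> (c i) = proj A)"
  have L: "det (L i) = 1 \<and> \<rho> (c i) = proj (L i)" if "i < n" for i
  proof -
    have "\<exists>A. det A = 1 \<and> \<rho> (c i) = proj A" using PSL2R_cases R.hom_closed[OF cc[OF that]] by metis
    then show ?thesis unfolding L_def by (rule someI_ex)
  qed
  define M where "M = (\<lambda>t i. if i < k then L i else h t ** L i ** h' t)"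
  have Mdet: "det (M t i) = 1" if "i < n" for t i using L[OF that] h h' by (simp add: M_def det_mul)
  have Mc: "continuous_on UNIV (\<lambda>t. M t i)" for i
    unfolding M_def by (cases "i < k") (simp_all add: continuous_on_matrix_mult hc h'c)
  define K where "K = (\<lambda>t i. proj (M t i))"
  have K: "K t i \<in> carrier PSL2R" if "i < n" for t i using Mdet[OF that] by (simp add: K_def proj_closed)
  have K1: "K t i = \<rho> (c i)" if "i < k" for t i using that k L[of i] by (simp add: K_def M_def)
  have K2: "K t i = proj (h t) \<otimes>\<^bsub>PSL2R\<^esub> \<rho> (c i) \<otimes>\<^bsub>PSL2R\<^esub> inv\<^bsub>PSL2R\<^esub> proj (h t)" if "k \<le> i" "i < n" for t i
    using that L[of i] hinv by (simp add: K_def M_def proj_mult)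
  have hcl: "proj (h t) \<in> carrier PSL2R" for t by (rule proj_closed[OF h])
  have Kprod: "prefix_product PSL2R (K t) n = \<one>\<^bsub>PSL2R\<^esub>" for t
  proof -
    let ?g = "inv\<^bsub>PSL2R\<^esub> proj (h t)"
    let ?d = "\<lambda>i. \<rho> (c i)"
    have d: "?d i \<in> carrier PSL2R" if "i < n" for i using cc that by simp
    have dn: "prefix_product PSL2R ?d n = \<one>\<^bsub>PSL2R\<^esub>"
      using hom_prefix_product[OF G.is_group PSL.is_group hom, of n c] cc presentation_product[OF G.is_group pres] by simp
    have dk: "prefix_product PSL2R ?d k = \<rho> pk"
      unfolding pk_def using hom_prefix_product[OF G.is_group PSL.is_group hom, of k c] cc k by simp
    have "proj (h t) \<otimes>\<^bsub>PSL2R\<^esub> \<rho> pk = \<rho> pk \<otimes>\<^bsub>PSL2R\<^esub> proj (h t)"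
      using comm[of t] by (simp add: S proj_mult h_def)
    then have gcomm: "?g \<otimes>\<^bsub>PSL2R\<^esub> \<rho> pk = \<rho> pk \<otimes>\<^bsub>PSL2R\<^esub> ?g"
      using hcl R.hom_closed[OF pk] PSL.inv_solve_left PSL.inv_solve_right
      by (metis PSL.inv_closed PSL.m_assoc PSL.m_closed)
    \<comment> \<open>up to conjugation by \<open>h t\<close>, the first \<open>k\<close> generators are twisted by its inverse\<close>
    have eq: "K t i = proj (h t) \<otimes>\<^bsub>PSL2R\<^esub> twist PSL2R k ?g ?d i \<otimes>\<^bsub>PSL2R\<^esub> ?g" if "i < n" for i
    proof (cases "i < k")
      case True
      have "a = b \<otimes>\<^bsub>PSL2R\<^esub> (inv\<^bsub>PSL2R\<^esub> b \<otimes>\<^bsub>PSL2R\<^esub> a \<otimes>\<^bsub>PSL2R\<^esub> b) \<otimes>\<^bsub>PSL2R\<^esub> inv\<^bsub>PSL2R\<^esub> b"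
        if "a \<in> carrier PSL2R" "b \<in> carrier PSL2R" for a b
        using that by (simp add: PSL.m_assoc[symmetric]) (simp add: PSL.m_assoc)
      then show ?thesis using True K1 d[OF that] hcl[of t] by (simp add: twist_def)
    next
      case False
      then show ?thesis using K2 that by (simp add: twist_def)
    qed
    have "prefix_product PSL2R (K t) n = prefix_product PSL2R (twist PSL2R n (proj (h t)) (twist PSL2R k ?g ?d)) n"
      using eq by (intro prefix_product_cong) (simp add: twist_def)
    also have "\<dots> = proj (h t) \<otimes>\<^bsub>PSL2R\<^esub> prefix_product PSL2R (twist PSL2R k ?g ?d) n \<otimes>\<^bsub>PSL2R\<^esub> ?g"
      using PSL.twist_closed[of n ?d ?g _ k] d hcl[of t] by (intro PSL.prefix_product_twist_le[of n]) auto
    also have "prefix_product PSL2R (twist PSL2R k ?g ?d) n = \<one>\<^bsub>PSL2R\<^esub>"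
      using PSL.prefix_product_twist_ge[of n ?d ?g k n] d hcl[of t] k gcomm dk dn by simp
    finally show ?thesis using hcl[of t] by simp
  qed
  have "\<exists>\<phi>. \<phi> \<in> hom ?G PSL2R \<and> (\<forall>i<n. \<phi> (c i) = K t i)" for t
  proof (rule presentation_universal[OF G.is_group pres product_relator_subset PSL.is_group, of "K t"])
    show "K t i \<in> carrier PSL2R" if "i \<in> {..<n}" for i using K that by simp
    show "eval_word PSL2R (K t) w = \<one>\<^bsub>PSL2R\<^esub>" if "w \<in> product_relator n" for w
      using that Kprod[of t] by (simp add: eval_word_product_relator)
    show "\<exists>\<phi>. \<phi> \<in> hom ?G PSL2R \<and> (\<forall>i<n. \<phi> (c i) = K t i)"
      if "\<phi> \<in> hom ?G PSL2R" "\<And>i. i \<in> {..<n} \<Longrightarrow> \<phi> (c i) = K t i" for \<phi>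
      using that by auto
  qed
  then obtain \<phi> where \<phi>: "\<And>t. \<phi> t \<in> hom ?G PSL2R" "\<And>t i. i < n \<Longrightarrow> \<phi> t (c i) = K t i" by metis
  define \<Phi> where "\<Phi> = (\<lambda>t. restrict (\<phi> t) (carrier ?G))"
  have \<Phi>H: "\<Phi> t \<in> hom ?G PSL2R" for t
    using \<phi>(1)[of t] by (auto simp: \<Phi>_def hom_def Pi_iff)
  have \<Phi>c: "\<Phi> t (c i) = K t i" if "i < n" for t i using \<phi>(2) that cc by (simp add: \<Phi>_def)
  have gen: "\<exists>A. continuous_on UNIV A \<and> (\<forall>t. det (A t) = 1) \<and> (\<forall>t. \<Phi> t a = proj (A t))" if "a \<in> carrier ?G" for a
  proof -
    have "a \<in> generate ?G (c ` {..<n})" using pres that by (simp add: is_presentation_def)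
    then show ?thesis
    proof (induction rule: generate.induct)
      case one
      have "\<Phi> t \<one>\<^bsub>?G\<^esub> = proj (mat 1)" for t
        using hom_one[OF \<Phi>H G.is_group PSL.is_group] by (simp add: proj_one)
      then show ?case by (intro exI[of _ "\<lambda>_. mat 1"]) auto
    next
      case (incl a)
      then obtain i where "i < n" "a = c i" by auto
      then show ?case using \<Phi>c Mc Mdet by (intro exI[of _ "\<lambda>t. M t i"]) (auto simp: K_def)
    next
      case (inv a)
      then obtain i where i: "i < n" "a = c i" by auto
      have "\<Phi> t (inv\<^bsub>?G\<^esub> a) = proj (trace (M t i) *\<^sub>R mat 1 - M t i)" for t
      proof -
        interpret F: group_hom ?G PSL2R "\<Phi> t" by unfold_locales (rule \<Phi>H)
        show ?thesis using i \<Phi>c cc Mdet by (simp add: K_def inv_proj)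
      qed
      then show ?case using inverse_SL2(3)[OF Mdet] continuous_on_inverse_SL2[OF Mc] i
        by (intro exI[of _ "\<lambda>t. trace (M t i) *\<^sub>R mat 1 - M t i"]) auto
    next
      case (eng a b)
      then obtain A B where A: "continuous_on UNIV A" "\<forall>t. det (A t) = 1" "\<forall>t. \<Phi> t a = proj (A t)"
        and B: "continuous_on UNIV B" "\<forall>t. det (B t) = 1" "\<forall>t. \<Phi> t b = proj (B t)" by blast
      have ab: "a \<in> carrier ?G" "b \<in> carrier ?G"
        using eng(1,2) G.generate_incl[of "c ` {..<n}"] cc by auto
      have "\<Phi> t (a \<otimes>\<^bsub>?G\<^esub> b) = proj (A t ** B t)" for t
        using hom_mult[OF \<Phi>H ab] A B by (simp add: proj_mult)
      then show ?case using A B continuous_on_matrix_mult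
        by (intro exI[of _ "\<lambda>t. A t ** B t"]) (auto simp: det_mul)
    qed
  qed
  have \<Phi>A: "\<Phi> t \<in> Hom_angles P x \<alpha>" for t
    unfolding Hom_angles_def
  proof (intro CollectI conjI IntI ballI)
    show "\<Phi> t \<in> hom ?G PSL2R" by (rule \<Phi>H)
    show "\<Phi> t \<in> extensional (carrier ?G)" by (simp add: \<Phi>_def)
    fix p' c' assume p': "p' \<in> P" and c': "c' \<in> peripheral_classes P x p'"
    obtain i where i: "i < n" "p' = pt i" using pt(1) p' by (auto simp: bij_betw_def)
    obtain g where g: "g \<in> carrier ?G" "c' = g \<otimes>\<^bsub>?G\<^esub> c i \<otimes>\<^bsub>?G\<^esub> inv\<^bsub>?G\<^esub> g"
      using peripheral_classes_conjugate[OF pt(2)[OF i(1)]] c' i(2) by metis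
    interpret F: group_hom ?G PSL2R "\<Phi> t" by unfold_locales (rule \<Phi>H)
    have "elliptic_with_angle (\<rho> (c i)) (\<alpha> p')" using ang[OF p'] pt(2)[OF i(1)] i(2) by simp
    then have "elliptic_with_angle (K t i) (\<alpha> p')"
      using K1[of i t] K2[of i t] i(1) elliptic_with_angle_conj hcl by (cases "i < k") auto
    then show "elliptic_with_angle (\<Phi> t c') (\<alpha> p')"
      using g cc[OF i(1)] \<Phi>c[OF i(1)] elliptic_with_angle_conj[of "K t i" "\<alpha> p'" "\<Phi> t g"] by simp
  qed
  have "continuous_map euclideanreal (product_topology (\<lambda>_. PSL2R_topology) (carrier ?G)) \<Phi>"
    unfolding continuous_map_componentwise
  proof (intro conjI ballI)
    show "\<Phi> ` topspace euclideanreal \<subseteq> extensional (carrier ?G)" by (auto simp: \<Phi>_def)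
    fix a assume "a \<in> carrier ?G"
    from gen[OF this] obtain A where "continuous_on UNIV A" "\<forall>t. det (A t) = 1" "\<forall>t. \<Phi> t a = proj (A t)" by blast
    then show "continuous_map euclideanreal PSL2R_topology (\<lambda>t. \<Phi> t a)" using continuous_map_proj by simp
  qed
  then have cont: "continuous_map euclideanreal (Hom_angles_topology P x \<alpha>) \<Phi>"
    unfolding Hom_angles_topology_def continuous_map_in_subtopology using \<Phi>A by auto
  have h0: "h 0 = mat 1" "h' 0 = mat 1" by (simp_all add: h_def flow_def h'_def trace_2 mat_def vec_eq_iff forall_2)
  have "\<Phi> 0 = \<rho>"
  proof (rule extensionalityI[of _ "carrier ?G"])
    show "\<Phi> 0 \<in> extensional (carrier ?G)" by (simp add: \<Phi>_def)
    have e: "\<Phi> 0 (c i) = \<rho> (c i)" if "i < n" for i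
      using that \<Phi>c L by (auto simp: K_def M_def h0)
    interpret F: group_hom ?G PSL2R "\<Phi> 0" by unfold_locales (rule \<Phi>H)
    fix a assume "a \<in> carrier ?G"
    then have "a \<in> generate ?G (c ` {..<n})" using pres by (simp add: is_presentation_def)
    then show "\<Phi> 0 a = \<rho> a"
    proof (induction rule: generate.induct)
      case (eng a b)
      have "a \<in> carrier ?G" "b \<in> carrier ?G"
        using eng(1,2) G.generate_incl[of "c ` {..<n}"] cc by auto
      then show ?case using eng by simp
    qed (use e cc in auto)
  qed (rule ext)
  then have "conjugacy_class P x (\<Phi> 0) \<in> C" using C(3) by simp
  moreover have "c 0 \<otimes>\<^bsub>?G\<^esub> c k \<in> carrier ?G" using cc k by simp
  ultimately obtain B where B: "\<And>t. trace_sq (\<Phi> t (c 0 \<otimes>\<^bsub>?G\<^esub> c k)) \<le> B"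
    using trace_sq_bounded[OF C(1,2) cont] by metis
  have "\<Phi> t (c 0 \<otimes>\<^bsub>?G\<^esub> c k) = proj (L 0 ** h t ** L k ** h' t)" for t
    using hom_mult[OF \<Phi>H[of t], of "c 0" "c k"] cc k \<Phi>c by (simp add: K_def M_def proj_mult matrix_mul_assoc)
  then have B': "(trace (L 0 ** h t ** L k ** h' t))\<^sup>2 \<le> B" for t
    using B[of t] by (simp add: trace_sq_proj)
  have el: "elliptic (proj (L i))" if "i < n" for i
    using elliptic_with_angle_elliptic(1)[OF ang[OF ptP[OF that] pt(2)[OF that]]] L[OF that] by simp
  show False
    by (rule trace_flow_unbounded[OF el _ el _ N(2,3,1), of 0 k B])
       (use B' k L in \<open>auto simp: h_def h'_def\<close>)
qed

section \<open>The fundamental group of a union of two simply connected open sets\<close>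

subsection \<open>Sections of a locally constant cocycle\<close>

text \<open>Gluing \<open>U \<times> K\<close> and \<open>V \<times> K\<close> along a locally constant \<open>\<tau>: U \<inter> V \<rightarrow> K\<close> gives a covering of
  \<open>X = U \<union> V\<close>. A section over a set \<open>A\<close> mapped to \<open>X\<close> by \<open>h\<close> is a pair of locally constant functions;
  the flag \<open>b\<close> selects the chart. Comparing the values at the two ends of a path gives its
  monodromy, which is a homotopy invariant because sections exist over a square.\<close>

definition locally_constant_on :: "'a::topological_space set \<Rightarrow> ('a \<Rightarrow> 'b) \<Rightarrow> bool" where
  "locally_constant_on S f \<longleftrightarrow> (\<forall>p\<in>S. \<exists>T. open T \<and> p \<in> T \<and> (\<forall>q\<in>S \<inter> T. f q = f p))"

lemma locally_constant_onD:
  "locally_constant_on S f \<Longrightarrow> p \<in> S \<Longrightarrow> \<exists>T. open T \<and> p \<in> T \<and> (\<forall>q\<in>S. q \<in> T \<longrightarrow> f q = f p)"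
  unfolding locally_constant_on_def by (drule (1) bspec) (simp add: Ball_def imp_conjL)

lemma locally_constant_on_connected:
  assumes "locally_constant_on S f" "connected S" "p \<in> S" "q \<in> S"
  shows "f p = f q"
proof -
  have "\<exists>T. openin (top_of_set S) T \<and> a \<in> T \<and> (\<forall>x\<in>T. f x = f a)" if a: "a \<in> S" for a
  proof -
    from locally_constant_onD[OF assms(1) a]
    obtain T where T: "open T" "a \<in> T" "\<forall>q\<in>S. q \<in> T \<longrightarrow> f q = f a"
      by (elim exE conjE)
    show ?thesis
    proof (intro exI[of _ "S \<inter> T"] conjI ballI)
      show "openin (top_of_set S) (S \<inter> T)" using T(1) by (rule openin_open_Int)
      show "a \<in> S \<inter> T" using a T(2) by (rule IntI)
      show "f x = f a" if "x \<in> S \<inter> T" for x using T(3) that by (metis IntD1 IntD2)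
    qed
  qed
  then have "f constant_on S" by (rule locally_constant_imp_constant[OF assms(2)])
  then show ?thesis using assms(3,4) unfolding constant_on_def by metis
qed

lemma locally_constant_on_pullback:
  assumes "locally_constant_on S f" "continuous_on B k" "C \<subseteq> B" "k ` C \<subseteq> S"
  shows "locally_constant_on C (\<lambda>p. f (k p))"
  unfolding locally_constant_on_def
proof
  fix p assume p: "p \<in> C"
  then have "k p \<in> S" using assms(4) by auto
  then obtain T where T: "open T" "k p \<in> T" "\<forall>q\<in>S. q \<in> T \<longrightarrow> f q = f (k p)"
    using locally_constant_onD[OF assms(1)] by blast
  obtain W where W: "open W" "W \<inter> B = k -` T \<inter> B"
    using assms(2) T(1) unfolding continuous_on_open_invariant by metis
  have "p \<in> W" using p T(2) W(2) assms(3) by auto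
  moreover have "f (k q) = f (k p)" if "q \<in> C \<inter> W" for q
  proof -
    have "k q \<in> T" "k q \<in> S" using that W(2) assms(3,4) by blast+
    then show ?thesis using T(3) by blast
  qed
  ultimately show "\<exists>T. open T \<and> p \<in> T \<and> (\<forall>q\<in>C \<inter> T. f (k q) = f (k p))" using W(1) by blast
qed

locale chart_cocycle = K: group K
  for K :: "'g monoid" (structure) +
  fixes X U V :: "'a::real_normed_vector set" and \<tau> :: "'a \<Rightarrow> 'g"
  assumes cover: "X = U \<union> V"
    and open_U: "openin (top_of_set X) U" and open_V: "openin (top_of_set X) V"
    and \<tau>_closed: "\<And>z. z \<in> U \<Longrightarrow> z \<in> V \<Longrightarrow> \<tau> z \<in> carrier K"
    and \<tau>_locally_constant: "locally_constant_on (U \<inter> V) \<tau>"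
begin

definition chart :: "bool \<Rightarrow> 'a set" where
  "chart b = (if b then U else V)"

lemma chart_simps [simp]: "chart True = U" "chart False = V"
  by (simp_all add: chart_def)

lemma chart_preimage_open:
  assumes "continuous_on A h" "h ` A \<subseteq> X"
  obtains T where "open T" "A \<inter> h -` chart b = A \<inter> T"
proof -
  have "openin (top_of_set X) (chart b)" using open_U open_V by (simp add: chart_def)
  then have "openin (top_of_set A) (A \<inter> h -` chart b)"
    using assms continuous_openin_preimage by (metis image_subset_iff_funcset)
  then show ?thesis using that by (auto simp: openin_open)
qed

definition is_section :: "'c::topological_space set \<Rightarrow> ('c \<Rightarrow> 'a) \<Rightarrow> (bool \<Rightarrow> 'c \<Rightarrow> 'g) \<Rightarrow> bool" where
  "is_section A h f \<longleftrightarrow>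
     (\<forall>b. locally_constant_on (A \<inter> h -` chart b) (f b) \<and> (\<forall>p\<in>A. h p \<in> chart b \<longrightarrow> f b p \<in> carrier K)) \<and>
     (\<forall>p\<in>A. h p \<in> U \<and> h p \<in> V \<longrightarrow> f False p = f True p \<otimes> \<tau> (h p))"

lemma section_closed: "is_section A h f \<Longrightarrow> p \<in> A \<Longrightarrow> h p \<in> chart b \<Longrightarrow> f b p \<in> carrier K"
  by (simp add: is_section_def)

lemma section_locally_constant: "is_section A h f \<Longrightarrow> locally_constant_on (A \<inter> h -` chart b) (f b)"
  by (simp add: is_section_def)

lemma section_transition:
  "is_section A h f \<Longrightarrow> p \<in> A \<Longrightarrow> h p \<in> U \<Longrightarrow> h p \<in> V \<Longrightarrow> f False p = f True p \<otimes> \<tau> (h p)"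
  by (simp add: is_section_def)

lemma section_pullback:
  assumes f: "is_section A h f" and k: "continuous_on B k" "k ` B \<subseteq> A" "\<And>p. p \<in> B \<Longrightarrow> h' p = h (k p)"
  shows "is_section B h' (\<lambda>b p. f b (k p))"
  unfolding is_section_def
proof (intro conjI allI ballI impI)
  show "locally_constant_on (B \<inter> h' -` chart b) (\<lambda>p. f b (k p))" for b
    by (rule locally_constant_on_pullback[OF section_locally_constant[OF f] k(1)]) (use k in auto)
  show "f b (k p) \<in> carrier K" if "p \<in> B" "h' p \<in> chart b" for b p
    using section_closed[OF f, of "k p" b] k that by auto
  show "f False (k p) = f True (k p) \<otimes> \<tau> (h' p)" if "p \<in> B" "h' p \<in> U \<and> h' p \<in> V" for p
    using section_transition[OF f, of "k p"] k that by auto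
qed

lemma section_restrict: "is_section A h f \<Longrightarrow> B \<subseteq> A \<Longrightarrow> is_section B h f"
  using section_pullback[of A h f B id h] by (auto simp: image_subset_iff)

lemma section_translate:
  assumes f: "is_section A h f" and g: "g \<in> carrier K"
  shows "is_section A h (\<lambda>b p. g \<otimes> f b p)"
  unfolding is_section_def
proof (intro conjI allI ballI impI)
  show "locally_constant_on (A \<inter> h -` chart b) (\<lambda>p. g \<otimes> f b p)" for b
    using section_locally_constant[OF f, of b] unfolding locally_constant_on_def by metis
  show "g \<otimes> f b p \<in> carrier K" if "p \<in> A" "h p \<in> chart b" for b p
    using section_closed[OF f that] g by simp
  show "g \<otimes> f False p = g \<otimes> f True p \<otimes> \<tau> (h p)" if "p \<in> A" "h p \<in> U \<and> h p \<in> V" for p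
    using section_transition[OF f that(1)] section_closed[OF f that(1), of True] \<tau>_closed[of "h p"] that g
    by (simp add: K.m_assoc)
qed

text \<open>Two sections over a connected set differ by a left translation.\<close>

lemma section_unique:
  assumes A: "connected A" "continuous_on A h" "h ` A \<subseteq> X"
    and f: "is_section A h f" and f': "is_section A h f'"
  obtains g where "g \<in> carrier K" "\<And>b p. p \<in> A \<Longrightarrow> h p \<in> chart b \<Longrightarrow> f' b p = g \<otimes> f b p"
proof (cases "A = {}")
  case True
  then show ?thesis using that[of \<one>] by simp
next
  case False
  define d where "d = (\<lambda>p. f' (h p \<in> U) p \<otimes> inv f (h p \<in> U) p)"
  have ch: "h p \<in> chart (h p \<in> U)" if "p \<in> A" for p using A(3) cover that by (auto simp: chart_def)
  have d: "d p = f' b p \<otimes> inv f b p" if p: "p \<in> A" "h p \<in> chart b" for p b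
  proof (cases "b = (h p \<in> U)")
    case F: False
    then have h: "h p \<in> U" "h p \<in> V" "\<not> b" using p by (cases b; auto)+
    have cl: "f True p \<in> carrier K" "f' True p \<in> carrier K" "\<tau> (h p) \<in> carrier K"
      using section_closed[OF f p(1), of True] section_closed[OF f' p(1), of True] \<tau>_closed h by auto
    have "f' True p \<otimes> \<tau> (h p) \<otimes> inv (f True p \<otimes> \<tau> (h p)) = f' True p \<otimes> inv f True p"
      using cl by (simp add: K.inv_mult_group K.m_assoc[symmetric]) (simp add: K.m_assoc)
    then show ?thesis
      using h section_transition[OF f p(1)] section_transition[OF f' p(1)] by (simp add: d_def)
  qed (simp add: d_def)
  have "locally_constant_on A d"
    unfolding locally_constant_on_def
  proof
    fix p assume p: "p \<in> A"
    define b where "b = (h p \<in> U)"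
    have pb: "p \<in> A \<inter> h -` chart b" using ch[OF p] p by (simp add: b_def)
    obtain T where T: "open T" "A \<inter> h -` chart b = A \<inter> T" by (rule chart_preimage_open[OF A(2,3)])
    obtain T1 where T1: "open T1" "p \<in> T1" "\<forall>q\<in>A \<inter> h -` chart b. q \<in> T1 \<longrightarrow> f b q = f b p"
      using locally_constant_onD[OF section_locally_constant[OF f] pb] by blast
    obtain T2 where T2: "open T2" "p \<in> T2" "\<forall>q\<in>A \<inter> h -` chart b. q \<in> T2 \<longrightarrow> f' b q = f' b p"
      using locally_constant_onD[OF section_locally_constant[OF f'] pb] by blast
    have "d q = d p" if "q \<in> A \<inter> (T \<inter> T1 \<inter> T2)" for q
    proof -
      have q: "q \<in> A \<inter> h -` chart b" using that T(2) by auto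
      then show ?thesis using d[of q b] d[of p b] T1(3) T2(3) q that pb by auto
    qed
    moreover have "p \<in> T" using pb T(2) by auto
    ultimately show "\<exists>T. open T \<and> p \<in> T \<and> (\<forall>q\<in>A \<inter> T. d q = d p)"
      using T T1 T2 by (intro exI[of _ "T \<inter> T1 \<inter> T2"]) auto
  qed
  then have const: "d p = d q" if "p \<in> A" "q \<in> A" for p q
    using locally_constant_on_connected A(1) that by blast
  obtain p0 where p0: "p0 \<in> A" using False by blast
  have cl: "f b p \<in> carrier K" "f' b p \<in> carrier K" if "p \<in> A" "h p \<in> chart b" for b p
    using section_closed[OF f that] section_closed[OF f' that] .
  show ?thesis
  proof (rule that[of "d p0"])
    show "d p0 \<in> carrier K" using cl[OF p0 ch[OF p0]] by (simp add: d_def)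
    show "f' b p = d p0 \<otimes> f b p" if p: "p \<in> A" "h p \<in> chart b" for b p
      using const[OF p0 p(1)] d[OF p] cl[OF p] by (simp add: K.m_assoc)
  qed
qed

text \<open>Over a connected intersection the two sections agree after a left translation of one of them.\<close>

lemma section_glue:
  fixes h :: "'c::topological_space \<Rightarrow> 'a"
  assumes cl: "closed A" "closed B" and con: "connected (A \<inter> B)"
    and h: "continuous_on (A \<inter> B) h" "h ` (A \<union> B) \<subseteq> X"
    and f: "is_section A h f" and f': "is_section B h f'"
  shows "\<exists>f. is_section (A \<union> B) h f"
proof -
  have "is_section (A \<inter> B) h f" "is_section (A \<inter> B) h f'"
    using section_restrict f f' by blast+
  moreover have "h ` (A \<inter> B) \<subseteq> X" using h(2) by auto
  ultimately obtain g where g: "g \<in> carrier K" "\<And>b p. p \<in> A \<inter> B \<Longrightarrow> h p \<in> chart b \<Longrightarrow> f' b p = g \<otimes> f b p"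
    using section_unique[OF con h(1)] by metis
  note gf = section_translate[OF f g(1)]
  define F where "F = (\<lambda>b p. if p \<in> A then g \<otimes> f b p else f' b p)"
  have FA: "F b p = g \<otimes> f b p" if "p \<in> A" for b p using that by (simp add: F_def)
  have FB: "F b p = f' b p" if "p \<in> B" "h p \<in> chart b" for b p using that g(2) by (simp add: F_def)
  have "is_section (A \<union> B) h F"
    unfolding is_section_def
  proof (intro conjI allI ballI impI)
    fix b
    show "locally_constant_on ((A \<union> B) \<inter> h -` chart b) (F b)"
      unfolding locally_constant_on_def
    proof
      fix p assume p: "p \<in> (A \<union> B) \<inter> h -` chart b"
      have TA: "\<exists>T. open T \<and> p \<in> T \<and> (\<forall>q\<in>A \<inter> h -` chart b \<inter> T. F b q = F b p)"
      proof (cases "p \<in> A")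
        case True
        then have "p \<in> A \<inter> h -` chart b" using p by auto
        from section_locally_constant[OF gf, of b, unfolded locally_constant_on_def, rule_format, OF this]
        obtain T where "open T" "p \<in> T" "\<forall>q\<in>A \<inter> h -` chart b \<inter> T. g \<otimes> f b q = g \<otimes> f b p" by auto
        then show ?thesis using FA True by (intro exI[of _ T]) auto
      next
        case False
        then show ?thesis using cl(1) by (intro exI[of _ "- A"]) auto
      qed
      have TB: "\<exists>T. open T \<and> p \<in> T \<and> (\<forall>q\<in>B \<inter> h -` chart b \<inter> T. F b q = F b p)"
      proof (cases "p \<in> B")
        case True
        then have "p \<in> B \<inter> h -` chart b" using p by auto
        from section_locally_constant[OF f', of b, unfolded locally_constant_on_def, rule_format, OF this]
        obtain T where "open T" "p \<in> T" "\<forall>q\<in>B \<inter> h -` chart b \<inter> T. f' b q = f' b p" by auto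
        moreover have "F b q = F b p" if "q \<in> B \<inter> h -` chart b \<inter> T" for q
          using FB[of q b] FB[of p b] that True p calculation(3) by (metis IntE vimageE)
        ultimately show ?thesis by blast
      next
        case False
        then show ?thesis using cl(2) by (intro exI[of _ "- B"]) auto
      qed
      from TA TB obtain T T' where "open T" "p \<in> T" "\<forall>q\<in>A \<inter> h -` chart b \<inter> T. F b q = F b p"
        "open T'" "p \<in> T'" "\<forall>q\<in>B \<inter> h -` chart b \<inter> T'. F b q = F b p" by blast
      then show "\<exists>T. open T \<and> p \<in> T \<and> (\<forall>q\<in>(A \<union> B) \<inter> h -` chart b \<inter> T. F b q = F b p)"
        by (intro exI[of _ "T \<inter> T'"]) auto
    qed
    show "F b p \<in> carrier K" if "p \<in> A \<union> B" "h p \<in> chart b" for p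
      using that section_closed[OF gf, of p b] section_closed[OF f', of p b] by (auto simp: F_def)
  next
    fix p assume "p \<in> A \<union> B" "h p \<in> U \<and> h p \<in> V"
    then show "F False p = F True p \<otimes> \<tau> (h p)"
      using section_transition[OF gf, of p] section_transition[OF f', of p] by (auto simp: F_def)
  qed
  then show ?thesis by blast
qed

lemma section_in_chart:
  assumes "continuous_on A h" "h ` A \<subseteq> chart c"
  shows "\<exists>f. is_section A h f \<and> (\<forall>p\<in>A. f c p = \<one>)"
proof (cases c)
  case True
  have "is_section A h (\<lambda>b p. if b then \<one> else \<tau> (h p))"
    unfolding is_section_def
  proof (intro conjI allI ballI impI)
    fix b show "locally_constant_on (A \<inter> h -` chart b) (\<lambda>p. if b then \<one> else \<tau> (h p))"
    proof (cases b)
      case F: False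
      show ?thesis using F True assms
        by (simp, intro locally_constant_on_pullback[OF \<tau>_locally_constant assms(1)]) auto
    qed (auto simp: locally_constant_on_def)
  qed (use assms True \<tau>_closed in \<open>auto simp: chart_def split: if_splits\<close>)
  then show ?thesis using True by (intro exI[of _ "\<lambda>b p. if b then \<one> else \<tau> (h p)"]) simp
next
  case False
  have lc: "locally_constant_on (U \<inter> V) (\<lambda>z. inv \<tau> z)"
    using \<tau>_locally_constant unfolding locally_constant_on_def by metis
  have "is_section A h (\<lambda>b p. if b then inv \<tau> (h p) else \<one>)"
    unfolding is_section_def
  proof (intro conjI allI ballI impI)
    fix b show "locally_constant_on (A \<inter> h -` chart b) (\<lambda>p. if b then inv \<tau> (h p) else \<one>)"
    proof (cases b)
      case T: True
      show ?thesis using T False assms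
        by (simp, intro locally_constant_on_pullback[OF lc assms(1)]) auto
    qed (auto simp: locally_constant_on_def)
  qed (use assms False \<tau>_closed in \<open>auto simp: chart_def split: if_splits\<close>)
  then show ?thesis using False by (intro exI[of _ "\<lambda>b p. if b then inv \<tau> (h p) else \<one>"]) simp
qed

text \<open>Sections exist over rectangles that are mapped into one chart. Gluing these along vertical edges
  gives sections over thin horizontal strips, and gluing the strips along horizontal edges gives one
  over the square.\<close>

lemma section_square:
  fixes h :: "real \<times> real \<Rightarrow> 'a"
  assumes h: "continuous_on ({0..1} \<times> {0..1}) h" "h ` ({0..1} \<times> {0..1}) \<subseteq> X"
  shows "\<exists>f. is_section ({0..1} \<times> {0..1}) h f"
proof -
  let ?S = "{0..1} \<times> {0..1} :: (real \<times> real) set"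
  let ?sec = "\<lambda>A. \<exists>f. is_section A h f"
  have glue: "?sec (A \<union> B)" if "closed A" "closed B" "connected (A \<inter> B)" "A \<subseteq> ?S" "B \<subseteq> ?S" "?sec A" "?sec B" for A B
  proof -
    have "continuous_on (A \<inter> B) h" using that(4) by (blast intro: continuous_on_subset[OF h(1)])
    moreover have "h ` (A \<union> B) \<subseteq> X" using that(4,5) h(2) by blast
    ultimately show ?thesis using section_glue[OF that(1-3)] that(6,7) by blast
  qed
  have local: "\<exists>d>0. \<forall>A. A \<subseteq> ?S \<inter> cball (s, t) d \<longrightarrow> ?sec A" if st: "(s, t) \<in> ?S" for s t
  proof -
    obtain b where b: "h (s, t) \<in> chart b" using h(2) st cover unfolding chart_def by (metis UnE imageI subsetD)
    obtain T where T: "open T" "?S \<inter> h -` chart b = ?S \<inter> T" by (rule chart_preimage_open[OF h])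
    then have "(s, t) \<in> T" using b st by blast
    then obtain d where d: "d > 0" "cball (s, t) d \<subseteq> T" using T(1) open_contains_cball by blast
    have "?sec A" if "A \<subseteq> ?S \<inter> cball (s, t) d" for A
    proof -
      have "h ` A \<subseteq> chart b" using that d(2) T(2) by blast
      then show ?thesis using section_in_chart[of A h b] continuous_on_subset[OF h(1), of A] that by blast
    qed
    then show ?thesis using d(1) by blast
  qed
  have strip: "\<exists>d>0. ?sec ({0..1} \<times> ({t - d..t + d} \<inter> {0..1}))" if t: "t \<in> {0..1}" for t
  proof -
    have "0 \<le> (0::real) \<longrightarrow> (1::real) \<le> 1 \<longrightarrow> (\<exists>d>0. ?sec ({0..1} \<times> ({t - d..t + d} \<inter> {0..1})))"
    proof (rule Bolzano[of 0 1 "\<lambda>a b. 0 \<le> a \<longrightarrow> b \<le> 1 \<longrightarrow> (\<exists>d>0. ?sec ({a..b} \<times> ({t - d..t + d} \<inter> {0..1})))"])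
      fix a b c :: real
      assume ab: "0 \<le> a \<longrightarrow> b \<le> 1 \<longrightarrow> (\<exists>d>0. ?sec ({a..b} \<times> ({t - d..t + d} \<inter> {0..1})))"
        and bc: "0 \<le> b \<longrightarrow> c \<le> 1 \<longrightarrow> (\<exists>d>0. ?sec ({b..c} \<times> ({t - d..t + d} \<inter> {0..1})))"
        and le: "a \<le> b" "b \<le> c"
      show "0 \<le> a \<longrightarrow> c \<le> 1 \<longrightarrow> (\<exists>d>0. ?sec ({a..c} \<times> ({t - d..t + d} \<inter> {0..1})))"
      proof (intro impI)
        assume "0 \<le> a" "c \<le> 1"
        then obtain d1 d2 where d1: "d1 > 0" "?sec ({a..b} \<times> ({t - d1..t + d1} \<inter> {0..1}))"
          and d2: "d2 > 0" "?sec ({b..c} \<times> ({t - d2..t + d2} \<inter> {0..1}))" using ab bc le by force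
        define d where "d = min d1 d2"
        let ?I = "{t - d..t + d} \<inter> {0..1}"
        have I: "?I = {max (t - d) 0..min (t + d) 1}" by auto
        have "{a..b} \<times> ?I \<subseteq> {a..b} \<times> ({t - d1..t + d1} \<inter> {0..1})" by (auto simp: d_def)
        then have s1: "?sec ({a..b} \<times> ?I)" using d1(2) section_restrict by meson
        have "{b..c} \<times> ?I \<subseteq> {b..c} \<times> ({t - d2..t + d2} \<inter> {0..1})" by (auto simp: d_def)
        then have s2: "?sec ({b..c} \<times> ?I)" using d2(2) section_restrict by meson
        have int: "{a..b} \<times> ?I \<inter> {b..c} \<times> ?I = {b} \<times> ?I" using le by auto
        have con: "connected ({b} \<times> ?I)" unfolding I by (intro connected_Times) auto
        have "?sec ({a..b} \<times> ?I \<union> {b..c} \<times> ?I)"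
        proof (intro glue)
          show "closed ({a..b} \<times> ?I)" "closed ({b..c} \<times> ?I)" unfolding I by (intro closed_Times closed_atLeastAtMost)+
          show "connected ({a..b} \<times> ?I \<inter> {b..c} \<times> ?I)" using con unfolding int .
          show "{a..b} \<times> ?I \<subseteq> ?S" "{b..c} \<times> ?I \<subseteq> ?S" using le \<open>0 \<le> a\<close> \<open>c \<le> 1\<close> by auto
        qed (fact s1 s2)+
        moreover have "{a..b} \<times> ?I \<union> {b..c} \<times> ?I = {a..c} \<times> ?I" using le by auto
        ultimately show "\<exists>d>0. ?sec ({a..c} \<times> ({t - d..t + d} \<inter> {0..1}))"
          using d1(1) d2(1) by (intro exI[of _ d]) (simp add: d_def)
      qed
    next
      fix s :: real assume s: "0 \<le> s" "s \<le> 1"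
      obtain d where d: "d > 0" "\<And>A. A \<subseteq> ?S \<inter> cball (s, t) d \<Longrightarrow> ?sec A" using local[of s t] s t by auto
      have "?sec ({a..b} \<times> ({t - d / 2..t + d / 2} \<inter> {0..1}))"
        if ab: "a \<le> s" "s \<le> b" "b - a < d / 2" "0 \<le> a" "b \<le> 1" for a b
      proof (rule d(2), rule subsetI)
        fix z assume "z \<in> {a..b} \<times> ({t - d / 2..t + d / 2} \<inter> {0..1})"
        then obtain z1 z2 where z: "z = (z1, z2)" "z1 \<in> {a..b}" "z2 \<in> {t - d / 2..t + d / 2}" "z2 \<in> {0..1}" by auto
        have "dist (s, t) (z1, z2) \<le> \<bar>s - z1\<bar> + \<bar>t - z2\<bar>"
          unfolding dist_prod_def fst_conv snd_conv dist_real_def using sqrt_sum_squares_le_sum_abs by simp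
        also have "\<bar>s - z1\<bar> \<le> b - a" using z ab by (simp add: abs_le_iff)
        also have "b - a \<le> d / 2" using ab by simp
        also have "\<bar>t - z2\<bar> \<le> d / 2" using z by (simp only: abs_le_iff) auto
        also have "d / 2 + d / 2 = d" by simp
        finally show "z \<in> ?S \<inter> cball (s, t) d" using z ab by auto
      qed
      then show "\<exists>e>0. \<forall>a b. a \<le> s \<and> s \<le> b \<and> b - a < e \<longrightarrow>
          (0 \<le> a \<longrightarrow> b \<le> 1 \<longrightarrow> (\<exists>d>0. ?sec ({a..b} \<times> ({t - d..t + d} \<inter> {0..1}))))"
        using d(1) by (intro exI[of _ "d / 2"]) (auto intro!: exI[of _ "d / 2"])
    qed simp
    then show ?thesis by simp
  qed
  have "0 \<le> (0::real) \<longrightarrow> (1::real) \<le> 1 \<longrightarrow> ?sec ({0..1} \<times> {0..1})"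
  proof (rule Bolzano[of 0 1 "\<lambda>a b. 0 \<le> a \<longrightarrow> b \<le> 1 \<longrightarrow> ?sec ({0..1} \<times> {a..b})"])
    fix a b c :: real
    assume ab: "0 \<le> a \<longrightarrow> b \<le> 1 \<longrightarrow> ?sec ({0..1} \<times> {a..b})" and bc: "0 \<le> b \<longrightarrow> c \<le> 1 \<longrightarrow> ?sec ({0..1} \<times> {b..c})"
      and le: "a \<le> b" "b \<le> c"
    show "0 \<le> a \<longrightarrow> c \<le> 1 \<longrightarrow> ?sec ({0..1} \<times> {a..c})"
    proof (intro impI)
      assume "0 \<le> a" "c \<le> 1"
      have int: "{0..1::real} \<times> {a..b} \<inter> {0..1} \<times> {b..c} = {0..1} \<times> {b}" using le by auto
      have "connected ({0..1::real} \<times> {b})" by (intro connected_Times) auto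
      note con = this
      have "?sec ({0..1} \<times> {a..b} \<union> {0..1} \<times> {b..c})"
      proof (intro glue)
        show "closed ({0..1::real} \<times> {a..b})" "closed ({0..1::real} \<times> {b..c})" by (intro closed_Times closed_atLeastAtMost)+
        show "connected ({0..1::real} \<times> {a..b} \<inter> {0..1} \<times> {b..c})" using con unfolding int .
        show "{0..1} \<times> {a..b} \<subseteq> ?S" "{0..1} \<times> {b..c} \<subseteq> ?S" using le \<open>0 \<le> a\<close> \<open>c \<le> 1\<close> by auto
        show "?sec ({0..1} \<times> {a..b})" "?sec ({0..1} \<times> {b..c})" using ab bc le \<open>0 \<le> a\<close> \<open>c \<le> 1\<close> by auto
      qed
      moreover have "{0..1::real} \<times> {a..b} \<union> {0..1} \<times> {b..c} = {0..1} \<times> {a..c}" using le by auto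
      ultimately show "?sec ({0..1} \<times> {a..c})" by simp
    qed
  next
    fix t :: real assume t: "0 \<le> t" "t \<le> 1"
    then obtain d where d: "d > 0" "?sec ({0..1} \<times> ({t - d..t + d} \<inter> {0..1}))" using strip[of t] by auto
    have "?sec ({0..1} \<times> {a..b})" if "a \<le> t" "t \<le> b" "b - a < d" "0 \<le> a" "b \<le> 1" for a b
    proof -
      have "{0..1} \<times> {a..b} \<subseteq> {0..1} \<times> ({t - d..t + d} \<inter> {0..1})" using that by auto
      then show ?thesis using d(2) section_restrict by blast
    qed
    then show "\<exists>d>0. \<forall>a b. a \<le> t \<and> t \<le> b \<and> b - a < d \<longrightarrow> (0 \<le> a \<longrightarrow> b \<le> 1 \<longrightarrow> ?sec ({0..1} \<times> {a..b}))"
      using d(1) by blast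
  qed simp
  then show ?thesis by simp
qed

subsection \<open>Monodromy\<close>

lemma section_path:
  assumes "path p" "path_image p \<subseteq> X"
  shows "\<exists>f. is_section {0..1} p f"
proof -
  have "continuous_on ({0..1} \<times> {0..1}) (\<lambda>z::real \<times> real. p (fst z))"
    using assms(1) unfolding path_def
    by (rule continuous_on_compose2[OF _ continuous_on_fst[OF continuous_on_id]]) force
  moreover have "(\<lambda>z::real \<times> real. p (fst z)) ` ({0..1} \<times> {0..1}) \<subseteq> X"
    using assms(2) unfolding path_image_def by force
  ultimately obtain f where f: "is_section ({0..1} \<times> {0..1}) (\<lambda>z::real \<times> real. p (fst z)) f"
    using section_square by blast
  have "is_section {0..1} p (\<lambda>b s. f b (s, 0))"
    by (rule section_pullback[OF f]) (auto intro!: continuous_intros)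
  then show ?thesis by blast
qed

text \<open>The flags select the charts in which the values at the two ends of the path are read off.\<close>

definition has_monodromy :: "(real \<Rightarrow> 'a) \<Rightarrow> bool \<Rightarrow> bool \<Rightarrow> 'g \<Rightarrow> bool" where
  "has_monodromy p b c g \<longleftrightarrow> path p \<and> path_image p \<subseteq> X \<and> pathstart p \<in> chart b \<and> pathfinish p \<in> chart c \<and>
     (\<exists>f. is_section {0..1} p f \<and> g = inv f b 0 \<otimes> f c 1)"

lemma has_monodromy_section:
  assumes "has_monodromy p b c g" "is_section {0..1} p f"
  shows "g = inv f b 0 \<otimes> f c 1"
proof -
  obtain f' where f': "is_section {0..1} p f'" "g = inv f' b 0 \<otimes> f' c 1"
    and p: "path p" "path_image p \<subseteq> X" "p 0 \<in> chart b" "p 1 \<in> chart c"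
    using assms(1) by (auto simp: has_monodromy_def pathstart_def pathfinish_def)
  obtain k where k: "k \<in> carrier K" "\<And>b t. t \<in> {0..1} \<Longrightarrow> p t \<in> chart b \<Longrightarrow> f' b t = k \<otimes> f b t"
    using section_unique[of "{0..1}" p f f'] assms(2) f'(1) p by (auto simp: path_def path_image_def)
  have cl: "f b 0 \<in> carrier K" "f c 1 \<in> carrier K"
    using section_closed[OF assms(2)] p by auto
  show ?thesis unfolding f'(2) using k(2)[of 0 b] k(2)[of 1 c] p cl k(1)
    by (simp add: K.inv_mult_group K.m_assoc[symmetric]) (simp add: K.m_assoc)
qed

lemma has_monodromy_exists:
  assumes "path p" "path_image p \<subseteq> X" "pathstart p \<in> chart b" "pathfinish p \<in> chart c"
  shows "\<exists>g. has_monodromy p b c g"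
  using section_path[OF assms(1,2)] assms by (auto simp: has_monodromy_def)

lemma has_monodromy_closed: "has_monodromy p b c g \<Longrightarrow> g \<in> carrier K"
  using section_closed[of "{0..1}" p] by (auto simp: has_monodromy_def pathstart_def pathfinish_def)

lemma has_monodromy_join:
  assumes p: "has_monodromy p b c g" and q: "has_monodromy q c d g'" and pq: "pathfinish p = pathstart q"
  shows "has_monodromy (p +++ q) b d (g \<otimes> g')"
proof -
  have J: "path (p +++ q)" "path_image (p +++ q) \<subseteq> X"
    using p q pq by (auto simp: has_monodromy_def path_image_join)
  obtain f where f: "is_section {0..1} (p +++ q) f" using section_path[OF J] by blast
  have "is_section {0..1} p (\<lambda>b t. f b (t / 2))"
    by (rule section_pullback[OF f]) (auto intro!: continuous_intros simp: joinpaths_def)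
  from has_monodromy_section[OF p this] have g: "g = inv f b 0 \<otimes> f c (1 / 2)" by simp
  have "is_section {0..1} q (\<lambda>b t. f b ((t + 1) / 2))"
    by (rule section_pullback[OF f])
       (use pq in \<open>auto intro!: continuous_intros simp: joinpaths_def pathfinish_def pathstart_def field_simps\<close>)
  from has_monodromy_section[OF q this] have g': "g' = inv f c (1 / 2) \<otimes> f d 1" by simp
  have cl: "f b 0 \<in> carrier K" "f c (1 / 2) \<in> carrier K" "f d 1 \<in> carrier K"
    using p q section_closed[OF f, of 0 b] section_closed[OF f, of "1/2" c] section_closed[OF f, of 1 d]
    by (auto simp: has_monodromy_def joinpaths_def pathfinish_def pathstart_def)
  have "g \<otimes> g' = inv f b 0 \<otimes> f d 1"
    unfolding g g' using cl by (simp add: K.m_assoc[symmetric]) (simp add: K.m_assoc)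
  then show ?thesis using J f p q unfolding has_monodromy_def by auto
qed

lemma has_monodromy_reversepath:
  assumes p: "has_monodromy p b c g"
  shows "has_monodromy (reversepath p) c b (inv g)"
proof -
  obtain f where f: "is_section {0..1} p f" "g = inv f b 0 \<otimes> f c 1" using p by (auto simp: has_monodromy_def)
  have s: "is_section {0..1} (reversepath p) (\<lambda>b t. f b (1 - t))"
    by (rule section_pullback[OF f(1)]) (auto intro!: continuous_intros simp: reversepath_def)
  have cl: "f b 0 \<in> carrier K" "f c 1 \<in> carrier K"
    using p section_closed[OF f(1)] by (auto simp: has_monodromy_def pathfinish_def pathstart_def)
  have "inv g = inv f c (1 - 0) \<otimes> f b (1 - 1)" using cl by (simp add: f(2) K.inv_mult_group)
  then show ?thesis using s p unfolding has_monodromy_def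
    by (intro conjI exI[of _ "\<lambda>b t. f b (1 - t)"]) auto
qed

lemma has_monodromy_in_chart:
  assumes "path p" "path_image p \<subseteq> chart b"
  shows "has_monodromy p b b \<one>"
proof -
  obtain f where f: "is_section {0..1} p f" "\<forall>t\<in>{0..1}. f b t = \<one>"
    using section_in_chart[of "{0..1}" p b] assms by (auto simp: path_def path_image_def)
  have "chart b \<subseteq> X" using cover by (auto simp: chart_def)
  then show ?thesis unfolding has_monodromy_def
    using f assms by (auto intro!: exI[of _ f])
qed

lemma has_monodromy_to_V:
  assumes "has_monodromy p b True g" "pathfinish p \<in> V"
  shows "has_monodromy p b False (g \<otimes> \<tau> (pathfinish p))"
proof -
  obtain f where f: "is_section {0..1} p f" "g = inv f b 0 \<otimes> f True 1" using assms by (auto simp: has_monodromy_def)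
  have p: "p 0 \<in> chart b" "p 1 \<in> U" "p 1 \<in> V"
    using assms by (auto simp: has_monodromy_def pathfinish_def pathstart_def)
  have cl: "f b 0 \<in> carrier K" "f True 1 \<in> carrier K" "\<tau> (p 1) \<in> carrier K"
    using p section_closed[OF f(1), of 0 b] section_closed[OF f(1), of 1 True] \<tau>_closed by auto
  have "f False 1 = f True 1 \<otimes> \<tau> (p 1)" using section_transition[OF f(1), of 1] p by simp
  then have "g \<otimes> \<tau> (pathfinish p) = inv f b 0 \<otimes> f False 1"
    using cl by (simp add: f(2) pathfinish_def K.m_assoc)
  then show ?thesis using assms f unfolding has_monodromy_def by auto
qed

text \<open>Along the two sides of the square that the homotopy contracts to the end points, a section is
  constant, so it takes the same values at the ends of both paths.\<close>

lemma has_monodromy_homotopic: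
  assumes p: "has_monodromy p b c g" and hom: "homotopic_paths X p q"
  shows "has_monodromy q b c g"
proof -
  obtain h :: "real \<times> real \<Rightarrow> 'a" where h0: "continuous_on ({0..1} \<times> {0..1}) h" "h \<in> {0..1} \<times> {0..1} \<rightarrow> X"
    "\<forall>t\<in>{0..1}. h (0, t) = p t" "\<forall>t\<in>{0..1}. h (1, t) = q t"
    "\<forall>s\<in>{0..1}. h (s, 0) = p 0 \<and> h (s, 1) = p 1"
    using hom unfolding homotopic_paths pathfinish_def pathstart_def comp_def
    by (elim exE conjE) (rule that, assumption+)
  have h: "continuous_on ({0..1} \<times> {0..1}) h" "h ` ({0..1} \<times> {0..1}) \<subseteq> X"
    "\<And>t. t \<in> {0..1} \<Longrightarrow> h (0, t) = p t" "\<And>t. t \<in> {0..1} \<Longrightarrow> h (1, t) = q t"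
    "\<And>s. s \<in> {0..1} \<Longrightarrow> h (s, 0) = p 0" "\<And>s. s \<in> {0..1} \<Longrightarrow> h (s, 1) = p 1"
    using h0 by blast+
  obtain f where f: "is_section ({0..1} \<times> {0..1}) h f" using section_square[OF h(1,2)] by blast
  have sp: "is_section {0..1} p (\<lambda>b t. f b (0, t))" and sq: "is_section {0..1} q (\<lambda>b t. f b (1, t))"
    by (rule section_pullback[OF f]; use h in \<open>auto intro!: continuous_intros\<close>)+
  have ends: "p 0 \<in> chart b" "p 1 \<in> chart c" using p by (auto simp: has_monodromy_def pathfinish_def pathstart_def)
  have const: "f a (0, e) = f a (1, e)" if e: "e \<in> {0, 1}" and pe: "p e \<in> chart a" for a e
  proof -
    have *: "is_section {0..1} (\<lambda>s. p e) (\<lambda>b s. f b (s, e))"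
      by (rule section_pullback[OF f]; use h e in \<open>auto intro!: continuous_intros\<close>)
    show ?thesis
      using locally_constant_on_connected[OF section_locally_constant[OF *, of a], of 0 1] pe by simp
  qed
  have "g = inv f b (0, 0) \<otimes> f c (0, 1)" using has_monodromy_section[OF p sp] .
  also have "\<dots> = inv f b (1, 0) \<otimes> f c (1, 1)" using const[of 0 b] const[of 1 c] ends by simp
  finally show ?thesis
    using p sq homotopic_paths_imp_path[OF hom] homotopic_paths_imp_subset[OF hom]
      homotopic_paths_imp_pathstart[OF hom] homotopic_paths_imp_pathfinish[OF hom]
    unfolding has_monodromy_def by auto
qed

definition monodromy :: "(real \<Rightarrow> 'a) set \<Rightarrow> 'g" where
  "monodromy C = (THE g. \<exists>p\<in>C. has_monodromy p True True g)"

lemma has_monodromy_unique: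
  "has_monodromy p b c g \<Longrightarrow> has_monodromy p b c g' \<Longrightarrow> g = g'"
  using has_monodromy_section unfolding has_monodromy_def by metis

lemma monodromy_path_class:
  assumes "has_monodromy p True True g"
  shows "monodromy (path_class X p) = g"
  unfolding monodromy_def
proof (rule the_equality)
  have "p \<in> path_class X p" using assms by (simp add: has_monodromy_def path_class_def)
  then show "\<exists>q\<in>path_class X p. has_monodromy q True True g"
    using assms by blast
  show "g' = g" if "\<exists>q\<in>path_class X p. has_monodromy q True True g'" for g'
    using that has_monodromy_homotopic[OF assms] has_monodromy_unique unfolding path_class_def by blast
qed

lemma monodromy_hom:
  assumes "x \<in> U"
  shows "monodromy \<in> hom (fundamental_group X x) K"
proof (rule homI)
  have ex: "\<exists>g. has_monodromy p True True g" if "p \<in> based_loops X x" for p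
    using that assms has_monodromy_exists[of p True True] by (auto simp: based_loops_def)
  show "monodromy C \<in> carrier K" if "C \<in> carrier (fundamental_group X x)" for C
    using that ex monodromy_path_class has_monodromy_closed by (fastforce simp: carrier_fundamental_group)
  fix C D assume "C \<in> carrier (fundamental_group X x)" "D \<in> carrier (fundamental_group X x)"
  then obtain p q where pq: "p \<in> based_loops X x" "C = path_class X p" "q \<in> based_loops X x" "D = path_class X q"
    by (auto simp: carrier_fundamental_group)
  obtain g g' where g: "has_monodromy p True True g" "has_monodromy q True True g'" using ex pq by blast
  have "has_monodromy (p +++ q) True True (g \<otimes> g')"
    by (rule has_monodromy_join[OF g]) (use pq in \<open>auto simp: based_loops_def\<close>)
  then show "monodromy (C \<otimes>\<^bsub>fundamental_group X x\<^esub> D) = monodromy C \<otimes> monodromy D"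
    using pq g by (simp add: fundamental_group_mult monodromy_path_class)
qed

end

subsection \<open>Generators\<close>

lemma homotopic_paths_cancel:
  fixes p :: "real \<Rightarrow> 'a::real_normed_vector"
  assumes p: "path p" "path_image p \<subseteq> X" and g: "path g" "path_image g \<subseteq> X" and q: "path q" "path_image q \<subseteq> X"
    and ends: "pathfinish p = pathstart g" "pathstart q = pathstart g"
  shows "homotopic_paths X ((p +++ g) +++ (reversepath g +++ q)) (p +++ q)"
proof -
  have 1: "homotopic_paths X (p +++ (g +++ (reversepath g +++ q))) ((p +++ g) +++ (reversepath g +++ q))"
    using assms by (intro homotopic_paths_assoc) (auto simp: path_image_join)
  have 2: "homotopic_paths X (g +++ (reversepath g +++ q)) ((g +++ reversepath g) +++ q)"
    using assms by (intro homotopic_paths_assoc) (auto simp: path_image_join)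
  have "homotopic_paths X (g +++ reversepath g) (linepath (pathstart g) (pathstart g))"
    using g by (rule homotopic_paths_rinv)
  then have "homotopic_paths X ((g +++ reversepath g) +++ q) (linepath (pathstart g) (pathstart g) +++ q)"
    using q ends by (intro homotopic_paths_join) auto
  moreover have "homotopic_paths X (linepath (pathstart g) (pathstart g) +++ q) q"
    using homotopic_paths_lid[of q X] q ends by simp
  ultimately have "homotopic_paths X (g +++ (reversepath g +++ q)) q"
    using 2 by (meson homotopic_paths_trans)
  then have "homotopic_paths X (p +++ (g +++ (reversepath g +++ q))) (p +++ q)"
    using p ends by (intro homotopic_paths_join) auto
  then show ?thesis using 1 by (meson homotopic_paths_sym homotopic_paths_trans)
qed

definition path_from_to :: "'a::real_normed_vector set \<Rightarrow> 'a \<Rightarrow> 'a \<Rightarrow> (real \<Rightarrow> 'a) \<Rightarrow> bool" where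
  "path_from_to S x z p \<longleftrightarrow> path p \<and> path_image p \<subseteq> S \<and> pathstart p = x \<and> pathfinish p = z"

lemma path_from_to_join:
  "path_from_to S x y p \<Longrightarrow> path_from_to S y z q \<Longrightarrow> path_from_to S x z (p +++ q)"
  by (simp add: path_from_to_def path_image_join)

lemma path_from_to_reverse: "path_from_to S x y p \<Longrightarrow> path_from_to S y x (reversepath p)"
  by (simp add: path_from_to_def)

lemma path_from_to_mono: "path_from_to S x y p \<Longrightarrow> S \<subseteq> T \<Longrightarrow> path_from_to T x y p"
  by (auto simp: path_from_to_def)

lemma based_loops_path_from_to: "p \<in> based_loops S x \<longleftrightarrow> path_from_to S x x p"
  by (simp add: based_loops_def path_from_to_def)

lemma simply_connected_homotopic:
  assumes "simply_connected S" "path_from_to S x y p" "path_from_to S x y q"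
  shows "homotopic_paths S p q"
  using assms unfolding simply_connected_eq_homotopic_paths path_from_to_def by metis

text \<open>Two simply connected charts, the components \<open>L k\<close> of their intersection with base points \<open>y k\<close>, and
  paths through them from the base point \<open>x\<close> of \<open>U\<close> to the base point \<open>a\<close> of \<open>V\<close>.\<close>

locale two_chart_union =
  fixes X U V :: "'a::real_normed_vector set" and n :: nat and L :: "nat \<Rightarrow> 'a set"
    and x a :: 'a and y :: "nat \<Rightarrow> 'a" and u v :: "nat \<Rightarrow> real \<Rightarrow> 'a"
  assumes cover: "X = U \<union> V"
    and open_U: "openin (top_of_set X) U" and open_V: "openin (top_of_set X) V"
    and sc: "simply_connected U" "simply_connected V"
    and n0: "0 < n"
    and int: "U \<inter> V = (\<Union>k<n. L k)"
    and L_disjoint: "\<And>j k. j < n \<Longrightarrow> k < n \<Longrightarrow> j \<noteq> k \<Longrightarrow> L j \<inter> L k = {}"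
    and L_open: "\<And>k. k < n \<Longrightarrow> openin (top_of_set X) (L k)"
    and L_connected: "\<And>k. k < n \<Longrightarrow> path_connected (L k)"
    and x: "x \<in> U"
    and y: "\<And>k. k < n \<Longrightarrow> y k \<in> L k"
    and u: "\<And>k. k < n \<Longrightarrow> path_from_to U x (y k) (u k)"
    and v: "\<And>k. k < n \<Longrightarrow> path_from_to V (y k) a (v k)"
begin

abbreviation "G \<equiv> fundamental_group X x"

lemma subsets: "U \<subseteq> X" "V \<subseteq> X" using cover by auto

lemma group_G: "group G"
  using x subsets by (intro group_fundamental_group) auto

sublocale G: group G by (rule group_G)

definition m :: "nat \<Rightarrow> real \<Rightarrow> 'a" where
  "m k = u k +++ v k"

definition loop :: "nat \<Rightarrow> real \<Rightarrow> 'a" where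
  "loop k = m k +++ reversepath (m (Suc k mod n))"

definition c :: "nat \<Rightarrow> (real \<Rightarrow> 'a) set" where
  "c k = path_class X (loop k)"

lemma m: "k < n \<Longrightarrow> path_from_to X x a (m k)"
  unfolding m_def using u v subsets path_from_to_mono path_from_to_join by metis

lemma loop: "k < n \<Longrightarrow> loop k \<in> based_loops X x"
  unfolding loop_def based_loops_path_from_to using m n0
  by (intro path_from_to_join[of _ _ a] path_from_to_reverse) auto

lemma c_closed: "k < n \<Longrightarrow> c k \<in> carrier G"
  using loop by (simp add: c_def carrier_fundamental_group)

definition H :: "(real \<Rightarrow> 'a) set set" where
  "H = generate G (c ` {..<n})"

lemma subgroup_H: "subgroup H G"
  unfolding H_def using c_closed by (intro G.generate_is_subgroup) auto

text \<open>Two paths from the base point to the same point are equivalent if the loop they bound lies in the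
  subgroup generated by the \<open>c k\<close>. Generation means that all of them are equivalent.\<close>

definition rel :: "(real \<Rightarrow> 'a) \<Rightarrow> (real \<Rightarrow> 'a) \<Rightarrow> bool" where
  "rel p q \<longleftrightarrow> path_class X (p +++ reversepath q) \<in> H"

lemma rel_homotopic:
  assumes "path_from_to X x z p" "homotopic_paths X p q"
  shows "rel p q"
proof -
  have "homotopic_paths X (p +++ reversepath p) (p +++ reversepath q)"
    using assms by (intro homotopic_paths_join) (auto simp: path_from_to_def homotopic_paths_reversepath)
  moreover have "homotopic_paths X (p +++ reversepath p) (linepath x x)"
    using assms homotopic_paths_rinv[of p X] by (simp add: path_from_to_def)
  ultimately have "path_class X (p +++ reversepath q) = \<one>\<^bsub>G\<^esub>"
    unfolding one_fundamental_group by (meson path_class_eqI homotopic_paths_sym homotopic_paths_trans)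
  then show ?thesis using subgroup.one_closed[OF subgroup_H] by (simp add: rel_def)
qed

lemma rel_loop: "path_from_to X x z p \<Longrightarrow> path_from_to X x z q \<Longrightarrow> p +++ reversepath q \<in> based_loops X x"
  unfolding based_loops_path_from_to by (intro path_from_to_join path_from_to_reverse)

lemma rel_sym:
  assumes "path_from_to X x z p" "path_from_to X x z q" "rel p q"
  shows "rel q p"
proof -
  have "inv\<^bsub>G\<^esub> path_class X (p +++ reversepath q) = path_class X (q +++ reversepath p)"
    using assms by (simp add: inv_path_class[OF rel_loop] reversepath_joinpaths path_from_to_def)
  then show ?thesis using assms(3) subgroup.m_inv_closed[OF subgroup_H] by (metis rel_def)
qed

lemma rel_trans:
  assumes p: "path_from_to X x z p" and q: "path_from_to X x z q" and r: "path_from_to X x z r"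
    and "rel p q" "rel q r"
  shows "rel p r"
proof -
  have "path_class X (p +++ reversepath q) \<otimes>\<^bsub>G\<^esub> path_class X (q +++ reversepath r)
     = path_class X ((p +++ reversepath q) +++ (q +++ reversepath r))"
    by (rule fundamental_group_mult) (use p q r rel_loop in blast)+
  also have "\<dots> = path_class X (p +++ reversepath r)"
    using homotopic_paths_cancel[of p X "reversepath q" "reversepath r"] p q r
    by (intro path_class_eqI) (auto simp: path_from_to_def)
  finally show ?thesis using assms(4,5) subgroup.m_closed[OF subgroup_H] unfolding rel_def by metis
qed

lemma rel_join:
  assumes p: "path_from_to X x z p" and q: "path_from_to X x z q" and g: "path_from_to X z w g" and "rel p q"
  shows "rel (p +++ g) (q +++ g)"
proof -
  have "homotopic_paths X ((p +++ g) +++ (reversepath g +++ reversepath q)) (p +++ reversepath q)"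
    using p q g by (intro homotopic_paths_cancel) (auto simp: path_from_to_def)
  then have "path_class X ((p +++ g) +++ reversepath (q +++ g)) = path_class X (p +++ reversepath q)"
    using q g by (intro path_class_eqI) (simp add: reversepath_joinpaths path_from_to_def)
  then show ?thesis using assms(4) by (simp add: rel_def)
qed

lemma rel_m:
  assumes "k < n"
  shows "rel (m 0) (m k)"
  using assms
proof (induction k)
  case 0
  then show ?case using rel_homotopic[OF m[OF n0], of "m 0"] m[OF n0] by (simp add: path_from_to_def)
next
  case (Suc k)
  have "c k \<in> H" unfolding H_def using Suc.prems by (intro generate.incl) auto
  then have 1: "rel (m k) (m (Suc k))" using Suc.prems by (simp add: c_def loop_def rel_def)
  have k: "k < n" using Suc.prems by simp
  show ?case by (rule rel_trans[OF m[OF n0] m[OF k] m[OF Suc.prems] Suc.IH[OF k] 1])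
qed

text \<open>Standard paths from \<open>x\<close> to a point \<open>z\<close>: inside \<open>U\<close>, or through \<open>L 0\<close> into \<open>V\<close> and then inside \<open>V\<close>.\<close>

definition adm :: "'a \<Rightarrow> (real \<Rightarrow> 'a) \<Rightarrow> bool" where
  "adm z p \<longleftrightarrow> path_from_to U x z p \<or> (\<exists>w. path_from_to V a z w \<and> p = m 0 +++ w)"

lemma adm_path: "adm z p \<Longrightarrow> path_from_to X x z p"
  unfolding adm_def using m[OF n0] subsets path_from_to_mono path_from_to_join by metis

text \<open>Over the \<open>k\<close>-th component the two kinds of standard paths differ by the loop along \<open>m 0\<close> and back
  along \<open>m k\<close>.\<close>

lemma adm_U_V:
  assumes p: "path_from_to U x z p" and w: "path_from_to V a z w"
  shows "rel p (m 0 +++ w)"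
proof -
  have "z \<in> U \<inter> V" using p w by (auto simp: path_from_to_def)
  then obtain k where k: "k < n" "z \<in> L k" using int by auto
  have LU: "L k \<subseteq> U" "L k \<subseteq> V" using int k by auto
  obtain e where e: "path_from_to (L k) (y k) z e"
    using L_connected[OF k(1)] y[OF k(1)] k(2) unfolding path_connected_def path_from_to_def by blast
  note eU = path_from_to_mono[OF e LU(1)] and eV = path_from_to_mono[OF e LU(2)]
  have uX: "path_from_to X x (y k) (u k)" and vX: "path_from_to X (y k) a (v k)" and eX: "path_from_to X (y k) z e"
    and wX: "path_from_to X a z w" and pX: "path_from_to X x z p"
    using u[OF k(1)] v[OF k(1)] eU w p subsets path_from_to_mono by blast+
  have 1: "homotopic_paths X p (u k +++ e)"
    using simply_connected_homotopic[OF sc(1) p path_from_to_join[OF u[OF k(1)] eU]] subsets(1) homotopic_paths_subset by blast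
  have 2: "homotopic_paths X w (reversepath (v k) +++ e)"
    using simply_connected_homotopic[OF sc(2) w path_from_to_join[OF path_from_to_reverse[OF v[OF k(1)]] eV]] subsets(2)
      homotopic_paths_subset by blast
  have "homotopic_paths X (m k +++ w) (m k +++ (reversepath (v k) +++ e))"
    using 2 m[OF k(1)] wX by (intro homotopic_paths_join) (auto simp: path_from_to_def)
  moreover have "homotopic_paths X (m k +++ (reversepath (v k) +++ e)) (u k +++ e)"
    unfolding m_def using uX vX eX by (intro homotopic_paths_cancel) (auto simp: path_from_to_def)
  ultimately have "homotopic_paths X p (m k +++ w)"
    using 1 by (meson homotopic_paths_sym homotopic_paths_trans)
  then have "rel p (m k +++ w)" by (rule rel_homotopic[OF pX])
  moreover have "rel (m k +++ w) (m 0 +++ w)"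
    by (rule rel_join[OF m[OF k(1)] m[OF n0] wX]) (rule rel_sym[OF m[OF n0] m[OF k(1)] rel_m[OF k(1)]])
  ultimately show ?thesis
    using rel_trans[OF pX path_from_to_join[OF m[OF k(1)] wX] path_from_to_join[OF m[OF n0] wX]] by blast
qed

lemma adm_rel:
  assumes p: "adm z p" and q: "adm z q"
  shows "rel p q"
proof -
  note pX = adm_path[OF p] and qX = adm_path[OF q]
  consider "path_from_to U x z p" "path_from_to U x z q"
    | w where "path_from_to U x z p" "path_from_to V a z w" "q = m 0 +++ w"
    | w where "path_from_to U x z q" "path_from_to V a z w" "p = m 0 +++ w"
    | w w' where "path_from_to V a z w" "p = m 0 +++ w" "path_from_to V a z w'" "q = m 0 +++ w'"
    using p q unfolding adm_def by blast
  then show ?thesis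
  proof cases
    case 1
    then show ?thesis
      using rel_homotopic[OF pX] simply_connected_homotopic[OF sc(1)] subsets(1) homotopic_paths_subset by blast
  next
    case 2
    then show ?thesis using adm_U_V by blast
  next
    case 3
    then show ?thesis using adm_U_V rel_sym[OF qX pX] by blast
  next
    case 4
    have "homotopic_paths X w w'"
      using simply_connected_homotopic[OF sc(2) 4(1,3)] subsets(2) homotopic_paths_subset by blast
    then have "homotopic_paths X p q"
      unfolding 4(2,4) using m[OF n0] 4(1) by (intro homotopic_paths_join) (auto simp: path_from_to_def)
    then show ?thesis by (rule rel_homotopic[OF pX])
  qed
qed

lemma adm_exists: "z \<in> U \<Longrightarrow> \<exists>p. path_from_to U x z p" "z \<in> V \<Longrightarrow> \<exists>w. path_from_to V a z w"
proof -
  show "z \<in> U \<Longrightarrow> \<exists>p. path_from_to U x z p"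
    using simply_connected_imp_path_connected[OF sc(1)] x unfolding path_connected_def path_from_to_def by blast
  have "a \<in> V" using v[OF n0] by (auto simp: path_from_to_def)
  then show "z \<in> V \<Longrightarrow> \<exists>w. path_from_to V a z w"
    using simply_connected_imp_path_connected[OF sc(2)] unfolding path_connected_def path_from_to_def by blast
qed

lemma adm_extend_in_chart:
  assumes p: "adm z p" and g: "path_from_to U z w g \<or> path_from_to V z w g" and q: "adm w q"
  shows "rel (p +++ g) q"
proof -
  obtain p' where p': "adm z p'" "rel (p' +++ g) q"
  proof (cases "path_from_to U z w g")
    case True
    then have "z \<in> U" by (auto simp: path_from_to_def)
    then obtain p' where p': "path_from_to U x z p'" using adm_exists(1) by blast
    then have "adm w (p' +++ g)" using True path_from_to_join unfolding adm_def by blast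
    then show ?thesis using that[of p'] adm_rel[OF _ q] p' unfolding adm_def by blast
  next
    case False
    then have gV: "path_from_to V z w g" using g by blast
    then have "z \<in> V" by (auto simp: path_from_to_def)
    then obtain e where e: "path_from_to V a z e" using adm_exists(2) by blast
    have eg: "path_from_to V a w (e +++ g)" using path_from_to_join[OF e gV] .
    have eX: "path_from_to X a z e" "path_from_to X z w g" using e gV subsets(2) path_from_to_mono by blast+
    have a1: "adm w (m 0 +++ (e +++ g))" using eg unfolding adm_def by blast
    have "homotopic_paths X (m 0 +++ (e +++ g)) ((m 0 +++ e) +++ g)"
      using m[OF n0] eX by (intro homotopic_paths_assoc) (auto simp: path_from_to_def)
    then have "rel (m 0 +++ (e +++ g)) ((m 0 +++ e) +++ g)" by (rule rel_homotopic[OF adm_path[OF a1]])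
    moreover have P: "path_from_to X x w ((m 0 +++ e) +++ g)" using m[OF n0] eX path_from_to_join by blast
    ultimately have "rel ((m 0 +++ e) +++ g) q"
      using rel_trans[OF P adm_path[OF a1] adm_path[OF q]] rel_sym[OF adm_path[OF a1] P] adm_rel[OF a1 q] by blast
    moreover have "adm z (m 0 +++ e)" using e unfolding adm_def by blast
    ultimately show ?thesis using that by blast
  qed
  have gX: "path_from_to X z w g" using g subsets path_from_to_mono by blast
  note pg = path_from_to_join[OF adm_path[OF p] gX] and pg' = path_from_to_join[OF adm_path[OF p'(1)] gX]
  show ?thesis
    by (rule rel_trans[OF pg pg' adm_path[OF q] rel_join[OF adm_path[OF p] adm_path[OF p'(1)] gX adm_rel[OF p p'(1)]] p'(2)])
qed

text \<open>A loop is cut into pieces lying in \<open>U\<close> or in \<open>V\<close>. A piece turns a standard path to its start into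
  a path that is equivalent to the standard paths to its end.\<close>

lemma generate_c: "generate G (c ` {..<n}) = carrier G"
proof
  show "generate G (c ` {..<n}) \<subseteq> carrier G" using c_closed by (intro G.generate_incl) auto
  show "carrier G \<subseteq> generate G (c ` {..<n})"
  proof
    fix C assume "C \<in> carrier G"
    then obtain g where g: "path_from_to X x x g" "C = path_class X g"
      by (auto simp: carrier_fundamental_group based_loops_path_from_to)
    have gp: "path g" "path_image g \<subseteq> X" "g 0 = x" "g 1 = x" using g(1) by (auto simp: path_from_to_def pathstart_def pathfinish_def)
    have sub: "path_from_to X (g s) (g t) (subpath s t g)" if "s \<in> {0..1}" "t \<in> {0..1}" for s t
      using that gp path_image_subpath_subset[of s t g] by (auto simp: path_from_to_def)
    let ?P = "\<lambda>s t. 0 \<le> s \<longrightarrow> t \<le> 1 \<longrightarrow> (\<forall>p q. adm (g s) p \<longrightarrow> adm (g t) q \<longrightarrow> rel (p +++ subpath s t g) q)"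
    have "?P 0 1"
    proof (rule Bolzano[of 0 1 ?P])
      fix r s t :: real
      assume rs: "?P r s" and st: "?P s t" and le: "r \<le> s" "s \<le> t"
      show "?P r t"
      proof (intro impI allI)
        fix p q assume rt: "0 \<le> r" "t \<le> 1" and p: "adm (g r) p" and q: "adm (g t) q"
        have I: "r \<in> {0..1}" "s \<in> {0..1}" "t \<in> {0..1}" using rt le by auto
        have "g s \<in> X" using gp I by (auto simp: path_image_def)
        then obtain e where e: "adm (g s) e" using adm_exists cover unfolding adm_def by blast
        have 1: "rel (p +++ subpath r s g) e" using rs rt le p e by auto
        have 2: "rel (e +++ subpath s t g) q" using st rt le q e by auto
        note prs = path_from_to_join[OF adm_path[OF p] sub[OF I(1,2)]]
        note A = path_from_to_join[OF prs sub[OF I(2,3)]]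
        note B = path_from_to_join[OF adm_path[OF e] sub[OF I(2,3)]]
        note D = path_from_to_join[OF adm_path[OF p] sub[OF I(1,3)]]
        have 3: "rel ((p +++ subpath r s g) +++ subpath s t g) q"
          by (rule rel_trans[OF A B adm_path[OF q] rel_join[OF prs adm_path[OF e] sub[OF I(2,3)] 1] 2])
        have "homotopic_paths X (subpath r s g +++ subpath s t g) (subpath r t g)"
          using gp I by (intro homotopic_join_subpaths) auto
        then have "homotopic_paths X (p +++ (subpath r s g +++ subpath s t g)) (p +++ subpath r t g)"
          using adm_path[OF p] by (intro homotopic_paths_join) (auto simp: path_from_to_def)
        moreover have "homotopic_paths X (p +++ (subpath r s g +++ subpath s t g)) ((p +++ subpath r s g) +++ subpath s t g)"
          using adm_path[OF p] sub[OF I(1,2)] sub[OF I(2,3)] by (intro homotopic_paths_assoc) (auto simp: path_from_to_def)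
        ultimately have "homotopic_paths X (p +++ subpath r t g) ((p +++ subpath r s g) +++ subpath s t g)"
          by (meson homotopic_paths_sym homotopic_paths_trans)
        then have "rel (p +++ subpath r t g) ((p +++ subpath r s g) +++ subpath s t g)" by (rule rel_homotopic[OF D])
        then show "rel (p +++ subpath r t g) q" using rel_trans[OF D A adm_path[OF q] _ 3] by blast
      qed
    next
      fix s :: real assume s: "0 \<le> s" "s \<le> 1"
      have gc: "continuous_on {0..1} g" "g ` {0..1} \<subseteq> X" using gp by (auto simp: path_def path_image_def)
      have "g s \<in> X" using gc(2) s by force
      then have "g s \<in> U \<or> g s \<in> V" using cover by blast
      then obtain W where W: "W = U \<or> W = V" "g s \<in> W" by metis
      have "openin (top_of_set X) W" using W(1) open_U open_V by auto
      then have "openin (top_of_set {0..1}) ({0..1} \<inter> g -` W)"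
        using gc continuous_openin_preimage by (metis image_subset_iff_funcset)
      then obtain d where d: "d > 0" "\<And>t. t \<in> {0..1} \<Longrightarrow> dist t s < d \<Longrightarrow> g t \<in> W"
        using W(2) s unfolding openin_euclidean_subtopology_iff
        by (elim conjE) (drule bspec[of _ _ s], auto)
      have "?P r t" if rt: "r \<le> s" "s \<le> t" "t - r < d" for r t
      proof (intro impI allI)
        fix p q assume b: "0 \<le> r" "t \<le> 1" and pq: "adm (g r) p" "adm (g t) q"
        have I: "r \<in> {0..1}" "t \<in> {0..1}" using rt b by auto
        have "path_image (subpath r t g) = g ` {r..t}" using rt by (simp add: path_image_subpath)
        also have "\<dots> \<subseteq> W"
        proof (rule image_subsetI)
          fix z assume "z \<in> {r..t}"
          then have "z \<in> {0..1}" "dist z s < d" using rt b by (auto simp: dist_real_def)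
          then show "g z \<in> W" by (rule d(2))
        qed
        finally have "path_from_to W (g r) (g t) (subpath r t g)"
          using sub[OF I] by (simp add: path_from_to_def)
        then show "rel (p +++ subpath r t g) q" using adm_extend_in_chart[OF pq(1) _ pq(2)] W(1) by blast
      qed
      then show "\<exists>d>0. \<forall>r t. r \<le> s \<and> s \<le> t \<and> t - r < d \<longrightarrow> ?P r t" using d(1) by blast
    qed simp
    moreover have l: "adm x (linepath x x)" using x by (simp add: adm_def path_from_to_def)
    ultimately have "rel (linepath x x +++ subpath 0 1 g) (linepath x x)" using gp by simp
    then have "path_class X ((linepath x x +++ g) +++ linepath x x) \<in> H"
      by (simp add: rel_def)
    moreover have "homotopic_paths X ((linepath x x +++ g) +++ linepath x x) g"
    proof -
      have "homotopic_paths X ((linepath x x +++ g) +++ linepath x x) (linepath x x +++ g)"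
        using homotopic_paths_rid[of "linepath x x +++ g" X] g(1) x subsets(1) by (auto simp: path_from_to_def path_image_join)
      moreover have "homotopic_paths X (linepath x x +++ g) g"
        using homotopic_paths_lid[of g X] g(1) by (simp add: path_from_to_def)
      ultimately show ?thesis by (rule homotopic_paths_trans)
    qed
    ultimately show "C \<in> generate G (c ` {..<n})" using path_class_eqI g(2) by (metis H_def)
  qed
qed

subsection \<open>The presentation\<close>

lemma prefix_c:
  "Suc k \<le> n \<Longrightarrow> prefix_product G c (Suc k) = path_class X (m 0 +++ reversepath (m (Suc k mod n)))"
proof (induction k)
  case 0
  then show ?case using c_closed[of 0] n0 by (simp add: prefix_product_def c_def loop_def)
next
  case (Suc k)
  have k: "Suc k < n" using Suc.prems by simp
  have "prefix_product G c (Suc (Suc k)) = prefix_product G c (Suc k) \<otimes>\<^bsub>G\<^esub> c (Suc k)"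
    using c_closed Suc.prems by (intro G.prefix_product_Suc) auto
  also have "\<dots> = path_class X (m 0 +++ reversepath (m (Suc k))) \<otimes>\<^bsub>G\<^esub> path_class X (loop (Suc k))"
    using Suc k by (simp add: c_def[of "Suc k"])
  also have "\<dots> = path_class X ((m 0 +++ reversepath (m (Suc k))) +++ loop (Suc k))"
    by (rule fundamental_group_mult[OF rel_loop[OF m[OF n0] m[OF k]] loop[OF k]])
  also have "\<dots> = path_class X (m 0 +++ reversepath (m (Suc (Suc k) mod n)))"
    using homotopic_paths_cancel[of "m 0" X "reversepath (m (Suc k))" "reversepath (m (Suc (Suc k) mod n))"]
      m[OF n0] m[OF k] m[of "Suc (Suc k) mod n"] n0
    unfolding loop_def by (intro path_class_eqI) (auto simp: path_from_to_def)
  finally show ?case .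
qed

lemma product_c: "prefix_product G c n = \<one>\<^bsub>G\<^esub>"
proof -
  obtain k where k: "n = Suc k" using n0 by (cases n) auto
  have "prefix_product G c n = path_class X (m 0 +++ reversepath (m 0))" using prefix_c[of k] k by simp
  also have "\<dots> = \<one>\<^bsub>G\<^esub>"
    unfolding one_fundamental_group
    using homotopic_paths_rinv[of "m 0" X] m[OF n0] by (intro path_class_eqI) (simp add: path_from_to_def)
  finally show ?thesis .
qed

text \<open>With the cocycle that takes the value \<open>(g\<^sub>0 \<cdots> g\<^sub>k\<^sub>-\<^sub>1)\<^sup>-\<^sup>1\<close> on the \<open>k\<close>-th component, the
  monodromy maps the loop through the \<open>k\<close>-th and the next component to the abstract generator \<open>g\<^sub>k\<close>.\<close>

theorem presentation: "is_presentation G {..<n} c (product_relator n)"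
proof (rule is_presentationI[OF group_G product_relator_subset])
  let ?K = "presented_group {..<n} (product_relator n)"
  let ?g = "presented_gen {..<n} (product_relator n)"
  interpret K: group ?K by (rule group_presented_group)
  have g: "?g j \<in> carrier ?K" if "j < n" for j using that by (simp add: presented_gen_closed)
  define t where "t = (\<lambda>k. inv\<^bsub>?K\<^esub> prefix_product ?K ?g k)"
  have pc: "prefix_product ?K ?g k \<in> carrier ?K" if "k \<le> n" for k using g that by (intro K.prefix_product_closed) auto
  have tc: "t k \<in> carrier ?K" if "k \<le> n" for k using pc[OF that] by (simp add: t_def)
  have tt: "t k \<otimes>\<^bsub>?K\<^esub> inv\<^bsub>?K\<^esub> t (Suc k mod n) = ?g k" if k: "k < n" for k
  proof -
    have "t (Suc k mod n) = t (Suc k)"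
      using k presented_gen_product[of n] by (cases "Suc k = n") (auto simp: t_def)
    then have "inv\<^bsub>?K\<^esub> t (Suc k mod n) = prefix_product ?K ?g k \<otimes>\<^bsub>?K\<^esub> ?g k"
      using pc[of "Suc k"] k g K.prefix_product_Suc[of k ?g] by (simp add: t_def)
    then show ?thesis using pc[of k] g[OF k] k by (simp add: t_def flip: K.m_assoc)
  qed
  define \<tau> where "\<tau> = (\<lambda>z. t (THE k. k < n \<and> z \<in> L k))"
  have \<tau>: "\<tau> z = t k" if "k < n" "z \<in> L k" for k z
  proof -
    have "(THE k. k < n \<and> z \<in> L k) = k" using that L_disjoint by (intro the_equality) blast+
    then show ?thesis by (simp add: \<tau>_def)
  qed
  interpret cc: chart_cocycle ?K X U V \<tau>
  proof
    show "\<tau> z \<in> carrier ?K" if z: "z \<in> U" "z \<in> V" for z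
    proof -
      obtain k where "k < n" "z \<in> L k" using z int by blast
      then show ?thesis using \<tau> tc by simp
    qed
    show "locally_constant_on (U \<inter> V) \<tau>"
      unfolding locally_constant_on_def
    proof
      fix z assume "z \<in> U \<inter> V"
      then obtain k where k: "k < n" "z \<in> L k" using int by blast
      obtain T where T: "open T" "L k = X \<inter> T" using L_open[OF k(1)] by (auto simp: openin_open)
      have "\<tau> w = \<tau> z" if "w \<in> U \<inter> V \<inter> T" for w
      proof -
        have "w \<in> L k" using that T(2) subsets by blast
        then show ?thesis using \<tau> k by simp
      qed
      then show "\<exists>T. open T \<and> z \<in> T \<and> (\<forall>q\<in>U \<inter> V \<inter> T. \<tau> q = \<tau> z)" using T k(2) by blast
    qed
  qed (use cover open_U open_V in auto)
  show "cc.monodromy \<in> hom G ?K" by (rule cc.monodromy_hom[OF x])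
  have mk: "cc.has_monodromy (m k) True False (t k)" if k: "k < n" for k
  proof -
    have "cc.has_monodromy (u k) True True \<one>\<^bsub>?K\<^esub>"
      using u[OF k] by (intro cc.has_monodromy_in_chart) (auto simp: path_from_to_def)
    moreover have yk: "pathfinish (u k) = y k" "y k \<in> V"
      using u[OF k] y[OF k] int k by (auto simp: path_from_to_def)
    ultimately have 1: "cc.has_monodromy (u k) True False (\<one>\<^bsub>?K\<^esub> \<otimes>\<^bsub>?K\<^esub> \<tau> (y k))"
      using cc.has_monodromy_to_V[of "u k" True "\<one>\<^bsub>?K\<^esub>"] by simp
    have 2: "cc.has_monodromy (v k) False False \<one>\<^bsub>?K\<^esub>"
      using v[OF k] by (intro cc.has_monodromy_in_chart) (auto simp: path_from_to_def)
    have "cc.has_monodromy (u k +++ v k) True False ((\<one>\<^bsub>?K\<^esub> \<otimes>\<^bsub>?K\<^esub> \<tau> (y k)) \<otimes>\<^bsub>?K\<^esub> \<one>\<^bsub>?K\<^esub>)"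
      by (rule cc.has_monodromy_join[OF 1 2]) (use u[OF k] v[OF k] in \<open>auto simp: path_from_to_def\<close>)
    then show ?thesis using \<tau>[OF k y[OF k]] tc[of k] k by (simp add: m_def)
  qed
  show "cc.monodromy (c k) = ?g k" if "k \<in> {..<n}" for k
  proof -
    have k: "k < n" "Suc k mod n < n" using that n0 by auto
    have "cc.has_monodromy (loop k) True True (t k \<otimes>\<^bsub>?K\<^esub> inv\<^bsub>?K\<^esub> t (Suc k mod n))"
      unfolding loop_def
      by (rule cc.has_monodromy_join[OF mk[OF k(1)] cc.has_monodromy_reversepath[OF mk[OF k(2)]]])
        (use m[OF k(1)] m[OF k(2)] in \<open>auto simp: path_from_to_def\<close>)
    then show ?thesis unfolding c_def using cc.monodromy_path_class tt[OF k(1)] by simp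
  qed
  show "c k \<in> carrier G" if "k \<in> {..<n}" for k using that c_closed by simp
  show "generate G (c ` {..<n}) = carrier G" by (rule generate_c)
  show "eval_word G c r = \<one>\<^bsub>G\<^esub>" if "r \<in> product_relator n" for r
    using that product_c by (simp add: eval_word_product_relator)
qed

end

section \<open>Loops around the punctures of a sphere\<close>

subsection \<open>Spherical coordinates\<close>

locale sphere_frame =
  fixes e1 e2 b :: "real^3"
  assumes frame: "norm e1 = 1" "norm e2 = 1" "e1 \<bullet> e2 = 0" "cross3 e1 e2 = b"
begin

lemma frame_inner [simp]:
  "e1 \<bullet> e1 = 1" "e2 \<bullet> e2 = 1" "b \<bullet> b = 1" "e1 \<bullet> e2 = 0" "e2 \<bullet> e1 = 0"
  "b \<bullet> e1 = 0" "e1 \<bullet> b = 0" "b \<bullet> e2 = 0" "e2 \<bullet> b = 0"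
  using frame cross3_frame[OF frame] by (simp_all add: norm_eq_1 inner_commute)

text \<open>Polar angle \<open>\<phi>\<close> and longitude \<open>\<theta>\<close>.\<close>

definition sph :: "real \<Rightarrow> real \<Rightarrow> real^3" where
  "sph \<phi> \<theta> = cos \<phi> *\<^sub>R b + sin \<phi> *\<^sub>R (cos \<theta> *\<^sub>R e1 + sin \<theta> *\<^sub>R e2)"

definition equatorial :: "real^3 \<Rightarrow> complex" where
  "equatorial y = Complex (e1 \<bullet> y) (e2 \<bullet> y)"

lemma norm_sph [simp]: "norm (sph \<phi> \<theta>) = 1"
  unfolding sph_def by (rule cap_boundary_on_sphere(1)[OF frame])

lemma inner_sph [simp]: "b \<bullet> sph \<phi> \<theta> = cos \<phi>"
  unfolding sph_def by (rule cap_boundary_on_sphere(2)[OF frame])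

lemma equatorial_sph: "equatorial (sph \<phi> \<theta>) = of_real (sin \<phi>) * cis \<theta>"
  by (simp add: equatorial_def sph_def complex_eq_iff inner_add_right)

lemma sph_poles [simp]: "sph 0 \<theta> = b" "sph pi \<theta> = - b"
  by (simp_all add: sph_def)

lemma sph_periodic: "sph \<phi> (\<theta> - 2 * pi) = sph \<phi> \<theta>"
  by (simp add: sph_def cos_diff sin_diff)

lemma frame_expand: "y = (e1 \<bullet> y) *\<^sub>R e1 + (e2 \<bullet> y) *\<^sub>R e2 + (b \<bullet> y) *\<^sub>R b"
proof -
  have "b \<bullet> (y - (b \<bullet> y) *\<^sub>R b) = 0" by (simp add: inner_diff_right)
  from orthonormal_frame_expand(1)[OF frame this]
  have "y - (b \<bullet> y) *\<^sub>R b = (e1 \<bullet> y) *\<^sub>R e1 + (e2 \<bullet> y) *\<^sub>R e2" by (simp add: inner_diff_right)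
  then show ?thesis by (simp add: algebra_simps)
qed

lemma equatorial_eqI:
  assumes "equatorial y = of_real s * equatorial z"
  shows "y - s *\<^sub>R z = (b \<bullet> y - s * (b \<bullet> z)) *\<^sub>R b"
proof -
  have "e1 \<bullet> y = s * (e1 \<bullet> z)" "e2 \<bullet> y = s * (e2 \<bullet> z)"
    using assms by (simp_all add: equatorial_def complex_eq_iff)
  then show ?thesis
    using frame_expand[of "y - s *\<^sub>R z"] by (simp add: inner_diff_right)
qed

lemma equatorial_lin: "equatorial (a *\<^sub>R y + c *\<^sub>R b) = of_real a * equatorial y"
  by (simp add: equatorial_def complex_eq_iff inner_add_right)

lemma cmod_equatorial: "norm y = 1 \<Longrightarrow> (cmod (equatorial y))\<^sup>2 + (b \<bullet> y)\<^sup>2 = 1"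
proof -
  assume "norm y = 1"
  then have "y \<bullet> y = 1" by (simp add: norm_eq_1)
  then have "(e1 \<bullet> y) * (e1 \<bullet> y) + (e2 \<bullet> y) * (e2 \<bullet> y) + (b \<bullet> y) * (b \<bullet> y) = 1"
    by (subst (asm) frame_expand[of y]) (simp add: inner_add_left)
  then show ?thesis unfolding cmod_power2 by (simp add: equatorial_def power2_eq_square)
qed

lemma continuous_on_sph [continuous_intros]:
  fixes f g :: "'c::t2_space \<Rightarrow> real"
  shows "continuous_on A f \<Longrightarrow> continuous_on A g \<Longrightarrow> continuous_on A (\<lambda>w. sph (f w) (g w))"
  unfolding sph_def by (intro continuous_intros)

lemma continuous_on_equatorial: "continuous_on A equatorial"
  unfolding equatorial_def by (intro continuous_intros)

lemma sph_coordinates: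
  assumes "norm y = 1" "equatorial y \<noteq> 0"
  obtains \<phi> where "0 < \<phi>" "\<phi> < pi" "y = sph \<phi> (Arg2pi (equatorial y))"
proof -
  define \<phi> where "\<phi> = arccos (b \<bullet> y)"
  have sq: "(cmod (equatorial y))\<^sup>2 + (b \<bullet> y)\<^sup>2 = 1" by (rule cmod_equatorial[OF assms(1)])
  then have "(b \<bullet> y)\<^sup>2 < 1" using assms(2) by (smt (verit) zero_less_power2 norm_eq_zero)
  then have bd: "-1 < b \<bullet> y" "b \<bullet> y < 1" by (auto simp: abs_square_less_1 abs_less_iff)
  then have \<phi>: "0 < \<phi>" "\<phi> < pi" "cos \<phi> = b \<bullet> y" using arccos_lt_bounded[of "b \<bullet> y"] by (auto simp: \<phi>_def)
  have "(sin \<phi>)\<^sup>2 = (cmod (equatorial y))\<^sup>2" using sq \<phi>(3) sin_cos_squared_add[of \<phi>] by simp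
  moreover have "sin \<phi> > 0" using \<phi> by (simp add: sin_gt_zero)
  ultimately have s: "sin \<phi> = cmod (equatorial y)" by (simp add: power2_eq_iff_nonneg)
  have "equatorial y = of_real (sin \<phi>) * cis (Arg2pi (equatorial y))"
    unfolding s cis_conv_exp by (rule Arg2pi_eq)
  then have "equatorial y = of_real 1 * equatorial (sph \<phi> (Arg2pi (equatorial y)))" by (simp add: equatorial_sph)
  from equatorial_eqI[OF this] have "y - sph \<phi> (Arg2pi (equatorial y)) = 0" using \<phi>(3) by simp
  then show ?thesis using that \<phi> by simp
qed

lemma Arg2pi_equatorial_sph:
  assumes "0 < \<phi>" "\<phi> < pi" "0 \<le> \<theta>" "\<theta> < 2 * pi"
  shows "Arg2pi (equatorial (sph \<phi> \<theta>)) = \<theta>" "equatorial (sph \<phi> \<theta>) \<noteq> 0"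
proof -
  have s: "sin \<phi> > 0" using assms by (simp add: sin_gt_zero)
  show "Arg2pi (equatorial (sph \<phi> \<theta>)) = \<theta>"
    by (rule Arg2pi_unique[of "sin \<phi>"]) (use s assms in \<open>auto simp: equatorial_sph cis_conv_exp\<close>)
  show "equatorial (sph \<phi> \<theta>) \<noteq> 0" using s by (simp add: equatorial_sph)
qed

subsection \<open>The boundary of a lune\<close>

text \<open>Small circles in the coordinates \<open>(\<phi>, \<theta>)\<close> and in the tangent plane are homotopic in the complement
  of the centre, because corresponding points never lie in opposite directions.\<close>

lemma sph_direction_pos:
  assumes \<phi>: "0 < \<phi>" "\<phi> < pi" and c: "\<bar>c\<bar> \<le> 1 / 2" and d: "\<bar>d\<bar> \<le> 1 / 2" and nz: "c \<noteq> 0 \<or> d \<noteq> 0"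
    and \<phi>0: "\<phi>0 = \<phi> - c"
  shows "c * (sin \<phi> * cos \<phi>0 * cos d - cos \<phi> * sin \<phi>0) + d * (sin \<phi> * sin d) > 0"
proof -
  define s where "s = sin (d / 2)"
  have cd: "1 - cos d = 2 * s\<^sup>2" "sin d = 2 * s * cos (d / 2)"
    using cos_double_sin[of "d / 2"] sin_double[of "d / 2"] by (simp_all add: s_def)
  have sp: "sin \<phi> > 0" using \<phi> by (simp add: sin_gt_zero)
  have "sin c = sin \<phi> * cos \<phi>0 - cos \<phi> * sin \<phi>0" unfolding \<phi>0 using sin_diff[of \<phi> "\<phi> - c"] by simp
  then have e: "sin \<phi> * cos \<phi>0 * cos d - cos \<phi> * sin \<phi>0 = sin c - sin \<phi> * cos \<phi>0 * (2 * s\<^sup>2)"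
    unfolding cd(1)[symmetric] by (simp add: algebra_simps)
  have "c * cos \<phi>0 \<le> 1 / 2"
    using c abs_cos_le_one[of \<phi>0] mult_mono[of "\<bar>c\<bar>" "1/2" "\<bar>cos \<phi>0\<bar>" 1] by (simp add: abs_mult[symmetric])
  then have 1: "c * cos \<phi>0 * (sin \<phi> * (2 * s\<^sup>2)) \<le> 1 / 2 * (sin \<phi> * (2 * s\<^sup>2))"
    using sp by (intro mult_right_mono) auto
  have cosd: "cos (d / 2) \<ge> 1 / 2"
  proof -
    have "cos (pi / 3) \<le> cos \<bar>d / 2\<bar>" using d pi_gt3 by (intro cos_monotone_0_pi_le) auto
    then show ?thesis by (simp only: cos_60 cos_abs_real)
  qed
  have ds: "d * s \<ge> 2 * s\<^sup>2"
  proof -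
    have a: "\<bar>s\<bar> \<le> \<bar>d / 2\<bar>" unfolding s_def by (rule abs_sin_x_le_abs_x)
    have "d * s = \<bar>d\<bar> * \<bar>s\<bar>"
    proof (cases "d \<ge> 0")
      case True
      then have "s \<ge> 0" unfolding s_def using d pi_gt3 by (intro sin_ge_zero) auto
      then show ?thesis using True by simp
    next
      case False
      then have "sin (- (d / 2)) \<ge> 0" using d pi_gt3 by (intro sin_ge_zero) auto
      then have "s \<le> 0" by (simp add: s_def)
      then show ?thesis using False by simp
    qed
    moreover have "2 * \<bar>s\<bar> * \<bar>s\<bar> \<le> \<bar>d\<bar> * \<bar>s\<bar>" using a by (intro mult_right_mono) auto
    ultimately show ?thesis by (simp add: power2_eq_square)
  qed
  have "2 * s\<^sup>2 * 1 \<le> d * s * (2 * cos (d / 2))"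
  proof (rule mult_mono)
    have "0 \<le> 2 * s\<^sup>2" by simp
    then show "0 \<le> d * s" using ds by linarith
  qed (use ds cosd in auto)
  then have 2: "sin \<phi> * (2 * s\<^sup>2) \<le> d * (sin \<phi> * sin d)"
    unfolding cd(2) using sp mult_left_mono[of "2 * s\<^sup>2" "d * s * (2 * cos (d / 2))" "sin \<phi>"] by (simp add: mult_ac)
  have 3: "c * sin c \<ge> 0 \<and> (c \<noteq> 0 \<longrightarrow> c * sin c > 0)"
  proof (cases "c \<ge> 0")
    case True
    then show ?thesis using c pi_gt3 sin_gt_zero[of c] sin_ge_zero[of c] by auto
  next
    case False
    then have "sin (- c) > 0" using c pi_gt3 by (intro sin_gt_zero) auto
    then show ?thesis using False by (auto simp: mult_neg_neg less_imp_le)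
  qed
  have "c * (sin \<phi> * cos \<phi>0 * cos d - cos \<phi> * sin \<phi>0) + d * (sin \<phi> * sin d)
      = c * sin c - c * cos \<phi>0 * (sin \<phi> * (2 * s\<^sup>2)) + d * (sin \<phi> * sin d)"
    unfolding e by (simp add: algebra_simps)
  also have "\<dots> \<ge> c * sin c + sin \<phi> * s\<^sup>2" using 1 2 by simp
  finally have ge: "c * (sin \<phi> * cos \<phi>0 * cos d - cos \<phi> * sin \<phi>0) + d * (sin \<phi> * sin d) \<ge> c * sin c + sin \<phi> * s\<^sup>2" .
  have "c * sin c + sin \<phi> * s\<^sup>2 > 0"
  proof (cases "c = 0")
    case True
    then have "d \<noteq> 0" using nz by simp
    have "s \<noteq> 0"
    proof (cases "d > 0")
      case True
      then have "sin (d / 2) > 0" using d pi_gt3 by (intro sin_gt_zero) auto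
      then show ?thesis by (simp add: s_def)
    next
      case False
      then have "sin (- (d / 2)) > 0" using d \<open>d \<noteq> 0\<close> pi_gt3 by (intro sin_gt_zero) auto
      then show ?thesis by (simp add: s_def)
    qed
    then show ?thesis using True sp by simp
  next
    case False
    then show ?thesis using 3 sp by (intro add_pos_nonneg) auto
  qed
  then show ?thesis using ge by linarith
qed

text \<open>The coordinates \<open>(\<phi>, \<theta>)\<close> turn the boundary of a lune into that of a rectangle, up to two sides that
  are collapsed to the poles. In the punctured rectangle winding numbers classify loops up to homotopy.\<close>

lemma lune_boundary_ccw:
  assumes P: "finite P" "P \<subseteq> sphere 0 1" and q0: "0 < \<phi>0" "\<phi>0 < pi" "A < \<theta>0" "\<theta>0 < B"
    and p: "p = sph \<phi>0 \<theta>0" "p \<in> P"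
    and only: "\<And>\<phi> \<theta>. 0 \<le> \<phi> \<Longrightarrow> \<phi> \<le> pi \<Longrightarrow> A \<le> \<theta> \<Longrightarrow> \<theta> \<le> B \<Longrightarrow> sph \<phi> \<theta> \<in> P \<Longrightarrow> \<phi> = \<phi>0 \<and> \<theta> = \<theta>0"
  shows "ccw_loop_around P p ((\<lambda>t. sph (pi * t) A) +++ reversepath (\<lambda>t. sph (pi * t) B))"
proof -
  let ?X = "punctured_sphere P"
  define g where "g = (\<lambda>w. sph (Re w) (Im w))"
  define q where "q = Complex \<phi>0 \<theta>0"
  let ?a = "Complex 0 A" and ?c = "Complex pi B"
  have AB: "A < B" using q0 by simp
  have gc: "continuous_on S g" for S unfolding g_def by (intro continuous_intros)
  have gX: "g w \<in> ?X" if "w \<in> cbox ?a ?c" "w \<noteq> q" for w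
  proof -
    have "\<not> (Re w = \<phi>0 \<and> Im w = \<theta>0)" using that(2) by (simp add: q_def complex_eq_iff)
    moreover have "0 \<le> Re w" "Re w \<le> pi" "A \<le> Im w" "Im w \<le> B" using that(1) by (simp_all add: in_cbox_complex_iff)
    ultimately have "sph (Re w) (Im w) \<notin> P" using only by blast
    then show ?thesis by (simp add: punctured_sphere_def g_def)
  qed
  have qbox: "q \<in> box ?a ?c" using q0 by (simp add: q_def in_box_complex_iff)
  \<comment> \<open>a retraction onto the rectangle that maps no other point to \<open>q\<close>\<close>
  define R where "R = (\<lambda>w. Complex (max 0 (min pi (Re w))) (max A (min B (Im w))))"
  have Rc: "continuous_on S R" for S unfolding R_def by (intro continuous_intros)
  have Rbox: "R w \<in> cbox ?a ?c" for w using AB by (simp add: R_def in_cbox_complex_iff)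
  have Rq: "R w \<noteq> q" if "w \<noteq> q" for w
    using that q0 by (auto simp: R_def q_def complex_eq_iff max_def min_def split: if_splits)
  have Rid: "R w = w" if "w \<in> cbox ?a ?c" for w
    using that by (simp add: R_def in_cbox_complex_iff complex_eq_iff)
  \<comment> \<open>a cap that contains no other puncture\<close>
  have pn: "norm p = 1" "p \<bullet> p = 1" using p(1) by (simp_all add: norm_eq_1[symmetric])
  have lt: "p \<bullet> z < 1" if "z \<in> P - {p}" for z
  proof -
    have "norm z = 1" using that P(2) by auto
    then have "p \<bullet> z \<le> 1" using norm_cauchy_schwarz[of p z] pn by simp
    moreover have "p \<bullet> z \<noteq> 1"
    proof
      assume "p \<bullet> z = 1"
      then have "(p - z) \<bullet> (p - z) = 0" using pn(2) \<open>norm z = 1\<close> by (simp add: inner_diff_left inner_diff_right norm_eq_1 inner_commute)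
      then show False using that by simp
    qed
    ultimately show ?thesis by simp
  qed
  define c0 where "c0 = (Max (insert 0 ((\<lambda>z. p \<bullet> z) ` (P - {p}))) + 1) / 2"
  have M: "Max (insert 0 ((\<lambda>z. p \<bullet> z) ` (P - {p}))) < 1" "0 \<le> Max (insert 0 ((\<lambda>z. p \<bullet> z) ` (P - {p})))"
    using P(1) lt by auto
  have Mge: "p \<bullet> z \<le> Max (insert 0 ((\<lambda>z. p \<bullet> z) ` (P - {p})))" if "z \<in> P - {p}" for z
    using P(1) that by (intro Max_ge) auto
  have c0: "0 < c0" "c0 < 1" "\<And>z. z \<in> P - {p} \<Longrightarrow> p \<bullet> z < c0"
  proof -
    show "0 < c0" "c0 < 1" using M by (simp_all add: c0_def)
    show "p \<bullet> z < c0" if "z \<in> P - {p}" for z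
      unfolding c0_def using Mge[OF that] M(1) by (simp only: pos_less_divide_eq zero_less_numeral)
  qed
  define r where "r = arccos c0"
  have r: "0 < r" "r < pi" "cos r = c0" using c0 arccos_lt_bounded[of c0] by (auto simp: r_def)
  have sr: "sin r > 0" using r by (simp add: sin_gt_zero)
  \<comment> \<open>a circle in coordinates that stays inside the rectangle and whose image stays inside the cap\<close>
  have "\<exists>e>0. \<forall>w. dist w q < e \<longrightarrow> p \<bullet> g w > c0"
  proof -
    have "continuous_on UNIV (\<lambda>w. p \<bullet> g w)" by (intro continuous_intros gc)
    then have "open ((\<lambda>w. p \<bullet> g w) -` {c0<..})" by (rule open_vimage[OF open_greaterThan])
    moreover have "q \<in> (\<lambda>w. p \<bullet> g w) -` {c0<..}" using c0 pn p by (simp add: g_def q_def)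
    ultimately show ?thesis unfolding open_dist by fastforce
  qed
  then obtain e where e: "e > 0" "\<And>w. dist w q < e \<Longrightarrow> p \<bullet> g w > c0" by blast
  obtain e' where e': "e' > 0" "cball q e' \<subseteq> box ?a ?c" using qbox open_box open_contains_cball by blast
  define \<epsilon> where "\<epsilon> = min (e / 2) (min e' (1 / 2))"
  have \<epsilon>: "0 < \<epsilon>" "\<epsilon> < e" "\<epsilon> \<le> e'" "\<epsilon> \<le> 1 / 2" using e(1) e'(1) by (auto simp: \<epsilon>_def)
  have circ: "circlepath q \<epsilon> t = Complex (\<phi>0 + \<epsilon> * cos (2 * pi * t)) (\<theta>0 + \<epsilon> * sin (2 * pi * t))" for t
  proof -
    have "exp (2 * complex_of_real pi * \<i> * complex_of_real t) = cis (2 * pi * t)"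
      by (simp add: cis_conv_exp mult_ac)
    then show ?thesis by (simp add: circlepath q_def complex_eq_iff)
  qed
  have circ_dist: "dist (circlepath q \<epsilon> t) q = \<epsilon>" for t
    using \<epsilon>(1) by (simp add: circlepath dist_norm norm_mult)
  have circ_box: "circlepath q \<epsilon> t \<in> box ?a ?c" for t
    using e'(2) circ_dist[of t] \<epsilon>(3) by (auto simp: dist_commute subset_eq)
  have sub_box: "box ?a ?c \<subseteq> cbox ?a ?c" by (rule box_subset_cbox)
  \<comment> \<open>the rectangle and the circle have the same winding number around \<open>q\<close>\<close>
  have ri: "path_image (rectpath ?a ?c) \<subseteq> cbox ?a ?c - {q}"
  proof -
    have "q \<notin> path_image (rectpath ?a ?c)"
      using path_image_rectpath_inter_box[of ?a ?c] qbox AB by auto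
    then show ?thesis using path_image_rectpath_subset_cbox[of ?a ?c] AB by auto
  qed
  have "homotopic_loops (- {q}) (rectpath ?a ?c) (circlepath q \<epsilon>)"
  proof (subst winding_number_homotopic_loops_eq[symmetric])
    show "winding_number (rectpath ?a ?c) q = winding_number (circlepath q \<epsilon>) q"
      using winding_number_rectpath[OF qbox] \<epsilon>(1) by (simp add: winding_number_circlepath)
  qed (use ri \<epsilon>(1) in \<open>auto simp: path_image_circlepath\<close>)
  then have "homotopic_loops ?X ((g \<circ> R) \<circ> rectpath ?a ?c) ((g \<circ> R) \<circ> circlepath q \<epsilon>)"
  proof (rule homotopic_loops_continuous_image)
    show "continuous_on (- {q}) (g \<circ> R)" by (intro continuous_on_compose Rc gc)
    show "g \<circ> R \<in> - {q} \<rightarrow> ?X" using gX Rbox Rq by auto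
  qed
  then have "homotopic_loops ?X (g \<circ> rectpath ?a ?c) ((g \<circ> R) \<circ> circlepath q \<epsilon>)"
  proof (rule homotopic_loops_trans[rotated])
    show "homotopic_loops ?X (g \<circ> rectpath ?a ?c) ((g \<circ> R) \<circ> rectpath ?a ?c)"
    proof (rule homotopic_loops_eq)
      show "path (g \<circ> rectpath ?a ?c)" by (intro path_continuous_image gc) simp
      show "path_image (g \<circ> rectpath ?a ?c) \<subseteq> ?X" using ri gX unfolding path_image_compose by blast
      show "pathfinish (g \<circ> rectpath ?a ?c) = pathstart (g \<circ> rectpath ?a ?c)"
        by (simp add: pathfinish_compose pathstart_compose)
      show "(g \<circ> rectpath ?a ?c) t = ((g \<circ> R) \<circ> rectpath ?a ?c) t" if "t \<in> {0..1}" for t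
        using ri that by (auto simp: path_image_def Rid image_subset_iff)
    qed
  qed
  moreover have "(g \<circ> R) \<circ> circlepath q \<epsilon> = g \<circ> circlepath q \<epsilon>"
  proof -
    have "R (circlepath q \<epsilon> t) = circlepath q \<epsilon> t" for t by (rule Rid) (use circ_box sub_box in blast)
    then show ?thesis by (simp add: fun_eq_iff)
  qed
  ultimately have rect_circ: "homotopic_loops ?X (g \<circ> rectpath ?a ?c) (g \<circ> circlepath q \<epsilon>)" by simp
  \<comment> \<open>the lune boundary is the image of the rectangle\<close>
  let ?MA = "\<lambda>t. sph (pi * t) A" and ?MB = "\<lambda>t. sph (pi * t) B"
  have MX: "path ?MA" "path_image ?MA \<subseteq> ?X" "path ?MB" "path_image ?MB \<subseteq> ?X"
  proof -
    show "path ?MA" "path ?MB" unfolding path_def by (intro continuous_intros)+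
    have "sph (pi * t) A \<in> ?X" "sph (pi * t) B \<in> ?X" if "t \<in> {0..1}" for t
    proof -
      have "0 \<le> pi * t" "pi * t \<le> pi" using that by auto
      then show "sph (pi * t) A \<in> ?X" "sph (pi * t) B \<in> ?X"
        using only[of "pi * t" A] only[of "pi * t" B] q0 by (auto simp: punctured_sphere_def)
    qed
    then show "path_image ?MA \<subseteq> ?X" "path_image ?MB \<subseteq> ?X" by (auto simp: path_image_def)
  qed
  have sides: "g \<circ> linepath ?a (Complex pi A) = ?MA" "g \<circ> linepath (Complex pi A) ?c = linepath (- b) (- b)"
    "g \<circ> linepath ?c (Complex 0 B) = reversepath ?MB" "g \<circ> linepath (Complex 0 B) ?a = linepath b b"
    by (auto simp: g_def linepath_def reversepath_def fun_eq_iff algebra_simps)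
  have "g \<circ> rectpath ?a ?c = ?MA +++ (linepath (- b) (- b) +++ (reversepath ?MB +++ linepath b b))"
    unfolding rectpath_def Let_def by (simp add: path_compose_join sides)
  moreover have "homotopic_loops ?X (?MA +++ (linepath (- b) (- b) +++ (reversepath ?MB +++ linepath b b))) (?MA +++ reversepath ?MB)"
  proof -
    have ends: "pathfinish ?MA = - b" "pathstart ?MA = b" "pathfinish ?MB = - b" "pathstart ?MB = b"
      by (simp_all add: pathfinish_def pathstart_def)
    have bX: "b \<in> ?X" "- b \<in> ?X" using MX(2) ends pathstart_in_path_image[of ?MA] pathfinish_in_path_image[of ?MA] by auto
    have 1: "homotopic_paths ?X (reversepath ?MB +++ linepath b b) (reversepath ?MB)"
      using homotopic_paths_rid[of "reversepath ?MB" ?X] MX ends by simp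
    have "homotopic_paths ?X (linepath (- b) (- b) +++ (reversepath ?MB +++ linepath b b)) (linepath (- b) (- b) +++ reversepath ?MB)"
      using 1 bX ends by (intro homotopic_paths_join) auto
    moreover have "homotopic_paths ?X (linepath (- b) (- b) +++ reversepath ?MB) (reversepath ?MB)"
      using homotopic_paths_lid[of "reversepath ?MB" ?X] MX ends by simp
    ultimately have "homotopic_paths ?X (linepath (- b) (- b) +++ (reversepath ?MB +++ linepath b b)) (reversepath ?MB)"
      by (rule homotopic_paths_trans)
    then have "homotopic_paths ?X (?MA +++ (linepath (- b) (- b) +++ (reversepath ?MB +++ linepath b b))) (?MA +++ reversepath ?MB)"
      using MX ends by (intro homotopic_paths_join) auto
    then show ?thesis by (rule homotopic_paths_imp_homotopic_loops) (use ends in auto)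
  qed
  ultimately have "homotopic_loops ?X (g \<circ> rectpath ?a ?c) (?MA +++ reversepath ?MB)" by simp
  from homotopic_loops_trans[OF homotopic_loops_sym[OF this] rect_circ]
  have lune_circ: "homotopic_loops ?X (?MA +++ reversepath ?MB) (g \<circ> circlepath q \<epsilon>)" .
  \<comment> \<open>Corresponding points of the image of the circle and of the cap boundary lie on the same side of \<open>p\<close>,
    so the straight homotopy between them, projected to the sphere, avoids \<open>p\<close>.\<close>
  define u where "u = cos \<phi>0 *\<^sub>R (cos \<theta>0 *\<^sub>R e1 + sin \<theta>0 *\<^sub>R e2) - sin \<phi>0 *\<^sub>R b"
  define v where "v = cos \<theta>0 *\<^sub>R e2 - sin \<theta>0 *\<^sub>R e1"
  note fr = cross3_frame[OF frame]
  have uu: "u \<bullet> u = (cos \<phi>0 * cos \<phi>0) * (cos \<theta>0 * cos \<theta>0 + sin \<theta>0 * sin \<theta>0) + sin \<phi>0 * sin \<phi>0"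
    by (simp add: u_def inner_diff_left inner_diff_right inner_add_left inner_add_right algebra_simps del: sin_cos_squared_add3)
  have uv: "norm u = 1" "norm v = 1" "u \<bullet> v = 0"
    using uu by (simp_all add: norm_eq_1 u_def v_def inner_diff_left inner_diff_right inner_add_left inner_add_right algebra_simps)
  have cr: "cross3 e2 e1 = - b" "cross3 b e1 = e2" "cross3 b e2 = - e1" "cross3 e1 e2 = b"
    using fr frame(4) cross_skew[of e2 e1] by simp_all
  have "cross3 u v = (cos \<phi>0 * (cos \<theta>0 * cos \<theta>0 + sin \<theta>0 * sin \<theta>0)) *\<^sub>R b + sin \<phi>0 *\<^sub>R (cos \<theta>0 *\<^sub>R e1 + sin \<theta>0 *\<^sub>R e2)"
    unfolding u_def v_def
    by (simp add: cross_add_left Cross3.left_diff_distrib Cross3.right_diff_distrib cross_mult_left cross_mult_right cr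
        algebra_simps del: sin_cos_squared_add3)
  then have uvp: "cross3 u v = p" by (simp add: p sph_def)
  have up: "p \<bullet> u = 0" "p \<bullet> v = 0" using cross3_frame(1,2)[OF uv uvp] .
  define y0 where "y0 = (\<lambda>t. g (circlepath q \<epsilon> t))"
  define y1 where "y1 = cap_boundary p r u v"
  define dir where "dir = (\<lambda>t::real. cos (2 * pi * t) *\<^sub>R u + sin (2 * pi * t) *\<^sub>R v)"
  have pd: "p \<bullet> dir t = 0" for t using up by (simp add: dir_def inner_add_right)
  have d0: "dir t \<bullet> y0 t > 0" for t
  proof -
    define c where "c = \<epsilon> * cos (2 * pi * t)"
    define d where "d = \<epsilon> * sin (2 * pi * t)"
    have w: "circlepath q \<epsilon> t = Complex (\<phi>0 + c) (\<theta>0 + d)" by (simp add: circ c_def d_def)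
    have b: "0 < \<phi>0 + c" "\<phi>0 + c < pi" using circ_box[of t] unfolding w by (simp_all add: in_box_complex_iff)
    have "\<bar>c\<bar> \<le> 1 / 2 * 1" "\<bar>d\<bar> \<le> 1 / 2 * 1"
      unfolding c_def d_def abs_mult using \<epsilon> by (intro mult_mono; simp)+
    moreover have "c \<noteq> 0 \<or> d \<noteq> 0"
    proof (rule ccontr)
      assume "\<not> ?thesis"
      then have "cos (2 * pi * t) = 0" "sin (2 * pi * t) = 0" using \<epsilon>(1) by (auto simp: c_def d_def)
      then show False using sin_cos_squared_add[of "2 * pi * t"] by simp
    qed
    ultimately have pos: "c * (sin (\<phi>0 + c) * cos \<phi>0 * cos d - cos (\<phi>0 + c) * sin \<phi>0) + d * (sin (\<phi>0 + c) * sin d) > 0"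
      using b by (intro sph_direction_pos) auto
    have cd: "cos (\<theta>0 + d) * cos \<theta>0 + sin (\<theta>0 + d) * sin \<theta>0 = cos d" "sin (\<theta>0 + d) * cos \<theta>0 - cos (\<theta>0 + d) * sin \<theta>0 = sin d"
      using cos_diff[of "\<theta>0 + d" \<theta>0] sin_diff[of "\<theta>0 + d" \<theta>0] by simp_all
    have 1: "u \<bullet> y0 t = sin (\<phi>0 + c) * cos \<phi>0 * (cos (\<theta>0 + d) * cos \<theta>0 + sin (\<theta>0 + d) * sin \<theta>0) - cos (\<phi>0 + c) * sin \<phi>0"
      by (simp add: y0_def g_def w u_def sph_def inner_diff_left inner_add_left inner_add_right algebra_simps)
    have 2: "v \<bullet> y0 t = sin (\<phi>0 + c) * (sin (\<theta>0 + d) * cos \<theta>0 - cos (\<theta>0 + d) * sin \<theta>0)"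
      by (simp add: y0_def g_def w v_def sph_def inner_diff_left inner_add_left inner_add_right algebra_simps)
    have "\<epsilon> * (dir t \<bullet> y0 t) = c * (u \<bullet> y0 t) + d * (v \<bullet> y0 t)"
      by (simp add: dir_def c_def d_def inner_add_left algebra_simps)
    then have "\<epsilon> * (dir t \<bullet> y0 t) > 0" using pos unfolding 1 2 cd by simp
    then show ?thesis using \<epsilon>(1) by (simp add: zero_less_mult_iff)
  qed
  have d1: "dir t \<bullet> y1 t > 0" for t
  proof -
    have "dir t \<bullet> dir t = cos (2 * pi * t) * cos (2 * pi * t) + sin (2 * pi * t) * sin (2 * pi * t)"
      using uv by (simp add: dir_def inner_add_left inner_add_right norm_eq_1 inner_commute algebra_simps del: sin_cos_squared_add3)
    moreover have "y1 t = cos r *\<^sub>R p + sin r *\<^sub>R dir t" by (simp add: y1_def cap_boundary_def dir_def)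
    ultimately have "dir t \<bullet> y1 t = sin r"
      using pd[of t] by (simp add: inner_add_right inner_commute[of "dir t" p])
    then show ?thesis using sr by simp
  qed
  have n0: "norm (y0 t) = 1" "p \<bullet> y0 t > c0" for t
    using e(2)[of "circlepath q \<epsilon> t"] circ_dist[of t] \<epsilon>(2) by (auto simp: y0_def g_def)
  have n1: "norm (y1 t) = 1" "p \<bullet> y1 t = c0" for t
    using cap_boundary_on_sphere[OF uv uvp, of r "2 * pi * t"] r(3) by (simp_all add: y1_def cap_boundary_def)
  define H where "H = (\<lambda>s t. sgn ((1 - s) *\<^sub>R y0 t + s *\<^sub>R y1 t))"
  have mid: "dir t \<bullet> ((1 - s) *\<^sub>R y0 t + s *\<^sub>R y1 t) > 0" if "s \<in> {0..1}" for s t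
  proof (cases "s = 1")
    case False
    then show ?thesis using that d0[of t] d1[of t] by (auto simp: inner_add_right intro!: add_pos_nonneg)
  qed (use d1 in simp)
  have "homotopic_loops ?X (g \<circ> circlepath q \<epsilon>) y1"
  proof (rule homotopic_loopsI[where H=H])
    have yc: "continuous_on S y0" "continuous_on S y1" for S
      unfolding y0_def circ g_def y1_def cap_boundary_def by (simp_all, (intro continuous_intros)+)
    show "continuous_on ({0..1} \<times> {0..1}) (\<lambda>z. H (fst z) (snd z))"
      unfolding H_def
    proof (rule continuous_on_sgn)
      show "continuous_on ({0..1} \<times> {0..1}) (\<lambda>z. (1 - fst z) *\<^sub>R y0 (snd z) + fst z *\<^sub>R y1 (snd z))"
        by (intro continuous_intros continuous_on_compose2[OF yc(1)] continuous_on_compose2[OF yc(2)]) auto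
      show "\<forall>z\<in>{0..1} \<times> {0..1}. (1 - fst z) *\<^sub>R y0 (snd z) + fst z *\<^sub>R y1 (snd z) \<noteq> 0"
      proof
        fix z :: "real \<times> real" assume "z \<in> {0..1} \<times> {0..1}"
        then show "(1 - fst z) *\<^sub>R y0 (snd z) + fst z *\<^sub>R y1 (snd z) \<noteq> 0"
          using mid[of "fst z" "snd z"] by (metis inner_zero_right less_irrefl mem_Times_iff)
      qed
    qed
    show "H 0 t = (g \<circ> circlepath q \<epsilon>) t" for t using n0(1)[of t] by (simp add: H_def sgn_div_norm y0_def)
    show "H 1 t = y1 t" for t using n1(1)[of t] by (simp add: H_def sgn_div_norm)
    show "H s 0 = H s 1" for s by (simp add: H_def y0_def y1_def circ cap_boundary_def)
    fix s t :: real assume s: "s \<in> {0..1}"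
    let ?z = "(1 - s) *\<^sub>R y0 t + s *\<^sub>R y1 t"
    have nz: "?z \<noteq> 0" using mid[OF s, of t] by (metis inner_zero_right less_irrefl)
    show "H s t \<in> ?X"
    proof (rule in_punctured_sphere_cap[of P p r])
      show "\<forall>z\<in>P - {p}. p \<bullet> z < cos r" using c0(3) r(3) by auto
      show "norm (H s t) = 1" using nz by (simp add: H_def norm_sgn)
      have le: "norm ?z \<le> 1"
        using s n0(1) n1(1) norm_triangle_ineq[of "(1 - s) *\<^sub>R y0 t" "s *\<^sub>R y1 t"] by simp
      have "(1 - s) * c0 + s * c0 \<le> p \<bullet> ?z"
        unfolding inner_add_right inner_scaleR_right using s n0(2)[of t] n1(2)[of t]
        by (intro add_mono mult_left_mono) auto
      then have ge: "c0 \<le> p \<bullet> ?z" by (simp add: algebra_simps)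
      have "c0 * norm ?z \<le> c0 * 1" using le c0(1) by (intro mult_left_mono) auto
      then have "c0 \<le> (p \<bullet> ?z) / norm ?z" using ge nz by (simp add: pos_le_divide_eq)
      then show "cos r \<le> p \<bullet> H s t" by (simp add: H_def sgn_div_norm r(3) divide_inverse mult.commute)
      have "dir t \<bullet> H s t > 0" using mid[OF s, of t] nz by (simp add: H_def sgn_div_norm)
      then show "H s t \<noteq> p" using pd[of t] by (auto simp: inner_commute)
    qed
  qed
  then have "homotopic_loops ?X (?MA +++ reversepath ?MB) (cap_boundary p r u v)"
    using lune_circ homotopic_loops_trans unfolding y1_def by blast
  moreover have "\<forall>z\<in>P - {p}. p \<bullet> z < cos r" using c0(3) r(3) by auto
  ultimately show ?thesis unfolding ccw_loop_around_def using r uv uvp by blast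
qed

end

subsection \<open>Two geodesically star-shaped charts\<close>

text \<open>The sphere minus the geodesic arcs that run from the punctures away from \<open>c\<close>.\<close>

definition star :: "(real^3) set \<Rightarrow> real^3 \<Rightarrow> (real^3) set" where
  "star P c = {y \<in> sphere 0 1. \<forall>p\<in>P. \<forall>\<alpha>\<ge>0. \<forall>\<beta>\<ge>0. y \<noteq> \<alpha> *\<^sub>R p - \<beta> *\<^sub>R c}"

lemma mem_starD: "y \<in> star P c \<Longrightarrow> p \<in> P \<Longrightarrow> 0 \<le> \<alpha> \<Longrightarrow> 0 \<le> \<beta> \<Longrightarrow> y \<noteq> \<alpha> *\<^sub>R p - \<beta> *\<^sub>R c"
  by (simp add: star_def)

lemma star_subset_punctured: "star P c \<subseteq> punctured_sphere P"
proof
  fix y assume y: "y \<in> star P c"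
  have "y \<notin> P" using mem_starD[OF y, of y 1 0] by auto
  then show "y \<in> punctured_sphere P" using y by (simp add: star_def punctured_sphere_def)
qed

lemma independent_pairD:
  fixes p q c :: "real^3"
  assumes "c \<notin> span {p, q}" "\<alpha> *\<^sub>R p + \<beta> *\<^sub>R q = \<gamma> *\<^sub>R c"
  shows "\<gamma> = 0"
proof (rule ccontr)
  assume g: "\<gamma> \<noteq> 0"
  have "\<alpha> *\<^sub>R p + \<beta> *\<^sub>R q \<in> span {p, q}" by (intro span_add span_scale span_base) auto
  then have "(1 / \<gamma>) *\<^sub>R (\<gamma> *\<^sub>R c) \<in> span {p, q}" unfolding assms(2) by (rule span_scale)
  then show False using g assms(1) by simp
qed

text \<open>Each removed arc is the radial projection of a segment that misses the origin, hence compact.\<close>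

lemma open_star:
  assumes P: "finite P" "P \<subseteq> sphere 0 1" and c: "\<And>p q. p \<in> P \<Longrightarrow> q \<in> P \<Longrightarrow> c \<notin> span {p, q}"
  shows "openin (top_of_set (punctured_sphere P)) (star P c)"
proof -
  define K where "K = (\<lambda>p. sgn ` closed_segment p (- c))"
  have nz: "y \<noteq> 0" if pp: "p \<in> P" "y \<in> closed_segment p (- c)" for p y
  proof
    assume y0: "y = 0"
    obtain t where t: "y = (1 - t) *\<^sub>R p + t *\<^sub>R (- c)" using pp(2) by (auto simp: closed_segment_def)
    then have "(1 - t) *\<^sub>R p + 0 *\<^sub>R p = t *\<^sub>R c" using y0 by (simp add: eq_neg_iff_add_eq_0)
    then have "t = 0" using independent_pairD[OF c[OF pp(1,1)]] by blast
    then have "p = 0" using t y0 by simp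
    then show False using pp(1) P(2) by auto
  qed
  have "compact (K p)" if "p \<in> P" for p
    unfolding K_def by (intro compact_continuous_image continuous_on_sgn continuous_on_id ballI nz[OF that]) auto
  then have "closed (\<Union>p\<in>P. K p)" using P(1) by (intro closed_UN) (auto intro: compact_imp_closed)
  moreover have "star P c = punctured_sphere P \<inter> - (\<Union>p\<in>P. K p)"
  proof (intro equalityI subsetI)
    fix y assume y: "y \<in> star P c"
    have "y \<notin> K p" if p: "p \<in> P" for p
    proof
      assume "y \<in> K p"
      then obtain w where w: "w \<in> closed_segment p (- c)" "y = sgn w" by (auto simp: K_def)
      then obtain t where t: "0 \<le> t" "t \<le> 1" "w = (1 - t) *\<^sub>R p + t *\<^sub>R (- c)" by (auto simp: closed_segment_def)
      have "y = ((1 - t) / norm w) *\<^sub>R p - (t / norm w) *\<^sub>R c"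
        unfolding w(2) sgn_div_norm by (subst (2) t(3)) (simp add: scaleR_diff_right divide_inverse mult.commute)
      then show False using mem_starD[OF y p, of "(1 - t) / norm w" "t / norm w"] t by simp
    qed
    then show "y \<in> punctured_sphere P \<inter> - (\<Union>p\<in>P. K p)" using y star_subset_punctured by auto
  next
    fix y assume y: "y \<in> punctured_sphere P \<inter> - (\<Union>p\<in>P. K p)"
    then have n1: "norm y = 1" by (auto simp: punctured_sphere_def)
    have "y \<noteq> \<alpha> *\<^sub>R p - \<beta> *\<^sub>R c" if p: "p \<in> P" and ab: "0 \<le> \<alpha>" "0 \<le> \<beta>" for p \<alpha> \<beta>
    proof
      assume eq: "y = \<alpha> *\<^sub>R p - \<beta> *\<^sub>R c"
      define s where "s = \<alpha> + \<beta>"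
      have "s \<noteq> 0"
      proof
        assume "s = 0"
        then have "\<alpha> = 0" "\<beta> = 0" using ab by (auto simp: s_def)
        then show False using eq n1 by simp
      qed
      then have s: "s > 0" using ab by (simp add: s_def)
      define t where "t = \<beta> / s"
      have t: "0 \<le> t" "t \<le> 1" "1 - t = \<alpha> / s" using ab s by (auto simp: t_def s_def field_simps)
      have seg: "(1 - t) *\<^sub>R p + t *\<^sub>R (- c) \<in> closed_segment p (- c)"
        unfolding closed_segment_def using t(1,2) by blast
      have "(1 - t) *\<^sub>R p + t *\<^sub>R (- c) = (1 / s) *\<^sub>R y"
        unfolding t(3) eq by (simp add: t_def scaleR_diff_right)
      then have "sgn ((1 - t) *\<^sub>R p + t *\<^sub>R (- c)) = y"
        using s n1 by (simp add: sgn_div_norm)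
      then have "y \<in> K p" unfolding K_def using seg by (metis imageI)
      then show False using y p by auto
    qed
    then show "y \<in> star P c" using n1 by (auto simp: star_def)
  qed
  ultimately show ?thesis by (metis openin_open open_Compl)
qed

text \<open>Moving every point along the great circle towards \<open>c\<close> contracts the star.\<close>

lemma simply_connected_star:
  assumes P: "P \<noteq> {}" and c: "norm c = 1" "\<And>p q. p \<in> P \<Longrightarrow> q \<in> P \<Longrightarrow> c \<notin> span {p, q}"
  shows "simply_connected (star P c)" "c \<in> star P c"
proof -
  show cS: "c \<in> star P c"
    unfolding star_def
  proof (intro CollectI conjI ballI allI impI)
    fix p :: "real^3" and \<alpha> \<beta> :: real assume p: "p \<in> P" and ab: "0 \<le> \<alpha>" "0 \<le> (\<beta>::real)"
    show "c \<noteq> \<alpha> *\<^sub>R p - \<beta> *\<^sub>R c"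
    proof
      assume "c = \<alpha> *\<^sub>R p - \<beta> *\<^sub>R c"
      then have "\<alpha> *\<^sub>R p + 0 *\<^sub>R p = (1 + \<beta>) *\<^sub>R c" by (simp add: scaleR_add_left eq_diff_eq)
      then have "1 + \<beta> = 0" using independent_pairD[OF c(2)[OF p p]] by blast
      then show False using ab by simp
    qed
  qed (use c in simp)
  define h where "h = (\<lambda>z::real \<times> (real^3). (1 - fst z) *\<^sub>R snd z + fst z *\<^sub>R c)"
  have nz: "h z \<noteq> 0" if zS: "z \<in> {0..1} \<times> star P c" for z
  proof
    obtain s y where z: "z = (s, y)" "0 \<le> s" "s \<le> 1" "y \<in> star P c" using zS by auto
    assume "h z = 0"
    then have eq: "(1 - s) *\<^sub>R y = - (s *\<^sub>R c)" by (simp add: h_def z(1) eq_neg_iff_add_eq_0)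
    have "s \<noteq> 1" using eq c(1) by auto
    then have "y = 0 *\<^sub>R (SOME p. p \<in> P) - (s / (1 - s)) *\<^sub>R c"
    proof -
      have "y = (1 / (1 - s)) *\<^sub>R ((1 - s) *\<^sub>R y)" using \<open>s \<noteq> 1\<close> by simp
      then show ?thesis unfolding eq by simp
    qed
    moreover have "(SOME p. p \<in> P) \<in> P" using P by (simp add: some_in_eq)
    ultimately show False using mem_starD[OF z(4), of _ 0 "s / (1 - s)"] z(2,3) by simp
  qed
  have into: "sgn (h z) \<in> star P c" if zS: "z \<in> {0..1} \<times> star P c" for z
    unfolding star_def
  proof (intro CollectI conjI ballI allI impI)
    show "sgn (h z) \<in> sphere 0 1" using nz[OF zS] by (simp add: norm_sgn)
    fix p :: "real^3" and \<alpha> \<beta> :: real assume p: "p \<in> P" and ab: "0 \<le> \<alpha>" "0 \<le> (\<beta>::real)"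
    obtain s y where z: "z = (s, y)" "0 \<le> s" "s \<le> 1" "y \<in> star P c" using zS by auto
    define N where "N = norm (h z)"
    have N: "N > 0" using nz[OF zS] by (simp add: N_def)
    show "sgn (h z) \<noteq> \<alpha> *\<^sub>R p - \<beta> *\<^sub>R c"
    proof
      assume "sgn (h z) = \<alpha> *\<^sub>R p - \<beta> *\<^sub>R c"
      then have "N *\<^sub>R sgn (h z) = N *\<^sub>R (\<alpha> *\<^sub>R p - \<beta> *\<^sub>R c)" by simp
      then have eq: "(1 - s) *\<^sub>R y + s *\<^sub>R c = (N * \<alpha>) *\<^sub>R p - (N * \<beta>) *\<^sub>R c"
        using N by (simp add: N_def sgn_div_norm h_def z(1) scaleR_diff_right)
      show False
      proof (cases "s = 1")
        case True
        have "c = (N * \<alpha>) *\<^sub>R p - (N * \<beta>) *\<^sub>R c" using eq True by simp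
        then show False using mem_starD[OF cS p, of "N * \<alpha>" "N * \<beta>"] N ab by simp
      next
        case False
        have "(1 - s) *\<^sub>R y = (N * \<alpha>) *\<^sub>R p - (N * \<beta> + s) *\<^sub>R c"
          using eq by (simp add: scaleR_add_left algebra_simps)
        then have "y = (1 / (1 - s)) *\<^sub>R ((N * \<alpha>) *\<^sub>R p - (N * \<beta> + s) *\<^sub>R c)"
          using False by (metis diff_eq_diff_eq diff_self divide_self_if eq_iff_diff_eq_0 scaleR_one scaleR_scaleR times_divide_eq_left mult_1)
        then have "y = (N * \<alpha> / (1 - s)) *\<^sub>R p - ((N * \<beta> + s) / (1 - s)) *\<^sub>R c"
          by (simp add: scaleR_diff_right)
        then show False
          using mem_starD[OF z(4) p, of "N * \<alpha> / (1 - s)" "(N * \<beta> + s) / (1 - s)"] N ab z(2,3) by simp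
      qed
    qed
  qed
  have cont: "continuous_on ({0..1} \<times> star P c) (\<lambda>z. sgn (h z))"
  proof (rule continuous_on_sgn)
    show "continuous_on ({0..1} \<times> star P c) h" unfolding h_def by (intro continuous_intros)
    show "\<forall>z\<in>{0..1} \<times> star P c. h z \<noteq> 0" using nz by blast
  qed
  have "homotopic_with_canon (\<lambda>x. True) (star P c) (star P c) id (\<lambda>x. c)"
  proof (subst homotopic_with, simp, intro exI[of _ "\<lambda>z. sgn (h z)"] conjI allI ballI)
    show "continuous_map (prod_topology (top_of_set {0..1}) (top_of_set (star P c))) (top_of_set (star P c)) (\<lambda>z. sgn (h z))"
      using cont into by (auto simp: continuous_map_in_subtopology)
    show "sgn (h (0, y)) = id y" if "y \<in> topspace (top_of_set (star P c))" for y
      using that by (simp add: h_def star_def sgn_div_norm)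
    show "sgn (h (1, y)) = c" if "y \<in> topspace (top_of_set (star P c))" for y using c(1) by (simp add: h_def sgn_div_norm)
  qed simp
  then show "simply_connected (star P c)"
    using contractible_imp_simply_connected unfolding contractible_def by blast
qed

subsection \<open>Existence of geometric presentations\<close>

text \<open>Finitely many planes and lines do not cover the space.\<close>

lemma generic_point:
  fixes S :: "(real^3) set"
  assumes "finite S"
  obtains b where "norm b = 1" "\<And>p q. p \<in> S \<Longrightarrow> q \<in> S \<Longrightarrow> b \<notin> span {p, q}"
proof -
  have neg: "negligible (span {p, q})" for p q :: "real^3"
  proof (rule negligible_lowdim)
    have "dim (span {p, q}) \<le> card {p, q}" by (simp add: dim_le_card')
    also have "\<dots> \<le> 2" by (simp add: card_insert_if)
    finally show "dim (span {p, q}) < DIM(real^3)" by simp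
  qed
  have "negligible (insert 0 (\<Union>z\<in>S \<times> S. span {fst z, snd z}))"
    using assms neg by (intro negligible_insert[THEN iffD2] negligible_Union) auto
  then have "insert 0 (\<Union>z\<in>S \<times> S. span {fst z, snd z}) \<noteq> UNIV"
    using non_negligible_UNIV by metis
  then obtain b0 where b: "b0 \<notin> insert 0 (\<Union>z\<in>S \<times> S. span {fst z, snd z})" by blast
  have b0: "b0 \<noteq> 0" using b by simp
  have b1: "b0 \<notin> span {p, q}" if "p \<in> S" "q \<in> S" for p q
  proof
    assume "b0 \<in> span {p, q}"
    then have "b0 \<in> (\<Union>z\<in>S \<times> S. span {fst z, snd z})"
      using that by (intro UN_I[of "(p, q)"]) simp_all
    then show False using b by blast
  qed
  have "(1 / norm b0) *\<^sub>R b0 \<notin> span {p, q}" if "p \<in> S" "q \<in> S" for p q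
  proof
    assume "(1 / norm b0) *\<^sub>R b0 \<in> span {p, q}"
    then have "norm b0 *\<^sub>R ((1 / norm b0) *\<^sub>R b0) \<in> span {p, q}" by (rule span_scale)
    moreover have "norm b0 *\<^sub>R ((1 / norm b0) *\<^sub>R b0) = b0" using b0 by simp
    ultimately show False using b1[OF that] by (simp only:)
  qed
  moreover have "norm ((1 / norm b0) *\<^sub>R b0) = 1" using b0 by simp
  ultimately show ?thesis by (rule that[rotated])
qed

lemma enumerate_by_key:
  fixes f :: "'a \<Rightarrow> real"
  assumes "finite S" "card S = n" "inj_on f S"
  obtains e where "bij_betw e {..<n} S" "\<And>i j. i < j \<Longrightarrow> j < n \<Longrightarrow> f (e i) < f (e j)"
proof -
  define xs where "xs = sorted_list_of_set (f ` S)"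
  have xs: "set xs = f ` S" "sorted_wrt (<) xs" "length xs = n" "distinct xs"
    using assms by (simp_all add: xs_def card_image)
  define e where "e = (\<lambda>i. inv_into S f (xs ! i))"
  have b1: "bij_betw ((!) xs) {..<n} (f ` S)"
    using bij_betw_nth[OF xs(4)] xs(1,3) by simp
  have "bij_betw (inv_into S f) (f ` S) S" using assms(3) by (intro bij_betw_inv_into) (simp add: bij_betw_def)
  then have "bij_betw (inv_into S f \<circ> (!) xs) {..<n} S" using b1 bij_betw_trans by blast
  then have bij: "bij_betw e {..<n} S" by (simp add: e_def comp_def)
  have fe: "f (e i) = xs ! i" if "i < n" for i
    unfolding e_def using that xs(1,3) by (intro f_inv_into_f) (metis nth_mem)
  have "f (e i) < f (e j)" if "i < j" "j < n" for i j
    using fe that sorted_wrt_nth_less[OF xs(2) that(1)] xs(3) by simp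
  then show ?thesis using that bij by blast
qed

text \<open>For \<open>b\<close> in general position the punctures have different longitudes with respect to the axis \<open>b\<close>, and
  the stars with the centres \<open>b\<close> and \<open>- b\<close> are the charts: a meridian arc removed from one of them ends at
  \<open>- b\<close>, in the other at \<open>b\<close>. They meet in the complement of the full meridians through the punctures.
  The meridians in the middle of the resulting lunes give the generators.\<close>

lemma geometric_presentation_exists:
  fixes P :: "(real^3) set"
  assumes n: "n \<ge> 3" and P: "P \<subseteq> sphere 0 1" "finite P" "card P = n" and x: "x \<in> punctured_sphere P"
  obtains c where "geometric_presentation P x n c"
proof -
  let ?X = "punctured_sphere P"
  obtain b where b: "norm b = 1" "\<And>p q. p \<in> insert x P \<Longrightarrow> q \<in> insert x P \<Longrightarrow> b \<notin> span {p, q}"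
    using generic_point[of "insert x P"] P(2) by auto
  have Pne: "P \<noteq> {}" using P n by auto
  have nP: "norm p = 1" if "p \<in> P" for p using that P(1) by auto
  then obtain p0 where p0: "p0 \<in> P" using Pne by auto
  \<comment> \<open>in a frame in which one puncture has longitude \<open>0\<close>, no lune contains the cut of \<open>Arg2pi\<close>\<close>
  have bb: "b \<bullet> b = 1" using b(1) by (simp add: norm_eq_1)
  define w where "w = p0 - (b \<bullet> p0) *\<^sub>R b"
  have "w \<noteq> 0"
  proof
    assume "w = 0"
    then have eq: "1 *\<^sub>R p0 + 0 *\<^sub>R p0 = (b \<bullet> p0) *\<^sub>R b" by (simp add: w_def)
    then have "b \<bullet> p0 = 0" using independent_pairD[OF b(2)[of p0 p0]] p0 by blast
    then show False using eq nP[OF p0] by simp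
  qed
  define e1 where "e1 = (1 / norm w) *\<^sub>R w"
  define e2 where "e2 = cross3 b e1"
  have bw: "b \<bullet> w = 0" using bb by (simp add: w_def inner_diff_right)
  have ne1: "norm e1 = 1" using \<open>w \<noteq> 0\<close> by (simp add: e1_def)
  have e1e1: "e1 \<bullet> e1 = 1" using ne1 by (simp only: norm_eq_1)
  have "b \<bullet> e1 = 0" using bw by (simp add: e1_def)
  note e1 = ne1 this e1e1
  have e2: "e1 \<bullet> e2 = 0" "cross3 e1 e2 = b"
    using e1 by (simp_all add: e2_def dot_cross_self Lagrange inner_commute)
  have "(norm e2)\<^sup>2 = 1" using norm_cross_dot[of b e1] b(1) e1 by (simp add: e2_def)
  then have ne2: "norm e2 = 1" by (simp add: power2_eq_1_iff) (smt (verit) norm_ge_zero)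
  interpret sphere_frame e1 e2 b by unfold_locales (use e1 e2 ne2 in auto)
  have eqnz: "equatorial p \<noteq> 0" if "p \<in> P" for p
  proof
    assume "equatorial p = 0"
    then have "equatorial p = of_real 0 * equatorial p" by simp
    from equatorial_eqI[OF this] have eq: "1 *\<^sub>R p + 0 *\<^sub>R p = (b \<bullet> p) *\<^sub>R b" by simp
    then have "b \<bullet> p = 0" using independent_pairD[OF b(2)[of p p]] that by blast
    then show False using eq nP[OF that] by simp
  qed
  define \<theta> where "\<theta> = (\<lambda>p. Arg2pi (equatorial p))"
  have \<theta>: "0 \<le> \<theta> p" "\<theta> p < 2 * pi" for p using Arg2pi by (auto simp: \<theta>_def)
  have same_arg: "\<exists>s>0. equatorial y = of_real s * equatorial z"
    if "equatorial y \<noteq> 0" "equatorial z \<noteq> 0" "\<theta> y = \<theta> z" for y z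
  proof -
    let ?s = "cmod (equatorial y) / cmod (equatorial z)"
    have "equatorial y = of_real (cmod (equatorial y)) * exp (\<i> * of_real (\<theta> z))"
      using Arg2pi_eq[of "equatorial y"] that(3) by (simp add: \<theta>_def)
    moreover have "equatorial z = of_real (cmod (equatorial z)) * exp (\<i> * of_real (\<theta> z))"
      using Arg2pi_eq[of "equatorial z"] by (simp add: \<theta>_def)
    ultimately have "equatorial y = of_real ?s * equatorial z"
      using that(2) by (metis (no_types, lifting) mult.assoc nonzero_eq_divide_eq norm_eq_zero of_real_divide of_real_eq_0_iff)
    moreover have "?s > 0" using that by simp
    ultimately show ?thesis by blast
  qed
  have inj: "inj_on \<theta> P"
  proof (rule inj_onI)
    fix p q assume pq: "p \<in> P" "q \<in> P" "\<theta> p = \<theta> q"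
    obtain s where s: "s > 0" "equatorial p = of_real s * equatorial q"
      using same_arg[OF eqnz eqnz] pq by blast
    have "1 *\<^sub>R p + (- s) *\<^sub>R q = (b \<bullet> p - s * (b \<bullet> q)) *\<^sub>R b" using equatorial_eqI[OF s(2)] by simp
    moreover from this have "b \<bullet> p - s * (b \<bullet> q) = 0" using independent_pairD[OF b(2)[of p q]] pq by blast
    ultimately have "p = s *\<^sub>R q" by simp
    then show "p = q" using nP[OF pq(1)] nP[OF pq(2)] s(1) by simp
  qed
  obtain pt where pt: "bij_betw pt {..<n} P" and mono: "\<And>i j. i < j \<Longrightarrow> j < n \<Longrightarrow> \<theta> (pt i) < \<theta> (pt j)"
    using enumerate_by_key[OF P(2,3) inj] by blast
  define th where "th = (\<lambda>k. \<theta> (pt k))"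
  have ptP: "pt k \<in> P" if "k < n" for k using pt that by (auto simp: bij_betw_def)
  have th_mono: "th i < th j" if "i < j" "j < n" for i j using mono that by (simp add: th_def)
  have th_mono_le: "th i \<le> th j" if "i \<le> j" "j < n" for i j using th_mono[of i j] that by (cases "i = j") auto
  have th_bd: "0 \<le> th k" "th k < 2 * pi" for k using \<theta> by (auto simp: th_def)
  have th0: "th 0 = 0"
  proof -
    have "\<theta> p0 = 0"
    proof -
      have "p0 = w + (b \<bullet> p0) *\<^sub>R b" by (simp add: w_def)
      then have "p0 = norm w *\<^sub>R e1 + (b \<bullet> p0) *\<^sub>R b" using \<open>w \<noteq> 0\<close> by (simp add: e1_def)
      then have "equatorial p0 = of_real (norm w) * equatorial e1" using equatorial_lin by metis
      also have "equatorial e1 = 1" by (simp add: equatorial_def complex_eq_iff)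
      finally show ?thesis by (simp add: \<theta>_def Arg2pi_eq_0)
    qed
    moreover obtain i where "i < n" "p0 = pt i" using pt p0 by (auto simp: bij_betw_def)
    ultimately have "th i = 0" by (simp add: th_def)
    then show ?thesis using th_mono_le[of 0 i] th_bd[of 0] \<open>i < n\<close> by simp
  qed
  \<comment> \<open>The lune that ends at longitude \<open>2 \<pi>\<close> comes first, so that the \<open>k\<close>-th puncture lies between the
    \<open>k\<close>-th and the next lune, cyclically.\<close>
  define lo where "lo = (\<lambda>k. if k = 0 then th (n - 1) else th (k - 1))"
  define hi where "hi = (\<lambda>k. if k = 0 then 2 * pi else th k)"
  define \<mu> where "\<mu> = (\<lambda>k. (lo k + hi k) / 2)"
  have lohi: "lo k < hi k" "0 \<le> lo k" "hi k \<le> 2 * pi" if "k < n" for k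
    using that th_bd th_mono[of "k - 1" k] by (auto simp: lo_def hi_def less_imp_le)
  have \<mu>: "lo k < \<mu> k" "\<mu> k < hi k" "0 < \<mu> k" "\<mu> k < 2 * pi" if "k < n" for k
    using lohi[OF that] by (auto simp: \<mu>_def)
  define L where "L = (\<lambda>k. {y \<in> sphere 0 1. equatorial y \<noteq> 0 \<and> lo k < \<theta> y \<and> \<theta> y < hi k})"
  let ?U = "star P b" and ?V = "star P (- b)"
  have bP: "b \<notin> span {p, q}" if "p \<in> P" "q \<in> P" for p q using b(2) that by auto
  have bP': "- b \<notin> span {p, q}" if "p \<in> P" "q \<in> P" for p q
    using bP[OF that] span_neg[of "- b" "{p, q}"] by auto
  have memU: "\<And>y p \<alpha> \<beta>. y \<in> ?U \<Longrightarrow> p \<in> P \<Longrightarrow> 0 \<le> \<alpha> \<Longrightarrow> 0 \<le> \<beta> \<Longrightarrow> y \<noteq> \<alpha> *\<^sub>R p - \<beta> *\<^sub>R b"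
    and memV: "\<And>y p \<alpha> \<beta>. y \<in> ?V \<Longrightarrow> p \<in> P \<Longrightarrow> 0 \<le> \<alpha> \<Longrightarrow> 0 \<le> \<beta> \<Longrightarrow> y \<noteq> \<alpha> *\<^sub>R p + \<beta> *\<^sub>R b"
    using mem_starD by fastforce+
  have cover: "?X = ?U \<union> ?V"
  proof
    show "?U \<union> ?V \<subseteq> ?X" using star_subset_punctured by blast
    show "?X \<subseteq> ?U \<union> ?V"
    proof
      fix y assume y: "y \<in> ?X"
      show "y \<in> ?U \<union> ?V"
      proof (rule ccontr)
        assume "\<not> ?thesis"
        then obtain p \<alpha> \<beta> q \<gamma> \<delta> where pq: "p \<in> P" "q \<in> P" and nn: "0 \<le> \<alpha>" "0 \<le> \<beta>" "0 \<le> \<gamma>" "0 \<le> (\<delta>::real)"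
          and eq: "y = \<alpha> *\<^sub>R p - \<beta> *\<^sub>R b" "y = \<gamma> *\<^sub>R q + \<delta> *\<^sub>R b"
          using y by (auto simp: star_def punctured_sphere_def)
        have "\<alpha> *\<^sub>R p + (- \<gamma>) *\<^sub>R q = (\<beta> + \<delta>) *\<^sub>R b"
          using eq by (simp add: scaleR_add_left algebra_simps)
        then have "\<beta> + \<delta> = 0" using independent_pairD[OF bP[OF pq]] by blast
        then have "\<beta> = 0" using nn by auto
        then have "y = \<alpha> *\<^sub>R p" using eq by simp
        moreover have "norm y = 1" using y by (auto simp: punctured_sphere_def)
        ultimately have "y = p" using nn nP[OF pq(1)] by simp
        then show False using y pq by (auto simp: punctured_sphere_def)
      qed
    qed
  qed
  have xU: "x \<in> ?U"
    unfolding star_def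
  proof (intro CollectI conjI ballI allI impI)
    show x1: "x \<in> sphere 0 1" using x by (simp add: punctured_sphere_def)
    fix p :: "real^3" and \<alpha> \<beta> :: real assume p: "p \<in> P" and ab: "0 \<le> \<alpha>" "0 \<le> (\<beta>::real)"
    show "x \<noteq> \<alpha> *\<^sub>R p - \<beta> *\<^sub>R b"
    proof
      assume eq: "x = \<alpha> *\<^sub>R p - \<beta> *\<^sub>R b"
      then have "\<alpha> *\<^sub>R p + (- 1) *\<^sub>R x = \<beta> *\<^sub>R b" by simp
      then have "\<beta> = 0" using independent_pairD[OF b(2)[of p x]] p by blast
      then have "x = p" using eq ab x1 nP[OF p] by simp
      then show False using x p by (simp add: punctured_sphere_def)
    qed
  qed
  have memUV: "y \<in> ?U \<inter> ?V \<longleftrightarrow> y \<in> sphere 0 1 \<and> equatorial y \<noteq> 0 \<and> (\<forall>k<n. \<theta> y \<noteq> th k)" for y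
  proof
    assume y: "y \<in> ?U \<inter> ?V"
    then have y1: "y \<in> sphere 0 1" by (simp add: star_def)
    have enz: "equatorial y \<noteq> 0"
    proof
      assume "equatorial y = 0"
      then have "equatorial y = of_real 0 * equatorial y" by simp
      from equatorial_eqI[OF this] have eq: "y = (b \<bullet> y) *\<^sub>R b" by simp
      show False
      proof (cases "b \<bullet> y \<ge> 0")
        case True
        then show False using memV[of y p0 0 "b \<bullet> y"] y p0 eq by simp
      next
        case False
        then show False using memU[of y p0 0 "- (b \<bullet> y)"] y p0 eq by simp
      qed
    qed
    have "\<theta> y \<noteq> th k" if k: "k < n" for k
    proof
      assume "\<theta> y = th k"
      then obtain s where s: "s > 0" "equatorial y = of_real s * equatorial (pt k)"
        using same_arg[OF enz eqnz[OF ptP[OF k]]] by (auto simp: th_def)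
      define g where "g = b \<bullet> y - s * (b \<bullet> pt k)"
      have eq: "y = s *\<^sub>R pt k + g *\<^sub>R b" using equatorial_eqI[OF s(2)] by (simp add: g_def algebra_simps)
      show False
      proof (cases "g \<ge> 0")
        case True
        then show False using memV[of y "pt k" s g] y ptP[OF k] eq s(1) by simp
      next
        case False
        then show False using memU[of y "pt k" s "- g"] y ptP[OF k] eq s(1) by simp
      qed
    qed
    then show "y \<in> sphere 0 1 \<and> equatorial y \<noteq> 0 \<and> (\<forall>k<n. \<theta> y \<noteq> th k)" using y1 enz by blast
  next
    assume y: "y \<in> sphere 0 1 \<and> equatorial y \<noteq> 0 \<and> (\<forall>k<n. \<theta> y \<noteq> th k)"
    have "y \<noteq> \<alpha> *\<^sub>R p + \<beta> *\<^sub>R b" if p: "p \<in> P" and a: "0 \<le> \<alpha>" for p \<alpha> \<beta>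
    proof
      assume "y = \<alpha> *\<^sub>R p + \<beta> *\<^sub>R b"
      then have e: "equatorial y = of_real \<alpha> * equatorial p" using equatorial_lin by metis
      then have "\<alpha> \<noteq> 0" using y by auto
      then have "\<theta> y = \<theta> p" unfolding \<theta>_def e using a Arg2pi_times_of_real by simp
      moreover obtain k where "k < n" "p = pt k" using pt p by (auto simp: bij_betw_def)
      ultimately show False using y by (auto simp: th_def)
    qed
    note off = this
    have "y \<noteq> \<alpha> *\<^sub>R p - \<beta> *\<^sub>R b" if "p \<in> P" "0 \<le> \<alpha>" for p \<alpha> \<beta>
      using off[OF that, of "- \<beta>"] by simp
    moreover have "y \<noteq> \<alpha> *\<^sub>R p - \<beta> *\<^sub>R (- b)" if "p \<in> P" "0 \<le> \<alpha>" for p \<alpha> \<beta>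
      using off[OF that, of \<beta>] by simp
    ultimately show "y \<in> ?U \<inter> ?V" using y by (simp add: star_def)
  qed
  have L_sub: "L k \<subseteq> ?U \<inter> ?V" if k: "k < n" for k
  proof
    fix y assume y: "y \<in> L k"
    have "\<theta> y \<noteq> th j" if j: "j < n" for j
    proof (cases "k = 0")
      case True
      then have "\<theta> y > th (n - 1)" using y by (simp add: L_def lo_def)
      moreover have "th j \<le> th (n - 1)" using th_mono_le[of j "n - 1"] j n by simp
      ultimately show ?thesis by auto
    next
      case False
      have "th (k - 1) < \<theta> y" "\<theta> y < th k" using False y by (simp_all add: L_def lo_def hi_def)
      show ?thesis
      proof (cases "j < k")
        case True
        then have "th j \<le> th (k - 1)" using k by (intro th_mono_le) auto
        then show ?thesis using \<open>th (k - 1) < \<theta> y\<close> by linarith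
      next
        case False
        then have "th k \<le> th j" using j by (intro th_mono_le) auto
        then show ?thesis using \<open>\<theta> y < th k\<close> by linarith
      qed
    qed
    then show "y \<in> ?U \<inter> ?V" unfolding memUV using y by (simp add: L_def)
  qed
  have int: "?U \<inter> ?V = (\<Union>k<n. L k)"
  proof
    show "(\<Union>k<n. L k) \<subseteq> ?U \<inter> ?V" using L_sub by blast
    show "?U \<inter> ?V \<subseteq> (\<Union>k<n. L k)"
    proof
      fix y assume "y \<in> ?U \<inter> ?V"
      then have y: "y \<in> sphere 0 1" "equatorial y \<noteq> 0" "\<And>k. k < n \<Longrightarrow> \<theta> y \<noteq> th k" unfolding memUV by blast+
      have "\<exists>k<n. lo k < \<theta> y \<and> \<theta> y < hi k"
      proof (cases "\<theta> y > th (n - 1)")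
        case True
        then show ?thesis using \<theta>(2)[of y] n by (intro exI[of _ 0]) (simp add: lo_def hi_def)
      next
        case False
        define k where "k = (LEAST k. \<theta> y < th k)"
        have ex: "\<theta> y < th (n - 1)" using False y(3)[of "n - 1"] n by simp
        have k1: "\<theta> y < th k" unfolding k_def by (rule LeastI[of _ "n - 1"]) (rule ex)
        have k2: "k \<le> n - 1" unfolding k_def by (rule Least_le) (rule ex)
        have k0: "k \<noteq> 0" using k1 th0 \<theta>(1)[of y] by (cases k) auto
        have "\<not> \<theta> y < th (k - 1)" unfolding k_def using k0 not_less_Least[of "k - 1" "\<lambda>k. \<theta> y < th k"] by (simp add: k_def)
        moreover have "k - 1 < n" using k2 n by simp
        then have "\<theta> y \<noteq> th (k - 1)" by (rule y(3))
        ultimately have "th (k - 1) < \<theta> y" by linarith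
        then show ?thesis using k1 k2 k0 n by (intro exI[of _ k]) (simp add: lo_def hi_def)
      qed
      then show "y \<in> (\<Union>k<n. L k)" using y(1,2) by (auto simp: L_def)
    qed
  qed
  have L_disj: "L j \<inter> L k = {}" if jk: "j < k" "k < n" for j k
  proof (cases "j = 0")
    case True
    moreover have "th k \<le> th (n - 1)" using jk by (intro th_mono_le) auto
    ultimately show ?thesis using jk by (auto simp: L_def lo_def hi_def)
  next
    case False
    moreover have "th j \<le> th (k - 1)" using jk by (intro th_mono_le) auto
    ultimately show ?thesis using jk by (auto simp: L_def lo_def hi_def)
  qed
  have L_open: "openin (top_of_set ?X) (L k)" if k: "k < n" for k
  proof -
    define W where "W = (- \<real>\<^sub>\<ge>\<^sub>0) \<inter> Arg2pi -` {lo k<..<hi k}"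
    have "continuous_on (- \<real>\<^sub>\<ge>\<^sub>0) Arg2pi"
      by (intro continuous_at_imp_continuous_on ballI continuous_at_Arg2pi) simp
    then have "open W" unfolding W_def
      by (rule continuous_open_preimage) (auto simp: closed_nonneg_Reals_complex open_Compl)
    then have "open (equatorial -` W)" using continuous_on_equatorial by (rule open_vimage)
    moreover have "L k = ?X \<inter> equatorial -` W"
    proof (intro equalityI subsetI)
      fix y assume y: "y \<in> L k"
      have "y \<in> ?X" using L_sub[OF k] cover y by blast
      moreover have "Arg2pi (equatorial y) > 0" using y lohi(2)[OF k] by (auto simp: L_def \<theta>_def)
      then have "equatorial y \<notin> \<real>\<^sub>\<ge>\<^sub>0" by (metis Arg2pi_eq_0 complex_nonneg_Reals_iff complex_is_Real_iff less_irrefl)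
      ultimately show "y \<in> ?X \<inter> equatorial -` W" using y by (auto simp: W_def L_def \<theta>_def)
    next
      fix y assume y: "y \<in> ?X \<inter> equatorial -` W"
      then have "equatorial y \<noteq> 0" by (auto simp: W_def)
      then show "y \<in> L k" using y by (auto simp: W_def L_def \<theta>_def punctured_sphere_def)
    qed
    ultimately show ?thesis by (metis openin_open)
  qed
  have sphL: "sph \<phi> t \<in> L k" if "k < n" "0 < \<phi>" "\<phi> < pi" "lo k < t" "t < hi k" for k \<phi> t
    using Arg2pi_equatorial_sph[OF that(2,3), of t] that lohi[OF that(1)] by (simp add: L_def \<theta>_def)
  have L_conn: "path_connected (L k)" if k: "k < n" for k
  proof -
    have "L k = (\<lambda>z. sph (fst z) (snd z)) ` ({0<..<pi} \<times> {lo k<..<hi k})"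
    proof (intro equalityI subsetI)
      fix y assume y: "y \<in> L k"
      then obtain \<phi> where "0 < \<phi>" "\<phi> < pi" "y = sph \<phi> (\<theta> y)"
        using sph_coordinates[of y] unfolding \<theta>_def L_def by auto
      then show "y \<in> (\<lambda>z. sph (fst z) (snd z)) ` ({0<..<pi} \<times> {lo k<..<hi k})"
        using y by (intro image_eqI[of _ _ "(\<phi>, \<theta> y)"]) (auto simp: L_def)
    qed (use sphL k in auto)
    moreover have "path_connected ({0<..<pi} \<times> {lo k<..<hi k})"
      by (intro convex_imp_path_connected convex_Times) auto
    moreover have "continuous_on ({0<..<pi} \<times> {lo k<..<hi k}) (\<lambda>z. sph (fst z) (snd z))"
      by (intro continuous_intros)
    ultimately show ?thesis using path_connected_continuous_image by metis
  qed
  have sphUV: "sph \<phi> (\<mu> k) \<in> ?U \<inter> ?V" if "k < n" "0 < \<phi>" "\<phi> < pi" for k \<phi>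
    using sphL[OF that] \<mu>[OF that(1)] L_sub[OF that(1)] by blast
  note scU = simply_connected_star[OF Pne b(1) bP]
  have nb: "norm (- b) = 1" using b(1) by simp
  note scV = simply_connected_star[OF Pne nb bP']
  obtain d where d: "path_from_to ?U x b d"
    using simply_connected_imp_path_connected[OF scU(1)] xU scU(2)
    unfolding path_connected_def path_from_to_def by blast
  define hu where "hu = (\<lambda>k t. sph (pi / 2 * t) (\<mu> k))"
  define v where "v = (\<lambda>k t. sph (pi / 2 * (t + 1)) (\<mu> k))"
  define y where "y = (\<lambda>k. sph (pi / 2) (\<mu> k))"
  have hu: "path_from_to ?U b (y k) (hu k)" if k: "k < n" for k
    unfolding path_from_to_def
  proof (intro conjI)
    show "path (hu k)" unfolding path_def hu_def by (intro continuous_intros)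
    have "hu k t \<in> ?U" if "t \<in> {0..1}" for t
    proof (cases "t = 0")
      case False
      have "pi / 2 * t \<le> pi / 2 * 1" using that by (intro mult_left_mono) auto
      then show ?thesis using sphUV[OF k, of "pi / 2 * t"] that False pi_gt_zero by (auto simp: hu_def)
    qed (use scU(2) in \<open>simp add: hu_def\<close>)
    then show "path_image (hu k) \<subseteq> ?U" by (auto simp: path_image_def)
    show "pathstart (hu k) = b" "pathfinish (hu k) = y k" by (simp_all add: hu_def y_def pathstart_def pathfinish_def)
  qed
  have v: "path_from_to ?V (y k) (- b) (v k)" if k: "k < n" for k
    unfolding path_from_to_def
  proof (intro conjI)
    show "path (v k)" unfolding path_def v_def by (intro continuous_intros)
    have "v k t \<in> ?V" if "t \<in> {0..1}" for t
    proof (cases "t = 1")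
      case False
      have "pi / 2 * (t + 1) < pi / 2 * 2" using that False by (intro mult_strict_left_mono) auto
      then show ?thesis using sphUV[OF k, of "pi / 2 * (t + 1)"] that by (auto simp: v_def)
    qed (use scV(2) in \<open>simp add: v_def\<close>)
    then show "path_image (v k) \<subseteq> ?V" by (auto simp: path_image_def)
    show "pathstart (v k) = y k" "pathfinish (v k) = - b" by (simp_all add: v_def y_def pathstart_def pathfinish_def)
  qed
  define u where "u = (\<lambda>k. d +++ hu k)"
  interpret tc: two_chart_union ?X ?U ?V n L x "- b" y u v
  proof
    show "openin (top_of_set ?X) ?U" "openin (top_of_set ?X) ?V"
      using open_star[OF P(2,1)] bP bP' by blast+
    show "L j \<inter> L k = {}" if "j < n" "k < n" "j \<noteq> k" for j k
      using L_disj[of j k] L_disj[of k j] that by (metis inf_commute linorder_neqE_nat)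
    show "y k \<in> L k" if "k < n" for k using sphL[OF that, of "pi / 2"] \<mu>[OF that] by (simp add: y_def)
    show "path_from_to ?U x (y k) (u k)" if "k < n" for k unfolding u_def using path_from_to_join[OF d hu[OF that]] .
  qed (use cover scU scV n int L_open L_conn xU v in auto)
  define M where "M = (\<lambda>k t. sph (pi * t) (\<mu> k))"
  have hv: "hu k +++ v k = M k" for k
    by (auto simp: joinpaths_def hu_def v_def M_def fun_eq_iff algebra_simps)
  have UX: "?U \<subseteq> ?X" "?V \<subseteq> ?X" using cover by auto
  have dX: "path_from_to ?X x b d" using d UX path_from_to_mono by blast
  have MX: "path_from_to ?X b (- b) (M k)" if "k < n" for k
    unfolding hv[symmetric] using path_from_to_join[OF path_from_to_mono[OF hu UX(1)] path_from_to_mono[OF v UX(2)]] that by blast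
  have mM: "homotopic_paths ?X (tc.m k) (d +++ M k)" if k: "k < n" for k
  proof -
    have "homotopic_paths ?X ((d +++ hu k) +++ v k) (d +++ (hu k +++ v k))"
      using homotopic_paths_sym[OF homotopic_paths_assoc[of d ?X "hu k" "v k"]]
        dX path_from_to_mono[OF hu[OF k] UX(1)] path_from_to_mono[OF v[OF k] UX(2)] by (simp add: path_from_to_def)
    then show ?thesis unfolding tc.m_def unfolding u_def hv .
  qed
  have ccw: "ccw_loop_around P (pt k) (tc.loop k)" if k: "k < n" for k
  proof -
    define k' where "k' = Suc k mod n"
    have k': "k' < n" using k by (simp add: k'_def)
    \<comment> \<open>the meridians on both sides of the \<open>k\<close>-th puncture\<close>
    define A where "A = (if k = 0 then \<mu> 0 - 2 * pi else \<mu> k)"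
    define B where "B = \<mu> k'"
    have MA: "M k = (\<lambda>t. sph (pi * t) A)" using sph_periodic by (auto simp: M_def A_def)
    have MB: "M k' = (\<lambda>t. sph (pi * t) B)" by (simp add: M_def B_def)
    have B: "th k < B" "B < (if Suc k < n then th (Suc k) else 2 * pi)"
    proof -
      have "lo k' = th k \<and> hi k' = (if Suc k < n then th (Suc k) else 2 * pi)"
      proof (cases "Suc k < n")
        case False
        then have "Suc k = n" using k by simp
        then have "k' = 0" "n - 1 = k" by (auto simp: k'_def)
        then show ?thesis using False by (simp add: lo_def hi_def)
      qed (simp add: k'_def lo_def hi_def)
      then show "th k < B" "B < (if Suc k < n then th (Suc k) else 2 * pi)" using \<mu>(1,2)[OF k'] by (simp_all add: B_def)
    qed
    have Ak: "A < th k" using \<mu>[OF k] th0 by (auto simp: A_def hi_def)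
    have AB: "A < B" using Ak B by simp
    obtain \<phi>0 where \<phi>0: "0 < \<phi>0" "\<phi>0 < pi" "pt k = sph \<phi>0 (th k)"
      using sph_coordinates[OF nP[OF ptP[OF k]] eqnz[OF ptP[OF k]]] unfolding th_def \<theta>_def by blast
    have "ccw_loop_around P (pt k) ((\<lambda>t. sph (pi * t) A) +++ reversepath (\<lambda>t. sph (pi * t) B))"
    proof (rule lune_boundary_ccw[OF P(2,1) \<phi>0(1,2) Ak B(1) \<phi>0(3) ptP[OF k]])
      fix \<phi> t assume a: "0 \<le> \<phi>" "\<phi> \<le> pi" "A \<le> t" "t \<le> B" and sP: "sph \<phi> t \<in> P"
      obtain j where j: "j < n" "sph \<phi> t = pt j" using pt sP by (auto simp: bij_betw_def)
      have "equatorial (sph \<phi> t) \<noteq> 0" using eqnz[OF sP] .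
      then have "sin \<phi> \<noteq> 0" by (simp add: equatorial_sph)
      then have "\<phi> \<noteq> 0" "\<phi> \<noteq> pi" by auto
      then have \<phi>: "0 < \<phi>" "\<phi> < pi" using a by auto
      have "t = th k"
      proof (cases "t \<ge> 0")
        case True
        have "B < 2 * pi" using B th_bd by (auto split: if_splits intro: less_trans)
        then have tj: "t = th j"
          using Arg2pi_equatorial_sph(1)[OF \<phi> True] a j(2) by (simp add: th_def \<theta>_def)
        have "j \<le> k"
        proof (rule ccontr)
          assume "\<not> j \<le> k"
          then have "Suc k < n" "th (Suc k) \<le> th j" using j by (auto intro: th_mono_le)
          then show False using B(2) a tj by auto
        qed
        moreover have "k \<le> j"
        proof (rule ccontr)
          assume jk: "\<not> k \<le> j"
          then have "th j \<le> th (k - 1)" using k by (intro th_mono_le) auto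
          moreover have "A = \<mu> k" "th (k - 1) < \<mu> k" using jk \<mu>(1)[OF k] by (auto simp: A_def lo_def)
          ultimately show False using a tj by auto
        qed
        ultimately show ?thesis using tj by simp
      next
        case False
        have k0: "k = 0"
        proof (rule ccontr)
          assume "k \<noteq> 0"
          then show False using False a \<mu>(3)[OF k] by (simp add: A_def)
        qed
        have "sph \<phi> ((t + 2 * pi) - 2 * pi) = sph \<phi> (t + 2 * pi)" by (rule sph_periodic)
        then have e: "sph \<phi> t = sph \<phi> (t + 2 * pi)" by simp
        have r: "\<mu> 0 \<le> t + 2 * pi" "t + 2 * pi < 2 * pi" using a False k0 by (auto simp: A_def)
        have "0 \<le> t + 2 * pi" using r \<mu>(3)[of 0] n by simp
        then have "t + 2 * pi = th j"
          using Arg2pi_equatorial_sph(1)[OF \<phi> _ r(2)] j(2) e by (simp add: th_def \<theta>_def)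
        moreover have "th j \<le> th (n - 1)" using j by (intro th_mono_le) auto
        moreover have "th (n - 1) < \<mu> 0" using \<mu>(1)[of 0] n by (simp add: lo_def)
        ultimately show ?thesis using r by simp
      qed
      moreover have "\<phi> = \<phi>0"
      proof -
        have "pt j = pt k"
        proof -
          have "equatorial (sph \<phi> t) = of_real (sin \<phi> / sin \<phi>0) * equatorial (pt k)"
            unfolding \<phi>0(3) equatorial_sph using \<open>t = th k\<close> sin_gt_zero[OF \<phi>0(1,2)] by simp
          then have "\<theta> (pt j) = \<theta> (pt k)"
            unfolding j(2) \<theta>_def using sin_gt_zero[OF \<phi>0(1,2)] sin_gt_zero[OF \<phi>] Arg2pi_times_of_real by simp
          then show ?thesis using inj ptP[OF j(1)] ptP[OF k] by (auto simp: inj_on_def)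
        qed
        then have "b \<bullet> sph \<phi> t = b \<bullet> sph \<phi>0 (th k)" using j(2) \<phi>0(3) by simp
        then have "cos \<phi> = cos \<phi>0" by simp
        with \<phi> \<phi>0(1,2) show ?thesis using cos_inj_pi[of \<phi> \<phi>0] by simp
      qed
      ultimately show "\<phi> = \<phi>0 \<and> t = th k" by blast
    qed
    then have lune: "ccw_loop_around P (pt k) (M k +++ reversepath (M k'))" by (simp add: MA MB)
    have lp: "path_from_to ?X b b (M k +++ reversepath (M k'))"
      using path_from_to_join[OF MX[OF k] path_from_to_reverse[OF MX[OF k']]] .
    have "homotopic_paths ?X (tc.loop k) ((d +++ M k) +++ reversepath (d +++ M k'))"
      unfolding tc.loop_def k'_def[symmetric]
      using mM[OF k] mM[OF k'] tc.m[OF k] tc.m[OF k']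
      by (intro homotopic_paths_join homotopic_paths_reversepath[THEN iffD2]) (auto simp: path_from_to_def)
    moreover have "homotopic_paths ?X ((d +++ M k) +++ reversepath (d +++ M k')) (d +++ ((M k +++ reversepath (M k')) +++ reversepath d))"
    proof -
      have r: "reversepath (d +++ M k') = reversepath (M k') +++ reversepath d"
        using dX MX[OF k'] by (intro reversepath_joinpaths) (simp add: path_from_to_def)
      have 1: "homotopic_paths ?X (d +++ (M k +++ (reversepath (M k') +++ reversepath d))) ((d +++ M k) +++ (reversepath (M k') +++ reversepath d))"
        using dX MX[OF k] MX[OF k'] by (intro homotopic_paths_assoc) (auto simp: path_from_to_def path_image_join)
      have "homotopic_paths ?X (M k +++ (reversepath (M k') +++ reversepath d)) ((M k +++ reversepath (M k')) +++ reversepath d)"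
        using dX MX[OF k] MX[OF k'] by (intro homotopic_paths_assoc) (auto simp: path_from_to_def path_image_join)
      then have "homotopic_paths ?X (d +++ (M k +++ (reversepath (M k') +++ reversepath d))) (d +++ ((M k +++ reversepath (M k')) +++ reversepath d))"
        using dX MX[OF k] by (intro homotopic_paths_join[OF homotopic_paths_refl[THEN iffD2]]) (auto simp: path_from_to_def)
      then show ?thesis unfolding r using 1 by (meson homotopic_paths_sym homotopic_paths_trans)
    qed
    ultimately have "homotopic_paths ?X (tc.loop k) (d +++ ((M k +++ reversepath (M k')) +++ reversepath d))"
      by (rule homotopic_paths_trans)
    then have "homotopic_loops ?X (tc.loop k) (d +++ ((M k +++ reversepath (M k')) +++ reversepath d))"
      by (rule homotopic_paths_imp_homotopic_loops) (use tc.loop[OF k] dX lp in \<open>auto simp: based_loops_def path_from_to_def\<close>)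
    moreover have "homotopic_loops ?X (d +++ ((M k +++ reversepath (M k')) +++ reversepath d)) (M k +++ reversepath (M k'))"
      by (rule homotopic_loops_conjugate) (use dX lp in \<open>auto simp: path_from_to_def\<close>)
    ultimately have "homotopic_loops ?X (tc.loop k) (M k +++ reversepath (M k'))" by (rule homotopic_loops_trans)
    then show ?thesis using lune unfolding ccw_loop_around_def by (blast intro: homotopic_loops_trans)
  qed
  have "tc.c k \<in> peripheral_classes P x (pt k)" if k: "k < n" for k
    using tc.c_closed[OF k] ccw[OF k] mem_path_class[OF tc.loop[OF k]]
    by (auto simp: peripheral_classes_def tc.c_def)
  then have "geometric_presentation P x n tc.c"
    unfolding geometric_presentation_def using tc.presentation pt by blast
  then show ?thesis by (rule that)
qed

section \<open>Choosing the presentation\<close>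

lemma geometric_presentation_closed:
  assumes "geometric_presentation P x n c" "i < n"
  shows "c i \<in> carrier (sphere_group P x)"
  using geometric_presentation_presentation[OF assms(1)] assms(2) by (auto simp: is_presentation_def)

lemma geometric_presentation_hurwitz_move:
  assumes x: "x \<in> punctured_sphere P" and c: "geometric_presentation P x n c" and i: "Suc i < n"
  shows "geometric_presentation P x n (hurwitz_move (sphere_group P x) i c)"
proof -
  let ?G = "sphere_group P x"
  interpret G: group ?G by (rule group_fundamental_group[OF x])
  obtain pt where pt: "bij_betw pt {..<n} P" "\<And>i. i < n \<Longrightarrow> c i \<in> peripheral_classes P x (pt i)"
    using c by (auto simp: geometric_presentation_def)
  define \<tau> where "\<tau> = id(i := Suc i, Suc i := i)"
  have "bij_betw \<tau> {..<n} {..<n}"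
    by (rule bij_betw_byWitness[where f'=\<tau>]) (use i in \<open>auto simp: \<tau>_def\<close>)
  then have "bij_betw (pt \<circ> \<tau>) {..<n} P" using pt(1) by (rule bij_betw_trans)
  moreover have "hurwitz_move ?G i c j \<in> peripheral_classes P x ((pt \<circ> \<tau>) j)" if j: "j < n" for j
  proof (cases "j = Suc i")
    case True
    have "c (Suc i) \<in> carrier ?G" using geometric_presentation_closed[OF c i] .
    then show ?thesis
      using True peripheral_classes_conj_closed[of "c i" P x "pt i" "inv\<^bsub>?G\<^esub> c (Suc i)"] pt(2)[of i] i
      by (simp add: hurwitz_move_def \<tau>_def)
  qed (use pt(2) i j in \<open>auto simp: hurwitz_move_def \<tau>_def\<close>)
  moreover have "is_presentation ?G {..<n} (hurwitz_move ?G i c) (product_relator n)"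
    by (rule presentation_hurwitz_move[OF G.is_group geometric_presentation_presentation[OF c] i])
  ultimately show ?thesis unfolding geometric_presentation_def by blast
qed

lemma geometric_presentation_twist:
  fixes j :: int
  assumes x: "x \<in> punctured_sphere P" and c: "geometric_presentation P x n c" and m: "m \<le> n"
  shows "geometric_presentation P x n
    (twist (sphere_group P x) m (prefix_product (sphere_group P x) c m [^]\<^bsub>sphere_group P x\<^esub> j) c)"
proof -
  let ?G = "sphere_group P x"
  interpret G: group ?G by (rule group_fundamental_group[OF x])
  have "prefix_product ?G c m \<in> carrier ?G"
    using geometric_presentation_closed[OF c] m by (intro G.prefix_product_closed) auto
  then have g: "prefix_product ?G c m [^]\<^bsub>?G\<^esub> j \<in> carrier ?G" by simp
  show ?thesis
    using c presentation_twist[OF G.is_group geometric_presentation_presentation[OF c] m, of j]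
      peripheral_classes_conj_closed[OF _ g]
    unfolding geometric_presentation_def twist_def by auto
qed

text \<open>The following context collects what is used about a Deroin--Tholozan representation: prefix
  products are elliptic, and the rotation angles do not add up to a multiple of \<open>2 \<pi>\<close>.\<close>

locale elliptic_prefix_rep =
  fixes P :: "(real^3) set" and x :: "real^3" and \<rho> :: sphere_rep and n :: nat and \<alpha> :: "real^3 \<Rightarrow> real"
  assumes n3: "n \<ge> 3" and base: "x \<in> punctured_sphere P"
    and hom: "\<rho> \<in> hom (sphere_group P x) PSL2R"
    and angles: "\<And>p a. p \<in> P \<Longrightarrow> a \<in> peripheral_classes P x p \<Longrightarrow> elliptic_with_angle (\<rho> a) (\<alpha> p)"
    and angle_sum: "cis (sum \<alpha> P) \<noteq> 1"
    and elliptic_prefix: "\<And>c k. geometric_presentation P x n c \<Longrightarrow> 0 < k \<Longrightarrow> k < n \<Longrightarrow>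
          elliptic (\<rho> (prefix_product (sphere_group P x) c k))"
begin

abbreviation "\<Gamma> \<equiv> sphere_group P x"
abbreviation "geo \<equiv> geometric_presentation P x n"
abbreviation "pre c k \<equiv> \<rho> (prefix_product \<Gamma> c k)"
abbreviation "fix_pre c k \<equiv> fixed_point (pre c k)"
abbreviation "fix_gen c k \<equiv> fixed_point (\<rho> (c k))"

lemma group_\<Gamma>: "group \<Gamma>"
  by (rule group_fundamental_group[OF base])

sublocale \<Gamma>: group \<Gamma> by (rule group_\<Gamma>)
sublocale rho: group_hom \<Gamma> PSL2R \<rho> by unfold_locales (rule hom)

lemma gen_closed: "geo c \<Longrightarrow> k < n \<Longrightarrow> \<rho> (c k) \<in> carrier PSL2R"
  using geometric_presentation_closed by simp

lemma prefix_closed: "geo c \<Longrightarrow> k \<le> n \<Longrightarrow> prefix_product \<Gamma> c k \<in> carrier \<Gamma>"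
  using geometric_presentation_closed by (intro \<Gamma>.prefix_product_closed) auto

lemma pre_Suc: "geo c \<Longrightarrow> k < n \<Longrightarrow> pre c (Suc k) = pre c k \<otimes>\<^bsub>PSL2R\<^esub> \<rho> (c k)"
  using geometric_presentation_closed prefix_closed[of c k] by (simp add: \<Gamma>.prefix_product_Suc)

lemma elliptic_gen:
  assumes "geo c" "k < n"
  shows "elliptic (\<rho> (c k))"
  using assms angles elliptic_with_angle_elliptic(1) unfolding geometric_presentation_def bij_betw_def by blast

lemma pre_fixes_gen_fixes:
  assumes "geo c" "k < n" "z \<in> hyp_plane"
  shows "PSL2R_act (pre c k) z = z \<Longrightarrow> PSL2R_act (\<rho> (c k)) z = z \<Longrightarrow> PSL2R_act (pre c (Suc k)) z = z"
    and "PSL2R_act (pre c (Suc k)) z = z \<Longrightarrow> PSL2R_act (\<rho> (c k)) z = z \<Longrightarrow> PSL2R_act (pre c k) z = z"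
    and "PSL2R_act (pre c (Suc k)) z = z \<Longrightarrow> PSL2R_act (pre c k) z = z \<Longrightarrow> PSL2R_act (\<rho> (c k)) z = z"
proof -
  have cl: "pre c k \<in> carrier PSL2R" "\<rho> (c k) \<in> carrier PSL2R"
    using prefix_closed[of c k] gen_closed assms by auto
  have m: "PSL2R_act (pre c (Suc k)) z = PSL2R_act (pre c k) (PSL2R_act (\<rho> (c k)) z)"
    using pre_Suc[OF assms(1,2)] act_mult cl assms(3) by simp
  show "PSL2R_act (pre c k) z = z \<Longrightarrow> PSL2R_act (\<rho> (c k)) z = z \<Longrightarrow> PSL2R_act (pre c (Suc k)) z = z"
    and "PSL2R_act (pre c (Suc k)) z = z \<Longrightarrow> PSL2R_act (\<rho> (c k)) z = z \<Longrightarrow> PSL2R_act (pre c k) z = z"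
    using m by simp_all
  assume "PSL2R_act (pre c (Suc k)) z = z" "PSL2R_act (pre c k) z = z"
  then show "PSL2R_act (\<rho> (c k)) z = z"
    using m act_inv(1)[OF cl(1), of z] act_inv(1)[OF cl(1), of "PSL2R_act (\<rho> (c k)) z"] act_closed[OF cl(2) assms(3)] assms(3)
    by metis
qed

text \<open>If all generators fixed one point, the derivatives there would multiply to \<open>1\<close>.\<close>

lemma no_common_fixed_point:
  assumes c: "geo c" and C: "C \<in> hyp_plane"
  shows "\<exists>i<n. PSL2R_act (\<rho> (c i)) C \<noteq> C"
proof (rule ccontr)
  assume "\<not> ?thesis"
  then have fx: "PSL2R_act (\<rho> (c i)) C = C" if "i < n" for i using that by blast
  obtain pt where pt: "bij_betw pt {..<n} P" "\<And>i. i < n \<Longrightarrow> c i \<in> peripheral_classes P x (pt i)"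
    using c by (auto simp: geometric_presentation_def)
  have ptP: "pt i \<in> P" if "i < n" for i using pt(1) that by (auto simp: bij_betw_def)
  have mult: "multiplier (\<rho> (c i)) C = cis (\<alpha> (pt i))" if "i < n" for i
    using elliptic_with_angle_elliptic[OF angles[OF ptP[OF that] pt(2)[OF that]]]
      fixed_point_eq[OF _ C fx[OF that]] by metis
  have "PSL2R_act (pre c k) C = C \<and> multiplier (pre c k) C = cis (\<Sum>i<k. \<alpha> (pt i))" if "k \<le> n" for k
    using that
  proof (induction k)
    case 0
    show ?case by (simp add: act_one multiplier_one)
  next
    case (Suc k)
    then have IH: "PSL2R_act (pre c k) C = C" "multiplier (pre c k) C = cis (\<Sum>i<k. \<alpha> (pt i))" by auto
    have cl: "pre c k \<in> carrier PSL2R" "\<rho> (c k) \<in> carrier PSL2R"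
      using prefix_closed[of c k] gen_closed c Suc.prems by auto
    show ?case
      using pre_fixes_gen_fixes(1)[OF c _ C IH(1) fx] Suc.prems multiplier_mult[OF cl C] fx[of k] IH(2) mult[of k]
        pre_Suc[OF c, of k] by (simp add: cis_mult)
  qed
  from this[of n] have "cis (\<Sum>i<n. \<alpha> (pt i)) = multiplier (pre c n) C" by simp
  also have "\<dots> = 1"
    using presentation_product[OF group_\<Gamma> geometric_presentation_presentation[OF c]] by (simp add: multiplier_one)
  also have "(\<Sum>i<n. \<alpha> (pt i)) = sum \<alpha> P" by (rule sum.reindex_bij_betw[OF pt(1)])
  finally show False using angle_sum by simp
qed

definition nondegenerate_below :: "nat \<Rightarrow> (nat \<Rightarrow> (real \<Rightarrow> real^3) set) \<Rightarrow> bool" where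
  "nondegenerate_below m c \<longleftrightarrow> geo c \<and> (\<forall>k. 0 < k \<and> k < m \<longrightarrow> fix_pre c k \<noteq> fix_gen c k)"

lemma geo_hurwitz_move: "geo c \<Longrightarrow> Suc i < n \<Longrightarrow> geo (hurwitz_move \<Gamma> i c)"
  by (rule geometric_presentation_hurwitz_move[OF base])

lemma prefix_hurwitz_move:
  "geo c \<Longrightarrow> Suc i < n \<Longrightarrow> k \<le> n \<Longrightarrow> k \<noteq> Suc i \<Longrightarrow>
     prefix_product \<Gamma> (hurwitz_move \<Gamma> i c) k = prefix_product \<Gamma> c k"
  using geometric_presentation_closed by (intro \<Gamma>.prefix_product_hurwitz_move[of n]) auto

text \<open>A later generator whose fixed point differs from that of the prefix product can be moved
  forward until it extends the nondegenerate part of the chain.\<close>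

lemma extend_nondegenerate:
  assumes "nondegenerate_below m c" "m \<le> j" "j < n" "fix_gen c j \<noteq> fix_pre c m"
  shows "\<exists>c'. nondegenerate_below (Suc m) c'"
  using assms
proof (induction j arbitrary: c)
  case 0
  then show ?case by (auto simp: nondegenerate_below_def)
next
  case (Suc j)
  show ?case
  proof (cases "Suc j = m")
    case True
    then have "nondegenerate_below (Suc m) c"
      using Suc.prems by (auto simp: nondegenerate_below_def less_Suc_eq)
    then show ?thesis by blast
  next
    case False
    then have mj: "m \<le> j" using Suc.prems by simp
    let ?c = "hurwitz_move \<Gamma> j c"
    have c: "geo c" using Suc.prems by (simp add: nondegenerate_below_def)
    have pr: "prefix_product \<Gamma> ?c k = prefix_product \<Gamma> c k" if "k \<le> m" for k
      using prefix_hurwitz_move[OF c, of j k] that mj Suc.prems by simp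
    have gen: "?c k = c k" if "k < m" for k using that mj by (simp add: hurwitz_move_def)
    have "nondegenerate_below m ?c"
      using Suc.prems geo_hurwitz_move[OF c, of j] pr gen by (auto simp: nondegenerate_below_def)
    moreover have "fix_gen ?c j \<noteq> fix_pre ?c m"
      using Suc.prems pr by (simp add: hurwitz_move_def)
    ultimately show ?thesis using Suc.IH[of ?c] mj Suc.prems by simp
  qed
qed

text \<open>If all later generators fix the same point \<open>C\<close> as the prefix product, the last generator
  before them is moved to the end. The prefix products before it do not fix \<open>C\<close>, and multiplying
  them by rotations about \<open>C\<close> does not change this.\<close>

lemma move_to_end:
  assumes c: "nondegenerate_below m c" and m: "2 \<le> m" "m < n"
    and stuck: "\<And>j. m \<le> j \<Longrightarrow> j < n \<Longrightarrow> fix_gen c j = fix_pre c m"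
  shows "\<exists>c'. nondegenerate_below (n - 1) c'"
proof -
  define C where "C = fix_pre c m"
  define l where "l = m - 1"
  have l: "m = Suc l" "0 < l" "l < n" using m by (auto simp: l_def)
  have geo: "geo c" using c by (simp add: nondegenerate_below_def)
  have CH: "C \<in> hyp_plane" "PSL2R_act (pre c m) C = C"
    using fixed_point[OF elliptic_prefix[OF geo, of m]] m by (auto simp: C_def)
  have nfix: "PSL2R_act (pre c l) C \<noteq> C"
  proof
    assume 1: "PSL2R_act (pre c l) C = C"
    then have 2: "PSL2R_act (\<rho> (c l)) C = C"
      using pre_fixes_gen_fixes(3)[OF geo l(3) CH(1)] CH(2) l(1) by simp
    have "fix_pre c l = C" by (rule fixed_point_eq[OF elliptic_prefix[OF geo l(2,3)] CH(1) 1])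
    moreover have "fix_gen c l = C" by (rule fixed_point_eq[OF elliptic_gen[OF geo l(3)] CH(1) 2])
    ultimately show False using c l by (auto simp: nondegenerate_below_def)
  qed
  let ?Q = "\<lambda>i d. nondegenerate_below l d \<and> PSL2R_act (pre d l) C \<noteq> C \<and>
     (\<forall>j. l \<le> j \<and> j < n \<and> j \<noteq> i \<longrightarrow> PSL2R_act (\<rho> (d j)) C = C)"
  have mv: "l \<le> i \<Longrightarrow> i < n \<Longrightarrow> \<exists>d. ?Q i d" for i
  proof (induction i rule: dec_induct)
    case base
    have "PSL2R_act (\<rho> (c j)) C = C" if "m \<le> j" "j < n" for j
      using stuck[OF that] fixed_point(2)[OF elliptic_gen[OF geo that(2)]] by (simp add: C_def)
    then have "?Q l c" using c nfix l by (auto simp: nondegenerate_below_def)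
    then show ?case by blast
  next
    case (step i)
    then obtain d where d: "?Q i d" by auto
    let ?d = "hurwitz_move \<Gamma> i d"
    have gd: "geo d" using d by (simp add: nondegenerate_below_def)
    have pr: "prefix_product \<Gamma> ?d k = prefix_product \<Gamma> d k" if "k \<le> l" for k
      using prefix_hurwitz_move[OF gd, of i k] that step by simp
    have gen: "?d k = d k" if "k < i" for k using that by (simp add: hurwitz_move_def)
    have "nondegenerate_below l ?d"
      using d geo_hurwitz_move[OF gd, of i] pr gen step by (auto simp: nondegenerate_below_def)
    moreover have "PSL2R_act (\<rho> (?d j)) C = C" if "l \<le> j" "j < n" "j \<noteq> Suc i" for j
      using d that step by (cases "j = i") (auto simp: hurwitz_move_def)
    ultimately have "?Q (Suc i) ?d" using d pr by auto
    then show ?case by blast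
  qed
  have "l \<le> n - 1" "n - 1 < n" using l by auto
  from mv[OF this] obtain d where d: "?Q (n - 1) d" by blast
  have gd: "geo d" using d by (simp add: nondegenerate_below_def)
  have nf: "l \<le> k \<Longrightarrow> k < n \<Longrightarrow> PSL2R_act (pre d k) C \<noteq> C" for k
  proof (induction k rule: dec_induct)
    case (step k)
    then show ?case using pre_fixes_gen_fixes(2)[OF gd, of k C] CH(1) d by auto
  qed (use d in simp)
  have "fix_pre d k \<noteq> fix_gen d k" if k: "l \<le> k" "k < n - 1" for k
  proof
    assume eq: "fix_pre d k = fix_gen d k"
    have kn: "k < n" "0 < k" using k l by auto
    have "fix_gen d k = C" by (rule fixed_point_eq[OF elliptic_gen[OF gd kn(1)] CH(1)]) (use d k in auto)
    then have "PSL2R_act (pre d k) C = C"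
      using eq fixed_point(2)[OF elliptic_prefix[OF gd kn(2,1)]] by simp
    then show False using nf[OF k(1) kn(1)] by simp
  qed
  then have "nondegenerate_below (n - 1) d"
    using d unfolding nondegenerate_below_def by (metis linorder_not_less)
  then show ?thesis by blast
qed

text \<open>The nondegenerate part is extended as long as possible. If this fails at the first step, all
  generators fix the same point; a failure at a later step is resolved by \<open>move_to_end\<close>.\<close>

lemma nondegenerate_exists:
  assumes "geo c"
  shows "\<exists>c. nondegenerate_below (n - 1) c"
proof (rule ccontr)
  assume no: "\<not> ?thesis"
  have "1 \<le> m \<Longrightarrow> m \<le> n - 1 \<Longrightarrow> \<exists>c. nondegenerate_below m c" for m
  proof (induction m rule: dec_induct)
    case base
    show ?case using assms by (auto simp: nondegenerate_below_def)
  next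
    case (step m)
    then obtain c where c: "nondegenerate_below m c" by auto
    then have gc: "geo c" by (simp add: nondegenerate_below_def)
    have mn: "m < n" using step by simp
    show ?case
    proof (cases "\<exists>j. m \<le> j \<and> j < n \<and> fix_gen c j \<noteq> fix_pre c m")
      case True
      then show ?thesis using extend_nondegenerate[OF c] by blast
    next
      case False
      show ?thesis
      proof (cases "m = 1")
        case True
        have p1: "prefix_product \<Gamma> c 1 = c 0"
          using geometric_presentation_closed[OF gc, of 0] n3 by (simp add: prefix_product_def)
        note F = fixed_point[OF elliptic_gen[OF gc, of 0]]
        have "fix_gen c j = fix_gen c 0" if "j < n" for j
          using False that True p1 by (cases "j = 0") auto
        then have "PSL2R_act (\<rho> (c j)) (fix_gen c 0) = fix_gen c 0" if "j < n" for j
          using fixed_point(2)[OF elliptic_gen[OF gc that]] that by metis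
        then show ?thesis using no_common_fixed_point[OF gc F(1)] n3 by auto
      next
        case m1: False
        then show ?thesis using move_to_end[OF c _ mn] False no step by auto
      qed
    qed
  qed
  from this[of "n - 1"] show False using no n3 by auto
qed

text \<open>The \<open>k\<close>-th triangle of the linear chain, uniformly in \<open>k\<close>: since the last generator is the
  inverse of the prefix product before it, the last triangle has the same form.\<close>

definition tri :: "(nat \<Rightarrow> (real \<Rightarrow> real^3) set) \<Rightarrow> nat \<Rightarrow> complex set" where
  "tri c k = {fix_pre c k, fix_gen c k, fix_pre c (Suc k)}"

lemma tri_in_hyp_plane: "geo c \<Longrightarrow> 0 < k \<Longrightarrow> Suc k < n \<Longrightarrow> tri c k \<subseteq> hyp_plane"
  using fixed_point(1) elliptic_prefix elliptic_gen by (simp add: tri_def)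

lemma direction_prefix:
  assumes c: "geo c" and k: "0 < k" "Suc k < n" and ne: "fix_pre c k \<noteq> fix_gen c k"
  obtains r :: real where "r \<noteq> 0" "direction (fix_pre c (Suc k)) (fix_pre c k) \<noteq> 0"
    "direction (fix_pre c (Suc k)) (fix_gen c k) =
       of_real r * half_turn (pre c (Suc k)) * direction (fix_pre c (Suc k)) (fix_pre c k)"
proof -
  have e: "elliptic (pre c k)" "elliptic (\<rho> (c k))" "elliptic (pre c (Suc k))"
    using elliptic_prefix[OF c] elliptic_gen[OF c] k by auto
  obtain r :: real where r: "r \<noteq> 0" "direction (fix_pre c (Suc k)) (fix_gen c k) =
       of_real r * half_turn (pre c (Suc k)) * direction (fix_pre c (Suc k)) (fix_pre c k)"
    using direction_factors[OF e] pre_Suc[OF c, of k] k by auto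
  have "fix_pre c k \<noteq> fix_pre c (Suc k)"
  proof
    assume eq: "fix_pre c k = fix_pre c (Suc k)"
    have "PSL2R_act (\<rho> (c k)) (fix_pre c k) = fix_pre c k"
      using pre_fixes_gen_fixes(3)[OF c, of k "fix_pre c k"] fixed_point[OF e(1)] fixed_point[OF e(3)] eq k by simp
    then show False using ne fixed_point_eq[OF e(2) fixed_point(1)[OF e(1)]] by simp
  qed
  then show ?thesis using that r direction_eq_0_iff fixed_point(1) e by metis
qed

lemma tri_not_degenerate:
  assumes c: "geo c" and k: "0 < k" "Suc k < n" and ne: "fix_pre c k \<noteq> fix_gen c k"
  shows "\<not> degenerate (geodesic_triangle (tri c k))"
proof -
  let ?C = "fix_pre c (Suc k)"
  obtain r :: real where r: "r \<noteq> 0" "direction ?C (fix_pre c k) \<noteq> 0"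
    "direction ?C (fix_gen c k) = of_real r * half_turn (pre c (Suc k)) * direction ?C (fix_pre c k)"
    by (rule direction_prefix[OF assms])
  let ?d = "direction ?C (fix_pre c k)"
  have "cnj ?d * direction ?C (fix_gen c k) = of_real (r * (cmod ?d)\<^sup>2) * half_turn (pre c (Suc k))"
    unfolding r(3) of_real_mult complex_norm_square by (simp add: mult_ac)
  moreover have "Im (half_turn (pre c (Suc k))) \<noteq> 0"
    using half_turn(2)[OF elliptic_prefix[OF c, of "Suc k"]] k by simp
  moreover have "Im (of_real a * w) = a * Im w" for a w by simp
  ultimately have "Im (cnj ?d * direction ?C (fix_gen c k)) \<noteq> 0" using r(1,2) by (simp only: mult_eq_0_iff) simp
  then show ?thesis
    by (rule not_degenerate_if_independent[OF tri_in_hyp_plane[OF c k], rotated 3]) (simp_all add: tri_def)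
qed

text \<open>A geodesic through the common vertex separates the two triangles.\<close>

definition separated_at :: "(nat \<Rightarrow> (real \<Rightarrow> real^3) set) \<Rightarrow> nat \<Rightarrow> bool" where
  "separated_at c k \<longleftrightarrow> (\<exists>\<nu>. \<nu> \<noteq> 0 \<and>
     (\<forall>z\<in>tri c k. Re (cnj \<nu> * direction (fix_pre c (Suc k)) z) \<ge> 0) \<and>
     (\<forall>z\<in>tri c (Suc k). Re (cnj \<nu> * direction (fix_pre c (Suc k)) z) \<le> 0))"

text \<open>Powers of the Dehn twist along the common curve rotate everything before it about the common
  vertex, and leave everything after it in place.\<close>

lemma twist_separates:
  assumes c: "nondegenerate_below (n - 1) c" and l: "0 < l" "Suc l < n - 1"
  shows "\<exists>c'. nondegenerate_below (n - 1) c' \<and> separated_at c' l \<and>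
     (\<forall>k>l. Suc (Suc k) < n \<longrightarrow> separated_at c k \<longrightarrow> separated_at c' k)"
proof -
  have geo: "geo c" and nd: "\<And>k. 0 < k \<Longrightarrow> k < n - 1 \<Longrightarrow> fix_pre c k \<noteq> fix_gen c k"
    using c by (auto simp: nondegenerate_below_def)
  define s where "s = pre c (Suc l)"
  define C where "C = fixed_point s"
  have es: "elliptic s" using elliptic_prefix[OF geo, of "Suc l"] l by (simp add: s_def)
  note C = fixed_point[OF es, folded C_def]
  have ln: "Suc l < n" and ln': "l < n - 1" using l by auto
  let ?j = "half_turn s"
  let ?X = "fix_pre c l" and ?Y = "fix_gen c l" and ?Z = "fix_gen c (Suc l)" and ?W = "fix_pre c (Suc (Suc l))"
  obtain r :: real where r: "r \<noteq> 0" "direction C ?X \<noteq> 0" "direction C ?Y = of_real r * ?j * direction C ?X"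
    by (rule direction_prefix[OF geo l(1) ln nd[OF l(1) ln'], folded s_def, folded C_def])
  have e: "elliptic (\<rho> (c (Suc l)))" "elliptic (pre c (Suc (Suc l)))"
    using elliptic_gen[OF geo, of "Suc l"] elliptic_prefix[OF geo, of "Suc (Suc l)"] l by auto
  obtain r' :: real where r': "r' \<noteq> 0" "direction C ?W = of_real r' * cnj ?j * direction C ?Z"
    using direction_multiple[OF es e] pre_Suc[OF geo, of "Suc l"] l unfolding s_def C_def by auto
  have Z: "direction C ?Z \<noteq> 0"
    using nd[of "Suc l"] l direction_eq_0_iff[OF fixed_point(1)[OF e(1)] C(1)] by (auto simp: C_def s_def)
  have "\<exists>(m :: int) \<nu>. \<nu> \<noteq> 0 \<and>
      (\<forall>y\<in>{direction C ?X, direction C ?Y}. Re (cnj \<nu> * (((cnj ?j)\<^sup>2) powi m * y)) \<ge> 0) \<and>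
      (\<forall>y\<in>{direction C ?Z, direction C ?W}. Re (cnj \<nu> * y) \<le> 0)"
    by (rule separate_sectors_by_rotation[OF half_turn(1,2)[OF es] r(2) Z r(1) r'(1) r(3) r'(2)]) blast
  then obtain m :: int and \<nu> where \<nu>: "\<nu> \<noteq> 0"
    "\<And>y. y \<in> {direction C ?X, direction C ?Y} \<Longrightarrow> Re (cnj \<nu> * (((cnj ?j)\<^sup>2) powi m * y)) \<ge> 0"
    "\<And>y. y \<in> {direction C ?Z, direction C ?W} \<Longrightarrow> Re (cnj \<nu> * y) \<le> 0" by blast
  define g where "g = prefix_product \<Gamma> c (Suc l) [^]\<^bsub>\<Gamma>\<^esub> m"
  define c' where "c' = twist \<Gamma> (Suc l) g c"
  have pc: "prefix_product \<Gamma> c (Suc l) \<in> carrier \<Gamma>" using prefix_closed[OF geo] l by simp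
  then have g: "g \<in> carrier \<Gamma>" by (simp add: g_def)
  have rg: "\<rho> g = s [^]\<^bsub>PSL2R\<^esub> m" using pc by (simp add: g_def s_def rho.hom_int_pow)
  have rgc: "\<rho> g \<in> carrier PSL2R" using g by simp
  have sc: "s \<in> carrier PSL2R" using elliptic_closed[OF es] .
  have gC: "PSL2R_act (\<rho> g) C = C" "multiplier (\<rho> g) C = ((cnj ?j)\<^sup>2) powi m"
    using multiplier_int_pow[OF sc C(1,2), of m] half_turn(3)[OF es] by (simp_all add: rg C_def)
  have geo': "geo c'" unfolding c'_def g_def
    by (rule geometric_presentation_twist[OF base geo]) (use l in simp)
  have cl: "\<And>j. j < n \<Longrightarrow> c j \<in> carrier \<Gamma>" using geometric_presentation_closed[OF geo] .
  have pre_le: "prefix_product \<Gamma> c' k = g \<otimes>\<^bsub>\<Gamma>\<^esub> prefix_product \<Gamma> c k \<otimes>\<^bsub>\<Gamma>\<^esub> inv\<^bsub>\<Gamma>\<^esub> g" if "k \<le> Suc l" for k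
    unfolding c'_def by (rule \<Gamma>.prefix_product_twist_le[of n c g]) (use cl g l that in auto)
  have pre_ge: "prefix_product \<Gamma> c' k = prefix_product \<Gamma> c k" if "Suc l \<le> k" "k \<le> n" for k
    unfolding c'_def
  proof (rule \<Gamma>.prefix_product_twist_ge[of n c g])
    show "g \<otimes>\<^bsub>\<Gamma>\<^esub> prefix_product \<Gamma> c (Suc l) = prefix_product \<Gamma> c (Suc l) \<otimes>\<^bsub>\<Gamma>\<^esub> g"
      unfolding g_def by (rule \<Gamma>.power_commutes[OF pc])
  qed (use cl g that in auto)
  have fp_le: "fix_pre c' k = PSL2R_act (\<rho> g) (fix_pre c k)" if "0 < k" "k \<le> Suc l" for k
  proof -
    have "pre c' k = \<rho> g \<otimes>\<^bsub>PSL2R\<^esub> pre c k \<otimes>\<^bsub>PSL2R\<^esub> inv\<^bsub>PSL2R\<^esub> \<rho> g"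
      using pre_le[OF that(2)] g prefix_closed[OF geo, of k] that l by simp
    then show ?thesis using elliptic_conj(2)[OF elliptic_prefix[OF geo, of k] rgc] that l by simp
  qed
  have fg_le: "fix_gen c' k = PSL2R_act (\<rho> g) (fix_gen c k)" if "k \<le> l" for k
  proof -
    have "\<rho> (c' k) = \<rho> g \<otimes>\<^bsub>PSL2R\<^esub> \<rho> (c k) \<otimes>\<^bsub>PSL2R\<^esub> inv\<^bsub>PSL2R\<^esub> \<rho> g"
      using g cl[of k] that l by (simp add: c'_def twist_def)
    then show ?thesis using elliptic_conj(2)[OF elliptic_gen[OF geo, of k] rgc] that l by simp
  qed
  have gen_ge: "c' k = c k" if "Suc l \<le> k" for k using that by (simp add: c'_def twist_def)
  have inj: "a = b" if "PSL2R_act (\<rho> g) a = PSL2R_act (\<rho> g) b" "a \<in> hyp_plane" "b \<in> hyp_plane" for a b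
    using that act_inv(1)[OF rgc] by metis
  have "fix_pre c' k \<noteq> fix_gen c' k" if k: "0 < k" "k < n - 1" for k
  proof (cases "k \<le> l")
    case True
    have "fix_pre c k \<in> hyp_plane" "fix_gen c k \<in> hyp_plane"
      using fixed_point(1) elliptic_prefix[OF geo, of k] elliptic_gen[OF geo, of k] k by auto
    then show ?thesis using nd[OF k] fp_le[of k] fg_le[of k] True k inj by auto
  next
    case False
    then show ?thesis using nd[OF k] pre_ge[of k] gen_ge[of k] k by auto
  qed
  then have "nondegenerate_below (n - 1) c'" using geo' by (simp add: nondegenerate_below_def)
  moreover have "separated_at c' k" if "k > l" "Suc (Suc k) < n" "separated_at c k" for k
    using that pre_ge gen_ge by (simp add: separated_at_def tri_def)
  moreover have "separated_at c' l"
    unfolding separated_at_def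
  proof (intro exI[of _ \<nu>] conjI ballI)
    have C': "fix_pre c' (Suc l) = C" using pre_ge[of "Suc l"] l by (simp add: C_def s_def)
    have XY: "?X \<in> hyp_plane" "?Y \<in> hyp_plane"
      using fixed_point(1) elliptic_prefix[OF geo, of l] elliptic_gen[OF geo, of l] l by auto
    have pos: "Re (cnj \<nu> * direction C (PSL2R_act (\<rho> g) y)) \<ge> 0" if y: "y = ?X \<or> y = ?Y" for y
    proof -
      obtain k :: real where k: "k > 0" "direction C (PSL2R_act (\<rho> g) y) = of_real k * multiplier (\<rho> g) C * direction C y"
        using direction_act[OF rgc gC(1) C(1), of y] XY y by auto
      have "cnj \<nu> * direction C (PSL2R_act (\<rho> g) y) = of_real k * (cnj \<nu> * (((cnj ?j)\<^sup>2) powi m * direction C y))"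
        unfolding k(2) gC(2) by (simp add: mult_ac)
      moreover have "Re (cnj \<nu> * (((cnj ?j)\<^sup>2) powi m * direction C y)) \<ge> 0" using \<nu>(2) y by blast
      moreover have "Re (of_real k * w) = k * Re w" for w by simp
      ultimately show ?thesis using k(1) by (simp only: mult_nonneg_nonneg less_imp_le)
    qed
    fix z assume "z \<in> tri c' l"
    then have "z = C \<or> z = PSL2R_act (\<rho> g) ?X \<or> z = PSL2R_act (\<rho> g) ?Y"
      using C' fp_le[of l] fg_le[of l] l by (auto simp: tri_def)
    then show "Re (cnj \<nu> * direction (fix_pre c' (Suc l)) z) \<ge> 0" unfolding C' using pos by auto
  next
    have C': "fix_pre c' (Suc l) = C" using pre_ge[of "Suc l"] l by (simp add: C_def s_def)
    fix z assume "z \<in> tri c' (Suc l)"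
    then have "z = C \<or> z = ?Z \<or> z = ?W"
      using C' pre_ge[of "Suc (Suc l)"] gen_ge[of "Suc l"] l by (auto simp: tri_def)
    then show "Re (cnj \<nu> * direction (fix_pre c' (Suc l)) z) \<le> 0" unfolding C' using \<nu>(3) by auto
  qed (rule \<nu>(1))
  ultimately show ?thesis by blast
qed

text \<open>Working from the last pair of triangles to the first, later twists do not disturb the pairs
  that are already separated.\<close>

lemma separated_exists:
  assumes "geo c0"
  shows "\<exists>c. nondegenerate_below (n - 1) c \<and> (\<forall>k. 0 < k \<longrightarrow> Suc (Suc k) < n \<longrightarrow> separated_at c k)"
proof -
  have "1 \<le> l \<Longrightarrow> l \<le> n - 2 \<Longrightarrow>
      \<exists>c. nondegenerate_below (n - 1) c \<and> (\<forall>k\<ge>l. Suc (Suc k) < n \<longrightarrow> separated_at c k)" for l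
  proof (induction "n - 2 - l" arbitrary: l)
    case 0
    then show ?case using nondegenerate_exists[OF assms] by auto
  next
    case (Suc d)
    have "d = n - 2 - Suc l" "1 \<le> Suc l" "Suc l \<le> n - 2" using Suc by auto
    from Suc.hyps(1)[OF this]
    obtain c where c: "nondegenerate_below (n - 1) c" "\<forall>k\<ge>Suc l. Suc (Suc k) < n \<longrightarrow> separated_at c k"
      by blast
    have "0 < l" "Suc l < n - 1" using Suc by auto
    from twist_separates[OF c(1) this] obtain c' where c': "nondegenerate_below (n - 1) c'" "separated_at c' l"
      "\<forall>k>l. Suc (Suc k) < n \<longrightarrow> separated_at c k \<longrightarrow> separated_at c' k" by blast
    then have "separated_at c' k" if "k \<ge> l" "Suc (Suc k) < n" for k
      using that c(2) by (cases "k = l") auto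
    then show ?case using c'(1) by blast
  qed
  from this[of 1] n3 show ?thesis by (auto simp: Suc_le_eq)
qed

lemma separated_not_overlap:
  assumes "geo c" "separated_at c k" "0 < k" "Suc (Suc k) < n"
  shows "\<not> overlap (geodesic_triangle (tri c k)) (geodesic_triangle (tri c (Suc k)))"
proof -
  obtain \<nu> where "\<nu> \<noteq> 0" "\<And>z. z \<in> tri c k \<Longrightarrow> Re (cnj \<nu> * direction (fix_pre c (Suc k)) z) \<ge> 0"
     "\<And>z. z \<in> tri c (Suc k) \<Longrightarrow> Re (cnj \<nu> * direction (fix_pre c (Suc k)) z) \<le> 0"
    using assms(2) by (auto simp: separated_at_def)
  then show ?thesis
    using not_overlap_if_separated[of "fix_pre c (Suc k)" \<nu> "tri c k" "tri c (Suc k)"]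
      tri_in_hyp_plane[OF assms(1), of k] tri_in_hyp_plane[OF assms(1), of "Suc k"] assms(3,4) by (auto simp: tri_def)
qed

lemma triangle_chain_linear:
  assumes c: "geo c" and k: "k \<in> {1..n - 2}"
  shows "triangle_chain P x \<rho> n c (\<lambda>_. 0) k = geodesic_triangle (tri c k)"
proof -
  have cp: "cyclic_product \<Gamma> n c 0 m = prefix_product \<Gamma> c m" if "m \<le> n" for m
    unfolding cyclic_product_def prefix_product_def by (rule foldr_cong) (use that in auto)
  have ci: "cyclic_interval n 0 m = {..<m}" if "m \<le> n" for m
    unfolding cyclic_interval_def using that by force
  have p1: "prefix_product \<Gamma> c (Suc 0) = c 0"
    using geometric_presentation_closed[OF c, of 0] n3 by (simp add: prefix_product_def)
  have last: "fix_pre c (n - 1) = fix_gen c (n - 1)"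
  proof -
    have "pre c (n - 1) \<otimes>\<^bsub>PSL2R\<^esub> \<rho> (c (n - 1)) = \<one>\<^bsub>PSL2R\<^esub>"
      using pre_Suc[OF c, of "n - 1"] n3 presentation_product[OF group_\<Gamma> geometric_presentation_presentation[OF c]]
      by simp
    then have "pre c (n - 1) = inv\<^bsub>PSL2R\<^esub> \<rho> (c (n - 1))"
      using PSL.inv_equality[of "pre c (n - 1)" "\<rho> (c (n - 1))"] prefix_closed[OF c, of "n - 1"] gen_closed[OF c, of "n - 1"] n3
      by simp
    then show ?thesis using elliptic_inv(2)[OF elliptic_gen[OF c, of "n - 1"]] n3 by simp
  qed
  have "triangle_vertices \<Gamma> n c (\<lambda>_. 0) (\<lambda>a. fixed_point (\<rho> a)) k = tri c k"
  proof -
    consider "n = 3" | "n \<noteq> 3" "k = 1" | "n \<noteq> 3" "k \<noteq> 1" "k \<le> n - 3" | "n \<noteq> 3" "k = n - 2" using k by fastforce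
    then show ?thesis
    proof cases
      case 1
      then have "k = 1" using k by auto
      then show ?thesis using 1 last p1 by (simp add: triangle_vertices_def tri_def numeral_2_eq_2)
    next
      case 2
      then show ?thesis using n3 p1 cp[of 2]
        by (simp add: triangle_vertices_def tri_def pants_curve_def numeral_2_eq_2)
    next
      case 3
      have "chain_set n (\<lambda>_. 0) k - chain_set n (\<lambda>_. 0) (k - 1) = {k}"
        using 3 k by (auto simp: chain_set_def ci)
      then show ?thesis using 3 k cp[of k] cp[of "Suc k"]
        by (auto simp: triangle_vertices_def tri_def pants_curve_def)
    next
      case 4
      have "{..<n} - chain_set n (\<lambda>_. 0) (n - 3) = {n - 2, n - 1}"
        using 4 n3 by (auto simp: chain_set_def ci)
      moreover have "Suc (n - 3) = n - 2" "Suc (n - 2) = n - 1" using n3 by auto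
      moreover have "\<not> n - 2 \<le> n - 3" "n - 2 \<noteq> 1" using 4 n3 by auto
      ultimately show ?thesis using 4 n3 cp[of "n - 2"] last
        by (auto simp: triangle_vertices_def tri_def pants_curve_def)
    qed
  qed
  then show ?thesis by (simp add: triangle_chain_def)
qed

end

lemma linear_chain_compatible: "n \<ge> 3 \<Longrightarrow> compatible_pants_decomposition n (\<lambda>_. 0)"
proof -
  assume n: "n \<ge> 3"
  have ci: "cyclic_interval n 0 m = {..<m}" if "m \<le> n" for m
    unfolding cyclic_interval_def using that by force
  show ?thesis using n by (auto simp: compatible_pants_decomposition_def chain_set_def ci)
qed

lemma cis_angle_sum:
  assumes "s \<in> {0<..<2 * pi} \<or> s \<in> {2 * pi * (real n - 1)<..<2 * pi * real n}"
  shows "cis s \<noteq> 1"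
proof
  assume "cis s = 1"
  then have "cos s = 1" by (metis cis.sel(1) one_complex.sel(1))
  then obtain k :: int where k: "s = of_int k * (2 * pi)" by (auto simp: cos_one_2pi_int)
  from assms show False
  proof
    assume "s \<in> {0<..<2 * pi}"
    then have "0 < real_of_int k" "real_of_int k < 1" by (auto simp: k zero_less_mult_iff)
    then have "0 < k" "k < 1" by simp_all
    then show False by simp
  next
    assume "s \<in> {2 * pi * (real n - 1)<..<2 * pi * real n}"
    then have "(2 * pi) * (real n - 1) < (2 * pi) * of_int k" "(2 * pi) * of_int k < (2 * pi) * real n"
      by (auto simp: k mult_ac)
    then have "real n - 1 < of_int k" "real_of_int k < real n" by (simp_all only: mult_less_cancel_left_pos pi_gt_zero mult_pos_pos zero_less_numeral)
    then have "real_of_int (int n - 1) < real_of_int k" "real_of_int k < real_of_int (int n)" by simp_all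
    then show False by (simp only: of_int_less_iff)
  qed
qed

theorem theorem2:
  fixes n :: nat and P :: "(real^3) set" and x :: "real^3" and \<rho> :: sphere_rep
  assumes "n \<ge> 3"
    and "P \<subseteq> sphere 0 1" and "finite P" and "card P = n"
    and "x \<in> punctured_sphere P"
    and "DT_representation P x \<rho>"
  shows "\<exists>c s. geometric_presentation P x n c \<and> compatible_pants_decomposition n s \<and>
           (\<forall>k\<in>{1..n - 2}. \<not> degenerate (triangle_chain P x \<rho> n c s k)) \<and>
           (\<forall>k\<in>{1..<n - 2}. \<not> overlap (triangle_chain P x \<rho> n c s k)
                                         (triangle_chain P x \<rho> n c s (k + 1)))"
proof -
  obtain \<alpha> C where \<alpha>: "sum \<alpha> P \<in> {0<..<2 * pi} \<or>
         sum \<alpha> P \<in> {2 * pi * (real (card P) - 1)<..<2 * pi * real (card P)}"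
    and \<rho>: "\<rho> \<in> Hom_angles P x \<alpha>"
    and C: "C \<in> connected_components_of (Rep_angles P x \<alpha>)" "compactin (Rep_angles P x \<alpha>) C"
      "conjugacy_class P x \<rho> \<in> C"
    using assms(6) unfolding DT_representation_def by blast
  interpret elliptic_prefix_rep P x \<rho> n \<alpha>
  proof
    show "\<rho> \<in> hom (sphere_group P x) PSL2R" using \<rho> by (auto simp: Hom_angles_def)
    show "elliptic_with_angle (\<rho> c) (\<alpha> p)" if "p \<in> P" "c \<in> peripheral_classes P x p" for p c
      using \<rho> that by (auto simp: Hom_angles_def)
    show "cis (sum \<alpha> P) \<noteq> 1" by (rule cis_angle_sum[OF \<alpha>])
    show "elliptic (\<rho> (prefix_product (sphere_group P x) c k))"
      if "geometric_presentation P x n c" "0 < k" "k < n" for c k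
      by (rule DT_prefix_product_elliptic[OF assms(5) \<rho> C that])
  qed (use assms in auto)
  obtain c0 where "geo c0" by (rule geometric_presentation_exists[OF assms(1-5)])
  from separated_exists[OF this] obtain c where c: "nondegenerate_below (n - 1) c"
    and sep: "\<And>k. 0 < k \<Longrightarrow> Suc (Suc k) < n \<Longrightarrow> separated_at c k" by blast
  then have geo: "geo c" and nd: "\<And>k. 0 < k \<Longrightarrow> k < n - 1 \<Longrightarrow> fix_pre c k \<noteq> fix_gen c k"
    by (auto simp: nondegenerate_below_def)
  have 1: "\<not> degenerate (triangle_chain P x \<rho> n c (\<lambda>_. 0) k)" if k: "k \<in> {1..n - 2}" for k
    unfolding triangle_chain_linear[OF geo k] by (rule tri_not_degenerate[OF geo]) (use k nd n3 in auto)
  have 2: "\<not> overlap (triangle_chain P x \<rho> n c (\<lambda>_. 0) k) (triangle_chain P x \<rho> n c (\<lambda>_. 0) (k + 1))"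
    if k: "k \<in> {1..<n - 2}" for k
    using separated_not_overlap[OF geo sep] k triangle_chain_linear[OF geo, of k] triangle_chain_linear[OF geo, of "k + 1"]
    by auto
  show ?thesis
    using geo linear_chain_compatible[OF assms(1)] 1 2 by (intro exI[of _ c] exI[of _ "\<lambda>_. 0"]) blast
qed

end
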